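(* For every integer $r\ge 2$ and every real number $K>1$, there is a stable non-$r$-partite $r$-graph $\mathcal F$ with the following property. There exist constants $\delta_{\mathcal F}>0$ and $n_{\mathcal F}>0$ such that, for every $n\ge n_{\mathcal F}$ and every integer $q$ with $1\le q\le \delta_{\mathcal F}\, n$, \[ h_{\mathcal F}(n,q)\le K^{-1}\, q\, c(n,\mathcal F). \]
   Context: An $r$-graph is a (finite) $r$-uniform hypergraph, identified with its edge set; $|\mathcal H|$ is the number of edges of $\mathcal H$. An $r$-graph is $r$-partite if its vertex set can be partitioned into $r$ parts so that every edge has exactly one vertex in each part. $\mathcal H$ is $\mathcal F$-free if it contains no (not necessarily induced) copy of $\mathcal F$. The Turán number is $\mathrm{ex}(n,\mathcal F):=\max\{|\mathcal H|: |V(\mathcal H)|=n,\ \mathcal H \text{ is } \mathcal F\text{-free}\}$. A copy means a labelled embedding: an injective map $V(\mathcal F)\to V(\mathcal G)$ sending edges to edges. $N_{\mathcal F}(\mathcal G)$ is the number of copies of $\mathcal F$ in $\mathcal G$, and $N_{\mathcal F}(\mathcal G;e)$ is the number of those copies in which $e$ is the image of some edge of $\mathcal F$. Stable: an $r$-graph $\mathcal F$ is stable if, for all sufficiently large $n$, the extremal $n$-vertex $\mathcal F$-free $r$-graph (one with $\mathrm{ex}(n,\mathcal F)$ edges) is unique up to isomorphism, denoted $\mathrm{EX}(n,\mathcal F)$, and every $n$-vertex $\mathcal F$-free $r$-graph with $(1-o(1))\mathrm{ex}(n,\mathcal F)$ edges differs from (a copy on the same vertex set of) $\mathrm{EX}(n,\mathcal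 F)$ in only $o(n^r)$ edges; i.e. for every $\eta>0$ there are $\varepsilon>0$ and $n_0$ such that every $\mathcal F$-free $r$-graph on $n\ge n_0$ vertices with at least $(1-\varepsilon)\mathrm{ex}(n,\mathcal F)$ edges has symmetric difference at most $\eta n^r$ with some copy of $\mathrm{EX}(n,\mathcal F)$ on its vertex set. For such $\mathcal F$ and sufficiently large $n$, \[ c(n,\mathcal F):=\min\Bigl\{N_{\mathcal F}(\mathrm{EX}(n,\mathcal F)\cup\{e\};e): e\in\tbinom{V(\mathrm{EX}(n,\mathcal F))}{r}\setminus \mathrm{EX}(n,\mathcal F)\Bigr\}, \] \[ h_{\mathcal F}(n,q):=\min\{N_{\mathcal F}(\mathcal H): |V(\mathcal H)|=n,\ |\mathcal H|=\mathrm{ex}(n,\mathcal F)+q\}. \] *)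

theory Defs
  imports Complex_Main "HOL-Library.FuncSet" "HOL-Library.Disjoint_Sets" "HOL-Library.Ramsey"
begin

record 'a hypergraph =
  verts :: "'a set"
  edges :: "'a set set"

definition rgraph :: "nat \<Rightarrow> 'a hypergraph \<Rightarrow> bool" where
  "rgraph r H \<longleftrightarrow> finite (verts H) \<and> edges H \<subseteq> nsets (verts H) r"

text \<open>Parts are allowed to be empty, so that every \<open>r\<close>-graph without edges is \<open>r\<close>-partite.\<close>

definition r_partite :: "nat \<Rightarrow> 'a hypergraph \<Rightarrow> bool" where
  "r_partite r H \<longleftrightarrow>
     (\<exists>P :: nat \<Rightarrow> 'a set. (\<Union>i<r. P i) = verts H \<and> disjoint_family_on P {..<r} \<and>
        (\<forall>e\<in>edges H. \<forall>i<r. card (e \<inter> P i) = 1))"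

definition hyp_iso :: "'a hypergraph \<Rightarrow> 'b hypergraph \<Rightarrow> bool" where
  "hyp_iso G H \<longleftrightarrow> (\<exists>f. bij_betw f (verts G) (verts H) \<and> edges H = (`) f ` edges G)"

text \<open>Copies are labelled. The maps are taken in the extensional function space, so that each one is
  counted once.\<close>

definition copies :: "'a hypergraph \<Rightarrow> 'b hypergraph \<Rightarrow> ('a \<Rightarrow> 'b) set" where
  "copies F G = {f \<in> verts F \<rightarrow>\<^sub>E verts G. inj_on f (verts F) \<and> (\<forall>e\<in>edges F. f ` e \<in> edges G)}"

definition num_copies :: "'a hypergraph \<Rightarrow> 'b hypergraph \<Rightarrow> nat" where
  "num_copies F G = card (copies F G)"

definition num_copies_at :: "'a hypergraph \<Rightarrow> 'b hypergraph \<Rightarrow> 'b set \<Rightarrow> nat" where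
  "num_copies_at F G e = card {f \<in> copies F G. \<exists>e'\<in>edges F. f ` e' = e}"

definition hyp_free :: "'a hypergraph \<Rightarrow> 'b hypergraph \<Rightarrow> bool" where
  "hyp_free F G \<longleftrightarrow> copies F G = {}"

text \<open>Host graphs have vertices in \<^typ>\<open>nat\<close>, which loses no generality as all graphs are finite.
  The values maximised or minimised in \<open>turan_number\<close> and \<open>min_copies\<close> form finite sets even though
  the graphs range over an infinite type: they are bounded by \<open>n choose r\<close> and by
  \<open>n ^ card (verts F)\<close> respectively.\<close>

definition turan_number :: "nat \<Rightarrow> 'a hypergraph \<Rightarrow> nat \<Rightarrow> nat" where
  "turan_number r F n =
     Max {card (edges H) | H :: nat hypergraph. rgraph r H \<and> card (verts H) = n \<and> hyp_free F H}"

definition extremal :: "nat \<Rightarrow> 'a hypergraph \<Rightarrow> nat \<Rightarrow> nat hypergraph \<Rightarrow> bool" where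
  "extremal r F n H \<longleftrightarrow> rgraph r H \<and> card (verts H) = n \<and> hyp_free F H \<and>
     card (edges H) = turan_number r F n"

text \<open>A representative of the extremal graphs, meaningful when these are unique up to isomorphism.\<close>

definition extremal_graph :: "nat \<Rightarrow> 'a hypergraph \<Rightarrow> nat \<Rightarrow> nat hypergraph" where
  "extremal_graph r F n = (SOME H. extremal r F n H)"

definition stable_rgraph :: "nat \<Rightarrow> 'a hypergraph \<Rightarrow> bool" where
  "stable_rgraph r F \<longleftrightarrow>
     (\<exists>n0. \<forall>n\<ge>n0. (\<exists>H. extremal r F n H) \<and>
        (\<forall>H H'. extremal r F n H \<longrightarrow> extremal r F n H' \<longrightarrow> hyp_iso H H')) \<and>
     (\<forall>\<eta>::real. \<eta> > 0 \<longrightarrow> (\<exists>\<epsilon>::real. \<epsilon> > 0 \<and> (\<exists>n0. \<forall>n\<ge>n0. \<forall>H :: nat hypergraph.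
        rgraph r H \<longrightarrow> card (verts H) = n \<longrightarrow> hyp_free F H \<longrightarrow>
        real (card (edges H)) \<ge> (1 - \<epsilon>) * real (turan_number r F n) \<longrightarrow>
        (\<exists>H' :: nat hypergraph. verts H' = verts H \<and> hyp_iso (extremal_graph r F n) H' \<and>
           real (card ((edges H - edges H') \<union> (edges H' - edges H))) \<le> \<eta> * real n ^ r))))"

definition c_min :: "nat \<Rightarrow> 'a hypergraph \<Rightarrow> nat \<Rightarrow> nat" where
  "c_min r F n =
     (let G = extremal_graph r F n in
      Min {num_copies_at F (G\<lparr>edges := edges G \<union> {e}\<rparr>) e | e. e \<in> nsets (verts G) r - edges G})"

definition min_copies :: "nat \<Rightarrow> 'a hypergraph \<Rightarrow> nat \<Rightarrow> nat \<Rightarrow> nat" where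
  "min_copies r F n q =
     Min {num_copies F H | H :: nat hypergraph.
            rgraph r H \<and> card (verts H) = n \<and> card (edges H) = turan_number r F n + q}"

end

theory Submission
 imports Defs "HOL-Library.Nat_Bijection"
begin

text \<open>The graph \<open>F\<close> consists of \<open>r + 1\<close> disjoint expansions of the complete graph on \<open>r + 1\<close> vertices (the
 blocks), an edge through one vertex \<open>u\<^sub>i\<close> of each of the first \<open>r\<close> blocks, and \<open>t\<close> pendant edges at each \<open>u\<^sub>i\<close>.
 Since \<open>r\<close> vertices can destroy only \<open>r\<close> blocks, the extremal graph is a join: all edges meeting an \<open>r\<close>-set \<open>S\<close> and
 the transversal edges of a balanced \<open>r\<close>-partition of the rest. Stability comes from the Moon--Moser
 inequalities for the graph of pairs of large codegree; exactness from a maximum cut, in which every vertex of large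
 bad degree and every disjoint bad edge yields a block.

 A new edge \<open>e\<close> creates many copies, because all \<open>u\<^sub>i\<close> can be sent to \<open>S\<close>, where pendant edges are unrestricted.
 With \<open>q + 1\<close> new edges, however, one can afford to delete the edge \<open>S\<close> itself. Then some \<open>u\<^sub>i\<close> has to leave \<open>S\<close>, its
 \<open>t\<close> pendant edges must be transversal, and this costs a factor \<open>(3/4)^t\<close>.\<close>

text \<open>Both counts have the same order in \<open>n\<close>: a copy through a nonedge of the
  extremal graph and a copy in the modified graph each have \<open>2 * r\<close> core vertices tied
  to \<open>S\<close> and one new edge. Only constants are compared, and those of the core do not
  depend on \<open>t\<close>. Deleting \<open>S\<close> pays off because the \<open>q + 1\<close>
  new edges share \<open>r - 1\<close> vertices. A block avoiding \<open>S\<close> needs a new edge,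
  and blocks are disjoint, so at most one block avoids \<open>S\<close> and the other
  \<open>r\<close> use \<open>S\<close> up. A pendant edge at a vertex outside \<open>S\<close> is
  then transversal or new. Since \<open>2 * (r - 1)! <= r ^ (r - 1)\<close>, transversality leaves
  at most half of the \<open>n ^ (r - 1)\<close> free choices; 3/4 makes room for the new edges. The
  obstacle in finding a copy is the edge that connects the blocks, as blocks found separately need
  not be connected. This edge is therefore fixed first, with vertices that can be put into a block
  avoiding any bounded set of other vertices; then the blocks are placed around it.\<close>

abbreviation rcard :: "'a set => real" where "rcard A == real (card A)"

section \<open>Codegrees, rich sets and rainbow edges\<close>

definition codeg :: "'a set set => 'a set => nat" where
 "codeg E B = card {e \<in> E. B \<subseteq> e}"

text \<open>Greedy embedding uses a large codegree only in this form, and the negation hands over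
  one small set that meets every edge above \<open>B\<close> outside \<open>B\<close>. Failure can
  therefore be counted, and success used without further counting.\<close>

definition rich :: "'a set set => real => 'a set => bool" where
 "rich E m B \<longleftrightarrow> (\<forall>X. finite X & rcard X <= m --> (\<exists>e\<in>E. B \<subseteq> e & (e - B) Int X = {}))"

text \<open>The index set \<open>K\<close> may omit colours, because transversal edges are often
  completed from a part whose colours are already used.\<close>

definition rainbow :: "('a => nat) => nat set => (nat => 'a set) => 'a set set" where
 "rainbow hue K U = {e. inj_on hue e & hue ` e = K & (\<forall>v\<in>e. v \<in> U (hue v))}"

text \<open>An edge has \<open>r\<close> vertices, so meeting all \<open>r\<close> colours already
  makes \<open>hue\<close> injective on it.\<close>

definition tedges :: "'a set => nat => ('a => nat) => 'a set set" where
 "tedges V r hue = {e \<in> nsets V r. hue ` e = {..<r}}"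

lemma richD:
 "rich E m B ==> finite X ==> rcard X <= m ==> \<exists>e\<in>E. B \<subseteq> e & (e - B) Int X = {}"
 unfolding rich_def by (elim allE[of _ X] impE conjI)

lemma not_richE:
 assumes "\<not> rich E m B"
 obtains X where "finite X" "rcard X <= m" "\<forall>e\<in>E. B \<subseteq> e --> (e - B) Int X ~= {}"
 using assms unfolding rich_def by meson

lemma rich_mono: "rich E m B ==> E \<subseteq> E' ==> m' <= m ==> rich E' m' B"
 unfolding rich_def by (meson order_trans subsetD)

lemma card_nsets_le: "finite V ==> card (nsets V k) <= card V ^ k"
 by (metis binomial_eq_0 binomial_le_pow card_nsets less_or_eq_imp_le linorder_not_less zero_le)

lemma codeg_nsets_le:
 assumes "finite V" "finite B" "card B <= r"
 shows "codeg (nsets V r) B <= card V ^ (r - card B)"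
proof -
 have "codeg (nsets V r) B <= card (nsets V (r - card B))"
  unfolding codeg_def
 proof (rule card_inj_on_le[where f = "%e. e - B"])
  show "inj_on (%e. e - B) {e \<in> nsets V r. B \<subseteq> e}"
   by (auto simp: inj_on_def)
  show "(%e. e - B) ` {e \<in> nsets V r. B \<subseteq> e} \<subseteq> nsets V (r - card B)"
   using assms by (auto simp: nsets_def card_Diff_subset)
  show "finite (nsets V (r - card B))"
   by (simp add: assms finite_imp_finite_nsets)
 qed
 then show ?thesis
  using card_nsets_le[OF assms(1)] order_trans by blast
qed

lemma codeg_mono: "finite E' ==> E \<subseteq> E' ==> codeg E B <= codeg E' B"
 unfolding codeg_def by (rule card_mono) auto

text \<open>A union bound over the vertex of \<open>X\<close> that is hit: fixing it together with
  \<open>B\<close> leaves one free vertex less.\<close>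

lemma card_hit_le:
 assumes "finite V" "finite B" "finite X"
 shows "card {e \<in> nsets V r. B \<subseteq> e & (e - B) Int X ~= {}} <= card X * card V ^ (r - card B - 1)"
proof -
 have "{e \<in> nsets V r. B \<subseteq> e & (e - B) Int X ~= {}} \<subseteq> (\<Union>z\<in>X - B. {e \<in> nsets V r. insert z B \<subseteq> e})"
  by auto
 then have "card {e \<in> nsets V r. B \<subseteq> e & (e - B) Int X ~= {}} <= card (\<Union>z\<in>X - B. {e \<in> nsets V r. insert z B \<subseteq> e})"
  by (rule card_mono[rotated]) (use assms in \<open>auto simp: finite_imp_finite_nsets\<close>)
 also have "... <= (\<Sum>z\<in>X - B. card {e \<in> nsets V r. insert z B \<subseteq> e})"
  by (rule card_UN_le) (use assms in auto)
 also have "... <= (\<Sum>z\<in>X - B. card V ^ (r - card B - 1))"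
 proof (rule sum_mono)
  fix z assume z: "z \<in> X - B"
  show "card {e \<in> nsets V r. insert z B \<subseteq> e} <= card V ^ (r - card B - 1)"
  proof (cases "card (insert z B) <= r")
   case True
   then show ?thesis
    using codeg_nsets_le[of V "insert z B" r] assms z by (simp add: codeg_def)
  next
   case False
   then have "{e \<in> nsets V r. insert z B \<subseteq> e} = {}"
    using card_mono by (fastforce simp: nsets_def)
   then show ?thesis by (metis card.empty zero_le)
  qed
 qed
 also have "... = card (X - B) * card V ^ (r - card B - 1)"
  by simp
 also have "... <= card X * card V ^ (r - card B - 1)"
  using assms by (intro mult_right_mono card_mono) auto
 finally show ?thesis .
qed

lemma card_meeting_le:
 assumes "finite V" "finite X" "r \<ge> 1"
 shows "card {e \<in> nsets V r. e Int X ~= {}} <= card X * card V ^ (r - 1)"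
 using card_hit_le[of V "{}" X r] assms by simp

text \<open>For \<open>card B = r\<close> the left-hand side is \<open>0\<close>: an edge equal to \<open>B\<close> makes \<open>B\<close> rich.\<close>

lemma not_rich_codeg:
 assumes "finite V" "E \<subseteq> nsets V r" "finite B" "card B <= r" "\<rho> \<ge> 0"
  and "\<not> rich E (\<rho> * rcard V) B"
 shows "real (codeg E B) <= \<rho> * rcard V ^ (r - card B)"
proof -
 obtain X where X: "finite X" "rcard X <= \<rho> * rcard V"
  "\<forall>e\<in>E. B \<subseteq> e --> (e - B) Int X ~= {}"
  by (rule not_richE[OF assms(6)])
 have sub: "{e \<in> E. B \<subseteq> e} \<subseteq> {e \<in> nsets V r. B \<subseteq> e & (e - B) Int X ~= {}}"
  using X(3) assms(2) by blast
 have fin: "finite {e \<in> nsets V r. B \<subseteq> e & (e - B) Int X ~= {}}"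
  using assms(1) by (simp add: finite_imp_finite_nsets)
 show ?thesis
 proof (cases "card B = r")
  case True
  have "{e \<in> nsets V r. B \<subseteq> e & (e - B) Int X ~= {}} = {}"
  proof -
   have "B = e" if "e \<in> nsets V r" "B \<subseteq> e" for e
    using that True by (intro card_subset_eq) (auto simp: nsets_def)
   then show ?thesis by blast
  qed
  then have "codeg E B = 0"
   unfolding codeg_def using sub by (metis card.empty subset_empty)
  then show ?thesis using assms(5) by simp
 next
  case False
  then have lt: "r - card B = Suc (r - card B - 1)" using assms(4) by simp
  have "codeg E B <= card X * card V ^ (r - card B - 1)"
   unfolding codeg_def using card_mono[OF fin sub] card_hit_le[OF assms(1,3) X(1), of r]
   by linarith
  then have "real (codeg E B) <= rcard X * rcard V ^ (r - card B - 1)"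
   by (metis of_nat_le_iff of_nat_mult of_nat_power)
  also have "... <= \<rho> * rcard V * rcard V ^ (r - card B - 1)"
   using X(2) by (intro mult_right_mono) auto
  also have "... = \<rho> * rcard V ^ (r - card B)"
   by (subst (2) lt) simp
  finally show ?thesis .
 qed
qed

text \<open>The colour of a vertex tells for which \<open>k\<close> it was chosen, so a choice
  function can be recovered from its image.\<close>

lemma card_rainbow:
 assumes K: "finite K" and U: "\<And>k v. k \<in> K ==> v \<in> U k ==> hue v = k"
 shows "card (rainbow hue K U) = (\<Prod>k\<in>K. card (U k))"
proof -
 have "bij_betw (%f. f ` K) (PiE K U) (rainbow hue K U)"
 proof (rule bij_betw_imageI)
  show "inj_on (%f. f ` K) (PiE K U)"
  proof (rule inj_onI)
   fix f g assume fg: "f \<in> PiE K U" "g \<in> PiE K U" "f ` K = g ` K"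
   show "f = g"
   proof (rule PiE_ext[OF fg(1,2)])
    fix k assume k: "k \<in> K"
    then obtain k' where k': "k' \<in> K" "f k = g k'" using fg(3) by (metis imageE imageI)
    then show "f k = g k" using U k fg(1,2) by (metis PiE_mem)
   qed
  qed
  show "(%f. f ` K) ` PiE K U = rainbow hue K U"
  proof
   show "(%f. f ` K) ` PiE K U \<subseteq> rainbow hue K U"
   proof
    fix e assume "e \<in> (%f. f ` K) ` PiE K U"
    then obtain f where f: "f \<in> PiE K U" "e = f ` K" by blast
    then have c: "hue (f k) = k" if "k \<in> K" for k using U that by (metis PiE_mem)
    show "e \<in> rainbow hue K U"
     unfolding rainbow_def using f c by (auto simp: inj_on_def image_image PiE_mem)
   qed
   show "rainbow hue K U \<subseteq> (%f. f ` K) ` PiE K U"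
   proof
    fix e assume e: "e \<in> rainbow hue K U"
    define f where "f = restrict (inv_into e hue) K"
    have e': "inj_on hue e" "hue ` e = K" "\<And>v. v \<in> e ==> v \<in> U (hue v)"
     using e by (auto simp: rainbow_def)
    have "f ` K = e"
     using e' unfolding f_def by (auto simp: image_iff inv_into_into)
    moreover have "f \<in> PiE K U"
    proof (rule PiE_I)
     fix k assume "k \<in> K"
     then show "f k \<in> U k"
      using e' unfolding f_def by (metis f_inv_into_f inv_into_into restrict_apply')
    qed (auto simp: f_def)
    ultimately show "e \<in> (%f. f ` K) ` PiE K U" by blast
   qed
  qed
 qed
 then have "card (rainbow hue K U) = card (PiE K U)"
  by (simp add: bij_betw_same_card)
 then show ?thesis by (simp add: card_PiE K)
qed

lemma tedges_inj: "e \<in> tedges V r hue ==> inj_on hue e"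
 by (auto simp: tedges_def nsets_def intro: eq_card_imp_inj_on)

lemma tedges_eq_rainbow:
 "tedges V r hue = rainbow hue {..<r} (%k. {v \<in> V. hue v = k})" if "finite V"
proof (intro set_eqI iffI)
 fix e assume e: "e \<in> tedges V r hue"
 then show "e \<in> rainbow hue {..<r} (%k. {v \<in> V. hue v = k})"
  using tedges_inj[OF e] by (auto simp: rainbow_def tedges_def nsets_def)
next
 fix e assume e: "e \<in> rainbow hue {..<r} (%k. {v \<in> V. hue v = k})"
 then have "e \<subseteq> V" by (auto simp: rainbow_def)
 moreover have "card e = r" using e by (auto simp: rainbow_def dest: card_image)
 ultimately show "e \<in> tedges V r hue"
  using e that by (auto simp: rainbow_def tedges_def nsets_def intro: finite_subset)
qed

lemma card_tedges:
 "finite V ==> card (tedges V r hue) = (\<Prod>k<r. card {v \<in> V. hue v = k})"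
 by (subst tedges_eq_rainbow, assumption, rule card_rainbow) auto

lemma tedges_same_colour:
 "e \<in> tedges V r hue ==> x \<in> e ==> y \<in> e ==> hue x = hue y ==> x = y"
 using tedges_inj by (meson inj_onD)

text \<open>Extending a partial embedding edge by edge: the base of every new edge is rich, so the
 new vertices can be chosen outside everything used so far.\<close>

lemma greedy_extension:
 assumes "finite \<E>" "finite W" "inj_on \<phi>0 W"
  and "\<And>A. A \<in> \<E> ==> finite A & card A = r"
  and "\<And>A. A \<in> \<E> ==> base A = A Int W"
  and "\<And>A A'. A \<in> \<E> ==> A' \<in> \<E> ==> A ~= A' ==> (A - W) Int (A' - W) = {}"
  and "\<And>A. A \<in> \<E> ==> rich E m (\<phi>0 ` base A)"
  and "real (card W + r * card \<E>) <= m"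
  and "\<And>e. e \<in> E ==> finite e & card e = r"
 shows "\<exists>\<phi>. inj_on \<phi> (W Un \<Union>\<E>) & (\<forall>w\<in>W. \<phi> w = \<phi>0 w) & (\<forall>A\<in>\<E>. \<phi> ` A \<in> E)"
 using assms
proof (induction \<E> rule: finite_induct)
 case empty
 then show ?case by auto
next
 case (insert A \<E>)
 have "\<exists>\<phi>. inj_on \<phi> (W Un \<Union>\<E>) & (\<forall>w\<in>W. \<phi> w = \<phi>0 w) & (\<forall>A\<in>\<E>. \<phi> ` A \<in> E)"
 proof (rule insert.IH)
  show "finite W" "inj_on \<phi>0 W" using insert.prems by simp_all
  show "real (card W + r * card \<E>) <= m"
   using insert.prems(7) insert.hyps by (simp add: algebra_simps)
  show "finite A & card A = r" "base A = A Int W" "rich E m (\<phi>0 ` base A)" if "A \<in> \<E>" for A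
   using insert.prems(3-6) that by (meson insertCI)+
  show "(A - W) Int (A' - W) = {}" if "A \<in> \<E>" "A' \<in> \<E>" "A ~= A'" for A A'
   using insert.prems(5) that by (meson insertCI)
  show "finite e & card e = r" if "e \<in> E" for e
   using insert.prems(8) that by meson
 qed
 then obtain \<phi> where \<phi>: "inj_on \<phi> (W Un \<Union>\<E>)" "\<forall>w\<in>W. \<phi> w = \<phi>0 w" "\<forall>A\<in>\<E>. \<phi> ` A \<in> E"
  by (elim exE conjE)
 define D where "D = W Un \<Union>\<E>"
 have finD: "finite D"
  unfolding D_def using insert.hyps insert.prems by auto
 have "card (\<Union>\<E>) <= (\<Sum>A\<in>\<E>. card A)" by (rule card_Union_le_sum_card)
 also have "... = r * card \<E>" using insert.prems by simp
 finally have "card D <= card W + r * card \<E>"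
  unfolding D_def by (meson add_left_mono card_Un_le order_trans)
 \<comment> \<open>The forbidden set is the whole image so far; the hypothesis on \<open>m\<close>
   leaves room for it.\<close>
 then have "card (\<phi> ` D) <= card W + r * card (insert A \<E>)"
  using insert.hyps card_image_le[OF finD, of \<phi>] by simp
 then have "rcard (\<phi> ` D) <= m"
  using insert.prems(7) by linarith
 from richD[OF insert.prems(6)[OF insertI1] finite_imageI[OF finD] this]
 obtain e where e: "e \<in> E" "\<phi>0 ` base A \<subseteq> e" "(e - \<phi>0 ` base A) Int \<phi> ` D = {}"
  by (elim bexE conjE)
 have bA: "base A = A Int W" using insert.prems(4)[of A] by simp
 have \<phi>b: "\<phi> ` base A = \<phi>0 ` base A" using \<phi>(2) bA by auto
 \<comment> \<open>The new vertices of different edges are disjoint, so the vertices of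
   \<open>A\<close> not yet placed are exactly those outside \<open>W\<close>.\<close>
 have AD: "A - D = A - W"
  using insert.prems(5) insert.hyps by (auto simp: D_def)
 have finA: "finite A" "card A = r" using insert.prems(3) by blast+
 have fine: "finite e" "card e = r" using insert.prems(8) e by blast+
 have "card (\<phi>0 ` base A) = card (base A)"
  using insert.prems(2) bA by (intro card_image) (auto intro: inj_on_subset)
 then have "card (A - D) = card (e - \<phi>0 ` base A)"
  using finA fine e(2) bA AD by (simp add: card_Diff_subset card_Diff_subset_Int)
 then obtain h where h: "bij_betw h (A - D) (e - \<phi>0 ` base A)"
  using finA fine by (meson finite_Diff finite_same_card_bij)
 define \<psi> where "\<psi> = (%w. if w \<in> D then \<phi> w else h w)"
 have eq: "W Un \<Union>(insert A \<E>) = D Un (A - D)" by (auto simp: D_def)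
 have himg: "h ` (A - D) = e - \<phi>0 ` base A" using h by (simp add: bij_betw_def)
 have "inj_on \<psi> (D Un (A - D))"
 proof (subst inj_on_Un, intro conjI)
  show "inj_on \<psi> D" using \<phi>(1) by (auto simp: \<psi>_def inj_on_def D_def)
  show "inj_on \<psi> (A - D)" using h by (auto simp: \<psi>_def inj_on_def bij_betw_def)
  have "\<psi> ` D = \<phi> ` D" "\<psi> ` (A - D) = h ` (A - D)" by (auto simp: \<psi>_def)
  moreover have "D - (A - D) = D" "A - D - D = A - D" by auto
  ultimately have *: "\<psi> ` (D - (A - D)) Int \<psi> ` (A - D - D) = \<phi> ` D Int (e - \<phi>0 ` base A)"
   using himg by simp
  show "\<psi> ` (D - (A - D)) Int \<psi> ` (A - D - D) = {}"
   unfolding * using e(3) by (simp only: Int_commute)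
 qed
 moreover have "\<forall>w\<in>W. \<psi> w = \<phi>0 w" using \<phi>(2) by (auto simp: \<psi>_def D_def)
 moreover have "\<psi> ` A' \<in> E" if "A' \<in> insert A \<E>" for A'
 proof (cases "A' = A")
  case True
  have "A = base A Un (A - D)" using bA AD by auto
  then have "\<psi> ` A = \<psi> ` base A Un \<psi> ` (A - D)" by (metis image_Un)
  also have "\<psi> ` base A = \<phi>0 ` base A"
   using bA \<open>\<forall>w\<in>W. \<psi> w = \<phi>0 w\<close> by auto
  also have "\<psi> ` (A - D) = e - \<phi>0 ` base A" using himg by (auto simp: \<psi>_def)
  finally show ?thesis using e True by (simp add: Un_absorb1)
 next
  case False
  then have "A' \<in> \<E>" using that by simp
  then have "\<psi> ` A' = \<phi> ` A'" by (intro image_cong) (auto simp: \<psi>_def D_def)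
  then show ?thesis using \<phi>(3) \<open>A' \<in> \<E>\<close> by simp
 qed
 ultimately show ?case unfolding eq by blast
qed

section \<open>The pattern graph\<close>

text \<open>The pattern must live on \<open>nat\<close>, so its vertices are coded tuples. The first
  entry is a tag that keeps core, private and pendant vertices apart.\<close>

definition vx :: "nat => nat => nat => nat => nat => nat" where
 "vx a i k l j = prod_encode (a, prod_encode (i, prod_encode (k, prod_encode (l, j))))"

text \<open>A decoder, through which maps on the pattern can be defined by cases on the tag and the
  indices.\<close>

definition vx_dec :: "nat => nat \<times> nat \<times> nat \<times> nat \<times> nat" where
 "vx_dec v = (case prod_decode v of (a, v1) => case prod_decode v1 of (i, v2) \<Rightarrow>
   case prod_decode v2 of (k, v3) => case prod_decode v3 of (l, j) => (a, i, k, l, j))"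

definition core :: "nat => nat => nat" where "core i k = vx 0 i k 0 0"
definition priv :: "nat => nat => nat => nat => nat" where "priv i k l j = vx 1 i k l j"
definition pend :: "nat => nat => nat => nat" where "pend i s j = vx 2 i s j 0"

definition pedge :: "nat => nat => nat => nat => nat set" where
 "pedge r i k l = {core i k, core i l} Un priv i k l ` {..<r - 2}"

text \<open>Every \<open>uvert i\<close> lies in \<open>pedge r i 0 1\<close>, so sending it into
  the dominating set takes care of that edge of its block. A core 0, a core 1 and private vertices
  otherwise: this is how an edge sits that meets an \<open>(r + 1)\<close>-clique in two vertices,
  and such an edge will serve as the connecting edge.\<close>

definition uvert :: "nat => nat" where
 "uvert i = (if i = 0 then core 0 0 else if i = 1 then core 1 1 else priv i 0 1 0)"

definition tail :: "nat => nat => nat => nat set" where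
 "tail r i s = insert (uvert i) (pend i s ` {..<r - 1})"

definition block :: "nat => nat => nat set" where
 "block r i = core i ` {..r} Un (\<Union>l\<le>r. \<Union>k<l. priv i k l ` {..<r - 2})"

definition core_part :: "nat => nat set" where
 "core_part r = (\<Union>i\<le>r. block r i)"

definition pend_part :: "nat => nat => nat set" where
 "pend_part r t = (\<Union>i<r. \<Union>s<t. pend i s ` {..<r - 1})"

definition pedges :: "nat => nat set set" where
 "pedges r = (\<Union>i\<le>r. \<Union>l\<le>r. (%k. pedge r i k l) ` {..<l})"

definition tails :: "nat => nat => nat set set" where
 "tails r t = (\<Union>i<r. tail r i ` {..<t})"

text \<open>The blocks are copies of the expansion of the complete graph on \<open>r + 1\<close> vertices; one
 vertex from each of the first \<open>r\<close> blocks is selected, the selected vertices form an edge, and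
 \<open>t\<close> pendant edges are attached to each of them.\<close>

definition pattern :: "nat => nat => nat hypergraph" where
 "pattern r t = \<lparr>verts = core_part r Un pend_part r t,
   edges = insert (uvert ` {..<r}) (pedges r Un tails r t)\<rparr>"

lemma vx_dec [simp]: "vx_dec (vx a i k l j) = (a, i, k, l, j)"
 by (simp add: vx_dec_def vx_def)

lemma vx_eq [simp]: "vx a i k l j = vx a' i' k' l' j' \<longleftrightarrow> a = a' & i = i' & k = k' & l = l' & j = j'"
 by (simp add: vx_def)

lemma vertex_eq [simp]:
 "core i k = core i' k' \<longleftrightarrow> i = i' & k = k'"
 "priv i k l j = priv i' k' l' j' \<longleftrightarrow> i = i' & k = k' & l = l' & j = j'"
 "pend i s j = pend i' s' j' \<longleftrightarrow> i = i' & s = s' & j = j'"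
 "core i k ~= priv i' k' l' j'" "priv i' k' l' j' ~= core i k"
 "core i k ~= pend i' s' j'" "pend i' s' j' ~= core i k"
 "priv i k l j ~= pend i' s' j'" "pend i' s' j' ~= priv i k l j"
 by (auto simp: core_def priv_def pend_def)

lemma uvert_eq [simp]: "uvert i = uvert j \<longleftrightarrow> i = j"
 by (auto simp: uvert_def)

lemma uvert_neq_pend [simp]: "uvert i ~= pend i' s j" "pend i' s j ~= uvert i"
 by (auto simp: uvert_def)

lemma core_in_pedge [simp]: "core i k \<in> pedge r i k l" "core i l \<in> pedge r i k l"
 by (auto simp: pedge_def)

lemma core_in_block: "k <= r ==> core i k \<in> block r i"
 by (auto simp: block_def)

lemma pedge_subset_block: "k < l ==> l <= r ==> pedge r i k l \<subseteq> block r i"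
 by (auto simp: pedge_def block_def)

text \<open>For \<open>i >= 2\<close> the bound \<open>i < r\<close> gives \<open>r >= 3\<close>, so
  the private vertex with index 0 exists.\<close>

lemma uvert_in_pedge: "i < r ==> 2 <= r ==> uvert i \<in> pedge r i 0 1"
 by (auto simp: uvert_def pedge_def)

lemma uvert_in_block: "i < r ==> 2 <= r ==> uvert i \<in> block r i"
 using uvert_in_pedge[of i r] pedge_subset_block[of 0 1 r i] by auto

lemma block_disjoint: "i ~= i' ==> block r i Int block r i' = {}"
 by (auto simp: block_def)

lemma finite_block [simp]: "finite (block r i)"
 by (auto simp: block_def)

lemma finite_core_part [simp]: "finite (core_part r)"
 by (auto simp: core_part_def)

lemma finite_pend_part [simp]: "finite (pend_part r t)"
 by (auto simp: pend_part_def)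

lemma finite_pedge [simp]: "finite (pedge r i k l)"
 by (simp add: pedge_def)

lemma finite_tail [simp]: "finite (tail r i s)"
 by (simp add: tail_def)

lemma core_part_pend_part_disjoint: "core_part r Int pend_part r t = {}"
 by (auto simp: core_part_def pend_part_def block_def)

lemma card_pedge:
 assumes "k ~= l" "2 <= r"
 shows "card (pedge r i k l) = r"
proof -
 have "card (priv i k l ` {..<r - 2}) = r - 2"
  by (subst card_image) (auto simp: inj_on_def)
 moreover have "{core i k, core i l} Int priv i k l ` {..<r - 2} = {}" by auto
 moreover have "card {core i k, core i l} = 2" using assms by simp
 ultimately show ?thesis
  using assms by (simp add: pedge_def card_Un_disjoint del: Un_insert_left)
qed

lemma card_tail:
 assumes "1 <= r"
 shows "card (tail r i s) = r"
proof -
 have "card (pend i s ` {..<r - 1}) = r - 1"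
  by (subst card_image) (auto simp: inj_on_def)
 then show ?thesis
  using assms by (subst tail_def, subst card_insert_disjoint) auto
qed

lemma pedges_iff: "A \<in> pedges r \<longleftrightarrow> (\<exists>i k l. i <= r & k < l & l <= r & A = pedge r i k l)"
 by (auto simp: pedges_def)

lemma tails_iff: "A \<in> tails r t \<longleftrightarrow> (\<exists>i s. i < r & s < t & A = tail r i s)"
 by (auto simp: tails_def)

lemma verts_pattern: "verts (pattern r t) = core_part r Un pend_part r t"
 by (simp add: pattern_def)

lemma edges_pattern: "edges (pattern r t) = insert (uvert ` {..<r}) (pedges r Un tails r t)"
 by (simp add: pattern_def)

lemma uvert_in_core_part: "i < r ==> 2 <= r ==> uvert i \<in> core_part r"
 using uvert_in_block[of i r] by (auto simp: core_part_def)

lemma pedge_subset_core_part: "i <= r ==> k < l ==> l <= r ==> pedge r i k l \<subseteq> core_part r"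
 using pedge_subset_block[of k l r i] by (auto simp: core_part_def)

lemma rgraph_pattern:
 assumes "2 <= r"
 shows "rgraph r (pattern r t)"
proof -
 have "e \<subseteq> core_part r Un pend_part r t & finite e & card e = r" if "e \<in> edges (pattern r t)" for e
 proof -
  have "e = uvert ` {..<r} \<or> (\<exists>i k l. i <= r & k < l & l <= r & e = pedge r i k l) \<or>
   (\<exists>i s. i < r & s < t & e = tail r i s)"
   using that by (simp add: edges_pattern pedges_iff tails_iff)
  then show ?thesis
  proof (elim disjE exE conjE)
   assume 1: "e = uvert ` {..<r}"
   have "card e = r" unfolding 1 by (subst card_image) (auto simp: inj_on_def)
   then show ?thesis using 1 uvert_in_core_part assms by auto
  next
   fix i k l assume "i <= r" "k < l" "l <= r" "e = pedge r i k l"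
   then show ?thesis using pedge_subset_core_part[of i r k l] card_pedge[of k l r i] assms by auto
  next
   fix i s assume 3: "i < r" "s < t" "e = tail r i s"
   then have "tail r i s \<subseteq> core_part r Un pend_part r t"
    using uvert_in_core_part[of i r] assms by (auto simp: tail_def pend_part_def)
   then show ?thesis using card_tail[of r i s] assms 3 by auto
  qed
 qed
 then show ?thesis unfolding rgraph_def verts_pattern nsets_def by auto
qed

text \<open>Copies are extensional functions, so an embedding given on the whole type has to be
  restricted first.\<close>

lemma not_hyp_freeI:
 assumes "inj_on \<phi> (verts F)" "\<And>v. v \<in> verts F ==> \<phi> v \<in> verts G"
  and "\<And>e. e \<in> edges F ==> \<phi> ` e \<in> edges G" and "\<And>e. e \<in> edges F ==> e \<subseteq> verts F"
 shows "\<not> hyp_free F G"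
proof -
 have "restrict \<phi> (verts F) \<in> copies F G"
  unfolding copies_def
 proof (intro CollectI conjI ballI)
  show "restrict \<phi> (verts F) \<in> verts F \<rightarrow>\<^sub>E verts G" using assms(2) by simp
  show "inj_on (restrict \<phi> (verts F)) (verts F)" using assms(1) by simp
  fix e assume e: "e \<in> edges F"
  then have "restrict \<phi> (verts F) ` e = \<phi> ` e"
   using assms(4) by (intro image_cong) auto
  then show "restrict \<phi> (verts F) ` e \<in> edges G" using assms(3) e by simp
 qed
 then show ?thesis by (auto simp: hyp_free_def)
qed

section \<open>Assembling the pattern from skeletons of its blocks\<close>

text \<open>A block of which the cores \<open>x\<close> and the edges \<open>f\<close>,
  \<open>h\<close> for the pairs (0,1) and (0,2) are placed, all other pairs being rich. Two pairs
  need actual edges: (0,1) carries the vertex that connects the blocks, and (0,2) may have both ends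
  in one colour class, where richness need not be available.\<close>

definition skel :: "nat => 'a set set => real => (nat => 'a) => 'a set => 'a set => bool" where
 "skel r E m x f h \<longleftrightarrow> inj_on x {..r} & f \<in> E & h \<in> E & f Int x ` {..r} = {x 0, x 1} \<and>
   h Int x ` {..r} = {x 0, x 2} & f Int h = {x 0} \<and>
   (\<forall>k l. k < l --> l <= r --> (k, l) ~= (0, 1) --> (k, l) ~= (0, 2) --> rich E m {x k, x l})"

definition blk :: "nat => (nat => 'a) => 'a set => 'a set => 'a set" where
 "blk r x f h = x ` {..r} Un f Un h"

text \<open>The position of \<open>uvert i\<close> in its block, with \<open>x\<close> for the cores
  and \<open>f\<close> for the edge of the pair (0,1).\<close>

definition role :: "nat => (nat => 'a) => 'a set => 'a => bool" where
 "role i x f u \<longleftrightarrow> (if i = 0 then u = x 0 else if i = 1 then u = x 1 else u \<in> f - {x 0, x 1})"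

text \<open>The first two summands cover the vertices met during greedy extension, the third the
  skeletons and reserved sets to be avoided while the blocks are placed in turn.\<close>

definition pattern_bound :: "nat => nat => nat" where
 "pattern_bound r t = card (verts (pattern r t)) + r * card (edges (pattern r t)) + (r + 1) * (5 * r + 2)"

lemma finite_edges_pattern: "finite (edges (pattern r t))"
 by (auto simp: edges_pattern pedges_def tails_def)

lemma finite_verts_pattern: "finite (verts (pattern r t))"
 by (simp add: verts_pattern)

lemma ex_bij_betw_at:
 assumes "finite A" "card A = n" "a \<in> A" "0 < n"
 shows "\<exists>b. bij_betw b {..<n} A & b 0 = a"
proof -
 obtain b where b: "bij_betw b {1..<n} (A - {a})"
  using assms finite_same_card_bij[of "{1..<n}" "A - {a}"] by auto
 define c where "c = (%k. if k = 0 then a else b k)"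
 have eq: "{..<n} = insert 0 {1..<n}" using assms(4) by auto
 have "bij_betw c {1..<n} (A - {a})"
  using b by (rule bij_betw_cong[THEN iffD1, rotated]) (auto simp: c_def)
 then have "bij_betw c ({1..<n} Un {0}) (A - {a} Un {c 0})"
  by (intro notIn_Un_bij_betw) (auto simp: c_def)
 moreover have "A - {a} Un {c 0} = A" using assms(3) by (auto simp: c_def)
 ultimately have "bij_betw c {..<n} A" by (simp add: eq)
 then show ?thesis by (intro exI[of _ c]) (simp add: c_def)
qed

text \<open>Once the skeletons are placed, every remaining edge of the pattern meets the placed part
  in a rich set, a core pair or some \<open>uvert i\<close>, and its other vertices belong to it
  alone. So \<open>greedy_extension\<close> completes the copy.\<close>

lemma pattern_from_skeletons:
 fixes G :: "'a hypergraph"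
 assumes r: "2 <= r" and G: "rgraph r G" and m: "real (pattern_bound r t) <= m"
  and sk: "\<And>i. i <= r ==> skel r (edges G) m (x i) (f i) (h i)"
  and ro: "\<And>i. i < r ==> role i (x i) (f i) (w i)"
  and dis: "\<And>i j. i <= r ==> j <= r ==> i ~= j ==>
    blk r (x i) (f i) (h i) Int blk r (x j) (f j) (h j) = {}"
  and w: "w ` {..<r} \<in> edges G" and wr: "\<And>i. i < r ==> rich (edges G) m {w i}"
 shows "\<not> hyp_free (pattern r t) G"
proof -
 note One_nat_def [simp del]
 let ?E = "edges G"
 have E: "finite e" "card e = r" "e \<subseteq> verts G" if "e \<in> ?E" for e
  using G that by (auto simp: rgraph_def nsets_def)
 have fh: "f i \<in> ?E" "h i \<in> ?E" if "i <= r" for i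
  using sk[OF that] by (simp_all add: skel_def)
 have inj: "inj_on (x i) {..r}" if "i <= r" for i
  using sk[OF that] by (simp add: skel_def)
 have xne: "x i k ~= x i l" if "i <= r" "k <= r" "l <= r" "k ~= l" for i k l
  using inj_onD[OF inj[OF that(1)], of k l] that by auto
 have fx: "f i Int x i ` {..r} = {x i 0, x i 1}" and hx: "h i Int x i ` {..r} = {x i 0, x i 2}"
  and fhx: "f i Int h i = {x i 0}" if "i <= r" for i
  using sk[OF that] by (simp_all add: skel_def)
 have x01: "x i 0 \<in> f i" "x i 1 \<in> f i" "x i 0 \<in> h i" "x i 2 \<in> h i" if "i <= r" for i
  using fx[OF that] hx[OF that] by auto
 have cf: "card (f i - {x i 0, x i 1}) = r - 2" if "i <= r" for i
  using that r x01[OF that] E[OF fh(1)[OF that]] xne[OF that, of 0 1]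
  by (subst card_Diff_subset) auto
 have ch: "card (h i - {x i 0, x i 2}) = r - 2" if "i <= r" for i
  using that r x01[OF that] E[OF fh(2)[OF that]] xne[OF that, of 0 2]
  by (subst card_Diff_subset) auto
 \<comment> \<open>For \<open>2 <= i < r\<close> the vertex \<open>uvert i\<close> is the private
   vertex with index 0, so the enumeration has to start at \<open>w i\<close>.\<close>
 have "\<exists>b. bij_betw b {..<r - 2} (f i - {x i 0, x i 1}) & (2 <= i & i < r --> b 0 = w i)"
  if i: "i <= r" for i
 proof (cases "2 <= i & i < r")
  case True
  then have "w i \<in> f i - {x i 0, x i 1}" using ro[of i] by (simp add: role_def)
  then show ?thesis
   using ex_bij_betw_at[of "f i - {x i 0, x i 1}" "r - 2" "w i"] cf[OF i] E(1)[OF fh(1)[OF i]] True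
   by auto
 next
  case False
  then show ?thesis
   using finite_same_card_bij[of "{..<r - 2}" "f i - {x i 0, x i 1}"] cf[OF i] E(1)[OF fh(1)[OF i]]
   by auto
 qed
 then have "\<forall>i. \<exists>b. i <= r --> bij_betw b {..<r - 2} (f i - {x i 0, x i 1}) & (2 <= i & i < r --> b 0 = w i)"
  by simp
 from choice[OF this] obtain b where b0: "\<forall>i. i <= r -->
   bij_betw (b i) {..<r - 2} (f i - {x i 0, x i 1}) & (2 <= i & i < r --> b i 0 = w i)"
  by (elim exE)
 have b: "bij_betw (b i) {..<r - 2} (f i - {x i 0, x i 1})" if "i <= r" for i
  using b0 that by simp
 have bw: "b i 0 = w i" if "2 <= i" "i < r" for i
  using b0 that by simp
 have "\<forall>i. \<exists>b. i <= r --> bij_betw b {..<r - 2} (h i - {x i 0, x i 2})"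
 proof (intro allI)
  fix i show "\<exists>b. i <= r --> bij_betw b {..<r - 2} (h i - {x i 0, x i 2})"
   using finite_same_card_bij[of "{..<r - 2}" "h i - {x i 0, x i 2}"] ch[of i] E(1)[OF fh(2), of i]
   by (cases "i <= r") auto
 qed
 from choice[OF this] obtain b' where b'0: "\<forall>i. i <= r -->
   bij_betw (b' i) {..<r - 2} (h i - {x i 0, x i 2})"
  by (elim exE)
 have b': "bij_betw (b' i) {..<r - 2} (h i - {x i 0, x i 2})" if "i <= r" for i
  using b'0 that by simp
 \<comment> \<open>Of the private vertices only those of the pairs (0,1) and (0,2) are placed here,
   so \<open>l\<close> decides between \<open>b\<close> and \<open>b'\<close>.\<close>
 define \<phi>0 where "\<phi>0 = (%v. case vx_dec v of (a, i, k, l, j) \<Rightarrow>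
  if a = 0 then x i k else if l = 1 then b i j else b' i j)"
 have \<phi>0 [simp]: "\<phi>0 (core i k) = x i k" "\<phi>0 (priv i 0 1 j) = b i j" "\<phi>0 (priv i 0 2 j) = b' i j"
  for i k j by (simp_all add: \<phi>0_def core_def priv_def)
 define Wi where "Wi = (%i. core i ` {..r} Un (priv i 0 1 ` {..<r - 2} Un priv i 0 2 ` {..<r - 2}))"
 define W where "W = (\<Union>i\<le>r. Wi i)"
 have im1: "\<phi>0 ` core i ` {..r} = x i ` {..r}" for i
  by (simp add: image_image)
 have im2: "\<phi>0 ` priv i 0 1 ` {..<r - 2} = f i - {x i 0, x i 1}" if "i <= r" for i
  using b[OF that] by (simp add: image_image bij_betw_def)
 have im3: "\<phi>0 ` priv i 0 2 ` {..<r - 2} = h i - {x i 0, x i 2}" if "i <= r" for i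
  using b'[OF that] by (simp add: image_image bij_betw_def)
 have WB: "\<phi>0 ` Wi i \<subseteq> blk r (x i) (f i) (h i)" if "i <= r" for i
  unfolding Wi_def image_Un im1 im2[OF that] im3[OF that] blk_def by auto
 have injWi: "inj_on \<phi>0 (Wi i)" if i: "i <= r" for i
  unfolding Wi_def inj_on_Un
 proof (intro conjI)
  show "inj_on \<phi>0 (core i ` {..r})"
   using inj[OF i] by (auto simp: inj_on_def)
  show "inj_on \<phi>0 (priv i 0 1 ` {..<r - 2})"
   using b[OF i] by (auto simp: inj_on_def bij_betw_def)
  show "inj_on \<phi>0 (priv i 0 2 ` {..<r - 2})"
   using b'[OF i] by (auto simp: inj_on_def bij_betw_def)
  have e1: "priv i 0 1 ` {..<r - 2} - priv i 0 2 ` {..<r - 2} = priv i 0 1 ` {..<r - 2}"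
   "priv i 0 2 ` {..<r - 2} - priv i 0 1 ` {..<r - 2} = priv i 0 2 ` {..<r - 2}"
   by auto
  show "\<phi>0 ` (priv i 0 1 ` {..<r - 2} - priv i 0 2 ` {..<r - 2}) \<inter>
   \<phi>0 ` (priv i 0 2 ` {..<r - 2} - priv i 0 1 ` {..<r - 2}) = {}"
   unfolding e1 im2[OF i] im3[OF i] using fhx[OF i] by auto
  have e2: "core i ` {..r} - (priv i 0 1 ` {..<r - 2} Un priv i 0 2 ` {..<r - 2}) = core i ` {..r}"
   "priv i 0 1 ` {..<r - 2} Un priv i 0 2 ` {..<r - 2} - core i ` {..r} =
    priv i 0 1 ` {..<r - 2} Un priv i 0 2 ` {..<r - 2}"
   by auto
  show "\<phi>0 ` (core i ` {..r} - (priv i 0 1 ` {..<r - 2} Un priv i 0 2 ` {..<r - 2})) \<inter>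
   \<phi>0 ` (priv i 0 1 ` {..<r - 2} Un priv i 0 2 ` {..<r - 2} - core i ` {..r}) = {}"
   unfolding e2 image_Un im1 im2[OF i] im3[OF i] using fx[OF i] hx[OF i] by blast
 qed
 have injW: "inj_on \<phi>0 W"
 proof (rule inj_onI)
  fix u v assume uv: "u \<in> W" "v \<in> W" "\<phi>0 u = \<phi>0 v"
  then obtain i j where ij: "i <= r" "u \<in> Wi i" "j <= r" "v \<in> Wi j"
   by (auto simp: W_def)
  show "u = v"
  proof (cases "i = j")
   case True
   then show ?thesis using injWi[OF ij(1)] ij uv(3) by (auto dest: inj_onD)
  next
   case False
   have "\<phi>0 u \<in> blk r (x i) (f i) (h i)" "\<phi>0 v \<in> blk r (x j) (f j) (h j)"
    using WB ij by auto
   then show ?thesis using dis[OF ij(1,3) False] uv(3) by auto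
  qed
 qed
 define P where "P = {pedge r i k l | i k l. i <= r & k < l & l <= r & (k, l) ~= (0, 1) & (k, l) ~= (0, 2)}"
 define \<E> where "\<E> = P Un tails r t"
 have P_sub: "P \<subseteq> pedges r" unfolding P_def subset_iff mem_Collect_eq pedges_iff by metis
 have \<E>_sub: "\<E> \<subseteq> edges (pattern r t)" unfolding \<E>_def edges_pattern using P_sub by auto
 have W_sub: "W \<subseteq> verts (pattern r t)"
 proof -
  have "Wi i \<subseteq> block r i" for i
   using r by (force simp: Wi_def block_def)
  then show ?thesis unfolding W_def verts_pattern core_part_def by blast
 qed
 have coreW: "core i k \<in> W" if "i <= r" "k <= r" for i k
  using that unfolding W_def Wi_def by (intro UN_I[of i]) auto
 have privW: "priv i 0 1 j \<in> W" "priv i 0 2 j \<in> W" if "i <= r" "j < r - 2" for i j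
  using that unfolding W_def Wi_def by (auto intro!: UN_I[of i])
 have u_W: "uvert i \<in> W" if "i < r" for i
  using that r unfolding W_def Wi_def uvert_def by (force intro!: bexI[of _ i])
 have pW: "pedge r i k l Int W = {core i k, core i l}"
  if "i <= r" "k < l" "l <= r" "(k, l) ~= (0, 1)" "(k, l) ~= (0, 2)" for i k l
  using that by (auto simp: pedge_def W_def Wi_def)
 have tW: "tail r i s Int W = {uvert i}" if "i < r" for i s
  using u_W[OF that] by (auto simp: tail_def W_def Wi_def)
 have \<phi>u: "\<phi>0 (uvert i) = w i" if "i < r" for i
  using ro[OF that] bw[of i] that by (auto simp: uvert_def role_def)
 have "\<exists>\<phi>. inj_on \<phi> (W Un \<Union>\<E>) & (\<forall>v\<in>W. \<phi> v = \<phi>0 v) & (\<forall>A\<in>\<E>. \<phi> ` A \<in> ?E)"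
 proof (rule greedy_extension[where base = "%A. A Int W" and m = m])
  show "finite \<E>" using \<E>_sub finite_edges_pattern finite_subset by blast
  show "finite W" using W_sub finite_verts_pattern finite_subset by blast
  show "inj_on \<phi>0 W" by (rule injW)
  show "finite A & card A = r" if "A \<in> \<E>" for A
   using rgraph_pattern[OF r, of t] \<E>_sub that by (auto simp: rgraph_def nsets_def)
  show "A Int W = A Int W" for A :: "nat set" ..
  show "(A - W) Int (A' - W) = {}" if AA: "A \<in> \<E>" "A' \<in> \<E>" "A ~= A'" for A A'
  proof (rule ccontr)
   assume "(A - W) Int (A' - W) ~= {}"
   then obtain v where v: "v \<in> A" "v \<in> A'" "v \<notin> W" by auto
   \<comment> \<open>A vertex outside \<open>W\<close> is private or pendant, and its code
     determines the edge that contains it.\<close>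
   have D: "(\<exists>i k l j. v = priv i k l j & B = pedge r i k l) \<or> (\<exists>i s j. v = pend i s j & B = tail r i s)"
    if B: "B \<in> \<E>" "v \<in> B" for B
   proof -
    have "B \<in> P \<or> B \<in> tails r t" using B(1) by (simp add: \<E>_def)
    then show ?thesis
    proof
     assume "B \<in> P"
     then obtain i k l where B': "B = pedge r i k l" "i <= r" "k < l" "l <= r" by (auto simp: P_def)
     have "core i k \<in> W" "core i l \<in> W" using B' by (auto intro: coreW)
     then obtain j where "v = priv i k l j"
      using B(2) v(3) B' by (auto simp: pedge_def)
     then show ?thesis using B' by auto
    next
     assume "B \<in> tails r t"
     then obtain i s where B': "B = tail r i s" "i < r" by (auto simp: tails_iff)
     then obtain j where "v = pend i s j" using B(2) v(3) u_W by (auto simp: tail_def)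
     then show ?thesis using B' by auto
    qed
   qed
   from D[OF AA(1) v(1)] D[OF AA(2) v(2)] AA(3) show False by auto
  qed
  show "rich ?E m (\<phi>0 ` (A Int W))" if "A \<in> \<E>" for A
  proof -
   have "A \<in> P \<or> A \<in> tails r t" using that by (simp add: \<E>_def)
   then show ?thesis
   proof
    assume "A \<in> P"
    then obtain i k l where A: "A = pedge r i k l" "i <= r" "k < l" "l <= r"
     "(k, l) ~= (0, 1)" "(k, l) ~= (0, 2)" by (auto simp: P_def)
    have "rich ?E m {x i k, x i l}"
     using sk[OF A(2)] A unfolding skel_def by meson
    then show ?thesis using A pW[OF A(2-6)] by simp
   next
    assume "A \<in> tails r t"
    then obtain i s where A: "A = tail r i s" "i < r" by (auto simp: tails_iff)
    then show ?thesis using tW[OF A(2)] wr[OF A(2)] \<phi>u[OF A(2)] by simp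
   qed
  qed
  have "card W + r * card \<E> <= pattern_bound r t"
   unfolding pattern_bound_def
   using card_mono[OF finite_verts_pattern W_sub] card_mono[OF finite_edges_pattern \<E>_sub]
   by (intro trans_le_add1 add_mono mult_le_mono2)
  then show "real (card W + r * card \<E>) <= m" using m by linarith
  show "finite e & card e = r" if "e \<in> ?E" for e using E[OF that] by simp
 qed
 then obtain \<phi> where \<phi>: "inj_on \<phi> (W Un \<Union>\<E>)" "\<forall>v\<in>W. \<phi> v = \<phi>0 v" "\<forall>A\<in>\<E>. \<phi> ` A \<in> ?E"
  by (elim exE conjE)
 have cov: "v \<in> W Un \<Union>\<E>" if v: "v \<in> verts (pattern r t)" for v
 proof -
  have "(\<exists>i k. v = core i k & i <= r & k <= r) \<or> (\<exists>i k l j. v = priv i k l j & i <= r & k < l & l <= r & j < r - 2)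
    \<or> (\<exists>i s j. v = pend i s j & i < r & s < t & j < r - 1)"
   using v unfolding verts_pattern core_part_def block_def pend_part_def by blast
  then show ?thesis
  proof (elim disjE exE conjE)
   fix i k assume "v = core i k" "i <= r" "k <= r"
   then show ?thesis by (simp add: coreW)
  next
   fix i k l j assume a: "v = priv i k l j" "i <= r" "k < l" "l <= r" "j < r - 2"
   show ?thesis
   proof (cases "(k, l) = (0, 1) \<or> (k, l) = (0, 2)")
    case True
    then show ?thesis using a privW by auto
   next
    case False
    then have "pedge r i k l \<in> \<E>" using a unfolding \<E>_def P_def by blast
    moreover have "v \<in> pedge r i k l" using a by (auto simp: pedge_def)
    ultimately show ?thesis by blast
   qed
  next
   fix i s j assume a: "v = pend i s j" "i < r" "s < t" "j < r - 1"
   then have "tail r i s \<in> \<E>" unfolding \<E>_def tails_iff Un_iff by blast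
   moreover have "v \<in> tail r i s" using a by (auto simp: tail_def)
   ultimately show ?thesis by blast
  qed
 qed
 have edge: "\<phi> ` e \<in> ?E" if e: "e \<in> edges (pattern r t)" for e
 proof -
  have "e = uvert ` {..<r} \<or> e \<in> tails r t \<or> (\<exists>i k l. i <= r & k < l & l <= r & e = pedge r i k l)"
   using e by (auto simp: edges_pattern pedges_iff)
  then consider "e = uvert ` {..<r}" | "e \<in> \<E>" | i where "i <= r" "e = pedge r i 0 1"
   | i where "i <= r" "e = pedge r i 0 2"
  proof (elim disjE exE conjE)
   fix i k l assume a: "i <= r" "k < l" "l <= r" "e = pedge r i k l"
    and c: "e \<in> \<E> ==> thesis" "\<And>i. i <= r ==> e = pedge r i 0 1 ==> thesis"
     "\<And>i. i <= r ==> e = pedge r i 0 2 ==> thesis"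
   show thesis
   proof (cases "(k, l) = (0, 1) \<or> (k, l) = (0, 2)")
    case True
    then show thesis using a c(2,3)[of i] by auto
   next
    case False
    then have "e \<in> \<E>" using a unfolding \<E>_def P_def by blast
    then show thesis by (rule c(1))
   qed
  qed (simp_all add: \<E>_def)
  then show ?thesis
  proof cases
   case 1
   have "\<phi> ` e = w ` {..<r}"
    unfolding 1 image_image using \<phi>(2) u_W \<phi>u by (intro image_cong) auto
   then show ?thesis using w by simp
  next
   case 2
   then show ?thesis using \<phi>(3) by simp
  next
   case 3
   have "e \<subseteq> W" using 3 r by (auto simp: pedge_def coreW privW)
   then have "\<phi> ` e = \<phi>0 ` e" using \<phi>(2) by (intro image_cong) auto
   also have "... = {x i 0, x i 1} Un (f i - {x i 0, x i 1})"
    unfolding 3 pedge_def image_Un im2[OF 3(1)] by simp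
   also have "... = f i" using x01[OF 3(1)] by auto
   finally show ?thesis using fh 3 by simp
  next
   case 4
   have "e \<subseteq> W" using 4 r by (auto simp: pedge_def coreW privW)
   then have "\<phi> ` e = \<phi>0 ` e" using \<phi>(2) by (intro image_cong) auto
   also have "... = {x i 0, x i 2} Un (h i - {x i 0, x i 2})"
    unfolding 4 pedge_def image_Un im3[OF 4(1)] by simp
   also have "... = h i" using x01[OF 4(1)] by auto
   finally show ?thesis using fh 4 by simp
  qed
 qed
 show ?thesis
 proof (rule not_hyp_freeI)
  show "inj_on \<phi> (verts (pattern r t))"
   by (rule inj_on_subset[OF \<phi>(1)]) (use cov in blast)
  show "\<phi> ` e \<in> ?E" if "e \<in> edges (pattern r t)" for e by (rule edge[OF that])
  show "e \<subseteq> verts (pattern r t)" if "e \<in> edges (pattern r t)" for e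
   using rgraph_pattern[OF r, of t] that by (auto simp: rgraph_def nsets_def)
  fix v assume v: "v \<in> verts (pattern r t)"
  show "\<phi> v \<in> verts G"
  proof -
   \<comment> \<open>Since the pattern has no isolated vertices, mapping edges to edges of
     \<open>G\<close> already puts every vertex image into \<open>verts G\<close>.\<close>
   have "\<exists>A\<in>edges (pattern r t). v \<in> A"
   proof (cases "v \<in> \<Union>\<E>")
    case True
    then show ?thesis using \<E>_sub by blast
   next
    case False
    then obtain i where i: "i <= r" "v \<in> Wi i" using cov[OF v] by (auto simp: W_def)
    have p: "pedge r i k l \<in> edges (pattern r t)" if "k < l" "l <= r" for k l
     unfolding edges_pattern insert_iff Un_iff pedges_iff using i that by blast
    have "v \<in> pedge r i 0 1 \<or> v \<in> pedge r i 0 2 \<or> (\<exists>k\<le>r. v = core i k)"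
     using i by (auto simp: Wi_def pedge_def)
    moreover have "v \<in> pedge r i 0 1" if "v = core i 0" using that by simp
    moreover have "v \<in> pedge r i 0 k" if "v = core i k" for k using that by simp
    ultimately show ?thesis
     using p[of 0 1] p[of 0 2] p[of 0] r by (metis One_nat_def Suc_1 Suc_le_lessD Suc_le_eq bot_nat_0.not_eq_extremum lessI less_le_trans order.strict_implies_order)
   qed
   then obtain A where A: "A \<in> edges (pattern r t)" "v \<in> A" by (elim bexE)
   then show ?thesis using E(3)[OF edge[OF A(1)]] by auto
  qed
 qed
qed

lemma card_blk_le:
 assumes "finite f" "card f = r" "finite h" "card h = r"
 shows "finite (blk r x f h)" "card (blk r x f h) <= 3 * r + 1"
proof -
 show "finite (blk r x f h)" using assms by (simp add: blk_def)
 have "card (blk r x f h) <= card (x ` {..r}) + card f + card h"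
  unfolding blk_def by (meson add_le_mono card_Un_le le_refl order_trans)
 also have "card (x ` {..r}) <= r + 1"
  using card_image_le[of "{..r}" x] by simp
 finally show "card (blk r x f h) <= 3 * r + 1" using assms by simp
qed

text \<open>Blocks are placed one at a time. Disjointness comes from giving the local hypothesis a
  set \<open>X\<close> made of the earlier blocks and of the sets \<open>P j\<close> reserved for
  the other blocks; \<open>P i\<close> holds what block \<open>i\<close> itself must be free to use,
  such as \<open>w i\<close>.\<close>

lemma pattern_from_local_skeletons:
 fixes G :: "'a hypergraph" and P :: "nat => 'a set"
 assumes r: "2 <= r" and G: "rgraph r G" and m: "real (pattern_bound r t) <= m"
  and Pdis: "\<And>i j. i <= r ==> j <= r ==> i ~= j ==> P i Int P j = {}"
  and Pfin: "\<And>i. i <= r ==> finite (P i) & card (P i) <= r + 1"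
  and loc: "\<And>i X. i <= r ==> finite X ==> card X <= pattern_bound r t ==> X Int P i = {} ==>
    \<exists>x f h. skel r (edges G) m x f h & (i < r --> role i x f (w i)) & blk r x f h Int X = {}"
  and w: "w ` {..<r} \<in> edges G" and wr: "\<And>i. i < r ==> rich (edges G) m {w i}"
 shows "\<not> hyp_free (pattern r t) G"
proof -
 let ?B = "%x f h i. blk r (x i) (f i) (h i)"
 have E: "finite e" "card e = r" if "e \<in> edges G" for e
  using G that by (auto simp: rgraph_def nsets_def)
 have "\<exists>x f h. \<forall>i<N. skel r (edges G) m (x i) (f i) (h i) & (i < r --> role i (x i) (f i) (w i)) \<and>
   (\<forall>j\<le>r. j ~= i --> ?B x f h i Int P j = {}) & (\<forall>j<i. ?B x f h i Int ?B x f h j = {})" if "N <= r + 1" for N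
  using that
 proof (induction N)
  case 0
  then show ?case by simp
 next
  case (Suc N)
  from Suc.IH[OF Suc_leD[OF Suc.prems]] obtain x f h where IH: "\<forall>i<N. skel r (edges G) m (x i) (f i) (h i) & (i < r --> role i (x i) (f i) (w i)) \<and>
   (\<forall>j\<le>r. j ~= i --> ?B x f h i Int P j = {}) & (\<forall>j<i. ?B x f h i Int ?B x f h j = {})"
   by (elim exE)
  define X1 where "X1 = (\<Union>j\<in>{..r} - {N}. P j)"
  define X2 where "X2 = (\<Union>i<N. ?B x f h i)"
  have N: "N <= r" using Suc.prems by simp
  have Bc: "finite (?B x f h i) & card (?B x f h i) <= 3 * r + 1" if "i < N" for i
  proof -
   have "f i \<in> edges G" "h i \<in> edges G" using IH that by (auto simp: skel_def)
   then show ?thesis using card_blk_le[of "f i" r "h i" "x i"] E by blast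
  qed
  have "card X1 <= (\<Sum>j\<in>{..r} - {N}. card (P j))" unfolding X1_def by (rule card_UN_le) simp
  also have "... <= (\<Sum>j\<in>{..r} - {N}. r + 1)" by (rule sum_mono) (use Pfin in auto)
  also have "... <= (r + 1) * (r + 1)" using N by simp
  finally have c1: "card X1 <= (r + 1) * (r + 1)" .
  have "card X2 <= (\<Sum>i<N. card (?B x f h i))" unfolding X2_def by (rule card_UN_le) simp
  also have "... <= (\<Sum>i<N. 3 * r + 1)" by (rule sum_mono) (use Bc in auto)
  also have "... = N * (3 * r + 1)" by simp
  also have "... <= (r + 1) * (3 * r + 1)" by (rule mult_le_mono1) (use N in simp)
  finally have c2: "card X2 <= (r + 1) * (3 * r + 1)" .
  have "card (X1 Un X2) <= card X1 + card X2" by (rule card_Un_le)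
  also have "... <= (r + 1) * (r + 1) + (r + 1) * (3 * r + 1)" using c1 c2 by (rule add_mono)
  also have "... <= (r + 1) * (5 * r + 2)" by (simp add: algebra_simps)
  also have "... <= pattern_bound r t" by (simp add: pattern_bound_def)
  finally have c3: "card (X1 Un X2) <= pattern_bound r t" .
  have fin: "finite (X1 Un X2)" unfolding X1_def X2_def using Pfin Bc by auto
  have "X1 Int P N = {}" unfolding X1_def using Pdis N by auto
  moreover have "X2 Int P N = {}" unfolding X2_def using IH N by auto
  ultimately have "(X1 Un X2) Int P N = {}" by auto
  from loc[OF N fin c3 this] obtain x' f' h' where new: "skel r (edges G) m x' f' h'"
   "N < r --> role N x' f' (w N)" "blk r x' f' h' Int (X1 Un X2) = {}"
   by (elim exE conjE)
  have n1: "blk r x' f' h' Int P j = {}" if "j <= r" "j ~= N" for j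
   using new(3) that unfolding X1_def by auto
  have n2: "blk r x' f' h' Int ?B x f h j = {}" if "j < N" for j
   using new(3) that unfolding X2_def by auto
  show ?case
  proof (intro exI allI impI)
   fix i assume "i < Suc N"
   show "skel r (edges G) m ((x(N := x')) i) ((f(N := f')) i) ((h(N := h')) i) \<and>
    (i < r --> role i ((x(N := x')) i) ((f(N := f')) i) (w i)) \<and>
    (\<forall>j\<le>r. j ~= i --> ?B (x(N := x')) (f(N := f')) (h(N := h')) i Int P j = {}) \<and>
    (\<forall>j<i. ?B (x(N := x')) (f(N := f')) (h(N := h')) i Int ?B (x(N := x')) (f(N := f')) (h(N := h')) j = {})"
   proof (cases "i = N")
    case True
    then show ?thesis using new(1,2) n1 n2 by auto
   next
    case False
    then have "i < N" using \<open>i < Suc N\<close> by simp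
    then show ?thesis using IH by auto
   qed
  qed
 qed
 from this[OF order_refl] obtain x f h where F: "\<forall>i<r+1. skel r (edges G) m (x i) (f i) (h i) & (i < r --> role i (x i) (f i) (w i)) \<and>
   (\<forall>j\<le>r. j ~= i --> ?B x f h i Int P j = {}) & (\<forall>j<i. ?B x f h i Int ?B x f h j = {})"
  by (elim exE)
 show ?thesis
 proof (rule pattern_from_skeletons[OF r G m, where x = x and f = f and h = h and w = w])
  show "skel r (edges G) m (x i) (f i) (h i)" if "i <= r" for i using F that by simp
  show "role i (x i) (f i) (w i)" if "i < r" for i using F that by simp
  show "?B x f h i Int ?B x f h j = {}" if "i <= r" "j <= r" "i ~= j" for i j
  proof (cases "j < i")
   case True
   then show ?thesis using F that by simp
  next
   case False
   then have "?B x f h j Int ?B x f h i = {}" using F that by simp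
   then show ?thesis by (simp only: Int_commute)
  qed
 qed (rule w, rule wr)
qed

section \<open>Clique counts and a colouring with few bad edges\<close>

definition cliques :: "'a set => ('a => 'a => bool) => nat => 'a set set" where
 "cliques V A s = {c \<in> nsets V s. \<forall>x\<in>c. \<forall>y\<in>c. x ~= y --> A x y}"

text \<open>Without loops \<open>y\<close> is its own nonneighbour, so a member of a clique misses
  exactly one vertex of it, itself. This fits the complete \<open>r\<close>-partite graph, where
  every vertex misses exactly one vertex of each \<open>r\<close>-clique.\<close>

definition nonadj :: "('a => 'a => bool) => 'a => 'a set" where
 "nonadj A y = {x. \<not> A x y}"

definition extenders :: "'a set => ('a => 'a => bool) => nat => 'a set => 'a set" where
 "extenders V A s b = {y \<in> V. y \<notin> b & insert y b \<in> cliques V A s}"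

lemma finite_cliques: "finite V ==> finite (cliques V A s)"
 by (simp add: cliques_def finite_imp_finite_nsets)

lemma cliques_D: "c \<in> cliques V A s ==> c \<subseteq> V & finite c & card c = s"
 by (simp add: cliques_def nsets_def)

lemma card_cliques_le: "finite V ==> card (cliques V A s) <= card V ^ s"
 using card_mono[of "nsets V s" "cliques V A s"] card_nsets_le[of V s]
 by (fastforce simp: cliques_def finite_imp_finite_nsets)

lemma cliques_remove:
 assumes "c \<in> cliques V A (Suc s)" "x \<in> c"
 shows "c - {x} \<in> cliques V A s"
 using assms by (auto simp: cliques_def nsets_def)

text \<open>Double counting of pairs of a clique and one of its vertices: removing the vertex is
  inverse to adding an extender.\<close>

lemma sum_cliques_remove:
 assumes "finite V"
 shows "(\<Sum>c\<in>cliques V A (Suc s). \<Sum>x\<in>c. g (c - {x})) =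
  (\<Sum>b\<in>cliques V A s. rcard (extenders V A (Suc s) b) * g b)"
proof -
 have fc: "finite c" if "c \<in> cliques V A s'" for c s' using cliques_D[OF that] by simp
 have fe: "finite (extenders V A (Suc s) b)" for b using assms by (simp add: extenders_def)
 have "(\<Sum>c\<in>cliques V A (Suc s). \<Sum>x\<in>c. g (c - {x})) =
  (\<Sum>(c, x)\<in>(SIGMA c:cliques V A (Suc s). c). g (c - {x}))"
  by (rule sum.Sigma) (use finite_cliques[OF assms] fc in auto)
 also have "... = (\<Sum>(b, x)\<in>(SIGMA b:cliques V A s. extenders V A (Suc s) b). g b)"
 proof (rule sum.reindex_bij_witness[where i = "%(b, x). (insert x b, x)" and j = "%(c, x). (c - {x}, x)"])
  fix a assume "a \<in> (SIGMA c:cliques V A (Suc s). c)"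
  then obtain c x where a: "a = (c, x)" "c \<in> cliques V A (Suc s)" "x \<in> c" by auto
  then have "insert x (c - {x}) = c" by auto
  then show "(case case a of (c, x) => (c - {x}, x) of (b, x) => (insert x b, x)) = a"
   "(case a of (c, x) => (c - {x}, x)) \<in> (SIGMA b:cliques V A s. extenders V A (Suc s) b)"
   using a cliques_remove[OF a(2,3)] cliques_D[OF a(2)] by (auto simp: extenders_def)
  show "(case case a of (c, x) => (c - {x}, x) of (b, x) => g b) = (case a of (c, x) => g (c - {x}))"
   using a by simp
 next
  fix a assume "a \<in> (SIGMA b:cliques V A s. extenders V A (Suc s) b)"
  then show "(case case a of (b, x) => (insert x b, x) of (c, x) => (c - {x}, x)) = a"
   "(case a of (b, x) => (insert x b, x)) \<in> (SIGMA c:cliques V A (Suc s). c)"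
   by (auto simp: extenders_def)
 qed
 also have "... = (\<Sum>b\<in>cliques V A s. \<Sum>x\<in>extenders V A (Suc s) b. g b)"
  by (rule sum.Sigma[symmetric]) (use finite_cliques[OF assms] fe in auto)
 finally show ?thesis by simp
qed

text \<open>Cauchy-Schwarz against the constant 1, from the nonnegativity of a multiple of the
  variance of \<open>d\<close>.\<close>

lemma sum_squared_le_card_mult:
 fixes d :: "'a => real"
 assumes "finite I"
 shows "(\<Sum>b\<in>I. d b)\<^sup>2 <= rcard I * (\<Sum>b\<in>I. (d b)\<^sup>2)"
proof (cases "I = {}")
 case False
 define k where "k = rcard I"
 have k: "k > 0" using False assms by (simp add: k_def card_gt_0_iff)
 define S where "S = (\<Sum>b\<in>I. d b)"
 have "0 <= (\<Sum>b\<in>I. (k * d b - S)\<^sup>2)" by (rule sum_nonneg) simp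
 also have "... = (\<Sum>b\<in>I. k\<^sup>2 * (d b)\<^sup>2 - 2 * k * S * d b + S\<^sup>2)"
  by (rule sum.cong) (auto simp: power2_eq_square algebra_simps)
 also have "... = k\<^sup>2 * (\<Sum>b\<in>I. (d b)\<^sup>2) - 2 * k * S * S + k * S\<^sup>2"
  by (simp add: sum.distrib sum_subtractf sum_distrib_left S_def k_def)
 also have "... = k * (k * (\<Sum>b\<in>I. (d b)\<^sup>2) - S\<^sup>2)"
  by (simp add: power2_eq_square algebra_simps)
 finally have "0 <= k * (\<Sum>b\<in>I. (d b)\<^sup>2) - S\<^sup>2"
  using k by (simp add: zero_le_mult_iff)
 then show ?thesis by (simp add: S_def k_def)
qed simp

text \<open>For \<open>s = r\<close> and with \<open>P\<close> saying that the number of misses is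
  not 1, the size of this set measures the distance from a complete \<open>r\<close>-partite
  graph.\<close>

definition miss_pairs :: "'a set => ('a => 'a => bool) => nat => (nat => bool) => ('a set \<times> 'a) set" where
 "miss_pairs V A s P = {(c, y). c \<in> cliques V A s & y \<in> V & P (card (c Int nonadj A y))}"

lemma finite_miss_pairs: "finite V ==> finite (miss_pairs V A s P)"
 by (rule finite_subset[of _ "cliques V A s \<times> V"]) (auto simp: miss_pairs_def finite_cliques)

text \<open>The Moon--Moser inequality, with the slack term kept: the pairs \<open>(c, y)\<close> for which \<open>y\<close>
 has two nonneighbours in \<open>c\<close> contribute nothing to the sum of squared codegrees.\<close>

lemma moon_moser:
 fixes V :: "'a set"
 assumes V: "finite V" and sym: "\<And>x y. A x y ==> A y x" and irr: "\<And>x. \<not> A x x"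
 defines "k \<equiv> %s. rcard (cliques V A s)"
 shows "(real (Suc s) * k (Suc s))\<^sup>2 <= k s * (rcard V * k (Suc s)
   + real s * (real s + 2) * k (Suc (Suc s)) - rcard (miss_pairs V A (Suc s) (%m. m \<ge> 2)))"
  and "rcard (miss_pairs V A (Suc s) (%m. m = 0)) = (real s + 2) * k (Suc (Suc s))"
proof -
 let ?K = "cliques V A (Suc s)"
 define d where "d = (%b. rcard (extenders V A (Suc s) b))"
 \<comment> \<open>The vertices of \<open>c\<close> that \<open>y\<close> can replace, itself
   included if \<open>y\<close> lies in \<open>c\<close>. Summed over \<open>y\<close> they give the
   sum of the degrees of the subcliques of \<open>c\<close>.\<close>
 define w where "w = (%c y. {x \<in> c. y \<in> extenders V A (Suc s) (c - {x})})"
 let ?M = "%P. miss_pairs V A (Suc s) P"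
 have finK: "finite ?K" by (rule finite_cliques[OF V])
 have zero: "insert y c \<in> cliques V A (Suc (Suc s)) & y \<notin> c \<longleftrightarrow> card (c Int nonadj A y) = 0"
  if "c \<in> ?K" "y \<in> V" for c y
 proof -
  have c: "c \<subseteq> V" "finite c" "card c = Suc s" using cliques_D[OF that(1)] by auto
  have "card (c Int nonadj A y) = 0 \<longleftrightarrow> c Int nonadj A y = {}" using c by simp
  also have "... \<longleftrightarrow> (\<forall>x\<in>c. A x y)" by (auto simp: nonadj_def)
  also have "... \<longleftrightarrow> y \<notin> c & (\<forall>x\<in>c. A x y)" using irr by auto
  also have "... \<longleftrightarrow> insert y c \<in> cliques V A (Suc (Suc s)) & y \<notin> c"
   using that c sym by (auto simp: cliques_def nsets_def)
  finally show ?thesis by simp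
 qed
 have "(\<Sum>c\<in>?K. rcard (extenders V A (Suc (Suc s)) c)) = (\<Sum>c\<in>cliques V A (Suc (Suc s)). \<Sum>x\<in>c. 1)"
  using sum_cliques_remove[OF V, of "%_. 1" A "Suc s"] by simp
 also have "... = (\<Sum>c\<in>cliques V A (Suc (Suc s)). real s + 2)"
  by (rule sum.cong) (use cliques_D in force)+
 finally have e2: "(\<Sum>c\<in>?K. rcard (extenders V A (Suc (Suc s)) c)) = (real s + 2) * k (Suc (Suc s))"
  by (simp add: k_def)
 have "?M (%m. m = 0) = (SIGMA c:?K. extenders V A (Suc (Suc s)) c)"
  using zero by (auto simp: miss_pairs_def extenders_def)
 then have "card (?M (%m. m = 0)) = (\<Sum>c\<in>?K. card (extenders V A (Suc (Suc s)) c))"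
  using finK V by (simp add: extenders_def)
 then show Z: "rcard (?M (%m. m = 0)) = (real s + 2) * k (Suc (Suc s))"
  using e2 by simp
 have sd: "(\<Sum>b\<in>cliques V A s. d b) = real (Suc s) * k (Suc s)"
 proof -
  have "(\<Sum>b\<in>cliques V A s. d b) = (\<Sum>c\<in>?K. \<Sum>x\<in>c. 1)"
   using sum_cliques_remove[OF V, of "%_. 1" A s] by (simp add: d_def)
  also have "... = (\<Sum>c\<in>?K. real (Suc s))"
   by (rule sum.cong) (use cliques_D in force)+
  finally show ?thesis by (simp add: k_def)
 qed
 \<comment> \<open>A nonneighbour of \<open>y\<close> in \<open>c\<close> must be the replaced
   vertex. So two nonneighbours leave no choice, one leaves at most one, and none leaves at most
   \<open>s + 1\<close>.\<close>
 have wle: "rcard (w c y) <= (if card (c Int nonadj A y) = 1 then 1 else 0)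
   + real (Suc s) * (if card (c Int nonadj A y) = 0 then 1 else 0)"
  if cy: "c \<in> ?K" "y \<in> V" for c y
 proof -
  have c: "c \<subseteq> V" "finite c" "card c = Suc s" using cliques_D[OF cy(1)] by auto
  have wsub: "c Int nonadj A y \<subseteq> {x}" if x: "x \<in> w c y" for x
  proof
   fix z assume z: "z \<in> c Int nonadj A y"
   have x': "x \<in> c" "y \<notin> c - {x}" "insert y (c - {x}) \<in> ?K"
    using x by (auto simp: w_def extenders_def)
   show "z \<in> {x}"
   proof (rule ccontr)
    assume "z \<notin> {x}"
    then have "z \<in> c - {x}" using z by auto
    moreover have "z ~= y" using calculation x'(2) by auto
    ultimately have "A z y" using x'(3) by (auto simp: cliques_def)
    then show False using z by (auto simp: nonadj_def)
   qed
  qed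
  have w_c: "w c y \<subseteq> c" by (auto simp: w_def)
  have cw: "card (w c y) <= Suc s" using card_mono[OF c(2) w_c] c by simp
  consider "card (c Int nonadj A y) = 0" | "card (c Int nonadj A y) = 1" | "card (c Int nonadj A y) \<ge> 2"
   by linarith
  then show ?thesis
  proof cases
   case 1
   then show ?thesis using cw by simp
  next
   case 2
   then obtain z where z: "c Int nonadj A y = {z}" using card_1_singletonE by metis
   then have "w c y \<subseteq> {z}" using wsub by auto
   then have "card (w c y) <= 1" using card_mono[of "{z}" "w c y"] by simp
   then show ?thesis using 2 by simp
  next
   case 3
   have "w c y = {}"
   proof (rule ccontr)
    assume "w c y ~= {}"
    then obtain x where "x \<in> w c y" by auto
    then have "card (c Int nonadj A y) <= 1" using wsub card_mono[of "{x}" "c Int nonadj A y"] by simp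
    then show False using 3 by simp
   qed
   then show ?thesis by simp
  qed
 qed
 have count: "(\<Sum>c\<in>?K. \<Sum>y\<in>V. if P (card (c Int nonadj A y)) then 1 else 0) = rcard (?M P)" for P
 proof -
  have "rcard (?M P) = (\<Sum>p\<in>?K \<times> V. if p \<in> ?M P then 1 else 0)"
  proof -
   have "?M P = {p \<in> ?K \<times> V. p \<in> ?M P}" by (auto simp: miss_pairs_def)
   then have "rcard (?M P) = (\<Sum>p\<in>{p \<in> ?K \<times> V. p \<in> ?M P}. 1)" by simp
   also have "... = (\<Sum>p\<in>?K \<times> V. if p \<in> ?M P then 1 else 0)"
    by (rule sum.inter_filter) (use finK V in simp)
   finally show ?thesis .
  qed
  also have "... = (\<Sum>c\<in>?K. \<Sum>y\<in>V. if (c, y) \<in> ?M P then 1 else 0)"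
   by (simp add: sum.cartesian_product)
  also have "... = (\<Sum>c\<in>?K. \<Sum>y\<in>V. if P (card (c Int nonadj A y)) then 1 else 0)"
   by (intro sum.cong refl) (auto simp: miss_pairs_def)
  finally show ?thesis by simp
 qed
 have "(\<Sum>b\<in>cliques V A s. (d b)\<^sup>2) = (\<Sum>c\<in>?K. \<Sum>x\<in>c. d (c - {x}))"
  using sum_cliques_remove[OF V, of d A s] by (simp add: d_def power2_eq_square)
 also have "... = (\<Sum>c\<in>?K. \<Sum>y\<in>V. rcard (w c y))"
 proof (rule sum.cong[OF refl])
  fix c assume c: "c \<in> ?K"
  then have fc: "finite c" using cliques_D by blast
  have "(\<Sum>x\<in>c. d (c - {x})) = (\<Sum>x\<in>c. \<Sum>y\<in>V. if y \<in> extenders V A (Suc s) (c - {x}) then 1 else 0)"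
  proof (rule sum.cong[OF refl])
   fix x
   have "extenders V A (Suc s) (c - {x}) = {y \<in> V. y \<in> extenders V A (Suc s) (c - {x})}"
    by (auto simp: extenders_def)
   then have "d (c - {x}) = (\<Sum>y\<in>{y \<in> V. y \<in> extenders V A (Suc s) (c - {x})}. 1)"
    by (simp add: d_def)
   also have "... = (\<Sum>y\<in>V. if y \<in> extenders V A (Suc s) (c - {x}) then 1 else 0)"
    by (rule sum.inter_filter[OF V])
   finally show "d (c - {x}) = (\<Sum>y\<in>V. if y \<in> extenders V A (Suc s) (c - {x}) then 1 else 0)" .
  qed
  also have "... = (\<Sum>y\<in>V. \<Sum>x\<in>c. if y \<in> extenders V A (Suc s) (c - {x}) then 1 else 0)"
   by (rule sum.swap)
  also have "... = (\<Sum>y\<in>V. rcard (w c y))"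
  proof (rule sum.cong[OF refl])
   fix y
   have "rcard (w c y) = (\<Sum>x\<in>w c y. 1)" by simp
   also have "... = (\<Sum>x\<in>c. if y \<in> extenders V A (Suc s) (c - {x}) then 1 else 0)"
    unfolding w_def by (rule sum.inter_filter[OF fc])
   finally show "(\<Sum>x\<in>c. if y \<in> extenders V A (Suc s) (c - {x}) then 1 else 0) = rcard (w c y)"
    by simp
  qed
  finally show "(\<Sum>x\<in>c. d (c - {x})) = (\<Sum>y\<in>V. rcard (w c y))" .
 qed
 also have "... <= (\<Sum>c\<in>?K. \<Sum>y\<in>V. (if card (c Int nonadj A y) = 1 then 1 else 0)
   + real (Suc s) * (if card (c Int nonadj A y) = 0 then 1 else 0))"
  by (intro sum_mono wle)
 also have "... = rcard (?M (%m. m = 1)) + real (Suc s) * rcard (?M (%m. m = 0))"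
  unfolding count[symmetric] by (simp only: sum.distrib sum_distrib_left)
 finally have sq: "(\<Sum>b\<in>cliques V A s. (d b)\<^sup>2) \<le>
   rcard (?M (%m. m = 1)) + real (Suc s) * rcard (?M (%m. m = 0))" .
 have "?K \<times> V = ?M (%m. m = 1) Un (?M (%m. m = 0) Un ?M (%m. m \<ge> 2))"
 proof (intro set_eqI iffI)
  fix p assume p: "p \<in> ?K \<times> V"
  have "card (fst p Int nonadj A (snd p)) = 1 \<or> card (fst p Int nonadj A (snd p)) = 0 \<or>
    card (fst p Int nonadj A (snd p)) \<ge> 2" by linarith
  then show "p \<in> ?M (%m. m = 1) Un (?M (%m. m = 0) Un ?M (%m. m \<ge> 2))"
   using p by (cases p) (simp add: miss_pairs_def)
 qed (auto simp: miss_pairs_def)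
 moreover have "card (?M (%m. m = 1) Un (?M (%m. m = 0) Un ?M (%m. m \<ge> 2))) =
   card (?M (%m. m = 1)) + card (?M (%m. m = 0) Un ?M (%m. m \<ge> 2))"
  by (rule card_Un_disjoint[OF finite_miss_pairs[OF V] finite_UnI[OF finite_miss_pairs[OF V] finite_miss_pairs[OF V]]])
   (auto simp: miss_pairs_def)
 moreover have "card (?M (%m. m = 0) Un ?M (%m. m \<ge> 2)) = card (?M (%m. m = 0)) + card (?M (%m. m \<ge> 2))"
  by (rule card_Un_disjoint[OF finite_miss_pairs[OF V] finite_miss_pairs[OF V]]) (auto simp: miss_pairs_def)
 ultimately have "card (?M (%m. m = 1)) + (card (?M (%m. m = 0)) + card (?M (%m. m \<ge> 2))) = card ?K * card V"
  by (metis card_cartesian_product)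
 then have tot: "rcard (?M (%m. m = 1)) + (rcard (?M (%m. m = 0)) + rcard (?M (%m. m \<ge> 2)))
   = k (Suc s) * rcard V"
  unfolding k_def by (metis of_nat_add of_nat_mult)
 have "(\<Sum>b\<in>cliques V A s. (d b)\<^sup>2) <= rcard V * k (Suc s)
   + real s * (real s + 2) * k (Suc (Suc s)) - rcard (?M (%m. m \<ge> 2))"
  using sq tot Z by (simp add: algebra_simps)
 then have "k s * (\<Sum>b\<in>cliques V A s. (d b)\<^sup>2) <= k s * (rcard V * k (Suc s)
   + real s * (real s + 2) * k (Suc (Suc s)) - rcard (?M (%m. m \<ge> 2)))"
  by (rule mult_left_mono) (simp add: k_def)
 moreover have "(real (Suc s) * k (Suc s))\<^sup>2 <= k s * (\<Sum>b\<in>cliques V A s. (d b)\<^sup>2)"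
  using sum_squared_le_card_mult[OF finite_cliques[OF V, of A s], of d] unfolding sd k_def .
 ultimately show "(real (Suc s) * k (Suc s))\<^sup>2 <= k s * (rcard V * k (Suc s)
   + real s * (real s + 2) * k (Suc (Suc s)) - rcard (?M (%m. m \<ge> 2)))"
  by linarith
qed

lemma prod_descending: "(\<Prod>s\<in>{1..<r}. real (r - s + 1)) = fact r" if "1 <= r"
proof -
 have "(\<Prod>s\<in>{1..<r}. real (r - s + 1)) = (\<Prod>j\<in>{2..r}. real j)"
  by (rule prod.reindex_bij_witness[where i = "%j. r + 1 - j" and j = "%s. r + 1 - s"]) auto
 also have "{1..r} = insert 1 {2..r}" using that by auto
 then have "(\<Prod>j\<in>{2..r}. real j) = (\<Prod>j\<in>{1..r}. real j)" by simp
 also have "... = fact r" by (simp add: fact_prod)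
 finally show ?thesis .
qed

text \<open>With \<open>a s = s k\<^sub>s / k\<^sub>s\<^sub>-\<^sub>1\<close> the Moon--Moser inequality reads
 \<open>s a\<^sub>s <= n + (s - 1) a\<^sub>s\<^sub>+\<^sub>1\<close>; the recursion is tight for balanced complete \<open>r\<close>-partite graphs.\<close>

definition rat_bound :: "nat => real => real" where
 "rat_bound r \<tau> = fact r * (1 / real r ^ r - \<tau>) / (\<Prod>s\<in>{1..<r}. real (r - s + 1) / real r + \<tau>)"

text \<open>At 0 the product is \<open>fact r / real r ^ (r - 1)\<close>, so
  \<open>rat_bound r 0\<close> is \<open>1 / r\<close> and the main terms cancel. Continuity gives
  the rest.\<close>

lemma rat_bound_tendsto:
 assumes "2 <= r"
 shows "((%\<tau>. 1 - real r * rat_bound r \<tau> + real r * \<tau>) \<longlongrightarrow> 0) (at_right 0)"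
proof -
 have p: "(\<Prod>s\<in>{1..<r}. real (r - s + 1) / real r) = fact r / real r ^ (r - 1)"
  using prod_descending[of r] assms by (simp add: prod_dividef)
 have pos: "(\<Prod>s\<in>{1..<r}. real (r - s + 1) / real r + 0) ~= 0"
  using assms by (simp add: p)
 have "((%\<tau>. 1 - real r * rat_bound r \<tau> + real r * \<tau>) \<longlongrightarrow>
  1 - real r * (fact r * (1 / real r ^ r - 0) / (\<Prod>s\<in>{1..<r}. real (r - s + 1) / real r + 0)) + real r * 0) (at_right 0)"
  unfolding rat_bound_def by (intro tendsto_intros pos)
 also have "1 - real r * (fact r * (1 / real r ^ r - 0) / (\<Prod>s\<in>{1..<r}. real (r - s + 1) / real r + 0)) + real r * 0 = 0"
 proof -
  have "real r ^ r = real r * real r ^ (r - 1)" using assms by (cases r) auto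
  then show ?thesis using assms p by (simp add: field_simps)
 qed
 finally show ?thesis .
qed

text \<open>The recursion, started at the small \<open>(r + 1)\<close>-clique ratio, bounds each
  ratio almost by its value in the balanced complete \<open>r\<close>-partite graph. The product of
  the ratios is \<open>fact r * k r\<close>, so many \<open>r\<close>-cliques force the last one to
  be almost \<open>n / r\<close>. The inequality at \<open>r\<close> is then nearly tight, and its
  slack counts the pairs with at least two misses; pairs without a miss are counted by
  \<open>(r + 1)\<close>-cliques.\<close>

lemma miss_pairs_small:
 fixes V :: "'a set"
 assumes r: "2 <= r" and V: "finite V" "V ~= {}"
  and sym: "\<And>x y. A x y ==> A y x" and irr: "\<And>x. \<not> A x x"
 defines "k \<equiv> %s. rcard (cliques V A s)" and "n \<equiv> rcard V"
 assumes kpos: "k r > 0" and kr: "k r \<ge> (1 / real r ^ r - \<tau>) * n ^ r"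
  and kr1: "(real r + 1) * k (Suc r) <= \<tau> * n * k r" and tau: "\<tau> > 0"
 shows "rcard (miss_pairs V A r (%m. m ~= 1)) <= (1 - real r * rat_bound r \<tau> + real r * \<tau>) * n ^ (r + 1)"
proof -
 have n: "n > 0" using V by (simp add: n_def card_gt_0_iff)
 have kp: "k s > 0" if "s <= r" for s
  using that
 proof (induction rule: inc_induct)
  case base
  show ?case by (rule kpos)
 next
  case (step s)
  then have "cliques V A (Suc s) ~= {}" by (auto simp: k_def)
  then obtain c where c: "c \<in> cliques V A (Suc s)" by auto
  then obtain x where "x \<in> c" using cliques_D[OF c] by fastforce
  then have "cliques V A s ~= {}" using cliques_remove[OF c] by auto
  then show ?case using finite_cliques[OF V(1)] by (simp add: k_def card_gt_0_iff)
 qed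
 define a where "a = (%s. real s * k s / k (s - 1))"
 have k0: "k 0 = 1"
 proof -
  have "cliques V A 0 = {{}}" by (auto simp: cliques_def nsets_def)
  then show ?thesis by (simp add: k_def)
 qed
 have ar1: "a (Suc r) <= \<tau> * n"
  using kr1 kpos by (simp add: a_def divide_le_eq field_simps)
 have rec: "real (Suc s) * a (Suc s) + rcard (miss_pairs V A (Suc s) (%m. m \<ge> 2)) / k (Suc s)
   <= n + real s * a (Suc (Suc s))" if "Suc s <= r" for s
 proof -
  let ?B = "rcard (miss_pairs V A (Suc s) (%m. m \<ge> 2))"
  have p: "k s > 0" "k (Suc s) > 0" using kp[of s] kp[of "Suc s"] that by simp_all
  have "(real (Suc s) * k (Suc s))\<^sup>2 <= k s * (n * k (Suc s) + real s * (real s + 2) * k (Suc (Suc s)) - ?B)"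
   using moon_moser(1)[where A = A and V = V and s = s, OF V(1) sym irr] unfolding k_def n_def by simp
  then have "(real (Suc s) * k (Suc s))\<^sup>2 / (k s * k (Suc s))
    <= k s * (n * k (Suc s) + real s * (real s + 2) * k (Suc (Suc s)) - ?B) / (k s * k (Suc s))"
   using p by (intro divide_right_mono) auto
  also have "... = n + real s * a (Suc (Suc s)) - ?B / k (Suc s)"
  proof -
   have a2: "a (Suc (Suc s)) = (real s + 2) * k (Suc (Suc s)) / k (Suc s)" by (simp add: a_def)
   show ?thesis unfolding a2 using p by (simp add: field_simps)
  qed
  also have "(real (Suc s) * k (Suc s))\<^sup>2 / (k s * k (Suc s)) = real (Suc s) * a (Suc s)"
   using p by (simp add: a_def power2_eq_square)
  finally show ?thesis by linarith
 qed
 \<comment> \<open>Induction downwards from \<open>r\<close>; the main terms reproduce themselves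
   and the error stays at \<open>\<tau> * n\<close>.\<close>
 have abound: "a s <= (real (r - s + 1) / real r + \<tau>) * n" if "1 <= s" "s <= r" for s
  using that(2,1)
 proof (induction rule: inc_induct)
  case base
  have "real r * a r <= n + (real r - 1) * a (Suc r)"
   using rec[of "r - 1"] r divide_nonneg_pos[OF _ kpos, of "rcard (miss_pairs V A r (%m. m \<ge> 2))"]
   by (simp add: of_nat_diff)
  also have "... <= n + (real r - 1) * (\<tau> * n)"
   using ar1 r by (intro add_left_mono mult_left_mono) auto
  also have "... <= n + real r * (\<tau> * n)"
   using n tau by (intro add_left_mono mult_right_mono) auto
  also have "... = real r * ((1 / real r + \<tau>) * n)" using r by (simp add: field_simps)
  finally have "real r * a r <= real r * ((1 / real r + \<tau>) * n)" .
  then show ?case using r by simp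
 next
  case (step s)
  define R S where "R = real r" and "S = real s"
  have RS: "1 <= S" "S + 1 <= R" using step by (simp_all add: R_def S_def)
  have ih: "a (Suc s) <= ((R - S) / R + \<tau>) * n"
  proof -
   have "real (r - Suc s + 1) = R - S" using step by (simp add: R_def S_def of_nat_diff)
   then show ?thesis using step.IH by (simp add: R_def)
  qed
  have "S * a s <= n + (S - 1) * a (Suc s)"
   using rec[of "s - 1"] step divide_nonneg_pos[OF _ kp[of s], of "rcard (miss_pairs V A s (%m. m \<ge> 2))"]
   by (simp add: of_nat_diff S_def)
  also have "... <= n + (S - 1) * (((R - S) / R + \<tau>) * n)"
   using ih RS by (intro add_left_mono mult_left_mono) auto
  also have "... <= S * (((R - S + 1) / R + \<tau>) * n)"
  proof -
   have "R * n + (S - 1) * ((R - S) * n) = S * ((R - S + 1) * n)" by algebra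
   then have "n + (S - 1) * ((R - S) / R * n) = S * ((R - S + 1) / R * n)"
    using RS by (simp add: field_simps)
   moreover have "(S - 1) * (\<tau> * n) <= S * (\<tau> * n)" using n tau by (intro mult_right_mono) auto
   ultimately show ?thesis by (simp only: distrib_left distrib_right)
  qed
  finally have "a s <= ((R - S + 1) / R + \<tau>) * n" using RS by simp
  moreover have "real (r - s + 1) = R - S + 1" using step by (simp add: R_def S_def of_nat_diff)
  ultimately show ?case by (simp only: R_def)
 qed
 have anon: "0 <= a s" for s by (simp add: a_def k_def)
 have prod_a: "(\<Prod>s\<in>{1..m}. a s) = fact m * k m" if "m <= r" for m
  using that
 proof (induction m)
  case (Suc m)
  then show ?case using kp[of m] by (simp add: a_def)
 qed (simp add: k0)
 have P: "(\<Prod>s\<in>{1..<r}. a s) <= (\<Prod>s\<in>{1..<r}. real (r - s + 1) / real r + \<tau>) * n ^ (r - 1)"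
 proof -
  have "(\<Prod>s\<in>{1..<r}. a s) <= (\<Prod>s\<in>{1..<r}. (real (r - s + 1) / real r + \<tau>) * n)"
   by (rule prod_mono) (use abound anon in auto)
  also have "... = (\<Prod>s\<in>{1..<r}. real (r - s + 1) / real r + \<tau>) * n ^ (r - 1)"
   by (simp add: prod.distrib)
  finally show ?thesis .
 qed
 \<comment> \<open>All ratios but the last are bounded above, so the product of all of them bounds
   the last one from below.\<close>
 have L: "rat_bound r \<tau> * n <= a r"
 proof -
  define Q where "Q = (\<Prod>s\<in>{1..<r}. real (r - s + 1) / real r + \<tau>)"
  have Q: "Q > 0" unfolding Q_def using tau r by (intro prod_pos) (auto intro!: add_nonneg_pos)
  have "{1..r} = insert r {1..<r}" using r by auto
  then have "fact r * k r = a r * (\<Prod>s\<in>{1..<r}. a s)" using prod_a[of r] by simp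
  also have "... <= a r * (Q * n ^ (r - 1))"
   using P anon unfolding Q_def by (intro mult_left_mono) auto
  finally have "fact r * ((1 / real r ^ r - \<tau>) * n ^ r) <= a r * (Q * n ^ (r - 1))"
   using kr by (meson fact_ge_zero mult_left_mono order_trans)
  moreover have "n ^ r = n * n ^ (r - 1)" using r by (cases r) auto
  ultimately have "(fact r * (1 / real r ^ r - \<tau>) * n) * n ^ (r - 1) <= (a r * Q) * n ^ (r - 1)"
   by (simp add: algebra_simps)
  then have "fact r * (1 / real r ^ r - \<tau>) * n <= a r * Q"
   using n by (simp add: mult_le_cancel_right)
  then show ?thesis using Q unfolding rat_bound_def Q_def[symmetric] by (simp add: field_simps)
 qed
 let ?b = "%P. rcard (miss_pairs V A r P)"
 have "?b (%m. m \<ge> 2) / k r <= n + (real r - 1) * a (Suc r) - real r * a r"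
  using rec[of "r - 1"] r by (simp add: of_nat_diff)
 then have b2: "?b (%m. m \<ge> 2) <= (n + (real r - 1) * a (Suc r) - real r * a r) * k r"
  using kpos by (simp add: divide_le_eq)
 have b0: "?b (%m. m = 0) = a (Suc r) * k r"
 proof -
  have "a (Suc r) * k r = (real r + 1) * k (Suc r)" using kpos by (simp add: a_def)
  moreover have "?b (%m. m = 0) = (real (r - 1) + 2) * k (Suc r)"
   using moon_moser(2)[where A = A and V = V and s = "r - 1", OF V(1) sym irr] r
   by (simp add: k_def)
  ultimately show ?thesis using r by (simp add: of_nat_diff)
 qed
 have "miss_pairs V A r (%m. m ~= 1) = miss_pairs V A r (%m. m = 0) Un miss_pairs V A r (%m. m \<ge> 2)"
  by (auto simp: miss_pairs_def)
 then have "?b (%m. m ~= 1) <= ?b (%m. m = 0) + ?b (%m. m \<ge> 2)"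
  by (metis card_Un_le of_nat_add of_nat_le_iff)
 also have "... <= (n + real r * a (Suc r) - real r * a r) * k r"
  using b2 b0 by (simp add: algebra_simps)
 also have "... <= (n + real r * (\<tau> * n) - real r * (rat_bound r \<tau> * n)) * k r"
  using ar1 L kpos by (intro mult_right_mono diff_mono add_left_mono mult_left_mono) auto
 also have "... <= (n + real r * (\<tau> * n) - real r * (rat_bound r \<tau> * n)) * n ^ r"
 proof (rule mult_left_mono)
  show "k r <= n ^ r" using card_cliques_le[OF V(1), of A r] unfolding k_def n_def
   by (metis of_nat_le_iff of_nat_power)
  have "0 <= (n + real r * a (Suc r) - real r * a r) * k r"
   using \<open>?b (%m. m = 0) + ?b (%m. m \<ge> 2) <= _\<close> by (meson add_nonneg_nonneg of_nat_0_le_iff order_trans)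
  then have "0 <= n + real r * a (Suc r) - real r * a r" using kpos by (simp add: zero_le_mult_iff)
  also have "... <= n + real r * (\<tau> * n) - real r * (rat_bound r \<tau> * n)"
   using ar1 L by (intro diff_mono add_left_mono mult_left_mono) auto
  finally show "0 <= n + real r * (\<tau> * n) - real r * (rat_bound r \<tau> * n)" .
 qed
 also have "... = (1 - real r * rat_bound r \<tau> + real r * \<tau>) * n ^ (r + 1)"
  by (simp add: algebra_simps)
 finally show ?thesis .
qed

text \<open>By averaging, some \<open>r\<close>-clique \<open>c\<close> is in few exceptional pairs,
  both itself and through its vertices. A vertex is coloured by its unique nonneighbour in
  \<open>c\<close>. If every vertex of \<open>e\<close> misses one vertex of \<open>c\<close> and
  every vertex of \<open>c\<close> misses one vertex of \<open>e\<close>, then \<open>e\<close>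
  contains each colour.\<close>

lemma colouring_from_miss_pairs:
 fixes V :: "'a set"
 assumes r: "1 <= r" and V: "finite V" "V ~= {}"
  and sym: "\<And>x y. A x y ==> A y x"
 defines "n \<equiv> rcard V"
 assumes mp: "rcard (miss_pairs V A r (%m. m ~= 1)) <= \<zeta> * n ^ (r + 1)"
  and kr: "rcard (cliques V A r) \<ge> \<beta> * n ^ r" and \<beta>: "\<beta> > 0" and \<zeta>: "\<zeta> \<ge> 0"
 shows "\<exists>hue. (\<forall>v. hue v < r) \<and>
  rcard {e \<in> cliques V A r. hue ` e ~= {..<r}} <= (real r + 1) * (2 * \<zeta> / \<beta>) * n ^ r"
proof -
 let ?K = "cliques V A r"
 have n: "n > 0" using V by (simp add: n_def card_gt_0_iff)
 have finK: "finite ?K" by (rule finite_cliques[OF V(1)])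
 define bY where "bY = (%c. {y \<in> V. card (c Int nonadj A y) ~= 1})"
 define bE where "bE = (%x. {e \<in> ?K. card (e Int nonadj A x) ~= 1})"
 define M where "M = rcard (miss_pairs V A r (%m. m ~= 1))"
 have finY: "finite (bY c)" for c using V by (simp add: bY_def)
 have finE: "finite (bE c)" for c using finK by (simp add: bE_def)
 have M1: "M = (\<Sum>c\<in>?K. rcard (bY c))"
 proof -
  have "miss_pairs V A r (%m. m ~= 1) = (SIGMA c:?K. bY c)" by (auto simp: miss_pairs_def bY_def)
  then show ?thesis using finK finY by (simp add: M_def)
 qed
 have M2: "M = (\<Sum>x\<in>V. rcard (bE x))"
 proof -
  have "miss_pairs V A r (%m. m ~= 1) = prod.swap ` (SIGMA x:V. bE x)"
   by (auto simp: miss_pairs_def bE_def image_iff)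
  then have "card (miss_pairs V A r (%m. m ~= 1)) = card (SIGMA x:V. bE x)"
   by (simp add: card_image)
  then show ?thesis using V(1) finE by (simp add: M_def)
 qed
 \<comment> \<open>One vertex of \<open>bY c\<close> can spoil up to \<open>n ^ (r - 1)\<close>
   edges, so this weight puts both kinds of exception on the same scale.\<close>
 define F where "F = (%c. n ^ (r - 1) * rcard (bY c) + (\<Sum>x\<in>c. rcard (bE x)))"
 have "(\<Sum>c\<in>?K. \<Sum>x\<in>c. rcard (bE x)) = (\<Sum>c\<in>?K. \<Sum>x\<in>{x \<in> V. x \<in> c}. rcard (bE x))"
 proof (rule sum.cong[OF refl])
  fix c assume "c \<in> ?K"
  then have "{x \<in> V. x \<in> c} = c" using cliques_D by blast
  then show "(\<Sum>x\<in>c. rcard (bE x)) = (\<Sum>x\<in>{x \<in> V. x \<in> c}. rcard (bE x))" by simp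
 qed
 also have "... = (\<Sum>c\<in>?K. \<Sum>x\<in>V. if x \<in> c then rcard (bE x) else 0)"
  by (intro sum.cong refl sum.inter_filter V(1))
 also have "... = (\<Sum>x\<in>V. \<Sum>c\<in>?K. if x \<in> c then rcard (bE x) else 0)"
  by (rule sum.swap)
 also have "... = (\<Sum>x\<in>V. \<Sum>c\<in>{c \<in> ?K. x \<in> c}. rcard (bE x))"
  by (intro sum.cong refl sum.inter_filter[symmetric] finK)
 also have "... <= (\<Sum>x\<in>V. n ^ (r - 1) * rcard (bE x))"
 proof (rule sum_mono)
  fix x assume x: "x \<in> V"
  have "{c \<in> ?K. x \<in> c} \<subseteq> {e \<in> nsets V r. {x} \<subseteq> e}" by (auto simp: cliques_def)
  then have "card {c \<in> ?K. x \<in> c} <= card {e \<in> nsets V r. {x} \<subseteq> e}"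
   by (rule card_mono[rotated]) (simp add: V finite_imp_finite_nsets)
  also have "... <= card V ^ (r - 1)"
   using codeg_nsets_le[OF V(1), of "{x}" r] r by (simp add: codeg_def)
  finally have "rcard {c \<in> ?K. x \<in> c} <= n ^ (r - 1)"
   unfolding n_def by (metis of_nat_le_iff of_nat_power)
  then show "(\<Sum>c\<in>{c \<in> ?K. x \<in> c}. rcard (bE x)) <= n ^ (r - 1) * rcard (bE x)"
   by (simp add: mult_right_mono)
 qed
 also have "... = n ^ (r - 1) * M" by (simp add: M2 sum_distrib_left)
 finally have s2: "(\<Sum>c\<in>?K. \<Sum>x\<in>c. rcard (bE x)) <= n ^ (r - 1) * M" .
 have "(\<Sum>c\<in>?K. F c) = n ^ (r - 1) * M + (\<Sum>c\<in>?K. \<Sum>x\<in>c. rcard (bE x))"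
  by (simp only: F_def sum.distrib M1 sum_distrib_left)
 then have "(\<Sum>c\<in>?K. F c) <= n ^ (r - 1) * M + n ^ (r - 1) * M"
  using s2 by linarith
 also have "... <= 2 * (n ^ (r - 1) * (\<zeta> * n ^ (r + 1)))"
  using mp n by (simp add: M_def)
 also have "... = (2 * \<zeta> * n ^ r) * n ^ r"
 proof -
  have "n ^ (r - 1) * n = n ^ r" using r by (cases r) auto
  then show ?thesis by (simp add: algebra_simps)
 qed
 finally have sumF: "(\<Sum>c\<in>?K. F c) <= (2 * \<zeta> * n ^ r) * n ^ r" .
 have "\<exists>c\<in>?K. F c <= 2 * \<zeta> / \<beta> * n ^ r"
 proof (rule ccontr)
  assume no: "\<not> (\<exists>c\<in>?K. F c <= 2 * \<zeta> / \<beta> * n ^ r)"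
  have kp: "rcard ?K > 0" using kr \<beta> n by (smt (verit) mult_pos_pos zero_less_power)
  then have "?K ~= {}" by auto
  then have "(\<Sum>c\<in>?K. 2 * \<zeta> / \<beta> * n ^ r) < (\<Sum>c\<in>?K. F c)"
   using no finK by (intro sum_strict_mono) auto
  moreover have "(2 * \<zeta> / \<beta> * n ^ r) * (\<beta> * n ^ r) <= (2 * \<zeta> / \<beta> * n ^ r) * rcard ?K"
   using kr \<zeta> \<beta> n by (intro mult_left_mono) auto
  ultimately show False using sumF \<beta> by (simp add: mult.commute)
 qed
 then obtain c where c: "c \<in> ?K" "F c <= 2 * \<zeta> / \<beta> * n ^ r" by blast
 define \<xi> where "\<xi> = 2 * \<zeta> / \<beta>"
 have cV: "c \<subseteq> V" "finite c" "card c = r" using cliques_D[OF c(1)] by auto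
 have cE: "rcard (bE x) <= \<xi> * n ^ r" if "x \<in> c" for x
 proof -
  have "rcard (bE x) <= (\<Sum>x\<in>c. rcard (bE x))"
   by (rule member_le_sum) (use that cV in auto)
  also have "... <= F c" using n by (simp add: F_def)
  finally show ?thesis using c(2) by (simp add: \<xi>_def)
 qed
 have cY: "n ^ (r - 1) * rcard (bY c) <= \<xi> * n ^ r"
 proof -
  have "n ^ (r - 1) * rcard (bY c) <= F c" by (simp add: F_def sum_nonneg)
  then show ?thesis using c(2) by (simp add: \<xi>_def)
 qed
 obtain p where p: "bij_betw p {..<r} c"
  using finite_same_card_bij[of "{..<r}" c] cV by auto
 \<comment> \<open>Vertices without a unique nonneighbour in \<open>c\<close> lie in
   \<open>bY c\<close>; their default colour 0 only affects edges counted as exceptional.\<close>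
 define hue where "hue = (%y. if card (c Int nonadj A y) = 1 then (THE i. i < r & \<not> A (p i) y) else 0)"
 have hue: "hue y = i" if c1: "card (c Int nonadj A y) = 1" and c2: "i < r" and c3: "\<not> A (p i) y" for y i
 proof -
  obtain z where z: "c Int nonadj A y = {z}" by (rule card_1_singletonE[OF c1])
  have "(THE i. i < r & \<not> A (p i) y) = i"
  proof (rule the_equality)
   show "i < r & \<not> A (p i) y" using c2 c3 by (rule conjI)
   fix j assume j: "j < r & \<not> A (p j) y"
   have pc: "p i \<in> c" "p j \<in> c" using p j c2 by (auto simp: bij_betw_def)
   have "p i \<in> c Int nonadj A y" using pc(1) c3 by (simp add: nonadj_def)
   moreover have "p j \<in> c Int nonadj A y" using pc(2) j by (simp add: nonadj_def)
   ultimately have "p j = p i" unfolding z by simp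
   then show "j = i" using inj_onD[of p "{..<r}" j i] p j c2 by (simp add: bij_betw_def)
  qed
  then show ?thesis using c1 by (simp add: hue_def)
 qed
 have huer: "hue y < r" for y
 proof (cases "card (c Int nonadj A y) = 1")
  case True
  then obtain z where z: "c Int nonadj A y = {z}" by (rule card_1_singletonE)
  then have "z \<in> c" by blast
  then have "z \<in> p ` {..<r}" using p by (simp add: bij_betw_def)
  then obtain i where i: "i < r" "p i = z" by auto
  have "z \<in> nonadj A y" using z by blast
  then have "\<not> A z y" by (simp add: nonadj_def)
  then show ?thesis using hue[OF True i(1)] i by simp
 qed (use r in \<open>simp add: hue_def\<close>)
 have sub: "{e \<in> ?K. hue ` e ~= {..<r}} \<subseteq> (\<Union>x\<in>c. bE x) Un {e \<in> nsets V r. e Int bY c ~= {}}"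
 proof
  fix e assume e: "e \<in> {e \<in> ?K. hue ` e ~= {..<r}}"
  show "e \<in> (\<Union>x\<in>c. bE x) Un {e \<in> nsets V r. e Int bY c ~= {}}"
  proof (rule ccontr)
   assume no: "e \<notin> (\<Union>x\<in>c. bE x) Un {e \<in> nsets V r. e Int bY c ~= {}}"
   have eK: "e \<in> ?K" "e \<subseteq> V" using e cliques_D by blast+
   have "{..<r} \<subseteq> hue ` e"
   proof
    fix i assume i: "i \<in> {..<r}"
    then have "p i \<in> c" using p by (auto simp: bij_betw_def)
    then have "card (e Int nonadj A (p i)) = 1" using no eK by (auto simp: bE_def)
    then obtain y where y: "e Int nonadj A (p i) = {y}" by (rule card_1_singletonE)
    then have "y \<in> e Int nonadj A (p i)" by simp
    then have y': "y \<in> e" "\<not> A (p i) y" using sym by (auto simp: nonadj_def)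
    have "y \<notin> bY c" using no eK y' by (auto simp: cliques_def)
    then have "card (c Int nonadj A y) = 1" using eK y' by (auto simp: bY_def)
    then have "hue y = i" using hue i y' sym by blast
    then show "i \<in> hue ` e" using y' by auto
   qed
   then show False using e huer by auto
  qed
 qed
 have "card {e \<in> ?K. hue ` e ~= {..<r}} <= card ((\<Union>x\<in>c. bE x) Un {e \<in> nsets V r. e Int bY c ~= {}})"
  by (rule card_mono[OF _ sub]) (use cV finE V in \<open>auto simp: finite_imp_finite_nsets\<close>)
 also have "... <= card (\<Union>x\<in>c. bE x) + card {e \<in> nsets V r. e Int bY c ~= {}}"
  by (rule card_Un_le)
 also have "... <= (\<Sum>x\<in>c. card (bE x)) + card (bY c) * card V ^ (r - 1)"
  by (rule add_mono[OF card_UN_le[OF cV(2)] card_meeting_le[OF V(1) finY r]])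
 finally have "rcard {e \<in> ?K. hue ` e ~= {..<r}} <= real ((\<Sum>x\<in>c. card (bE x)) + card (bY c) * card V ^ (r - 1))"
  by (simp only: of_nat_le_iff)
 also have "... = (\<Sum>x\<in>c. rcard (bE x)) + rcard (bY c) * n ^ (r - 1)"
  by (simp add: n_def)
 also have "... <= (\<Sum>x\<in>c. \<xi> * n ^ r) + \<xi> * n ^ r"
  using cE cY by (intro add_mono sum_mono) (auto simp: mult.commute)
 also have "... = (real r + 1) * \<xi> * n ^ r" using cV by (simp add: algebra_simps)
 finally show ?thesis using huer unfolding \<xi>_def by (intro exI[of _ hue]) simp
qed

text \<open>\<open>card_hit_le\<close> as a fraction of all extensions of \<open>B\<close>. If
  \<open>card B = r\<close> the only edge above \<open>B\<close> is \<open>B\<close> itself, and the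
  left-hand side is 0.\<close>

lemma card_hit_le_real:
 assumes "finite V" "V ~= {}" "finite B" "finite X" "card B <= r"
 shows "rcard {e \<in> nsets V r. B \<subseteq> e & (e - B) Int X ~= {}}
  <= rcard X / rcard V * rcard V ^ (r - card B)"
proof (cases "card B = r")
 case True
 have "{e \<in> nsets V r. B \<subseteq> e & (e - B) Int X ~= {}} = {}"
 proof -
  have "B = e" if "e \<in> nsets V r" "B \<subseteq> e" for e
   using that True by (intro card_subset_eq) (auto simp: nsets_def)
  then show ?thesis by blast
 qed
 then show ?thesis by (simp only: card.empty) simp
next
 case False
 have n: "rcard V > 0" using assms by (simp add: card_gt_0_iff)
 have "r - card B = Suc (r - card B - 1)" using False assms by simp
 then have "rcard V ^ (r - card B) = rcard V * rcard V ^ (r - card B - 1)"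
  by (metis power_Suc)
 then have "rcard X / rcard V * rcard V ^ (r - card B) = real (card X * card V ^ (r - card B - 1))"
  using n by simp
 then show ?thesis using card_hit_le[OF assms(1,3,4), of r] by (simp only: of_nat_le_iff)
qed

text \<open>Contrapositive of \<open>not_rich_codeg\<close>, at the density
  \<open>m / rcard V\<close>.\<close>

lemma rich_of_codeg:
 assumes "finite V" "V ~= {}" "E \<subseteq> nsets V r" "finite B" "card B <= r"
  and "m < \<beta> * rcard V" "0 <= m" "\<beta> * rcard V ^ (r - card B) <= real (codeg E B)"
 shows "rich E m B"
proof (rule ccontr)
 have n: "rcard V > 0" using assms by (simp add: card_gt_0_iff)
 assume "\<not> rich E m B"
 then have "\<not> rich E (m / rcard V * rcard V) B" using n by simp
 then have "real (codeg E B) <= m / rcard V * rcard V ^ (r - card B)"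
  using assms n by (intro not_rich_codeg) auto
 moreover have "m / rcard V < \<beta>" using assms n by (simp add: divide_less_eq)
 ultimately show False using assms(8) n
  by (smt (verit) mult_strict_right_mono zero_less_power)
qed

section \<open>Heavy pairs, flags and the approximate structure\<close>

text \<open>The clique is ordered with \<open>p\<close>, \<open>q\<close> in front and
  \<open>f\<close> serves the pair (0,1). Richness of \<open>p\<close> and the next core yields
  \<open>h\<close>, which has to avoid \<open>c\<close> and \<open>f\<close> besides
  \<open>X\<close>; this is the allowance \<open>2 * r + 1\<close>.\<close>

lemma skel_of_clique:
 assumes r: "2 <= r" and E: "\<And>e. e \<in> E ==> finite e & card e = r"
  and c: "finite c" "card c = r + 1" and f: "f \<in> E" "c Int f = {p, q}" "p ~= q"
  and pairs: "\<And>x y. x \<in> c ==> y \<in> c ==> x ~= y ==> rich E (m + real (2 * r + 1)) {x, y}"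
  and X: "finite X" "rcard X <= m" "(c Un f) Int X = {}"
 shows "\<exists>x h. skel r E m x f h & x 0 = p & x 1 = q & blk r x f h Int X = {}"
proof -
 have "p \<in> c Int f" "q \<in> c Int f" unfolding f(2) by simp_all
 then have pq: "p \<in> c" "q \<in> c" "p \<in> f" "q \<in> f" by simp_all
 have ff: "finite f" "card f = r" using E[OF f(1)] by auto
 have "card (c - {p, q}) = r - 1"
  using c pq f(3) by (simp add: card_Diff_subset)
 then have "card (c - {p, q}) = card {2..r}" by simp
 then obtain b where b: "bij_betw b {2..r} (c - {p, q})"
  using finite_same_card_bij[of "{2..r}" "c - {p, q}"] c by auto
 define x where "x = (%i. if i = 0 then p else if i = 1 then q else b i)"
 have x01: "x 0 = p" "x 1 = q" by (simp_all add: x_def)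
 have bx: "bij_betw x {2..r} (c - {p, q})"
  using b by (rule bij_betw_cong[THEN iffD1, rotated]) (auto simp: x_def)
 have seteq: "{..r} = insert 0 (insert 1 {2..r})" using r by auto
 have xc: "x ` {..r} = c"
 proof -
  have "x ` {2..r} = c - {p, q}" using bx by (simp add: bij_betw_def)
  then have "x ` {..r} = insert p (insert q (c - {p, q}))"
   unfolding seteq image_insert x01 by simp
  also have "... = c" using pq by auto
  finally show ?thesis .
 qed
 have injx: "inj_on x {..r}"
  by (rule eq_card_imp_inj_on) (use xc c in simp_all)
 have xne: "x k ~= x l" if "k <= r" "l <= r" "k ~= l" for k l
  using inj_onD[OF injx, of k l] that by auto
 have "x 2 \<in> x ` {2..r}" using r by simp
 then have x2: "x 2 \<in> c - {p, q}" using bx by (simp add: bij_betw_def)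
 have "card (c Un f Un X) <= card c + card f + card X"
  by (meson add_le_mono card_Un_le le_refl order_trans)
 then have "rcard (c Un f Un X) <= m + real (2 * r + 1)"
  using c ff X(2) by simp
 moreover have "rich E (m + real (2 * r + 1)) {p, x 2}"
  using pairs[of p "x 2"] pq x2 by auto
 ultimately obtain h where h: "h \<in> E" "{p, x 2} \<subseteq> h" "(h - {p, x 2}) Int (c Un f Un X) = {}"
  using richD[of E "m + real (2 * r + 1)" "{p, x 2}" "c Un f Un X"] c ff X(1) by auto
 have x2f: "x 2 \<notin> f" using x2 f(2) by auto
 have "skel r E m x f h"
  unfolding skel_def xc x01
 proof (intro conjI allI impI)
  show "f Int c = {p, q}" using f(2) by auto
  show "h Int c = {p, x 2}" using h x2 pq by blast
  show "f Int h = {p}" using h x2f pq by blast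
  fix k l assume kl: "k < l" "l <= r"
  have "x k \<in> c" "x l \<in> c" using kl xc by auto
  then have "rich E (m + real (2 * r + 1)) {x k, x l}" using pairs xne[of k l] kl by simp
  then show "rich E m {x k, x l}" by (rule rich_mono) auto
 qed (use injx f h in auto)
 moreover have "blk r x f h Int X = {}"
  unfolding blk_def xc using h X(3) x2 pq by blast
 ultimately show ?thesis using x01 by blast
qed

text \<open>Heavy pairs are defined through these edges and not through all edges, so that an edge
  found above a heavy pair has only vertices of large degree, to which pendant edges can be
  attached.\<close>

definition heavy_edges :: "'a hypergraph => nat => real => 'a set set" where
 "heavy_edges G r \<beta> = {e \<in> edges G. \<forall>v\<in>e. real (codeg (edges G) {v}) \<ge> \<beta> * rcard (verts G) ^ (r - 1)}"

definition heavy_pair :: "'a hypergraph => nat => real => 'a => 'a => bool" where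
 "heavy_pair G r \<beta> x y \<longleftrightarrow> x ~= y & real (codeg (heavy_edges G r \<beta>) {x, y}) \<ge> \<beta> * rcard (verts G) ^ (r - 2)"

text \<open>A lost edge has a vertex of low degree or a pair of low codegree. Each of the
  \<open>n\<close> vertices and of the at most \<open>n\<close> squared ordered pairs is responsible
  for few edges.\<close>

lemma card_light_edges:
 fixes G :: "'a hypergraph"
 assumes r: "2 <= r" and G: "rgraph r G" and \<beta>: "\<beta> \<ge> 0"
 shows "rcard (edges G - cliques (verts G) (heavy_pair G r \<beta>) r) <= 2 * \<beta> * rcard (verts G) ^ r"
proof -
 let ?V = "verts G" and ?E = "edges G" and ?H = "heavy_edges G r \<beta>"
 define n where "n = rcard ?V"
 have fin: "finite ?V" "?E \<subseteq> nsets ?V r" using G by (auto simp: rgraph_def)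
 have finE: "finite ?E" using fin finite_imp_finite_nsets finite_subset by blast
 have HE: "?H \<subseteq> ?E" by (auto simp: heavy_edges_def)
 have finH: "finite ?H" using finE HE finite_subset by blast
 define L where "L = {v \<in> ?V. real (codeg ?E {v}) < \<beta> * n ^ (r - 1)}"
 define L2 where "L2 = {p \<in> ?V \<times> ?V. real (codeg ?H {fst p, snd p}) < \<beta> * n ^ (r - 2)}"
 have finL2: "finite L2" unfolding L2_def using fin by simp
 have nn: "n ^ r = n * n ^ (r - 1)" "n ^ r = n * (n * n ^ (r - 2))"
 proof -
  obtain s where "r = s + 2" using r by (metis le_add_diff_inverse2)
  then show "n ^ r = n * n ^ (r - 1)" "n ^ r = n * (n * n ^ (r - 2))" by simp_all
 qed
 have "?E - ?H \<subseteq> (\<Union>v\<in>L. {e \<in> ?E. {v} \<subseteq> e})"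
 proof
  fix e assume e: "e \<in> ?E - ?H"
  then obtain v where v: "v \<in> e" "\<not> real (codeg ?E {v}) \<ge> \<beta> * n ^ (r - 1)"
   by (auto simp: heavy_edges_def n_def)
  have "v \<in> ?V" using e fin(2) v(1) by (auto simp: nsets_def)
  then have "v \<in> L" using v(2) by (simp add: L_def)
  then show "e \<in> (\<Union>v\<in>L. {e \<in> ?E. {v} \<subseteq> e})" using e v(1) by auto
 qed
 then have "card (?E - ?H) <= card (\<Union>v\<in>L. {e \<in> ?E. {v} \<subseteq> e})"
  by (rule card_mono[rotated]) (use fin finE in \<open>auto simp: L_def\<close>)
 also have "... <= (\<Sum>v\<in>L. codeg ?E {v})"
  unfolding codeg_def by (rule card_UN_le) (simp add: L_def fin)
 finally have "rcard (?E - ?H) <= (\<Sum>v\<in>L. real (codeg ?E {v}))"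
  by (simp only: of_nat_le_iff of_nat_sum[symmetric])
 also have "... <= (\<Sum>v\<in>L. \<beta> * n ^ (r - 1))" by (rule sum_mono) (simp add: L_def)
 also have "... <= n * (\<beta> * n ^ (r - 1))"
  using card_mono[of ?V L] fin \<beta> by (simp add: L_def n_def mult_right_mono)
 finally have 1: "rcard (?E - ?H) <= \<beta> * n ^ r" by (simp add: nn(1) mult.left_commute)
 have "?H - cliques ?V (heavy_pair G r \<beta>) r \<subseteq> (\<Union>p\<in>L2. {e \<in> ?H. {fst p, snd p} \<subseteq> e})"
 proof
  fix e assume e: "e \<in> ?H - cliques ?V (heavy_pair G r \<beta>) r"
  then have eV: "e \<in> nsets ?V r" using HE fin by auto
  then obtain x y where xy: "x \<in> e" "y \<in> e" "x ~= y" "\<not> heavy_pair G r \<beta> x y"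
   using e by (auto simp: cliques_def)
  then have "(x, y) \<in> L2" using eV by (auto simp: L2_def heavy_pair_def n_def nsets_def)
  then show "e \<in> (\<Union>p\<in>L2. {e \<in> ?H. {fst p, snd p} \<subseteq> e})" using e xy by force
 qed
 then have "card (?H - cliques ?V (heavy_pair G r \<beta>) r) <= card (\<Union>p\<in>L2. {e \<in> ?H. {fst p, snd p} \<subseteq> e})"
  by (rule card_mono[rotated]) (simp add: finL2 finH)
 also have "... <= (\<Sum>p\<in>L2. codeg ?H {fst p, snd p})"
  unfolding codeg_def by (rule card_UN_le) (simp add: L2_def fin)
 finally have "rcard (?H - cliques ?V (heavy_pair G r \<beta>) r) <= (\<Sum>p\<in>L2. real (codeg ?H {fst p, snd p}))"
  by (simp only: of_nat_le_iff of_nat_sum[symmetric])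
 also have "... <= (\<Sum>p\<in>L2. \<beta> * n ^ (r - 2))" by (rule sum_mono) (simp add: L2_def)
 also have "... = rcard L2 * (\<beta> * n ^ (r - 2))" by simp
 also have "... <= (n * n) * (\<beta> * n ^ (r - 2))"
 proof (rule mult_right_mono)
  have "card L2 <= card (?V \<times> ?V)" by (rule card_mono) (auto simp only: L2_def finite_cartesian_product fin)
  then show "rcard L2 <= n * n" unfolding n_def by (metis card_cartesian_product of_nat_le_iff of_nat_mult)
  show "0 <= \<beta> * n ^ (r - 2)" using \<beta> by (simp add: n_def)
 qed
 finally have 2: "rcard (?H - cliques ?V (heavy_pair G r \<beta>) r) <= \<beta> * n ^ r"
  by (simp add: nn(2) mult_ac)
 have "?E - cliques ?V (heavy_pair G r \<beta>) r \<subseteq> (?E - ?H) Un (?H - cliques ?V (heavy_pair G r \<beta>) r)" by auto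
 then have "card (?E - cliques ?V (heavy_pair G r \<beta>) r) <= card (?E - ?H) + card (?H - cliques ?V (heavy_pair G r \<beta>) r)"
  using finE finH by (intro order_trans[OF card_mono card_Un_le]) simp_all
 then have "rcard (?E - cliques ?V (heavy_pair G r \<beta>) r) <= rcard (?E - ?H) + rcard (?H - cliques ?V (heavy_pair G r \<beta>) r)"
  by (metis of_nat_add of_nat_le_iff)
 then show ?thesis using 1 2 unfolding n_def by linarith
qed

text \<open>Candidates for the cores of a block together with the edge of the pair (0,1). The two
  sets span \<open>2 * r - 1\<close> vertices.\<close>

definition flags :: "'a hypergraph => nat => real => ('a set \<times> 'a set) set" where
 "flags G r \<beta> = {(c, f). c \<in> cliques (verts G) (heavy_pair G r \<beta>) (r + 1) & f \<in> heavy_edges G r \<beta> & card (c Int f) = 2}"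

lemma finite_flags: "rgraph r G ==> finite (flags G r \<beta>)"
 by (rule finite_subset[of _ "cliques (verts G) (heavy_pair G r \<beta>) (r + 1) \<times> Pow (verts G)"])
  (auto simp: flags_def rgraph_def finite_cliques heavy_edges_def nsets_def)

text \<open>Each set of \<open>2 * r - 1\<close> vertices carries at most
  \<open>4 ^ (2 * r - 1)\<close> pairs of subsets, and only the supersets of \<open>B\<close>
  matter.\<close>

lemma flags_containing:
 assumes r: "2 <= r" and G: "rgraph r G" and B: "finite B" "card B <= 2 * r - 1"
 shows "card {p \<in> flags G r \<beta>. B \<subseteq> fst p Un snd p} <= card (verts G) ^ (2 * r - 1 - card B) * 4 ^ (2 * r - 1)"
proof -
 let ?V = "verts G" and ?s = "2 * r - 1"
 have fin: "finite ?V" "edges G \<subseteq> nsets ?V r" using G by (auto simp: rgraph_def)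
 define D where "D = {d \<in> nsets ?V ?s. B \<subseteq> d}"
 have finD: "finite D" by (simp add: D_def fin finite_imp_finite_nsets)
 have "{p \<in> flags G r \<beta>. B \<subseteq> fst p Un snd p} \<subseteq> (\<Union>d\<in>D. Pow d \<times> Pow d)"
 proof
  fix p assume p: "p \<in> {p \<in> flags G r \<beta>. B \<subseteq> fst p Un snd p}"
  obtain c f where cf: "p = (c, f)" by (cases p)
  have c: "c \<subseteq> ?V" "finite c" "card c = r + 1"
   using p cf cliques_D[of c ?V "heavy_pair G r \<beta>" "r + 1"] by (auto simp: flags_def)
  have f: "f \<subseteq> ?V" "finite f" "card f = r"
   using p cf fin(2) by (auto simp: flags_def heavy_edges_def nsets_def)
  have i: "card (c Int f) = 2" using p cf by (simp add: flags_def)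
  have "card (c Un f) + card (c Int f) = card c + card f" using card_Un_Int[OF c(2) f(2)] by simp
  then have "card (c Un f) = ?s" using i c f r by simp
  then have "c Un f \<in> D" using c f p cf by (auto simp: D_def nsets_def)
  then show "p \<in> (\<Union>d\<in>D. Pow d \<times> Pow d)" using cf by auto
 qed
 then have "card {p \<in> flags G r \<beta>. B \<subseteq> fst p Un snd p} <= card (\<Union>d\<in>D. Pow d \<times> Pow d)"
  by (rule card_mono[rotated]) (use finD in \<open>auto simp: D_def nsets_def\<close>)
 also have "... <= (\<Sum>d\<in>D. card (Pow d \<times> Pow d))" by (rule card_UN_le[OF finD])
 also have "... = (\<Sum>d\<in>D. 4 ^ ?s)"
 proof (rule sum.cong[OF refl])
  fix d assume "d \<in> D"
  then have "finite d" "card d = ?s" by (auto simp: D_def nsets_def)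
  then have "card (Pow d \<times> Pow d) = 2 ^ ?s * 2 ^ ?s" by (simp only: card_cartesian_product card_Pow)
  also have "... = (2 * 2 :: nat) ^ ?s" by (simp only: power_mult_distrib)
  finally show "card (Pow d \<times> Pow d) = 4 ^ ?s" by simp
 qed
 also have "... = card D * 4 ^ ?s" by simp
 also have "... <= card ?V ^ (?s - card B) * 4 ^ ?s"
  using codeg_nsets_le[OF fin(1) B] by (intro mult_right_mono) (simp_all add: D_def codeg_def)
 finally show ?thesis .
qed

text \<open>If there are many flags, some flag \<open>(c, f)\<close> has all vertices of \<open>f\<close> robust: avoiding any
 bounded set, the vertex plays the same role in another flag.\<close>

lemma robust_flag:
 fixes G :: "'a hypergraph"
 assumes r: "2 <= r" and G: "rgraph r G"
  and many: "card (flags G r \<beta>) > 2 * M * 4 ^ (2 * r - 1) * card (verts G) ^ (2 * r - 2)"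
 defines "rob \<equiv> %R u. \<forall>X. finite X --> card X <= M --> u \<notin> X -->
    (\<exists>(c, f)\<in>flags G r \<beta>. R c f u & (c Un f) Int X = {})"
 shows "\<exists>(c, f)\<in>flags G r \<beta>. (\<forall>u\<in>c Int f. rob (%c f u. u \<in> c Int f) u) & (\<forall>u\<in>f - c. rob (%c f u. u \<in> f - c) u)"
  and "finite X ==> card X <= M ==> \<exists>(c, f)\<in>flags G r \<beta>. (c Un f) Int X = {}"
proof -
 let ?V = "verts G" and ?\<Phi> = "flags G r \<beta>" and ?s = "2 * r - 1"
 have fin: "finite ?V" "edges G \<subseteq> nsets ?V r" using G by (auto simp: rgraph_def)
 have fin\<Phi>: "finite ?\<Phi>" by (rule finite_flags[OF G])
 have s2: "?s - 1 = 2 * r - 2" "?s - 2 + 1 = 2 * r - 2" using r by auto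
 show "\<exists>(c, f)\<in>?\<Phi>. (c Un f) Int X = {}" if X: "finite X" "card X <= M"
 proof (rule ccontr)
  assume no: "\<not> (\<exists>(c, f)\<in>?\<Phi>. (c Un f) Int X = {})"
  have "?\<Phi> \<subseteq> (\<Union>z\<in>X. {p \<in> ?\<Phi>. {z} \<subseteq> fst p Un snd p})"
  proof
   fix p assume p: "p \<in> ?\<Phi>"
   then have "(fst p Un snd p) Int X ~= {}" using no by (cases p) auto
   then show "p \<in> (\<Union>z\<in>X. {p \<in> ?\<Phi>. {z} \<subseteq> fst p Un snd p})" using p by auto
  qed
  then have "card ?\<Phi> <= card (\<Union>z\<in>X. {p \<in> ?\<Phi>. {z} \<subseteq> fst p Un snd p})"
   by (rule card_mono[rotated]) (use X fin\<Phi> in auto)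
  also have "... <= (\<Sum>z\<in>X. card {p \<in> ?\<Phi>. {z} \<subseteq> fst p Un snd p})" by (rule card_UN_le[OF X(1)])
  also have "... <= (\<Sum>z\<in>X. card ?V ^ (2 * r - 2) * 4 ^ ?s)"
  proof (rule sum_mono)
   fix z show "card {p \<in> ?\<Phi>. {z} \<subseteq> fst p Un snd p} <= card ?V ^ (2 * r - 2) * 4 ^ ?s"
    using flags_containing[OF r G, of "{z}" \<beta>] r s2(1) by simp
  qed
  also have "... = card X * (card ?V ^ (2 * r - 2) * 4 ^ ?s)" by simp
  also have "... <= 2 * M * (card ?V ^ (2 * r - 2) * 4 ^ ?s)" using X(2) by (intro mult_right_mono) auto
  finally show False using many by (simp add: algebra_simps)
 qed
 let ?C = "%c f u. u \<in> c Int f" and ?P = "%c f u. u \<in> f - c"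
 show "\<exists>(c, f)\<in>?\<Phi>. (\<forall>u\<in>c Int f. rob ?C u) & (\<forall>u\<in>f - c. rob ?P u)"
 proof (rule ccontr)
  assume no: "\<not> (\<exists>(c, f)\<in>?\<Phi>. (\<forall>u\<in>c Int f. rob ?C u) & (\<forall>u\<in>f - c. rob ?P u))"
  have wit: "\<exists>X. finite X & card X <= M & u \<notin> X & (\<forall>(c, f)\<in>?\<Phi>. R c f u --> (c Un f) Int X ~= {})"
   if "\<not> rob R u" for R u
  proof -
   from that obtain X where X: "finite X" "card X <= M" "u \<notin> X"
    "\<not> (\<exists>(c, f)\<in>?\<Phi>. R c f u & (c Un f) Int X = {})"
    unfolding rob_def by (simp only: not_all not_imp) (elim exE conjE)
   have "\<forall>(c, f)\<in>?\<Phi>. R c f u --> (c Un f) Int X ~= {}"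
   proof (clarify)
    fix c f assume "(c, f) \<in> ?\<Phi>" "R c f u" "(c Un f) Int X = {}"
    then have "\<exists>(c, f)\<in>?\<Phi>. R c f u & (c Un f) Int X = {}" by (intro bexI[of _ "(c, f)"]) simp_all
    then show False using X(4) by simp
   qed
   then show ?thesis using X by (intro exI[of _ X]) simp
  qed
  define W where "W = (%R u. SOME X. finite X & card X <= M & u \<notin> X \<and>
   (\<forall>(c, f)\<in>?\<Phi>. R c f u --> (c Un f) Int X ~= {}))"
  have W: "finite (W R u) & card (W R u) <= M & u \<notin> W R u \<and>
   (\<forall>(c, f)\<in>?\<Phi>. R c f u --> (c Un f) Int W R u ~= {})" if "\<not> rob R u" for R u
   unfolding W_def by (rule someI_ex[OF wit[OF that]])
  \<comment> \<open>Obstacles to both roles of \<open>u\<close>. A flag violating the claim contains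
    some \<open>u\<close> and a point of \<open>Y u\<close>, hence two prescribed vertices, and
    there are too few such flags.\<close>
  define Y where "Y = (%u. (if rob ?C u then {} else W ?C u) Un (if rob ?P u then {} else W ?P u))"
  have Y: "finite (Y u)" "card (Y u) <= 2 * M" "u \<notin> Y u" for u
  proof -
   have a: "finite (if rob R u then {} else W R u) & card (if rob R u then {} else W R u) <= M
    & u \<notin> (if rob R u then {} else W R u)" for R
    using W[of R u] by simp
   show "finite (Y u)" "u \<notin> Y u" unfolding Y_def using a[of ?C] a[of ?P] by simp_all
   have "card (Y u) <= card (if rob ?C u then {} else W ?C u) + card (if rob ?P u then {} else W ?P u)"
    unfolding Y_def by (rule card_Un_le)
   then show "card (Y u) <= 2 * M" using a[of ?C] a[of ?P] by linarith
  qed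
  have "?\<Phi> \<subseteq> (\<Union>u\<in>?V. \<Union>z\<in>Y u. {p \<in> ?\<Phi>. {u, z} \<subseteq> fst p Un snd p})"
  proof
   fix p assume p: "p \<in> ?\<Phi>"
   obtain c f where cf: "p = (c, f)" by (cases p)
   have "\<not> ((\<forall>u\<in>c Int f. rob ?C u) & (\<forall>u\<in>f - c. rob ?P u))"
   proof
    assume "(\<forall>u\<in>c Int f. rob ?C u) & (\<forall>u\<in>f - c. rob ?P u)"
    then have "\<exists>(c, f)\<in>?\<Phi>. (\<forall>u\<in>c Int f. rob ?C u) & (\<forall>u\<in>f - c. rob ?P u)"
     using p cf by (intro bexI[of _ "(c, f)"]) simp_all
    then show False using no by simp
   qed
   then have "(\<exists>u. u \<in> c Int f & \<not> rob ?C u) \<or> (\<exists>u. u \<in> f - c & \<not> rob ?P u)" by auto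
   then obtain u z where u: "u \<in> f" "z \<in> Y u" "z \<in> c Un f"
   proof (elim disjE exE conjE)
    fix u assume a: "u \<in> c Int f" "\<not> rob ?C u"
    have "(c Un f) Int W ?C u ~= {}" using W[OF a(2)] p cf a(1) by blast
    then obtain z where "z \<in> c Un f" "z \<in> W ?C u" by blast
    then show thesis using a that[of u z] by (simp add: Y_def)
   next
    fix u assume a: "u \<in> f - c" "\<not> rob ?P u"
    have "(c Un f) Int W ?P u ~= {}" using W[OF a(2)] p cf a(1) by blast
    then obtain z where "z \<in> c Un f" "z \<in> W ?P u" by blast
    then show thesis using a that[of u z] by (simp add: Y_def)
   qed
   have "f \<subseteq> ?V" using p cf fin(2) by (auto simp: flags_def heavy_edges_def nsets_def)
   then have "u \<in> ?V" using u by auto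
   then show "p \<in> (\<Union>u\<in>?V. \<Union>z\<in>Y u. {p \<in> ?\<Phi>. {u, z} \<subseteq> fst p Un snd p})"
    using u p cf by auto
  qed
  then have "card ?\<Phi> <= card (\<Union>u\<in>?V. \<Union>z\<in>Y u. {p \<in> ?\<Phi>. {u, z} \<subseteq> fst p Un snd p})"
   by (rule card_mono[rotated]) (use fin fin\<Phi> Y in auto)
  also have "... <= (\<Sum>u\<in>?V. card (\<Union>z\<in>Y u. {p \<in> ?\<Phi>. {u, z} \<subseteq> fst p Un snd p}))"
   by (rule card_UN_le[OF fin(1)])
  also have "... <= (\<Sum>u\<in>?V. 2 * M * (card ?V ^ (?s - 2) * 4 ^ ?s))"
  proof (rule sum_mono)
   fix u
   have "card (\<Union>z\<in>Y u. {p \<in> ?\<Phi>. {u, z} \<subseteq> fst p Un snd p}) <= (\<Sum>z\<in>Y u. card {p \<in> ?\<Phi>. {u, z} \<subseteq> fst p Un snd p})"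
    by (rule card_UN_le[OF Y(1)])
   also have "... <= (\<Sum>z\<in>Y u. card ?V ^ (?s - 2) * 4 ^ ?s)"
   proof (rule sum_mono)
    fix z assume "z \<in> Y u"
    then have "u ~= z" using Y(3)[of u] by blast
    then have "card {u, z} = 2" by simp
    then show "card {p \<in> ?\<Phi>. {u, z} \<subseteq> fst p Un snd p} <= card ?V ^ (?s - 2) * 4 ^ ?s"
     using flags_containing[OF r G, of "{u, z}" \<beta>] r by simp
   qed
   also have "... = card (Y u) * (card ?V ^ (?s - 2) * 4 ^ ?s)" by simp
   also have "... <= 2 * M * (card ?V ^ (?s - 2) * 4 ^ ?s)" using Y(2) by (intro mult_right_mono) auto
   finally show "card (\<Union>z\<in>Y u. {p \<in> ?\<Phi>. {u, z} \<subseteq> fst p Un snd p}) <= 2 * M * (card ?V ^ (?s - 2) * 4 ^ ?s)" .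
  qed
  also have "... = 2 * M * 4 ^ ?s * (card ?V * card ?V ^ (?s - 2))" by simp
  also have "card ?V * card ?V ^ (?s - 2) = card ?V ^ (2 * r - 2)"
   using s2(2) by (metis add.commute plus_1_eq_Suc power_Suc)
  finally show False using many by simp
 qed
qed

text \<open>The edge \<open>f0\<close> of a robust flag becomes the connecting edge: its two
  vertices in \<open>c0\<close> are the cores for blocks 0 and 1, the others the private vertices
  for the later blocks. Robustness finds for each of them a flag in the same role that avoids any
  bounded set of other vertices.\<close>

lemma not_free_of_many_flags:
 fixes G :: "'a hypergraph"
 assumes r: "2 <= r" and G: "rgraph r G" and ne: "verts G ~= {}"
  and big: "real (pattern_bound r t + 2 * r + 1) < \<beta> * rcard (verts G)"
  and many: "card (flags G r \<beta>) > 2 * pattern_bound r t * 4 ^ (2 * r - 1) * card (verts G) ^ (2 * r - 2)"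
 shows "\<not> hyp_free (pattern r t) G"
proof -
 let ?V = "verts G" and ?E = "edges G" and ?H = "heavy_edges G r \<beta>" and ?M = "pattern_bound r t"
 have fin: "finite ?V" "?E \<subseteq> nsets ?V r" using G by (auto simp: rgraph_def)
 have HE: "?H \<subseteq> ?E" by (auto simp: heavy_edges_def)
 have HV: "?H \<subseteq> nsets ?V r" using HE fin(2) by (rule subset_trans)
 have Er: "finite e & card e = r" if "e \<in> ?E" for e using that fin(2) by (auto simp: nsets_def)
 have pair_rich: "rich ?E (real ?M + real (2 * r + 1)) {x, y}" if "heavy_pair G r \<beta> x y" for x y
 proof -
  have xy: "x ~= y" "\<beta> * rcard ?V ^ (r - 2) <= real (codeg ?H {x, y})"
   using that by (auto simp: heavy_pair_def)
  have c2: "card {x, y} = 2" using xy(1) by simp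
  have "rich ?H (real ?M + real (2 * r + 1)) {x, y}"
   by (rule rich_of_codeg[OF fin(1) ne HV, where \<beta> = \<beta>]) (use xy(2) c2 big r in simp_all)
  then show ?thesis by (rule rich_mono[OF _ HE order_refl])
 qed
 from robust_flag(1)[OF r G many] obtain p0 where p0: "p0 \<in> flags G r \<beta>" "case p0 of (c, f) \<Rightarrow>
   (\<forall>u\<in>c Int f. \<forall>X. finite X --> card X <= ?M --> u \<notin> X -->
    (\<exists>(c, f)\<in>flags G r \<beta>. u \<in> c Int f & (c Un f) Int X = {})) \<and>
   (\<forall>u\<in>f - c. \<forall>X. finite X --> card X <= ?M --> u \<notin> X -->
    (\<exists>(c, f)\<in>flags G r \<beta>. u \<in> f - c & (c Un f) Int X = {}))"
  by (rule bexE)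
 obtain c0 f0 where p0cf: "p0 = (c0, f0)" by (cases p0)
 have cf0: "(c0, f0) \<in> flags G r \<beta>" using p0(1) unfolding p0cf .
 note rob1 = p0(2)[unfolded p0cf prod.case, THEN conjunct1]
 note rob2 = p0(2)[unfolded p0cf prod.case, THEN conjunct2]
 have f0: "f0 \<in> ?H" "card (c0 Int f0) = 2" using cf0 by (auto simp: flags_def)
 have f0E: "f0 \<in> ?E" using f0 HE by auto
 obtain p q where pq: "c0 Int f0 = {p, q}" "p ~= q" using f0(2) by (auto simp: card_2_iff)
 have "p \<in> c0 Int f0" "q \<in> c0 Int f0" unfolding pq by simp_all
 then have pqf: "p \<in> f0" "q \<in> f0" by simp_all
 have "card (f0 - {p, q}) = card {2..<r}"
  using Er[OF f0E] pqf pq(2) by (simp add: card_Diff_subset)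
 then obtain b where b: "bij_betw b {2..<r} (f0 - {p, q})"
  using finite_same_card_bij[of "{2..<r}" "f0 - {p, q}"] Er[OF f0E] by auto
 define w where "w = (%i. if i = 0 then p else if i = 1 then q else b i)"
 have w01: "w 0 = p" "w 1 = q" by (simp_all add: w_def)
 have wb: "w ` {2..<r} = f0 - {p, q}"
  using b by (auto simp: w_def bij_betw_def image_iff)
 have winj: "inj_on w {..<r}" and wim: "w ` {..<r} = f0"
 proof -
  have "{..<r} = insert 0 (insert 1 {2..<r})" using r by auto
  then have "w ` {..<r} = insert p (insert q (f0 - {p, q}))"
   using wb by (simp only: image_insert w01)
  also have "... = f0" using pqf by auto
  finally show "w ` {..<r} = f0" .
  then show "inj_on w {..<r}" using Er[OF f0E] by (intro eq_card_imp_inj_on) simp_all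
 qed
 have wf: "w i \<in> f0" if "i < r" for i using that wim by auto
 have w2: "w i \<in> f0 - c0" if "i < r" "i ~= 0" "i ~= 1" for i
 proof -
  have "w i \<in> w ` {2..<r}" using that by (intro imageI) auto
  then have "w i \<in> f0 - {p, q}" using wb by simp
  then show ?thesis using pq(1) by auto
 qed
 \<comment> \<open>Block \<open>r\<close> contains no vertex of the connecting edge, so nothing is
   reserved for it.\<close>
 define P where "P = (%i. if i < r then {w i} else {})"
 show ?thesis
 proof (rule pattern_from_local_skeletons[OF r G order_refl, where P = P and w = w])
  show "P i Int P j = {}" if "i <= r" "j <= r" "i ~= j" for i j
   using that inj_onD[OF winj, of i j] by (auto simp: P_def)
  show "finite (P i) & card (P i) <= r + 1" if "i <= r" for i by (simp add: P_def)
  show "w ` {..<r} \<in> ?E" using wim f0E by simp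
  show "rich ?E (real ?M) {w i}" if i: "i < r" for i
  proof (rule rich_of_codeg[OF fin(1) ne fin(2), where \<beta> = \<beta>])
   show "\<beta> * rcard ?V ^ (r - card {w i}) <= real (codeg ?E {w i})"
    using f0(1) wf[OF i] by (simp add: heavy_edges_def)
  qed (use big r in auto)
  fix i X assume i: "i <= r" and X: "finite X" "card X <= ?M" "X Int P i = {}"
  have main: "\<exists>x h. skel r ?E (real ?M) x f' h & x 0 = a & x 1 = a' & blk r x f' h Int X = {}"
   if cf: "(c, f') \<in> flags G r \<beta>" "(c Un f') Int X = {}" "c Int f' = {a, a'}" "a ~= a'" for c f' a a'
  proof -
   have c: "c \<in> cliques ?V (heavy_pair G r \<beta>) (r + 1)" and f': "f' \<in> ?E"
    using cf(1) HE by (auto simp: flags_def)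
   show ?thesis
   proof (rule skel_of_clique[OF r Er _ _ f' cf(3,4)])
    show "finite c" "card c = r + 1" using cliques_D[OF c] by auto
    show "rich ?E (real ?M + real (2 * r + 1)) {x, y}" if "x \<in> c" "y \<in> c" "x ~= y" for x y
     using c that by (intro pair_rich) (auto simp: cliques_def)
    show "finite X" "rcard X <= real ?M" "(c Un f') Int X = {}" using X cf by auto
   qed
  qed
  have two: "\<exists>a'. c Int f = {a, a'} & a ~= a'" if "(c, f) \<in> flags G r \<beta>" "a \<in> c Int f" for c f a
  proof -
   have "card (c Int f) = 2" using that by (simp add: flags_def)
   then obtain u v where uv: "c Int f = {u, v}" "u ~= v" by (auto simp: card_2_iff)
   have "a = u \<or> a = v" using that(2) unfolding uv by simp
   then show ?thesis
   proof
    assume "a = u" then show ?thesis using uv by blast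
   next
    assume "a = v" then show ?thesis using uv by (intro exI[of _ u]) auto
   qed
  qed
  show "\<exists>x f h. skel r ?E (real ?M) x f h & (i < r --> role i x f (w i)) & blk r x f h Int X = {}"
  proof (cases "i < r")
   case False
   obtain c f where cf: "(c, f) \<in> flags G r \<beta>" "(c Un f) Int X = {}"
    using robust_flag(2)[OF r G many X(1,2)] by auto
   have "card (c Int f) = 2" using cf by (simp add: flags_def)
   then obtain u v where uv: "c Int f = {u, v}" "u ~= v" by (auto simp: card_2_iff)
   from main[OF cf uv] obtain x h where xh: "skel r ?E (real ?M) x f h" "x 0 = u" "x 1 = v" "blk r x f h Int X = {}"
      by (elim exE conjE)
     show ?thesis
      by (intro exI[of _ x] exI[of _ f] exI[of _ h]) (use xh False in \<open>simp add: role_def\<close>)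
  next
   case True
   have wX: "w i \<notin> X" using X(3) True by (auto simp: P_def)
   show ?thesis
   proof (cases "i = 0 \<or> i = 1")
    case True01: True
    have "w i \<in> c0 Int f0" using True01 pq(1) w01 by auto
    with rob1 X wX obtain c f where cf: "(c, f) \<in> flags G r \<beta>" "w i \<in> c Int f" "(c Un f) Int X = {}"
     by blast
    obtain a' where a': "c Int f = {w i, a'}" "w i ~= a'" using two[OF cf(1,2)] by blast
    \<comment> \<open>In block 1 the connecting vertex is core 1, so the two common vertices change
      places.\<close>
    then have a'': "c Int f = {a', w i}" "a' ~= w i" by auto
    show ?thesis
    proof (cases "i = 0")
     case True
     from main[OF cf(1,3) a'] obtain x h where xh: "skel r ?E (real ?M) x f h" "x 0 = w i" "x 1 = a'" "blk r x f h Int X = {}"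
      by (elim exE conjE)
     show ?thesis
      by (intro exI[of _ x] exI[of _ f] exI[of _ h]) (use xh True in \<open>simp add: role_def\<close>)
    next
     case False
     then have "i = 1" using True01 by simp
     from main[OF cf(1,3) a''] obtain x h where xh: "skel r ?E (real ?M) x f h" "x 0 = a'" "x 1 = w i" "blk r x f h Int X = {}"
      by (elim exE conjE)
     show ?thesis
      by (intro exI[of _ x] exI[of _ f] exI[of _ h]) (use xh \<open>i = 1\<close> in \<open>simp add: role_def\<close>)
    qed
   next
    case False
    then have "w i \<in> f0 - c0" using w2[of i] True by auto
    with rob2 X wX obtain c f where cf: "(c, f) \<in> flags G r \<beta>" "w i \<in> f - c" "(c Un f) Int X = {}"
     by blast
    have "card (c Int f) = 2" using cf by (simp add: flags_def)
    then obtain u v where uv: "c Int f = {u, v}" "u ~= v" by (auto simp: card_2_iff)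
    have "w i \<in> f - {u, v}" using cf(2) uv(1) by auto
    from main[OF cf(1,3) uv] obtain x h where xh: "skel r ?E (real ?M) x f h" "x 0 = u" "x 1 = v" "blk r x f h Int X = {}"
      by (elim exE conjE)
     show ?thesis
      by (intro exI[of _ x] exI[of _ f] exI[of _ h]) (use xh False \<open>w i \<in> f - {u, v}\<close> in \<open>simp add: role_def\<close>)
   qed
  qed
 qed
qed

text \<open>A heavy pair inside a clique has many heavy edges above it, and few of them meet the
  clique in a third vertex.\<close>

lemma flags_lower:
 fixes G :: "'a hypergraph"
 assumes r: "2 <= r" and G: "rgraph r G" and ne: "verts G ~= {}"
  and big: "real (r + 1) <= \<beta> / 2 * rcard (verts G)"
 shows "rcard (cliques (verts G) (heavy_pair G r \<beta>) (r + 1)) * (\<beta> / 2 * rcard (verts G) ^ (r - 2))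
  <= rcard (flags G r \<beta>)"
proof -
 let ?V = "verts G" and ?H = "heavy_edges G r \<beta>" and ?K = "cliques (verts G) (heavy_pair G r \<beta>) (r + 1)"
 define n where "n = rcard ?V"
 have fin: "finite ?V" "edges G \<subseteq> nsets ?V r" using G by (auto simp: rgraph_def)
 have n: "n > 0" using fin ne by (simp add: n_def card_gt_0_iff)
 have HV: "?H \<subseteq> nsets ?V r" using fin by (auto simp: heavy_edges_def)
 have finH: "finite ?H" using HV fin finite_imp_finite_nsets finite_subset by blast
 define F where "F = (%c. {f \<in> ?H. card (c Int f) = 2})"
 have low: "\<beta> / 2 * n ^ (r - 2) <= rcard (F c)" if c: "c \<in> ?K" for c
 proof -
  have cc: "finite c" "card c = r + 1" using cliques_D[OF c] by auto
  then obtain p q where pq: "p \<in> c" "q \<in> c" "p ~= q"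
   using r card_le_Suc0_iff_eq[of c] by auto
  then have "heavy_pair G r \<beta> p q" using c by (auto simp: cliques_def)
  then have h: "\<beta> * n ^ (r - 2) <= real (codeg ?H {p, q})" by (simp add: heavy_pair_def n_def)
  let ?T = "{e \<in> nsets ?V r. {p, q} \<subseteq> e & (e - {p, q}) Int c ~= {}}"
  have "{f \<in> ?H. {p, q} \<subseteq> f} \<subseteq> F c Un ?T"
  proof
   fix f assume f: "f \<in> {f \<in> ?H. {p, q} \<subseteq> f}"
   show "f \<in> F c Un ?T"
   proof (cases "(f - {p, q}) Int c = {}")
    case True
    then have "c Int f = {p, q}" using f pq by auto
    then show ?thesis using f pq(3) by (simp add: F_def)
   next
    case False
    then show ?thesis using f HV by auto
   qed
  qed
  moreover have "finite (F c Un ?T)" using finH fin by (simp add: F_def finite_imp_finite_nsets)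
  ultimately have "codeg ?H {p, q} <= card (F c) + card ?T"
   unfolding codeg_def by (meson card_Un_le card_mono order_trans)
  moreover have "rcard ?T <= rcard c / n * n ^ (r - 2)"
  proof -
   have c2: "card {p, q} = 2" using pq(3) by simp
   have "rcard ?T <= rcard c / n * n ^ (r - card {p, q})"
    unfolding n_def by (rule card_hit_le_real[OF fin(1) ne _ cc(1)]) (use c2 r in simp_all)
   then show ?thesis unfolding c2 .
  qed
  moreover have "rcard c / n <= \<beta> / 2" using big n cc by (simp add: n_def divide_le_eq)
  then have "rcard c / n * n ^ (r - 2) <= \<beta> / 2 * n ^ (r - 2)"
   using n by (intro mult_right_mono) auto
  ultimately have "\<beta> * n ^ (r - 2) <= rcard (F c) + \<beta> / 2 * n ^ (r - 2)"
   using h by linarith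
  then show ?thesis by (simp add: field_simps)
 qed
 have "flags G r \<beta> = (SIGMA c:?K. F c)" by (auto simp: flags_def F_def)
 then have "rcard (flags G r \<beta>) = (\<Sum>c\<in>?K. rcard (F c))"
  using finH fin by (simp add: F_def finite_cliques)
 also have "... \<ge> (\<Sum>c\<in>?K. \<beta> / 2 * n ^ (r - 2))" by (rule sum_mono) (rule low)
 finally show ?thesis by (simp add: n_def)
qed

text \<open>Freeness allows only \<open>n ^ (2 * r - 2)\<close> flags up to a constant, hence
  \<open>(r + 1)\<close>-cliques of order at most \<open>n ^ r\<close>, which is the smallness that
  \<open>miss_pairs_small\<close> asks for. What remains is the choice of parameters.\<close>

lemma near_rainbow:
 fixes \<zeta> :: real
 assumes r: "2 <= r" and \<zeta>: "\<zeta> > 0"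
 shows "\<exists>\<gamma>>0. \<exists>n0. \<forall>G :: 'a hypergraph. rgraph r G --> n0 <= card (verts G) --> hyp_free (pattern r t) G -->
  rcard (edges G) \<ge> (1 / real r ^ r - \<gamma>) * rcard (verts G) ^ r -->
  (\<exists>hue. (\<forall>v. hue v < r) & rcard {e \<in> edges G. hue ` e ~= {..<r}} <= \<zeta> * rcard (verts G) ^ r)"
proof -
 define R where "R = real r ^ r"
 have R: "R > 0" using r by (simp add: R_def)
 \<comment> \<open>Makes the bound of \<open>colouring_from_miss_pairs\<close>, at clique density
   \<open>1 / (2 * R)\<close>, equal to \<open>\<zeta> / 2\<close>.\<close>
 define \<zeta>0 where "\<zeta>0 = \<zeta> / (8 * (real r + 1) * R)"
 have \<zeta>0: "\<zeta>0 > 0" using \<zeta> R by (simp add: \<zeta>0_def)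
 have "\<forall>\<^sub>F \<tau> in at_right 0. 1 - real r * rat_bound r \<tau> + real r * \<tau> < \<zeta>0"
  using rat_bound_tendsto[OF r] \<zeta>0 by (rule order_tendstoD(2))
 moreover have "\<forall>\<^sub>F \<tau> in at_right (0::real). \<tau> < min (1 / (2 * R)) \<zeta>"
  using R \<zeta> by (intro eventually_at_right_less[THEN eventually_mono] order_tendstoD(2)[OF tendsto_ident_at]) auto
 moreover have "\<forall>\<^sub>F \<tau> in at_right (0::real). 0 < \<tau>" by (rule eventually_at_right_less)
 ultimately have "\<forall>\<^sub>F \<tau> in at_right (0::real). (1 - real r * rat_bound r \<tau> + real r * \<tau> < \<zeta>0 & \<tau> < min (1 / (2 * R)) \<zeta>) & 0 < \<tau>"
  by (intro eventually_conj)
 then obtain \<tau> where \<tau>: "1 - real r * rat_bound r \<tau> + real r * \<tau> < \<zeta>0" "\<tau> < 1 / (2 * R)" "\<tau> < \<zeta>" "0 < \<tau>"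
  using eventually_happens'[OF trivial_limit_at_right_real] by fastforce
 \<comment> \<open>Light edges cost \<open>2 * \<beta>\<close> and the density hypothesis
   \<open>\<gamma>\<close>, together \<open>\<tau>\<close>.\<close>
 define \<beta> where "\<beta> = \<tau> / 4"
 define \<gamma> where "\<gamma> = \<tau> / 2"
 have \<beta>: "\<beta> > 0" and \<gamma>: "\<gamma> > 0" using \<tau> by (simp_all add: \<beta>_def \<gamma>_def)
 define M where "M = pattern_bound r t"
 define C where "C = 2 * M * 4 ^ (2 * r - 1)"
 \<comment> \<open>The last summand is what makes the \<open>(r + 1)\<close>-cliques negligible
   against \<open>\<tau> * n\<close> times the number of \<open>r\<close>-cliques.\<close>
 define N where "N = 1 + real (M + 2 * r + 1) / \<beta> + 2 * real (r + 1) / \<beta> + 4 * (real r + 1) * real C * R / (\<beta> * \<tau>)"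
 have main: "\<exists>hue. (\<forall>v. hue v < r) & rcard {e \<in> edges G. hue ` e ~= {..<r}} <= \<zeta> * rcard (verts G) ^ r"
  if G: "rgraph r G" and n0: "N < rcard (verts G)" and free: "hyp_free (pattern r t) G"
   and dens: "rcard (edges G) \<ge> (1 / R - \<gamma>) * rcard (verts G) ^ r"
  for G :: "'a hypergraph"
 proof -
  let ?V = "verts G" and ?E = "edges G" and ?A = "heavy_pair G r \<beta>"
  define n where "n = rcard ?V"
  have fin: "finite ?V" "?E \<subseteq> nsets ?V r" using G by (auto simp: rgraph_def)
  have finE: "finite ?E" using fin finite_imp_finite_nsets finite_subset by blast
  have parts: "0 <= real (M + 2 * r + 1) / \<beta>" "0 <= 2 * real (r + 1) / \<beta>" "0 <= 4 * (real r + 1) * real C * R / (\<beta> * \<tau>)"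
   using \<beta> \<tau> R by auto
  have n: "n > 0" "n > real (M + 2 * r + 1) / \<beta>" "n > 2 * real (r + 1) / \<beta>"
   "n > 4 * (real r + 1) * real C * R / (\<beta> * \<tau>)"
   using n0 parts unfolding N_def n_def by linarith+
  have ne: "?V ~= {}" using n(1) by (auto simp: n_def)
  have sym: "?A x y ==> ?A y x" for x y by (auto simp: heavy_pair_def insert_commute)
  have irr: "\<not> ?A x x" for x by (simp add: heavy_pair_def)
  define k where "k = (%s. rcard (cliques ?V ?A s))"
  have light: "rcard (?E - cliques ?V ?A r) <= 2 * \<beta> * n ^ r"
   unfolding n_def by (rule card_light_edges[OF r G]) (use \<beta> in simp)
  have fc: "finite (cliques ?V ?A r)" by (rule finite_cliques[OF fin(1)])
  have "card ?E <= card (cliques ?V ?A r Un (?E - cliques ?V ?A r))"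
   by (rule card_mono) (use fc finE in auto)
  also have "... <= card (cliques ?V ?A r) + card (?E - cliques ?V ?A r)" by (rule card_Un_le)
  finally have "rcard ?E <= k r + rcard (?E - cliques ?V ?A r)"
   unfolding k_def by (simp only: of_nat_add[symmetric] of_nat_le_iff)
  then have "(1 / R - \<gamma>) * n ^ r - 2 * \<beta> * n ^ r <= k r"
   using dens light unfolding n_def by linarith
  moreover have "(1 / R - \<gamma>) * n ^ r - 2 * \<beta> * n ^ r = (1 / R - \<tau>) * n ^ r"
   by (simp add: \<gamma>_def \<beta>_def algebra_simps)
  ultimately have kr: "(1 / R - \<tau>) * n ^ r <= k r" by simp
  have "1 / R - \<tau> \<ge> 1 / (2 * R)" using \<tau>(2) by (simp add: field_simps)
  then have "1 / (2 * R) * n ^ r <= (1 / R - \<tau>) * n ^ r" using n(1) by (intro mult_right_mono) auto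
  then have kr2: "1 / (2 * R) * n ^ r <= k r" using kr by linarith
  then have kpos: "k r > 0" using R n(1) by (smt (verit) divide_pos_pos mult_pos_pos zero_less_power)
  have "card (flags G r \<beta>) <= C * card ?V ^ (2 * r - 2)"
  proof (rule ccontr)
   assume "\<not> card (flags G r \<beta>) <= C * card ?V ^ (2 * r - 2)"
   then have "\<not> hyp_free (pattern r t) G"
    using n(2) \<beta> by (intro not_free_of_many_flags[OF r G ne, where \<beta> = \<beta>])
     (auto simp: C_def M_def n_def divide_less_eq mult.commute)
   then show False using free by simp
  qed
  then have "rcard (flags G r \<beta>) <= real (C * card ?V ^ (2 * r - 2))" by (simp only: of_nat_le_iff)
  then have fl: "rcard (flags G r \<beta>) <= real C * n ^ (2 * r - 2)" by (simp add: n_def)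
  have "k (r + 1) * (\<beta> / 2 * n ^ (r - 2)) <= rcard (flags G r \<beta>)"
   unfolding k_def n_def using n(3) \<beta>
   by (intro flags_lower[OF r G ne]) (simp add: n_def divide_less_eq field_simps)
  also note fl
  also have "n ^ (2 * r - 2) = n ^ r * n ^ (r - 2)"
  proof -
   have "2 * r - 2 = r + (r - 2)" using r by simp
   then show ?thesis by (simp only: power_add)
  qed
  finally have "(k (r + 1) * (\<beta> / 2)) * n ^ (r - 2) <= (real C * n ^ r) * n ^ (r - 2)" by (simp add: mult_ac)
  then have kb: "k (r + 1) * (\<beta> / 2) <= real C * n ^ r" using n(1) by (simp add: mult_le_cancel_right)
  have kr1: "(real r + 1) * k (Suc r) <= \<tau> * n * k r"
  proof -
   have "(real r + 1) * k (Suc r) <= (real r + 1) * (2 / \<beta> * (real C * n ^ r))"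
    using kb \<beta> by (intro mult_left_mono) (simp_all add: field_simps)
   also have "... = (4 * (real r + 1) * real C * R / (\<beta> * \<tau>)) * (\<tau> * (1 / (2 * R) * n ^ r))"
    using \<beta> \<tau> R by (simp add: field_simps)
   also have "... <= n * (\<tau> * k r)"
    using n kr2 \<tau> R by (intro mult_mono) (auto intro: less_imp_le)
   finally show ?thesis by (simp add: mult_ac)
  qed
  have "rcard (miss_pairs ?V ?A r (%m. m ~= 1)) <= (1 - real r * rat_bound r \<tau> + real r * \<tau>) * n ^ (r + 1)"
   unfolding n_def
   by (rule miss_pairs_small[OF r fin(1) ne sym irr])
    (use kpos kr kr1 \<tau> in \<open>simp_all add: k_def n_def R_def\<close>)
  also have "... <= \<zeta>0 * n ^ (r + 1)" using \<tau>(1) n(1) by (intro mult_right_mono) auto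
  finally have mp: "rcard (miss_pairs ?V ?A r (%m. m ~= 1)) <= \<zeta>0 * n ^ (r + 1)" .
  have "\<exists>hue. (\<forall>v. hue v < r) \<and>
   rcard {e \<in> cliques ?V ?A r. hue ` e ~= {..<r}} <= (real r + 1) * (2 * \<zeta>0 / (1 / (2 * R))) * n ^ r"
   unfolding n_def
   by (rule colouring_from_miss_pairs[OF _ fin(1) ne sym])
    (use r mp kr2 R \<zeta>0 in \<open>simp_all add: k_def n_def\<close>)
  then obtain hue where hue: "\<forall>v. hue v < r"
   "rcard {e \<in> cliques ?V ?A r. hue ` e ~= {..<r}} <= (real r + 1) * (2 * \<zeta>0 / (1 / (2 * R))) * n ^ r"
   by (elim exE conjE)
  have "{e \<in> ?E. hue ` e ~= {..<r}} \<subseteq> {e \<in> cliques ?V ?A r. hue ` e ~= {..<r}} Un (?E - cliques ?V ?A r)" by auto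
  then have "card {e \<in> ?E. hue ` e ~= {..<r}} <= card ({e \<in> cliques ?V ?A r. hue ` e ~= {..<r}} Un (?E - cliques ?V ?A r))"
   by (rule card_mono[rotated]) (simp add: fc finE)
  also have "... <= card {e \<in> cliques ?V ?A r. hue ` e ~= {..<r}} + card (?E - cliques ?V ?A r)" by (rule card_Un_le)
  finally have "rcard {e \<in> ?E. hue ` e ~= {..<r}} \<le>
    rcard {e \<in> cliques ?V ?A r. hue ` e ~= {..<r}} + rcard (?E - cliques ?V ?A r)"
   by (simp only: of_nat_add[symmetric] of_nat_le_iff)
  also have "... <= (real r + 1) * (2 * \<zeta>0 / (1 / (2 * R))) * n ^ r + 2 * \<beta> * n ^ r"
   using hue(2) light by (rule add_mono)
  also have "(real r + 1) * (2 * \<zeta>0 / (1 / (2 * R))) = \<zeta> / 2"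
  proof -
   have "real r + 1 ~= 0" by linarith
   then show ?thesis unfolding \<zeta>0_def using R by (simp add: divide_simps)
  qed
  also have "\<zeta> / 2 * n ^ r + 2 * \<beta> * n ^ r = (\<zeta> / 2 + \<tau> / 2) * n ^ r"
   by (simp add: \<beta>_def algebra_simps)
  also have "... <= \<zeta> * n ^ r" using \<tau>(3) n(1) by (intro mult_right_mono) auto
  finally show ?thesis using hue(1) unfolding n_def by blast
 qed
 show ?thesis
 proof (intro exI[of _ \<gamma>] conjI exI[of _ "nat \<lceil>N\<rceil> + 1"] allI impI)
  show "0 < \<gamma>" by (rule \<gamma>)
  fix G :: "'a hypergraph"
  assume "rgraph r G" "nat \<lceil>N\<rceil> + 1 <= card (verts G)" "hyp_free (pattern r t) G"
   "(1 / real r ^ r - \<gamma>) * rcard (verts G) ^ r <= rcard (edges G)"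
  then show "\<exists>hue. (\<forall>v. hue v < r) & rcard {e \<in> edges G. hue ` e ~= {..<r}} <= \<zeta> * rcard (verts G) ^ r"
   by (intro main) (simp_all add: R_def, linarith)
 qed
qed

section \<open>Gadgets in a nearly partite graph\<close>

lemma ex_in_diff_of_card_less:
 "finite Z ==> card Z < card S ==> \<exists>z\<in>S. z \<notin> Z"
 by (meson card_mono not_le subsetI)

text \<open>The permutation gives the later vertices of the connecting edge colours that differ from
  those of their gadgets. A conflict at \<open>i\<close> is removed by exchanging the values at 1
  and \<open>i\<close>; position 1 stays free of conflict because its colour
  \<open>c 1 = c 0\<close> is taken at 0. Without that equality there may be no solution, as for
  \<open>r = 2\<close>, \<open>c 0 = 0\<close>, \<open>c 1 = 1\<close>.\<close>

lemma ex_colour_assignment: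
 fixes c :: "nat => nat"
 assumes r: "2 <= r" and c: "\<And>i. c i < r" and c01: "c 0 = c 1"
 shows "\<exists>\<tau>. bij_betw \<tau> {..<r} {..<r} & \<tau> 0 = c 0 & (\<forall>i\<in>{1..<r}. \<tau> i ~= c i)"
proof -
 have step: "\<exists>\<sigma>. bij_betw \<sigma> {..<r} {..<r} & \<sigma> 0 = c 0 & (\<forall>i\<in>{1..<r}. \<sigma> i ~= c i)"
  if "bij_betw \<tau> {..<r} {..<r}" "\<tau> 0 = c 0" "card {i \<in> {1..<r}. \<tau> i = c i} = m" for m \<tau>
  using that
 proof (induction m arbitrary: \<tau> rule: less_induct)
  case (less m)
  show ?case
  proof (cases "\<forall>i\<in>{1..<r}. \<tau> i ~= c i")
   case True
   then show ?thesis using less.prems by blast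
  next
   case False
   then obtain i where i: "i \<in> {1..<r}" "\<tau> i = c i" by blast
   have inj: "\<tau> j ~= \<tau> k" if "j < r" "k < r" "j ~= k" for j k
    using less.prems(1) that by (auto simp: bij_betw_def inj_on_def)
   have t1: "\<tau> 1 ~= c 1" using inj[of 1 0] r less.prems(2) c01 by auto
   then have i1: "i ~= 1" using i by auto
   define \<sigma> where "\<sigma> = \<tau>(1 := \<tau> i, i := \<tau> 1)"
   define sw where "sw = (%j. if j = 1 then i else if j = i then 1 else j)"
   have \<sigma>sw: "\<sigma> j = \<tau> (sw j)" for j by (simp add: \<sigma>_def sw_def)
   have swr: "sw j < r" if "j < r" for j using that i r by (auto simp: sw_def)
   have sw_inj: "sw j ~= sw k" if "j ~= k" for j k using that by (auto simp: sw_def)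
   have "inj_on \<sigma> {..<r}"
   proof (rule inj_onI, rule ccontr)
    fix j k assume jk: "j \<in> {..<r}" "k \<in> {..<r}" "\<sigma> j = \<sigma> k" "j ~= k"
    show False using inj[OF swr swr sw_inj[OF jk(4)]] jk(1-3) by (simp add: \<sigma>sw)
   qed
   moreover have "\<sigma> ` {..<r} \<subseteq> {..<r}"
    using less.prems(1) i r c[of i] by (auto simp: \<sigma>_def bij_betw_def)
   ultimately have bij: "bij_betw \<sigma> {..<r} {..<r}"
    by (simp add: bij_betw_def endo_inj_surj)
   have s0: "\<sigma> 0 = c 0" using i less.prems(2) by (simp add: \<sigma>_def)
   have s1: "\<sigma> 1 ~= c 1" using inj[of i 0] i i1 r less.prems(2) c01 by (auto simp: \<sigma>_def)
   have si: "\<sigma> i ~= c i" using inj[of 1 i] i i1 r by (auto simp: \<sigma>_def)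
   have sub: "{j \<in> {1..<r}. \<sigma> j = c j} \<subset> {j \<in> {1..<r}. \<tau> j = c j}"
   proof
    show "{j \<in> {1..<r}. \<sigma> j = c j} \<subseteq> {j \<in> {1..<r}. \<tau> j = c j}"
    proof
     fix j assume j: "j \<in> {j \<in> {1..<r}. \<sigma> j = c j}"
     then have "j ~= 1" "j ~= i" using s1 si by auto
     then show "j \<in> {j \<in> {1..<r}. \<tau> j = c j}" using j by (simp add: \<sigma>_def)
    qed
    show "{j \<in> {1..<r}. \<sigma> j = c j} ~= {j \<in> {1..<r}. \<tau> j = c j}" using i si by blast
   qed
   then have "card {j \<in> {1..<r}. \<sigma> j = c j} < m"
    unfolding less.prems(3)[symmetric] by (rule psubset_card_mono[rotated]) simp
   from less.IH[OF this bij s0 refl] show ?thesis .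
  qed
 qed
 obtain \<tau> where "bij_betw \<tau> {..<r} {..<r}" "\<tau> 0 = c 0"
  using ex_bij_betw_at[of "{..<r}" r "c 0"] c r by auto
 from step[OF this refl] show ?thesis .
qed

text \<open>A transversal edge above \<open>B\<close> is \<open>B\<close> together with a rainbow
  choice of the missing colours.\<close>

lemma card_trans_extensions:
 assumes V: "finite V" and B: "B \<subseteq> V" "inj_on hue B" "hue ` B \<subseteq> {..<r}"
  and U: "\<And>j. j \<in> {..<r} - hue ` B ==> U j \<subseteq> {v \<in> V. hue v = j}"
 defines "F \<equiv> (\<union>) B ` rainbow hue ({..<r} - hue ` B) U"
 shows "card F = (\<Prod>j\<in>{..<r} - hue ` B. card (U j))"
  and "F \<subseteq> {e \<in> tedges V r hue. B \<subseteq> e & (\<forall>v\<in>e - B. v \<in> U (hue v))}"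
proof -
 let ?K = "{..<r} - hue ` B"
 have dis: "B Int e = {}" if "e \<in> rainbow hue ?K U" for e
  using that by (auto simp: rainbow_def)
 have "inj_on ((\<union>) B) (rainbow hue ?K U)"
 proof (rule inj_onI)
  fix d e assume "d \<in> rainbow hue ?K U" "e \<in> rainbow hue ?K U" "B Un d = B Un e"
  then show "d = e" using dis by blast
 qed
 then have "card F = card (rainbow hue ?K U)" unfolding F_def by (rule card_image)
 also have "... = (\<Prod>j\<in>?K. card (U j))"
 proof (rule card_rainbow)
  fix k v assume "k \<in> ?K" "v \<in> U k"
  then show "hue v = k" using U[of k] by auto
 qed simp
 finally show "card F = (\<Prod>j\<in>?K. card (U j))" .
 show "F \<subseteq> {e \<in> tedges V r hue. B \<subseteq> e & (\<forall>v\<in>e - B. v \<in> U (hue v))}"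
 proof
  fix e assume "e \<in> F"
  then obtain d where d: "e = B Un d" "d \<in> rainbow hue ?K U" by (auto simp: F_def)
  have d': "inj_on hue d" "hue ` d = ?K" "\<And>v. v \<in> d ==> v \<in> U (hue v)" using d(2) by (auto simp: rainbow_def)
  have dV: "d \<subseteq> V"
  proof
   fix v assume v: "v \<in> d"
   then have "hue v \<in> ?K" using d'(2) by blast
   then show "v \<in> V" using U[of "hue v"] d'(3)[OF v] by auto
  qed
  have inj: "inj_on hue (B Un d)"
  proof (subst inj_on_Un, intro conjI B(2) d'(1))
   show "hue ` (B - d) Int hue ` (d - B) = {}" using d'(2) by blast
  qed
  have im: "hue ` (B Un d) = {..<r}" using d'(2) B(3) by auto
  have "card (B Un d) = r" using card_image[OF inj] im by simp
  moreover have "finite (B Un d)" using B(1) dV V finite_subset by blast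
  ultimately have "e \<in> tedges V r hue"
   using im d(1) B(1) dV by (simp add: tedges_def nsets_def)
  then show "e \<in> {e \<in> tedges V r hue. B \<subseteq> e & (\<forall>v\<in>e - B. v \<in> U (hue v))}"
   using d d' by auto
 qed
qed

text \<open>\<open>A\<close> collects the exceptional vertices. The constant \<open>\<nu>\<close> is
  so small against \<open>kap\<close> that \<open>A\<close>, the poor partners of
  \<open>r + 1\<close> typical vertices and a bounded set cannot use up \<open>kap * n\<close>
  candidates; the bound with exponent \<open>r - 1\<close> is for finding a transversal edge through
  a typical vertex.\<close>

locale near_partite =
 fixes G :: "'a hypergraph" and r :: nat and hue :: "'a => nat" and A :: "'a set"
  and kap \<nu> :: real and M :: nat
 assumes r: "2 <= r" and G: "rgraph r G" and hue: "\<And>v. hue v < r"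
  and A: "A \<subseteq> verts G" "rcard A <= \<nu> * rcard (verts G)"
  and typical: "\<And>y k. y \<in> verts G - A ==> k < r ==> k ~= hue y ==>
   rcard {z \<in> verts G. hue z = k & \<not> rich (edges G Int tedges (verts G) r hue)
     (kap * rcard (verts G)) {y, z}} <= \<nu> * rcard (verts G)"
  and miss: "\<And>y. y \<in> verts G - A ==>
   rcard {e \<in> tedges (verts G) r hue - edges G. y \<in> e} <= \<nu> * rcard (verts G) ^ (r - 1)"
  and vrich: "\<And>y. y \<in> verts G - A ==> rich (edges G) (real M) {y}"
  and kap: "kap > 0" "\<nu> \<ge> 0" "4 * (real r + 4) * \<nu> <= kap" "\<nu> < (kap / 2) ^ (r - 1)"
  and large: "real M + 10 * (real r + 1)\<^sup>2 <= kap / 4 * rcard (verts G)"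
begin

definition n :: real where "n = rcard (verts G)"

definition R :: "'a => 'a => bool" where
 "R y z \<longleftrightarrow> rich (edges G Int tedges (verts G) r hue) (kap * n) {y, z}"

text \<open>A non-transversal edge around which a block can be built, with \<open>y\<close> and
  \<open>y'\<close> as the two cores of one colour. Only \<open>y\<close> has to be typical;
  \<open>y'\<close> may be exceptional if it is rich to many vertices of each other colour.\<close>

definition gadget :: "'a set => 'a => 'a => bool" where
 "gadget e y y' \<longleftrightarrow> e \<in> edges G & y \<in> e & y' \<in> e & y ~= y' & hue y = hue y' & y \<notin> A \<and>
   (\<forall>k<r. k ~= hue y --> kap * n <= rcard {z \<in> verts G. hue z = k & R y' z})"

definition NR :: "'a => 'a set" where
 "NR y = {z \<in> verts G. hue z ~= hue y & \<not> R y z}"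

lemma fin: "finite (verts G)" "edges G \<subseteq> nsets (verts G) r"
 using G by (auto simp: rgraph_def)

lemma edgeD: "e \<in> edges G ==> finite e & card e = r & e \<subseteq> verts G"
 using fin by (auto simp: nsets_def)

lemma n_pos: "n > 0"
proof -
 have "0 < real M + 10 * (real r + 1)\<^sup>2" by (simp add: add_nonneg_pos)
 then have "0 < kap / 4 * n" using large unfolding n_def by linarith
 then show ?thesis using kap(1) by (simp add: zero_less_mult_iff)
qed

lemma large': "real M + 10 * (real r + 1)\<^sup>2 <= kap * n / 4"
 using large by (simp add: n_def)

lemma R_sym: "R y z ==> R z y"
 by (simp add: R_def insert_commute)

lemma finA: "finite A"
 using A fin finite_subset by blast

lemma card_NR_colour:
 assumes "y \<in> verts G - A" "k < r" "k ~= hue y"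
 shows "rcard {z \<in> verts G. hue z = k & \<not> R y z} <= \<nu> * n"
 using typical[OF assms] unfolding R_def n_def .

lemma finite_NR: "finite (NR y)"
 using fin by (simp add: NR_def)

lemma card_NR:
 assumes "y \<in> verts G - A"
 shows "rcard (NR y) <= real r * \<nu> * n"
proof -
 have "NR y \<subseteq> (\<Union>k\<in>{..<r} - {hue y}. {z \<in> verts G. hue z = k & \<not> R y z})"
  using hue by (auto simp: NR_def)
 then have "card (NR y) <= card (\<Union>k\<in>{..<r} - {hue y}. {z \<in> verts G. hue z = k & \<not> R y z})"
  by (rule card_mono[rotated]) (simp add: fin)
 also have "... <= (\<Sum>k\<in>{..<r} - {hue y}. card {z \<in> verts G. hue z = k & \<not> R y z})"
  by (rule card_UN_le) simp
 finally have "rcard (NR y) <= (\<Sum>k\<in>{..<r} - {hue y}. rcard {z \<in> verts G. hue z = k & \<not> R y z})"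
  by (simp only: of_nat_le_iff of_nat_sum[symmetric])
 also have "... <= (\<Sum>k\<in>{..<r} - {hue y}. \<nu> * n)"
  by (rule sum_mono) (use card_NR_colour[OF assms] in auto)
 also have "... <= real r * (\<nu> * n)"
  using hue[of y] kap(2) n_pos by (auto intro!: mult_right_mono)
 finally show ?thesis by simp
qed

text \<open>The poor partners of \<open>Y\<close> and the set \<open>A\<close> together cost at most
  a quarter of \<open>kap * n\<close>, and so does \<open>Z\<close>.\<close>

lemma ex_candidate:
 assumes gad: "kap * n <= rcard {z \<in> verts G. hue z = k & R y' z}"
  and Y: "finite Y" "card Y <= r + 1" "\<And>y. y \<in> Y ==> y \<in> verts G - A & hue y ~= k"
  and k: "k < r" and Z: "finite Z" "rcard Z <= real M + 5 * (real r + 1)\<^sup>2"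
 defines "S \<equiv> {z \<in> verts G. hue z = k & R y' z & (\<forall>y\<in>Y. R y z) & z \<notin> A & z \<notin> Z}"
 shows "kap * n / 2 <= rcard S" "S ~= {}"
proof -
 let ?S0 = "{z \<in> verts G. hue z = k & R y' z}"
 let ?N = "%y. {z \<in> verts G. hue z = k & \<not> R y z}"
 have "?S0 \<subseteq> S Un ((\<Union>y\<in>Y. ?N y) Un (A Un Z))" by (auto simp: S_def)
 moreover have "finite (S Un ((\<Union>y\<in>Y. ?N y) Un (A Un Z)))"
  using fin Y Z finA by (simp add: S_def)
 ultimately have "card ?S0 <= card (S Un ((\<Union>y\<in>Y. ?N y) Un (A Un Z)))" by (rule card_mono[rotated])
 also have "... <= card S + card ((\<Union>y\<in>Y. ?N y) Un (A Un Z))" by (rule card_Un_le)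
 also have "... <= card S + (card (\<Union>y\<in>Y. ?N y) + card (A Un Z))"
  by (rule add_left_mono, rule card_Un_le)
 also have "... <= card S + ((\<Sum>y\<in>Y. card (?N y)) + (card A + card Z))"
  by (rule add_left_mono, rule add_mono, rule card_UN_le[OF Y(1)], rule card_Un_le)
 finally have "rcard ?S0 <= real (card S + ((\<Sum>y\<in>Y. card (?N y)) + (card A + card Z)))"
  by (simp only: of_nat_le_iff)
 also have "... = rcard S + ((\<Sum>y\<in>Y. rcard (?N y)) + (rcard A + rcard Z))" by simp
 also have "(\<Sum>y\<in>Y. rcard (?N y)) <= (\<Sum>y\<in>Y. \<nu> * n)"
  by (rule sum_mono) (use card_NR_colour Y(3) k in auto)
 also have "... <= (real r + 1) * (\<nu> * n)"
  using Y(2) kap(2) n_pos by (simp add: mult_right_mono)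
 finally have "rcard ?S0 <= rcard S + ((real r + 1) * (\<nu> * n) + (rcard A + rcard Z))"
  by simp
 moreover have "rcard A <= \<nu> * n" using A by (simp add: n_def)
 moreover have "4 * (real r + 4) * (\<nu> * n) <= kap * n"
  using mult_right_mono[OF kap(3), of n] n_pos by simp
 moreover have "0 <= \<nu> * n" using kap(2) n_pos by simp
 moreover have "(real r + 1) * (\<nu> * n) + \<nu> * n <= (real r + 4) * (\<nu> * n)"
  using \<open>0 <= \<nu> * n\<close> by (simp add: distrib_right)
 moreover have "real M + 5 * (real r + 1)\<^sup>2 <= kap * n / 4" using large' by (smt (verit) zero_le_power2)
 ultimately show *: "kap * n / 2 <= rcard S" using gad Z(2) by linarith
 have "0 < kap * n / 2" using kap(1) n_pos by simp
 with * have "0 < rcard S" by linarith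
 then show "S ~= {}" by auto
qed

lemma R_rich:
 assumes "R y z" "real m <= kap * n"
 shows "rich (edges G) (real m) {y, z}"
 using assms unfolding R_def by (auto intro: rich_mono)

text \<open>The gadget edge takes the pair (0,2), whose ends share a colour, and \<open>f\<close>
  the pair (0,1). The other \<open>r - 2\<close> cores get the remaining colours, one each, and are
  chosen in turn rich to all earlier cores. Either end of the gadget can be core 0.\<close>

lemma skel_from_gadget:
 assumes gad: "gadget e y y'" and p: "p = y & p' = y' \<or> p = y' & p' = y"
  and f: "f \<in> edges G" "f \<in> tedges (verts G) r hue" "f Int e = {p}"
  and a: "a \<in> f" "a ~= p" "a \<notin> A" "R p' a"
  and X: "finite X" "card X <= M" "f Int X = {}" "e Int X = {}"
 shows "\<exists>x. skel r (edges G) (real M) x f e & x 0 = p & x 1 = a & blk r x f e Int X = {}"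
proof -
 define c where "c = hue y"
 have e: "e \<in> edges G" "y \<in> e" "y' \<in> e" "y ~= y'" "hue y' = c" "y \<notin> A"
  and gk: "\<And>k. k < r ==> k ~= c ==> kap * n <= rcard {z \<in> verts G. hue z = k & R y' z}"
  using gad by (auto simp: gadget_def c_def)
 have pf: "p \<in> f" "p \<in> e" "p' \<in> e" "p ~= p'" "hue p = c" "hue p' = c"
  using p e f(3) by (auto simp: c_def)
 have yV: "y \<in> verts G - A" using e edgeD by blast
 have aV: "a \<in> verts G - A" using a edgeD[OF f(1)] by blast
 have ac: "hue a ~= c" using tedges_same_colour[OF f(2) a(1) pf(1)] a(2) pf(5) by auto
 have "card ({..<r} - {c, hue a}) = card {3..<r + 1}"
  using hue[of y] hue[of a] ac by (simp add: card_Diff_subset c_def)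
 then obtain col where col: "bij_betw col {3..<r + 1} ({..<r} - {c, hue a})"
  using finite_same_card_bij[of "{3..<r + 1}" "{..<r} - {c, hue a}"] by auto
 have colD: "col i < r" "col i ~= c" "col i ~= hue a" if "i \<in> {3..<r + 1}" for i
 proof -
  have "col i \<in> {..<r} - {c, hue a}" by (rule bij_betw_apply[OF col that])
  then show "col i < r" "col i ~= c" "col i ~= hue a" by auto
 qed
 have col_inj: "col i ~= col j" if "i \<in> {3..<r + 1}" "j \<in> {3..<r + 1}" "i ~= j" for i j
  using inj_onD[OF bij_betw_imp_inj_on[OF col] _ that(1,2)] that(3) by blast
 let ?Z = "X Un f Un e"
 have cZ: "rcard ?Z <= real M + 5 * (real r + 1)\<^sup>2"
 proof -
  have "card ?Z <= card X + card f + card e" by (meson add_le_mono card_Un_le le_refl order_trans)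
  also have "... <= M + 2 * r" using X(2) edgeD[OF f(1)] edgeD[OF e(1)] by simp
  finally have "rcard ?Z <= real M + 2 * real r" by (simp only: of_nat_le_iff[symmetric, where 'a = real] of_nat_add of_nat_mult of_nat_numeral)
  also have "2 * real r <= 5 * (real r + 1)\<^sup>2" by (simp add: power2_eq_square algebra_simps)
  finally show ?thesis by simp
 qed
 have finZ: "finite ?Z" using X(1) edgeD[OF f(1)] edgeD[OF e(1)] by simp
 \<comment> \<open>Positions 0, 1, 2 are kept for \<open>p\<close>, \<open>a\<close>,
   \<open>p'\<close>, so the choice starts at 3.\<close>
 define Q where "Q = (%x i. x i \<in> verts G & hue (x i) = col i & R y' (x i) & R y (x i) & R a (x i) \<and>
   (\<forall>j\<in>{3..<i}. R (x j) (x i)) & x i \<notin> A & x i \<notin> ?Z)"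
 have "\<exists>x. \<forall>i\<in>{3..<N}. Q x i" if "N <= r + 1" for N
  using that
 proof (induction N)
  case (Suc N)
  then obtain x where x: "\<forall>i\<in>{3..<N}. Q x i" by auto
  show ?case
  proof (cases "N < 3")
   case True
   then show ?thesis by (intro exI[of _ x]) auto
  next
   case False
   then have N: "N \<in> {3..<r + 1}" using Suc.prems by auto
   let ?Y = "insert y (insert a (x ` {3..<N}))"
   have Y1: "finite ?Y" by simp
   have "card (x ` {3..<N}) <= N - 3" using card_image_le[of "{3..<N}" x] by simp
   then have Y2: "card ?Y <= r + 1" using N
    by (intro order_trans[OF card_insert_le_m1] order_trans[OF card_insert_le_m1]) auto
   have Y3: "v \<in> verts G - A & hue v ~= col N" if "v \<in> ?Y" for v
   proof -
    consider "v = y" | "v = a" | i where "i \<in> {3..<N}" "v = x i" using \<open>v \<in> ?Y\<close> by auto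
    then show ?thesis
    proof cases
     case 3
     then have "Q x i" using x by blast
     moreover have "col i ~= col N" using col_inj[of i N] 3 N by auto
     ultimately show ?thesis using 3 by (simp add: Q_def)
    qed (use yV aV colD[OF N] in \<open>auto simp: c_def\<close>)
   qed
   have "{z \<in> verts G. hue z = col N & R y' z & (\<forall>y\<in>?Y. R y z) & z \<notin> A & z \<notin> ?Z} ~= {}"
    using ex_candidate(2)[OF gk[OF colD(1,2)[OF N]] Y1 Y2 Y3 colD(1)[OF N] finZ cZ] .
   then obtain z where z: "z \<in> verts G" "hue z = col N" "R y' z" "\<forall>y\<in>?Y. R y z" "z \<notin> A" "z \<notin> ?Z"
    by blast
   have "Q (x(N := z)) i" if "i \<in> {3..<Suc N}" for i
   proof (cases "i = N")
    case True
    then show ?thesis using z by (auto simp: Q_def)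
   next
    case False
    then have "i \<in> {3..<N}" using that by auto
    moreover then have "Q x i" using x by blast
    ultimately show ?thesis by (auto simp: Q_def)
   qed
   then show ?thesis by (intro exI[of _ "x(N := z)"]) blast
  qed
 qed auto
 from this[OF order_refl] obtain x0 where x0: "\<forall>i\<in>{3..<r + 1}. Q x0 i" by (elim exE)
 define x where "x = (%i. if i = 0 then p else if i = 1 then a else if i = 2 then p' else x0 i)"
 have x012: "x 0 = p" "x (Suc 0) = a" "x 2 = p'" by (simp_all add: x_def)
 have x3: "x i \<in> verts G" "hue (x i) = col i" "R y' (x i)" "R y (x i)" "R a (x i)" "x i \<notin> X" "x i \<notin> f" "x i \<notin> e"
  if "3 <= i" "i <= r" for i
 proof -
  have "Q x0 i" using x0 that by auto
  then show "x i \<in> verts G" "hue (x i) = col i" "R y' (x i)" "R y (x i)" "R a (x i)" "x i \<notin> X" "x i \<notin> f" "x i \<notin> e"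
   using that by (auto simp: Q_def x_def)
 qed
 have x33: "R (x j) (x i)" if "3 <= j" "j < i" "i <= r" for i j
 proof -
  have "Q x0 i" using x0 that by auto
  then show ?thesis using that by (auto simp: Q_def x_def)
 qed
 have ca: "i = 0 \<or> i = 1 \<or> i = 2 \<or> 3 <= i" for i :: nat by linarith
 have a_e: "a \<notin> e" using f(3) a by auto
 have p'_f: "p' \<notin> f" using f(3) pf by auto
 have Rp: "R p (x i)" "R p' (x i)" if "3 <= i" "i <= r" for i
  using p x3[OF that] by auto
 have inj: "x i ~= x j" if ij: "i < j" "j <= r" for i j
 proof -
  have j: "j = 1 \<or> j = 2 \<or> 3 <= j" using ij by linarith
  show ?thesis
  proof (cases "3 <= j")
   case True
   show ?thesis
   proof (cases "3 <= i")
    case True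
    then have "col i ~= col j" using col_inj[of i j] ij by auto
    then show ?thesis using x3(2)[of i] x3(2)[of j] ij True by auto
   next
    case False
    then have "x i \<in> f Un e" using ca[of i] x012 pf a by auto
    then show ?thesis using x3(7,8)[of j] True ij by auto
   qed
  next
   case False
   then have "(i = 0 & j = 1) \<or> (i = 0 & j = 2) \<or> (i = 1 & j = 2)" using ij j by linarith
   then show ?thesis using x012 pf a a_e p'_f by auto
  qed
 qed
 have injx: "inj_on x {..r}"
 proof (rule inj_onI)
  fix i j assume "i \<in> {..r}" "j \<in> {..r}" "x i = x j"
  then show "i = j" using inj[of i j] inj[of j i] by (cases i j rule: linorder_cases) auto
 qed
 have im: "x ` {..r} = {p, a, p'} Un x ` {3..r}"
 proof -
  have "{..r} = {0, 1, 2} Un {3..r}" using r by auto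
  then have "x ` {..r} = x ` {0, 1, 2} Un x ` {3..r}" by (simp only: image_Un)
  also have "x ` {0, 1, 2} = {p, a, p'}" by (simp add: x012)
  finally show ?thesis .
 qed
 have mk: "real M <= kap * n"
 proof -
  have "0 <= 10 * (real r + 1)\<^sup>2" "0 <= kap * n" using kap(1) n_pos by simp_all
  then show ?thesis using large' by linarith
 qed
 have "skel r (edges G) (real M) x f e"
  unfolding skel_def
 proof (intro conjI allI impI)
  show "inj_on x {..r}" "f \<in> edges G" "e \<in> edges G" by (rule injx f(1) e(1))+
  have *: "x ` {3..r} Int f = {}" "x ` {3..r} Int e = {}" using x3(7,8) by auto
  show "f Int x ` {..r} = {x 0, x 1}" unfolding im using * pf a p'_f by (auto simp: x012)
  show "e Int x ` {..r} = {x 0, x 2}" unfolding im using * pf a_e by (auto simp: x012)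
  show "f Int e = {x 0}" using f(3) by (simp add: x012)
  fix k l assume kl: "k < l" "l <= r" "(k, l) ~= (0, 1)" "(k, l) ~= (0, 2)"
  have "R (x k) (x l)"
  proof (cases "3 <= l")
   case True
   then show ?thesis using ca[of k] x33[of k l] Rp[of l] x3(5)[of l] kl by (auto simp: x012)
  next
   case False
   then have "k = 1 & l = 2" using kl by auto
   then show ?thesis using R_sym[OF a(4)] by (simp add: x012)
  qed
  then show "rich (edges G) (real M) {x k, x l}" by (rule R_rich[OF _ mk])
 qed
 moreover have "blk r x f e Int X = {}"
 proof -
  have "x ` {3..r} Int X = {}" using x3(6) by auto
  then show ?thesis unfolding blk_def im using X(3,4) pf a by auto
 qed
 ultimately show ?thesis by (intro exI[of _ x]) (simp add: x012)
qed

end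

context near_partite
begin

text \<open>For the blocks whose connecting vertex is core 0 or core 1, and for the block without
  one: \<open>y\<close> is core 0 and \<open>u\<close> core 1.\<close>

lemma skel_base_typical:
 assumes gad: "gadget e y y'" and u: "u \<in> verts G" "u \<notin> A" "R y u" "R y' u" "u \<notin> e"
  and X: "finite X" "card X <= M" "X Int insert u e = {}"
 shows "\<exists>x f. skel r (edges G) (real M) x f e & x 0 = y & x 1 = u & blk r x f e Int X = {}"
proof -
 have e: "e \<in> edges G" "y \<in> e" "y' \<in> e" using gad by (auto simp: gadget_def)
 have fe: "finite e" "card e = r" using edgeD[OF e(1)] by auto
 have "card (X Un e) <= M + r" using card_Un_le[of X e] X fe by linarith
 then have "rcard (X Un e) <= real M + real r" by (simp only: of_nat_le_iff[symmetric, where 'a = real] of_nat_add)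
 also have "... <= real M + 10 * (real r + 1)\<^sup>2" by (simp add: power2_eq_square algebra_simps)
 also have "... <= kap * n"
 proof -
  have "0 <= kap * n" using kap(1) n_pos by simp
  then show ?thesis using large' by linarith
 qed
 finally have cX: "rcard (X Un e) <= kap * n" .
 obtain f where f: "f \<in> edges G Int tedges (verts G) r hue" "{y, u} \<subseteq> f" "(f - {y, u}) Int (X Un e) = {}"
  using richD[OF u(3)[unfolded R_def] _ cX] X(1) fe(1) by auto
 have "f Int e = {y}" "f Int X = {}" using f(2,3) e(2) u(5) X(3) by auto
 moreover have "y ~= u" using e(2) u(5) by auto
 ultimately have "\<exists>x. skel r (edges G) (real M) x f e & x 0 = y & x 1 = u & blk r x f e Int X = {}"
  using f X u by (intro skel_from_gadget[OF gad, where p' = y']) auto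
 then show ?thesis by blast
qed

text \<open>For blocks whose connecting vertex is private. The edge \<open>f\<close> is found above
  \<open>{y', u}\<close>, and a third vertex of it becomes core 1; avoiding \<open>NR y\<close>
  makes that vertex rich to \<open>y\<close>.\<close>

lemma skel_private:
 assumes gad: "gadget e y y'" and u: "u \<in> verts G" "R y' u" "u \<notin> e" and r3: "3 <= r"
  and X: "finite X" "card X <= M" "X Int insert u e = {}"
 shows "\<exists>x f. skel r (edges G) (real M) x f e & u \<in> f - {x 0, x 1} & blk r x f e Int X = {}"
proof -
 have e: "e \<in> edges G" "y \<in> e" "y' \<in> e" "hue y = hue y'" "y \<notin> A" using gad by (auto simp: gadget_def)
 have fe: "finite e" "card e = r" using edgeD[OF e(1)] by auto
 have yV: "y \<in> verts G - A" using e edgeD by blast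
 let ?Z = "X Un (e Un (A Un NR y))"
 have "card ?Z <= card X + (card e + (card A + card (NR y)))"
  by (rule order_trans[OF card_Un_le], rule add_left_mono, rule order_trans[OF card_Un_le],
    rule add_left_mono, rule card_Un_le)
 also have "... <= M + (r + (card A + card (NR y)))" using X fe by simp
 finally have "rcard ?Z <= real M + (real r + (rcard A + rcard (NR y)))"
  by (simp only: of_nat_le_iff[symmetric, where 'a = real] of_nat_add)
 also have "... <= real M + (real r + (\<nu> * n + real r * (\<nu> * n)))"
  using card_NR[OF yV] A(2) by (simp add: n_def)
 also have "... <= kap * n"
 proof -
  have 1: "4 * (real r + 4) * (\<nu> * n) <= kap * n" using mult_right_mono[OF kap(3), of n] n_pos by simp
  have "0 <= \<nu> * n" using kap(2) n_pos by simp
  have "2 * (\<nu> * n + real r * (\<nu> * n)) <= 4 * (real r + 4) * (\<nu> * n)"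
  proof -
   have "2 * (\<nu> * n + real r * (\<nu> * n)) = (2 + 2 * real r) * (\<nu> * n)" by algebra
   also have "... <= 4 * (real r + 4) * (\<nu> * n)"
    by (rule mult_right_mono[OF _ \<open>0 <= \<nu> * n\<close>]) simp
   finally show ?thesis .
  qed
  from order_trans[OF this 1] have 2: "\<nu> * n + real r * (\<nu> * n) <= kap * n / 2" by (simp add: field_simps)
  have "real r <= 10 * (real r + 1)\<^sup>2" by (simp add: power2_eq_square algebra_simps)
  then have 3: "real M + real r <= kap * n / 4" using large' by linarith
  have 4: "0 < kap * n" using kap(1) n_pos by simp
  have "real M + (real r + (\<nu> * n + real r * (\<nu> * n))) <= kap * n / 4 + kap * n / 2"
   using add_mono[OF 3 2] by (simp only: add.assoc)
  also have "... <= kap * n" using 4 by linarith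
  finally show ?thesis .
 qed
 finally have cZ: "rcard ?Z <= kap * n" .
 obtain f where f: "f \<in> edges G Int tedges (verts G) r hue" "{y', u} \<subseteq> f" "(f - {y', u}) Int ?Z = {}"
  using richD[OF u(2)[unfolded R_def] _ cZ] X(1) fe(1) finA finite_NR by auto
 have ff: "finite f" "card f = r" using f edgeD by auto
 have "card {y', u} < card f" using ff r3 by (simp add: card_insert_if)
 then obtain a where a: "a \<in> f" "a \<notin> {y', u}" using ex_in_diff_of_card_less[of "{y', u}" f] by auto
 have "a \<in> f - {y', u}" using a by simp
 then have aZ: "a \<notin> A" "a \<notin> NR y" using f(3) by auto
 have aV: "a \<in> verts G" using edgeD[of f] f(1) a(1) by blast
 have "hue a ~= hue y'" using tedges_same_colour[of f "verts G" r hue a y'] f a by auto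
 then have Ra: "R y a" using aZ aV e(4) by (auto simp: NR_def)
 have "f Int e = {y'}" "f Int X = {}" using f(2,3) e(3) u(3) X(3) by auto
 then have "\<exists>x. skel r (edges G) (real M) x f e & x 0 = y' & x 1 = a & blk r x f e Int X = {}"
  using f X a aZ Ra by (intro skel_from_gadget[OF gad, where p' = y]) auto
 then obtain x where x: "skel r (edges G) (real M) x f e" "x 0 = y'" "x 1 = a" "blk r x f e Int X = {}"
  by (elim exE conjE)
 have "u ~= y'" using u(3) e(3) by auto
 then have "u \<in> f - {x 0, x 1}" using f(2) a(2) x by auto
 then show ?thesis using x by blast
qed

text \<open>The connecting edge is a transversal edge through \<open>y 0\<close> whose vertex for a
  later block \<open>i\<close> is rich to both ends of gadget \<open>i\<close> and differs from them
  in colour. There are at least \<open>(kap / 2 * n) ^ (r - 1)\<close> candidates, and at most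
  \<open>\<nu> * n ^ (r - 1)\<close> transversal edges are missing at \<open>y 0\<close>, so one
  candidate is present.\<close>

lemma pattern_of_gadgets_aux:
 assumes M: "pattern_bound r t <= M" and gad: "\<And>i. i <= r ==> gadget (e i) (y i) (y' i)"
  and dis: "\<And>i j. i <= r ==> j <= r ==> i ~= j ==> e i Int e j = {}"
  and same: "hue (y 0) = hue (y 1)"
 shows "\<not> hyp_free (pattern r t) G"
proof -
 let ?V = "verts G" and ?T = "tedges (verts G) r hue"
 have g: "e i \<in> edges G" "y i \<in> e i" "y i \<in> ?V - A" "finite (e i)" "card (e i) = r" if "i <= r" for i
  using gad[OF that] edgeD[of "e i"] by (auto simp: gadget_def)
 have gk: "kap * n <= rcard {z \<in> ?V. hue z = k & R (y' i) z}" if "i <= r" "k < r" "k ~= hue (y i)" for i k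
  using gad[OF that(1)] that by (auto simp: gadget_def)
 obtain \<tau> where \<tau>: "bij_betw \<tau> {..<r} {..<r}" "\<tau> 0 = hue (y 0)" "\<forall>i\<in>{1..<r}. \<tau> i ~= hue (y i)"
  using ex_colour_assignment[OF r, of "%i. hue (y i)"] hue same by auto
 have \<tau>r: "\<tau> i < r" if "i < r" for i using bij_betw_apply[OF \<tau>(1), of i] that by simp
 have \<tau>inj: "\<tau> i = \<tau> j ==> i = j" if "i < r" "j < r" for i j
  using inj_onD[OF bij_betw_imp_inj_on[OF \<tau>(1)], of i j] that by simp
 define E where "E = (\<Union>i\<le>r. e i)"
 have finE: "finite E" using g by (simp add: E_def)
 have "card E <= (\<Sum>i\<le>r. card (e i))" unfolding E_def by (rule card_UN_le) simp
 also have "... = (\<Sum>i\<le>r. r)" by (rule sum.cong) (use g in auto)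
 also have "... = (r + 1) * r" by simp
 finally have "rcard E <= real ((r + 1) * r)" by (simp only: of_nat_le_iff)
 also have "... <= real M + 5 * (real r + 1)\<^sup>2" by (simp add: power2_eq_square algebra_simps)
 finally have cE: "rcard E <= real M + 5 * (real r + 1)\<^sup>2" .
 define U where "U = (%i. {z \<in> ?V. hue z = \<tau> i & R (y' i) z & (\<forall>v\<in>{y i}. R v z) & z \<notin> A & z \<notin> E})"
 have U: "kap * n / 2 <= rcard (U i)" if i: "i \<in> {1..<r}" for i
  unfolding U_def
 proof (rule ex_candidate(1))
  have ir: "i <= r" "i < r" using i by auto
  show "kap * n <= rcard {z \<in> ?V. hue z = \<tau> i & R (y' i) z}"
   using gk[OF ir(1) \<tau>r[OF ir(2)]] \<tau>(3) i by auto
  show "v \<in> ?V - A & hue v ~= \<tau> i" if "v \<in> {y i}" for v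
  proof -
   have "v = y i" using that by simp
   moreover have "\<tau> i ~= hue (y i)" using \<tau>(3) i by blast
   ultimately show ?thesis using g(3)[OF ir(1)] by metis
  qed
 qed (use \<tau>r i finE cE in auto)
 define \<sigma> where "\<sigma> = the_inv_into {..<r} \<tau>"
 have \<sigma>\<tau>: "\<sigma> (\<tau> i) = i" if "i < r" for i
  unfolding \<sigma>_def by (rule the_inv_into_f_f[OF bij_betw_imp_inj_on[OF \<tau>(1)]]) (use that in simp)
 have \<tau>\<sigma>: "\<tau> (\<sigma> k) = k & \<sigma> k < r" if "k < r" for k
 proof -
  have "k \<in> \<tau> ` {..<r}" using \<tau>(1) that by (simp add: bij_betw_def)
  then obtain i where "i < r" "k = \<tau> i" by auto
  then show ?thesis using \<sigma>\<tau> by simp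
 qed
 define K where "K = {..<r} - hue ` {y 0}"
 define F where "F = (\<union>) {y 0} ` rainbow hue K (%k. U (\<sigma> k))"
 have y0: "{y 0} \<subseteq> ?V" "inj_on hue {y 0}" "hue ` {y 0} \<subseteq> {..<r}" using g(3)[of 0] hue by auto
 have K\<sigma>: "\<sigma> k \<in> {1..<r}" if "k \<in> K" for k
 proof -
  have k: "k < r" "k ~= hue (y 0)" using that by (auto simp: K_def)
  have "\<sigma> k ~= 0" using \<tau>\<sigma>[OF k(1)] \<tau>(2) k(2) by metis
  then show ?thesis using \<tau>\<sigma>[OF k(1)] by auto
 qed
 have Usub: "U (\<sigma> j) \<subseteq> {v \<in> ?V. hue v = j}" if "j \<in> {..<r} - hue ` {y 0}" for j
  using \<tau>\<sigma>[of j] that by (auto simp: U_def)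
 have cardF: "card F = (\<Prod>j\<in>K. card (U (\<sigma> j)))"
  unfolding F_def K_def by (rule card_trans_extensions(1)[OF fin(1) y0 Usub])
 have Fsub: "F \<subseteq> {f \<in> ?T. {y 0} \<subseteq> f & (\<forall>v\<in>f - {y 0}. v \<in> U (\<sigma> (hue v)))}"
  unfolding F_def K_def by (rule card_trans_extensions(2)[OF fin(1) y0 Usub])
 have cK: "card K = r - 1" using hue by (simp add: K_def card_Diff_subset)
 have "(kap / 2 * n) ^ (r - 1) = (\<Prod>j\<in>K. kap * n / 2)" using cK by simp
 also have "... <= (\<Prod>j\<in>K. rcard (U (\<sigma> j)))"
  by (rule prod_mono) (use U K\<sigma> kap(1) n_pos in auto)
 also have "... = rcard F" by (simp add: cardF)
 finally have Fbig: "(kap / 2) ^ (r - 1) * n ^ (r - 1) <= rcard F" by (simp only: power_mult_distrib)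
 have "\<exists>f\<in>F. f \<in> edges G"
 proof (rule ccontr)
  assume no: "\<not> (\<exists>f\<in>F. f \<in> edges G)"
  have "F \<subseteq> {f \<in> ?T - edges G. y 0 \<in> f}" using Fsub no by auto
  then have "card F <= card {f \<in> ?T - edges G. y 0 \<in> f}"
   by (rule card_mono[rotated]) (simp add: tedges_def fin finite_imp_finite_nsets)
  then have "rcard F <= \<nu> * n ^ (r - 1)"
   using miss[OF g(3)[of 0]] unfolding n_def by linarith
  moreover have "\<nu> * n ^ (r - 1) < (kap / 2) ^ (r - 1) * n ^ (r - 1)"
   using kap(4) n_pos by (intro mult_strict_right_mono) auto
  ultimately show False using Fbig by linarith
 qed
 then obtain f where f: "f \<in> F" "f \<in> edges G" by blast
 have fT: "f \<in> ?T" "y 0 \<in> f" "\<And>v. v \<in> f ==> v ~= y 0 ==> v \<in> U (\<sigma> (hue v))"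
  using Fsub f(1) by auto
 have fim: "hue ` f = {..<r}" and finj: "inj_on hue f"
  using fT(1) tedges_inj[OF fT(1)] by (auto simp: tedges_def)
 define w where "w = (%i. inv_into f hue (\<tau> i))"
 have w: "w i \<in> f" "hue (w i) = \<tau> i" if "i < r" for i
 proof -
  have "\<tau> i \<in> hue ` f" using \<tau>r[OF that] fim by simp
  then show "w i \<in> f" "hue (w i) = \<tau> i" unfolding w_def by (simp_all add: inv_into_into f_inv_into_f)
 qed
 have w0: "w 0 = y 0"
  using inj_onD[OF finj, of "w 0" "y 0"] w[of 0] fT(2) \<tau>(2) r by auto
 have wU: "w i \<in> U i" if "i \<in> {1..<r}" for i
 proof -
  have i: "i < r" "i ~= 0" using that by auto
  have "hue (w i) ~= hue (y 0)" using w(2)[OF i(1)] \<tau>(2) \<tau>inj[of i 0] i r by auto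
  then have "w i ~= y 0" by metis
  from fT(3)[OF w(1)[OF i(1)] this] show ?thesis using w(2)[OF i(1)] \<sigma>\<tau>[OF i(1)] by simp
 qed
 have wim: "w ` {..<r} = f"
 proof
  show "w ` {..<r} \<subseteq> f" using w by auto
  show "f \<subseteq> w ` {..<r}"
  proof
   fix v assume v: "v \<in> f"
   then have "hue v < r" using hue by simp
   then have "v = w (\<sigma> (hue v))"
    using inj_onD[OF finj, of v "w (\<sigma> (hue v))"] v w \<tau>\<sigma> by auto
   then show "v \<in> w ` {..<r}" using \<tau>\<sigma>[OF \<open>hue v < r\<close>] by auto
  qed
 qed
 have wUD: "w i \<in> ?V" "R (y' i) (w i)" "R (y i) (w i)" "w i \<notin> A" "w i \<notin> E" if "i < r" "i ~= 0" for i
  using wU[of i] that by (auto simp: U_def)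
 have wVA: "w i \<in> ?V - A" if "i < r" for i
  using wUD[OF that] w0 g(3)[of 0] by (cases "i = 0") auto
 have eE: "e i \<subseteq> E" if "i <= r" for i using that by (auto simp: E_def)
 define P where "P = (%i. if i < r then insert (w i) (e i) else e i)"
 have wne: "w i ~= w j" if "i < r" "j < r" "i ~= j" for i j
  using w[OF that(1)] w[OF that(2)] \<tau>inj[OF that(1,2)] that(3) by metis
 have we: "w i \<notin> e j" if "i < r" "j <= r" "i ~= j" for i j
 proof (cases "i = 0")
  case True
  then show ?thesis using dis[of 0 j] g(2)[of 0] w0 that by auto
 next
  case False
  then show ?thesis using wUD(5)[OF that(1)] eE[OF that(2)] by auto
 qed
 show ?thesis
 proof (rule pattern_from_local_skeletons[OF r G, where P = P and w = w and m = "real M"])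
  show "real (pattern_bound r t) <= real M" using M by simp
  show "P i Int P j = {}" if "i <= r" "j <= r" "i ~= j" for i j
   using dis[OF that] wne[of i j] we[of i j] we[of j i] that by (auto simp: P_def)
  show "finite (P i) & card (P i) <= r + 1" if "i <= r" for i
   using g(4,5)[OF that] card_insert_le_m1[of "r + 1" "e i" "w i"] by (auto simp: P_def)
  show "w ` {..<r} \<in> edges G" using wim f(2) by simp
  show "rich (edges G) (real M) {w i}" if "i < r" for i by (rule vrich[OF wVA[OF that]])
  fix i X assume i: "i <= r" and X: "finite X" "card X <= pattern_bound r t" "X Int P i = {}"
  have XM: "card X <= M" using X(2) M by simp
  show "\<exists>x f h. skel r (edges G) (real M) x f h & (i < r --> role i x f (w i)) & blk r x f h Int X = {}"
  \<comment> \<open>Block \<open>r\<close> has no connecting vertex; an auxiliary \<open>u\<close>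
    serves for it as for block 0.\<close>
  proof (cases "i = 0 \<or> i = r")
   case True
   define k where "k = (if hue (y i) = 0 then 1 else 0 :: nat)"
   have k: "k < r" "k ~= hue (y i)" using r by (auto simp: k_def)
   have "card (X Un e i) <= M + r" using card_Un_le[of X "e i"] XM g(5)[OF i] by linarith
   then have "rcard (X Un e i) <= real M + real r"
    by (simp only: of_nat_le_iff[symmetric, where 'a = real] of_nat_add)
   also have "... <= real M + 5 * (real r + 1)\<^sup>2" by (simp add: power2_eq_square algebra_simps)
   finally have cX: "rcard (X Un e i) <= real M + 5 * (real r + 1)\<^sup>2" .
   have "{z \<in> ?V. hue z = k & R (y' i) z & (\<forall>v\<in>{y i}. R v z) & z \<notin> A & z \<notin> X Un e i} ~= {}"
   proof (rule ex_candidate(2)[OF gk[OF i k]])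
    show "v \<in> ?V - A & hue v ~= k" if "v \<in> {y i}" for v using that g(3)[OF i] k(2) by auto
   qed (use X(1) g(4)[OF i] cX k in auto)
   then obtain u where u: "u \<in> ?V" "R (y' i) u" "R (y i) u" "u \<notin> A" "u \<notin> X" "u \<notin> e i" by blast
   have "X Int insert u (e i) = {}" using X(3) u by (auto simp: P_def split: if_splits)
   from skel_base_typical[OF gad[OF i] u(1,4,3,2,6) X(1) XM this]
   obtain x f where x: "skel r (edges G) (real M) x f (e i)" "x 0 = y i" "x 1 = u" "blk r x f (e i) Int X = {}"
    by (elim exE conjE)
   have "i < r --> role i x f (w i)" using True x(2) w0 by (auto simp: role_def)
   then show ?thesis using x by blast
  next
   case False
   then have ir: "i < r" "i ~= 0" using i by auto
   have we': "w i \<notin> e i" using wUD(5)[OF ir] eE[OF i] by auto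
   have Xw: "X Int insert (w i) (e i) = {}" using X(3) ir by (simp add: P_def)
   show ?thesis
   proof (cases "i = 1")
    case True
    from skel_base_typical[OF gad[OF i] wUD(1,4,3,2)[OF ir] we' X(1) XM Xw]
    obtain x f where x: "skel r (edges G) (real M) x f (e i)" "x 0 = y i" "x 1 = w i" "blk r x f (e i) Int X = {}"
     by (elim exE conjE)
    have "role i x f (w i)" using True x(3) by (simp add: role_def)
    then show ?thesis using x by blast
   next
    case False
    then have "3 <= r" using ir by auto
    from skel_private[OF gad[OF i] wUD(1,2)[OF ir] we' this X(1) XM Xw]
    obtain x f where x: "skel r (edges G) (real M) x f (e i)" "w i \<in> f - {x 0, x 1}" "blk r x f (e i) Int X = {}"
     by (elim exE conjE)
    have "role i x f (w i)" using False ir x(2) by (simp add: role_def)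
    then show ?thesis using x by blast
   qed
  qed
 qed
qed

text \<open>By pigeonhole two of the \<open>r + 1\<close> gadgets have their pairs in the same
  colour, and these are moved to positions 0 and 1.\<close>

lemma pattern_of_gadgets:
 assumes M: "pattern_bound r t <= M" and gad: "\<And>i. i <= r ==> gadget (e i) (y i) (y' i)"
  and dis: "\<And>i j. i <= r ==> j <= r ==> i ~= j ==> e i Int e j = {}"
 shows "\<not> hyp_free (pattern r t) G"
proof -
 have "\<not> inj_on (%i. hue (y i)) {..r}"
 proof
  assume "inj_on (%i. hue (y i)) {..r}"
  then have "card {..r} <= card {..<r}" by (rule card_inj_on_le) (use hue in auto)
  then show False by simp
 qed
 then obtain p q where pq: "p <= r" "q <= r" "p ~= q" "hue (y p) = hue (y q)" by (auto simp: inj_on_def)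
 have "card ({..r} - {p, q}) = card {2..r}" using pq by (simp add: card_Diff_subset)
 then obtain b where b: "bij_betw b {2..r} ({..r} - {p, q})"
  using finite_same_card_bij[of "{2..r}" "{..r} - {p, q}"] by auto
 define \<pi> where "\<pi> = (%i. if i = 0 then p else if i = 1 then q else b i)"
 have br: "b i <= r" "b i ~= p" "b i ~= q" if "2 <= i" "i <= r" for i
  using bij_betw_apply[OF b, of i] that by auto
 have binj: "b i ~= b j" if "2 <= i" "i <= r" "2 <= j" "j <= r" "i ~= j" for i j
  using inj_onD[OF bij_betw_imp_inj_on[OF b], of i j] that by auto
 have \<pi>r: "\<pi> i <= r" if "i <= r" for i using that pq br by (auto simp: \<pi>_def)
 have \<pi>inj: "\<pi> i ~= \<pi> j" if ij: "i <= r" "j <= r" "i ~= j" for i j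
 proof -
  have ci: "i = 0 \<or> i = 1 \<or> 2 <= i" and cj: "j = 0 \<or> j = 1 \<or> 2 <= j" by linarith+
  from ci cj show ?thesis
   using ij pq(3) br[of i] br[of j] binj[of i j] by (elim disjE) (simp_all add: \<pi>_def)
 qed
 show ?thesis
 proof (rule pattern_of_gadgets_aux[OF M, where e = "%i. e (\<pi> i)" and y = "%i. y (\<pi> i)" and y' = "%i. y' (\<pi> i)"])
  show "gadget (e (\<pi> i)) (y (\<pi> i)) (y' (\<pi> i))" if "i <= r" for i by (rule gad[OF \<pi>r[OF that]])
  show "e (\<pi> i) Int e (\<pi> j) = {}" if "i <= r" "j <= r" "i ~= j" for i j
   by (rule dis[OF \<pi>r[OF that(1)] \<pi>r[OF that(2)] \<pi>inj[OF that]])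
  show "hue (y (\<pi> 0)) = hue (y (\<pi> 1))" using pq by (simp add: \<pi>_def)
 qed
qed

end

section \<open>Maximum cuts, bad vertices and bad edges\<close>

definition bad_deg :: "'a hypergraph => nat => ('a => nat) => 'a => real" where
 "bad_deg G r hue v = rcard {e \<in> edges G - tedges (verts G) r hue. v \<in> e}"

definition max_cut :: "'a hypergraph => nat => ('a => nat) => bool" where
 "max_cut G r hue \<longleftrightarrow> (\<forall>hue'. (\<forall>v. hue' v < r) -->
   card (edges G Int tedges (verts G) r hue') <= card (edges G Int tedges (verts G) r hue))"

text \<open>Giving \<open>v\<close> the colour \<open>j\<close> makes the edges on the left
  transversal and can destroy only transversal edges at \<open>v\<close>, so maximality compares the
  two.\<close>

lemma max_cut_link:
 assumes mc: "max_cut G r hue" and G: "rgraph r G" and hue: "\<And>v. hue v < r" and j: "j < r"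
 shows "card {e \<in> edges G. v \<in> e & hue ` (e - {v}) = {..<r} - {j}}
  <= card {e \<in> edges G Int tedges (verts G) r hue. v \<in> e}"
proof -
 let ?E = "edges G" and ?hue' = "hue(v := j)" and ?T = "%hue. tedges (verts G) r hue"
 let ?L = "{e \<in> ?E. v \<in> e & hue ` (e - {v}) = {..<r} - {j}}"
 have fin: "finite (verts G)" "?E \<subseteq> nsets (verts G) r" using G by (auto simp: rgraph_def)
 have finE: "finite ?E" using fin finite_imp_finite_nsets finite_subset by blast
 have same: "?hue' ` e = hue ` e" if "v \<notin> e" for e using that by (intro image_cong) auto
 have img: "?hue' ` e = insert j (hue ` (e - {v}))" if "v \<in> e" for e
 proof -
  have "e = insert v (e - {v})" using that by auto
  then have "?hue' ` e = insert (?hue' v) (?hue' ` (e - {v}))" by (metis image_insert)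
  also have "?hue' ` (e - {v}) = hue ` (e - {v})" by (intro image_cong) auto
  finally show ?thesis by simp
 qed
 have "?L Un {e \<in> ?E Int ?T hue. v \<notin> e} \<subseteq> ?E Int ?T ?hue'"
  using fin(2) j same img by (auto simp: tedges_def)
 then have "card (?L Un {e \<in> ?E Int ?T hue. v \<notin> e}) <= card (?E Int ?T ?hue')"
  by (rule card_mono[rotated]) (simp add: finE)
 also have "... <= card (?E Int ?T hue)" using mc hue j by (simp add: max_cut_def)
 finally have 1: "card (?L Un {e \<in> ?E Int ?T hue. v \<notin> e}) <= card (?E Int ?T hue)" .
 have "?E Int ?T hue = {e \<in> ?E Int ?T hue. v \<in> e} Un {e \<in> ?E Int ?T hue. v \<notin> e}" by auto
 then have "card (?E Int ?T hue) <= card {e \<in> ?E Int ?T hue. v \<in> e} + card {e \<in> ?E Int ?T hue. v \<notin> e}"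
  using card_Un_le[of "{e \<in> ?E Int ?T hue. v \<in> e}" "{e \<in> ?E Int ?T hue. v \<notin> e}"] by (simp only:)
 moreover have "card (?L Un {e \<in> ?E Int ?T hue. v \<notin> e}) = card ?L + card {e \<in> ?E Int ?T hue. v \<notin> e}"
  by (rule card_Un_disjoint) (auto simp: finE)
 ultimately show ?thesis using 1 by linarith
qed

context near_partite
begin

text \<open>When \<open>y'\<close> is typical too, at most \<open>\<nu> * n <= kap * n\<close>
  vertices of a class are poor to it, and the class has at least \<open>2 * kap * n\<close>.\<close>

lemma typical_gadget:
 assumes size: "\<And>k. k < r ==> 2 * kap * n <= rcard {v \<in> verts G. hue v = k}"
  and e: "e \<in> edges G" "y \<in> e" "y' \<in> e" "y ~= y'" "hue y = hue y'" "y \<notin> A" "y' \<notin> A"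
 shows "gadget e y y'"
 unfolding gadget_def
proof (intro conjI allI impI e)
 fix k assume k: "k < r" "k ~= hue y"
 have y': "y' \<in> verts G - A" using e edgeD[OF e(1)] by auto
 have eq: "{v \<in> verts G. hue v = k} = {z \<in> verts G. hue z = k & R y' z} Un {z \<in> verts G. hue z = k & \<not> R y' z}" by auto
 have "card {v \<in> verts G. hue v = k} <= card {z \<in> verts G. hue z = k & R y' z} + card {z \<in> verts G. hue z = k & \<not> R y' z}"
  by (subst eq, rule card_Un_le)
 then have "rcard {v \<in> verts G. hue v = k} <= rcard {z \<in> verts G. hue z = k & R y' z} + rcard {z \<in> verts G. hue z = k & \<not> R y' z}"
  by (simp only: of_nat_le_iff[symmetric, where 'a = real] of_nat_add)
 moreover have "rcard {z \<in> verts G. hue z = k & \<not> R y' z} <= \<nu> * n"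
  using card_NR_colour[OF y' k(1)] k(2) e(5) by simp
 moreover have "\<nu> * n <= kap * n"
 proof -
  have "1 * \<nu> <= 4 * (real r + 4) * \<nu>" by (rule mult_right_mono[OF _ kap(2)]) simp
  then have "\<nu> <= kap" using kap(3) by simp
  then show ?thesis using n_pos by (simp add: mult_right_mono)
 qed
 ultimately show "kap * n <= rcard {z \<in> verts G. hue z = k & R y' z}" using size[OF k(1)] by linarith
qed

text \<open>Only bad edges at \<open>v\<close> that otherwise avoid \<open>A\<close> and
  \<open>X\<close> are considered. If one of them has two further vertices of equal colour, these
  form a gadget. Otherwise all their links are rainbow and one colour \<open>j\<close> is missing in
  many of them; by maximality \<open>v\<close> then has as many transversal edges, which makes it
  rich to the other colours. So \<open>v\<close> can be the exceptional end
  \<open>y'\<close>.\<close>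

lemma gadget_of_bad_deg:
 assumes size: "\<And>k. k < r ==> 2 * kap * n <= rcard {v \<in> verts G. hue v = k}"
  and mc: "max_cut G r hue" and v: "v \<in> verts G" and bd: "4 * real r * kap * n ^ (r - 1) <= bad_deg G r hue v"
  and X: "finite X" "card X <= M" "v \<notin> X"
 shows "\<exists>e y y'. gadget e y y' & v \<in> e & e Int X = {}"
proof -
 let ?V = "verts G" and ?E = "edges G" and ?T = "tedges (verts G) r hue"
 have finE: "finite ?E" using fin finite_imp_finite_nsets finite_subset by blast
 have rr: "n ^ (r - 1) = n * n ^ (r - 2)"
 proof -
  have "r - 1 = Suc (r - 2)" using r by simp
  then show ?thesis by simp
 qed
 define B where "B = {e \<in> ?E - ?T. v \<in> e}"
 define H where "H = {e \<in> nsets ?V r. {v} \<subseteq> e & (e - {v}) Int (A Un X) ~= {}}"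
 define B' where "B' = {e \<in> B. (e - {v}) Int (A Un X) = {}}"
 have cAX: "rcard (A Un X) <= kap * n / 2"
 proof -
  have "rcard (A Un X) <= rcard A + rcard X"
   using card_Un_le[of A X] by (simp only: of_nat_le_iff[symmetric, where 'a = real] of_nat_add)
  moreover have "rcard A <= \<nu> * n" using A(2) by (simp add: n_def)
  moreover have "4 * \<nu> <= kap"
  proof -
   have "4 * \<nu> <= 4 * (real r + 4) * \<nu>" by (rule mult_right_mono[OF _ kap(2)]) simp
   then show ?thesis using kap(3) by simp
  qed
  then have "4 * \<nu> * n <= kap * n" using n_pos by (simp add: mult_right_mono)
  moreover have "rcard X <= real M" using X(2) by simp
  moreover have "0 <= 10 * (real r + 1)\<^sup>2" by simp
  ultimately show ?thesis using large' by linarith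
 qed
 have ne: "?V ~= {}" using v by auto
 have "rcard H <= rcard (A Un X) / rcard ?V * rcard ?V ^ (r - card {v})"
  unfolding H_def by (rule card_hit_le_real[OF fin(1) ne]) (use finA X r in auto)
 also have "... = rcard (A Un X) / n * n ^ (r - 1)" by (simp add: n_def)
 also have "... <= kap / 2 * n ^ (r - 1)"
  using cAX n_pos by (intro mult_right_mono) (simp_all add: divide_le_eq)
 finally have cH: "rcard H <= kap / 2 * n ^ (r - 1)" .
 have finB': "finite B'" using finE by (simp add: B'_def B_def)
 have "B \<subseteq> B' Un H" using fin(2) by (auto simp: B_def B'_def H_def)
 moreover have "finite (B' Un H)" using finB' fin by (simp add: H_def finite_imp_finite_nsets)
 ultimately have "card B <= card B' + card H" by (meson card_Un_le card_mono order_trans)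
 then have "rcard B <= rcard B' + rcard H"
  by (simp only: of_nat_le_iff[symmetric, where 'a = real] of_nat_add)
 moreover have "4 * real r * kap * n ^ (r - 1) <= rcard B" using bd by (simp add: bad_deg_def B_def)
 moreover have knn: "0 < kap * n ^ (r - 1)" using kap(1) n_pos by simp
 moreover have "kap / 2 * n ^ (r - 1) <= 2 * real r * kap * n ^ (r - 1)"
 proof -
  have "1 / 2 * (kap * n ^ (r - 1)) <= 2 * real r * (kap * n ^ (r - 1))"
   using r knn by (intro mult_right_mono) auto
  then show ?thesis by (simp add: mult_ac)
 qed
 ultimately have cB': "real r * (2 * kap * n ^ (r - 1)) <= rcard B'" using cH by linarith
 have eB': "e \<in> ?E" "v \<in> e" "e Int X = {}" "(e - {v}) Int A = {}" "e \<notin> ?T" if "e \<in> B'" for e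
  using that X(3) by (auto simp: B'_def B_def)
 show ?thesis
 proof (cases "\<exists>e\<in>B'. \<exists>y\<in>e - {v}. \<exists>y'\<in>e - {v}. y ~= y' & hue y = hue y'")
  case True
  then obtain e y y' where e: "e \<in> B'" "y \<in> e - {v}" "y' \<in> e - {v}" "y ~= y'" "hue y = hue y'" by blast
  have "gadget e y y'"
   by (rule typical_gadget[OF size eB'(1)[OF e(1)]]) (use e eB'(4)[OF e(1)] in auto)
  then show ?thesis using eB'[OF e(1)] by blast
 next
  case False
  define L where "L = (%j. {e \<in> B'. hue ` (e - {v}) = {..<r} - {j}})"
  have "B' \<subseteq> (\<Union>j\<in>{..<r}. L j)"
  proof
   fix e assume e: "e \<in> B'"
   have inj: "inj_on hue (e - {v})"
   proof (rule inj_onI, rule ccontr)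
    fix a b assume "a \<in> e - {v}" "b \<in> e - {v}" "hue a = hue b" "a ~= b"
    then show False using False e by blast
   qed
   have "card (e - {v}) = r - 1" using edgeD[OF eB'(1)[OF e]] eB'(2)[OF e] by simp
   then have c: "card (hue ` (e - {v})) = r - 1" using card_image[OF inj] by simp
   have sub: "hue ` (e - {v}) \<subseteq> {..<r}" using hue by auto
   have "card ({..<r} - hue ` (e - {v})) = 1" using c sub r by (simp add: card_Diff_subset finite_subset)
   then obtain j where "{..<r} - hue ` (e - {v}) = {j}" by (rule card_1_singletonE)
   then have "hue ` (e - {v}) = {..<r} - {j}" "j < r" using sub by auto
   then show "e \<in> (\<Union>j\<in>{..<r}. L j)" using e by (auto simp: L_def)
  qed
  then have "card B' <= card (\<Union>j\<in>{..<r}. L j)" by (rule card_mono[rotated]) (use finB' in \<open>simp add: L_def\<close>)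
  also have "... <= (\<Sum>j\<in>{..<r}. card (L j))" by (rule card_UN_le) simp
  finally have "rcard B' <= (\<Sum>j<r. rcard (L j))"
   by (simp only: of_nat_le_iff[symmetric, where 'a = real] of_nat_sum)
  then have sumL: "real r * (2 * kap * n ^ (r - 1)) <= (\<Sum>j<r. rcard (L j))" using cB' by linarith
  have "\<exists>j<r. 2 * kap * n ^ (r - 1) <= rcard (L j)"
  proof (rule ccontr)
   assume no: "\<not> (\<exists>j<r. 2 * kap * n ^ (r - 1) <= rcard (L j))"
   have "(\<Sum>j<r. rcard (L j)) < (\<Sum>j<r. 2 * kap * n ^ (r - 1))"
    by (rule sum_strict_mono) (use no r in \<open>auto simp: not_le lessThan_empty_iff\<close>)
   then show False using sumL by simp
  qed
  then obtain j where j: "j < r" "2 * kap * n ^ (r - 1) <= rcard (L j)" by blast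
  have "card (L j) <= card {e \<in> ?E. v \<in> e & hue ` (e - {v}) = {..<r} - {j}}"
  proof (rule card_mono)
   show "L j \<subseteq> {e \<in> ?E. v \<in> e & hue ` (e - {v}) = {..<r} - {j}}"
   proof
    fix e assume "e \<in> L j"
    then have "e \<in> B'" "hue ` (e - {v}) = {..<r} - {j}" by (simp_all add: L_def)
    then show "e \<in> {e \<in> ?E. v \<in> e & hue ` (e - {v}) = {..<r} - {j}}" using eB'(1,2) by simp
   qed
  qed (simp add: finE)
  also have "... <= card {e \<in> ?E Int ?T. v \<in> e}" by (rule max_cut_link[OF mc G hue j(1)])
  finally have deg: "2 * kap * n ^ (r - 1) <= rcard {e \<in> ?E Int ?T. v \<in> e}" using j(2) by linarith
  \<comment> \<open>Transversal edges at \<open>v\<close> are counted over class \<open>k\<close>.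
    Pairs that are not rich contribute at most \<open>kap * n ^ (r - 2)\<close> each, so at least
    half of the lower bound must come from rich pairs.\<close>
  have rich: "kap * n <= rcard {z \<in> ?V. hue z = k & R v z}" if k: "k < r" "k ~= hue v" for k
  proof -
   let ?C = "{z \<in> ?V. hue z = k}" and ?S = "{z \<in> ?V. hue z = k & R v z}"
   have "{e \<in> ?E Int ?T. v \<in> e} \<subseteq> (\<Union>z\<in>?C. {e \<in> ?E Int ?T. {v, z} \<subseteq> e})"
   proof
    fix e assume e: "e \<in> {e \<in> ?E Int ?T. v \<in> e}"
    then have "k \<in> hue ` e" using k by (auto simp: tedges_def)
    then obtain z where "z \<in> e" "hue z = k" by auto
    then show "e \<in> (\<Union>z\<in>?C. {e \<in> ?E Int ?T. {v, z} \<subseteq> e})" using e edgeD by auto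
   qed
   then have "card {e \<in> ?E Int ?T. v \<in> e} <= card (\<Union>z\<in>?C. {e \<in> ?E Int ?T. {v, z} \<subseteq> e})"
    by (rule card_mono[rotated]) (simp add: fin finE)
   also have "... <= (\<Sum>z\<in>?C. codeg (?E Int ?T) {v, z})"
    unfolding codeg_def by (rule card_UN_le) (simp add: fin)
   finally have "rcard {e \<in> ?E Int ?T. v \<in> e} <= (\<Sum>z\<in>?C. real (codeg (?E Int ?T) {v, z}))"
    by (simp only: of_nat_le_iff[symmetric, where 'a = real] of_nat_sum)
   also have "... <= (\<Sum>z\<in>?C. (if R v z then n ^ (r - 2) else 0) + kap * n ^ (r - 2))"
   proof (rule sum_mono)
    fix z assume z: "z \<in> ?C"
    then have "v ~= z" using k by auto
    then have c2: "card {v, z} = 2" by simp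
    have sub: "?E Int ?T \<subseteq> nsets ?V r" using fin(2) by auto
    show "real (codeg (?E Int ?T) {v, z}) <= (if R v z then n ^ (r - 2) else 0) + kap * n ^ (r - 2)"
    proof (cases "R v z")
     case True
     have "codeg (?E Int ?T) {v, z} <= codeg (nsets ?V r) {v, z}"
      by (rule codeg_mono[OF _ sub]) (simp add: fin finite_imp_finite_nsets)
     also have "... <= card ?V ^ (r - card {v, z})" by (rule codeg_nsets_le[OF fin(1)]) (use c2 r in auto)
     finally have "real (codeg (?E Int ?T) {v, z}) <= real (card ?V ^ (r - 2))" unfolding c2 by (simp only: of_nat_le_iff)
     then show ?thesis using True kap(1) n_pos by (simp add: n_def add_increasing2)
    next
     case False
     then have "real (codeg (?E Int ?T) {v, z}) <= kap * rcard ?V ^ (r - card {v, z})"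
      by (intro not_rich_codeg[OF fin(1) sub]) (use c2 r kap(1) in \<open>auto simp: R_def n_def\<close>)
     then show ?thesis using False unfolding c2 by (simp add: n_def)
    qed
   qed
   also have "... = (\<Sum>z\<in>?C. if R v z then n ^ (r - 2) else 0) + (\<Sum>z\<in>?C. kap * n ^ (r - 2))"
    by (rule sum.distrib)
   also have "(\<Sum>z\<in>?C. if R v z then n ^ (r - 2) else 0) = (\<Sum>z\<in>{z \<in> ?C. R v z}. n ^ (r - 2))"
    by (rule sum.inter_filter[symmetric]) (simp add: fin)
   also have "... = rcard ?S * n ^ (r - 2)" by (simp add: conj_assoc)
   also have "(\<Sum>z\<in>?C. kap * n ^ (r - 2)) <= n * (kap * n ^ (r - 2))"
   proof -
    have "card ?C <= card ?V" by (rule card_mono) (auto simp: fin)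
    then have "rcard ?C <= n" by (simp add: n_def)
    then show ?thesis using kap(1) n_pos by (simp add: mult_right_mono)
   qed
   finally have "2 * kap * n ^ (r - 1) <= rcard ?S * n ^ (r - 2) + n * (kap * n ^ (r - 2))"
    using deg by linarith
   then have "(kap * n) * n ^ (r - 2) <= rcard ?S * n ^ (r - 2)" unfolding rr by (simp add: algebra_simps)
   then show ?thesis using n_pos by (simp add: mult_le_cancel_right)
  qed
  have "0 < 2 * kap * n ^ (r - 1)" using knn by simp
  then have "L j ~= {}" using j(2) by auto
  then obtain e where e: "e \<in> B'" "hue ` (e - {v}) = {..<r} - {j}" by (auto simp: L_def)
  \<comment> \<open>Otherwise the edge would be transversal. Hence the colour of \<open>v\<close>
    occurs in the link, which supplies \<open>y\<close>.\<close>
  have "j ~= hue v"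
  proof
   assume "j = hue v"
   have "e = insert v (e - {v})" using eB'(2)[OF e(1)] by auto
   then have "hue ` e = insert (hue v) (hue ` (e - {v}))" by (metis image_insert)
   also have "... = {..<r}" using e(2) \<open>j = hue v\<close> j(1) by auto
   finally have "e \<in> ?T" using eB'(1)[OF e(1)] fin(2) by (auto simp: tedges_def)
   then show False using eB'(5)[OF e(1)] by simp
  qed
  then have "hue v \<in> hue ` (e - {v})" using e(2) hue by auto
  then obtain y where y: "y \<in> e - {v}" "hue y = hue v" by (metis imageE)
  have "y \<notin> A" using y(1) eB'(4)[OF e(1)] by blast
  then have "gadget e y v"
   unfolding gadget_def using y eB'(1,2)[OF e(1)] rich by auto
  then show ?thesis using eB'[OF e(1)] by blast
 qed
qed

text \<open>Each vertex of \<open>S\<close> and each edge of \<open>D\<close> yields a gadget, and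
  the gadgets can be made disjoint. With \<open>r + 1\<close> of them the pattern would
  appear.\<close>

lemma card_bad_vertices_plus_matching:
 assumes size: "\<And>k. k < r ==> 2 * kap * n <= rcard {v \<in> verts G. hue v = k}"
  and mc: "max_cut G r hue" and free: "hyp_free (pattern r t) G" and M: "pattern_bound r t <= M"
  and S: "\<And>v. v \<in> S ==> v \<in> verts G & 4 * real r * kap * n ^ (r - 1) <= bad_deg G r hue v"
  and D: "D \<subseteq> edges G - tedges (verts G) r hue" "\<And>e e'. e \<in> D ==> e' \<in> D ==> e ~= e' ==> e Int e' = {}"
   "\<And>e. e \<in> D ==> e Int (S Un A) = {}"
 shows "card S + card D <= r"
proof (rule ccontr)
 assume "\<not> card S + card D <= r"
 then have big: "r + 1 <= card S + card D" by simp
 let ?T = "tedges (verts G) r hue"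
 have finE: "finite (edges G)" using fin finite_imp_finite_nsets finite_subset by blast
 have finS: "finite S" using S fin(1) by (meson finite_subset subsetI)
 have finD: "finite D" using D(1) finE by (meson Diff_subset finite_subset)
 define s where "s = min (card S) (r + 1)"
 have s: "s <= card S" "r + 1 - s <= card D" "s <= r + 1" using big by (auto simp: s_def)
 obtain S' where S': "S' \<subseteq> S" "card S' = s" using obtain_subset_with_card_n[OF s(1)] by metis
 obtain D' where D': "D' \<subseteq> D" "card D' = r + 1 - s" using obtain_subset_with_card_n[OF s(2)] by metis
 have finS': "finite S'" using S' finS finite_subset by blast
 have finD': "finite D'" using D' finD finite_subset by blast
 obtain v where v: "bij_betw v {..<s} S'"
  using finite_same_card_bij[of "{..<s}" S'] S' finS' by auto
 have "card {s..r} = card D'" using D' s by simp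
 then obtain d where d: "bij_betw d {s..r} D'"
  using finite_same_card_bij[of "{s..r}" D'] finD' by auto
 have vS: "v i \<in> S'" if "i < s" for i using bij_betw_apply[OF v, of i] that by simp
 have vinj: "v i ~= v j" if "i < s" "j < s" "i ~= j" for i j
  using inj_onD[OF bij_betw_imp_inj_on[OF v], of i j] that by auto
 have dD: "d i \<in> D'" if "s <= i" "i <= r" for i using bij_betw_apply[OF d, of i] that by simp
 have dinj: "d i ~= d j" if "s <= i" "i <= r" "s <= j" "j <= r" "i ~= j" for i j
  using inj_onD[OF bij_betw_imp_inj_on[OF d], of i j] that by auto
 have D'E: "e \<in> edges G" "e \<notin> ?T" "e Int S = {}" "e Int A = {}" if "e \<in> D'" for e
 proof -
  have e: "e \<in> D" using that D'(1) by blast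
  then show "e \<in> edges G" "e \<notin> ?T" using D(1) by auto
  show "e Int S = {}" "e Int A = {}" using D(3)[OF e] by auto
 qed
 have cUD: "card (\<Union>D') <= (r + 1) * r"
 proof -
  have "card (\<Union>D') <= (\<Sum>e\<in>D'. card e)" by (rule card_Union_le_sum_card)
  also have "... = (\<Sum>e\<in>D'. r)" by (rule sum.cong) (use D'E edgeD in auto)
  also have "... = card D' * r" by simp
  also have "... <= (r + 1) * r" by (rule mult_le_mono1) (use D' in simp)
  finally show ?thesis .
 qed
 have finUD: "finite (\<Union>D')" using finD' D'E edgeD by auto
 \<comment> \<open>Each new gadget avoids the other chosen vertices and edges as well as the earlier
   gadgets, so that all of them remain usable.\<close>
 define Q where "Q = (%e y y' i. gadget (e i) (y i) (y' i) & v i \<in> e i & e i Int (S' - {v i}) = {} \<and>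
   e i Int \<Union>D' = {} & (\<forall>j<i. e i Int e j = {}))"
 have "\<exists>e y y'. \<forall>i<N. Q e y y' i" if "N <= s" for N
  using that
 proof (induction N)
  case (Suc N)
  then obtain e y y' where IH: "\<forall>i<N. Q e y y' i" by auto
  have N: "N < s" using Suc.prems by simp
  let ?X = "(S' - {v N}) Un (\<Union>D' Un (\<Union>i<N. e i))"
  have ge: "finite (e i) & card (e i) = r" if "i < N" for i
   using IH that edgeD by (auto simp: Q_def gadget_def)
  have "card ?X <= card (S' - {v N}) + (card (\<Union>D') + card (\<Union>i<N. e i))"
   by (rule order_trans[OF card_Un_le], rule add_left_mono, rule card_Un_le)
  also have "... <= (r + 1) + ((r + 1) * r + (r + 1) * r)"
  proof (intro add_mono)
   show "card (S' - {v N}) <= r + 1" using card_Diff1_le[of S' "v N"] S' s by linarith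
   show "card (\<Union>D') <= (r + 1) * r" by (rule cUD)
   have "card (\<Union>i<N. e i) <= (\<Sum>i<N. card (e i))" by (rule card_UN_le) simp
   also have "... = (\<Sum>i<N. r)" by (rule sum.cong) (use ge in auto)
   also have "... = N * r" by simp
   also have "... <= (r + 1) * r" by (rule mult_le_mono1) (use N s in simp)
   finally show "card (\<Union>i<N. e i) <= (r + 1) * r" .
  qed
  also have "... <= (r + 1) * (5 * r + 2)" by (simp add: algebra_simps)
  also have "... <= M" using M by (simp add: pattern_bound_def)
  finally have cX: "card ?X <= M" .
  have finX: "finite ?X" using finS' finUD ge by auto
  have "v N \<in> S" using vS[OF N] S'(1) by auto
  have "v N \<notin> \<Union>D'" using \<open>v N \<in> S\<close> D'E(3) by blast
  moreover have "v N \<notin> e i" if "i < N" for i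
  proof -
   have "v N \<in> S' - {v i}" using vS[OF N] vinj[of N i] N that by auto
   then show ?thesis using IH that unfolding Q_def by blast
  qed
  ultimately have vX: "v N \<notin> ?X" by auto
  obtain e' z z' where new: "gadget e' z z'" "v N \<in> e'" "e' Int ?X = {}"
   using gadget_of_bad_deg[OF size mc _ _ finX cX vX] S[OF \<open>v N \<in> S\<close>] by blast
  have "Q (e(N := e')) (y(N := z)) (y'(N := z')) i" if "i < Suc N" for i
  proof (cases "i = N")
   case True
   have "e' Int e j = {}" if "j < N" for j using new(3) that by blast
   then show ?thesis using True new by (auto simp: Q_def)
  next
   case False
   then have "i < N" using that by simp
   then have "Q e y y' i" using IH by blast
   then show ?thesis using \<open>i < N\<close> by (simp add: Q_def)
  qed
  then show ?case by blast
 qed auto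
 from this[OF order_refl] obtain e y y' where Q: "\<forall>i<s. Q e y y' i" by (elim exE)
 have "\<exists>z z'. gadget (d i) z z'" if i: "s <= i" "i <= r" for i
 proof -
  note di = D'E[OF dD[OF i]]
  have "\<not> inj_on hue (d i)"
  proof
   assume inj: "inj_on hue (d i)"
   have "card (hue ` d i) = r" using card_image[OF inj] edgeD[OF di(1)] by simp
   then have "hue ` d i = {..<r}" using hue by (intro card_subset_eq) auto
   then show False using di(1,2) fin(2) by (auto simp: tedges_def)
  qed
  then obtain z z' where z: "z \<in> d i" "z' \<in> d i" "z ~= z'" "hue z = hue z'" by (auto simp: inj_on_def)
  have "gadget (d i) z z'" by (rule typical_gadget[OF size di(1)]) (use z di(4) in auto)
  then show ?thesis by blast
 qed
 then have "\<forall>i. \<exists>z. \<exists>z'. s <= i --> i <= r --> gadget (d i) z z'" by blast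
 from choice[OF this] obtain z where z: "\<forall>i. \<exists>z'. s <= i --> i <= r --> gadget (d i) (z i) z'" by (elim exE)
 from choice[OF z] obtain z' where z': "\<forall>i. s <= i --> i <= r --> gadget (d i) (z i) (z' i)" by (elim exE)
 define e1 where "e1 = (%i. if i < s then e i else d i)"
 have dis: "e1 i Int e1 j = {}" if ij: "j < i" "i <= r" for i j
 proof (cases "i < s")
  case True
  then show ?thesis using Q ij by (simp add: e1_def Q_def)
 next
  case False
  show ?thesis
  proof (cases "j < s")
   case True
   have "d i \<subseteq> \<Union>D'" using dD[of i] False ij by auto
   moreover have "e j Int \<Union>D' = {}" using Q True by (simp add: Q_def)
   ultimately show ?thesis using True False by (auto simp: e1_def)
  next
   case False': False
   have "d i \<in> D" "d j \<in> D" "d i ~= d j" using dD[of i] dD[of j] dinj[of i j] False False' ij D'(1) by auto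
   then show ?thesis using D(2) False False' by (simp add: e1_def)
  qed
 qed
 have "\<not> hyp_free (pattern r t) G"
 proof (rule pattern_of_gadgets[OF M, where e = e1 and y = "%i. if i < s then y i else z i"
    and y' = "%i. if i < s then y' i else z' i"])
  show "gadget (e1 i) (if i < s then y i else z i) (if i < s then y' i else z' i)" if "i <= r" for i
   using Q z' that by (auto simp: e1_def Q_def)
  show "e1 i Int e1 j = {}" if "i <= r" "j <= r" "i ~= j" for i j
  proof (cases "j < i")
   case True
   then show ?thesis by (rule dis[OF _ that(1)])
  next
   case False
   then have "e1 j Int e1 i = {}" using that by (intro dis) auto
   then show ?thesis by (simp only: Int_commute)
  qed
 qed
 then show False using free by simp
qed

end

section \<open>Sizes of joins and balanced products\<close>

text \<open>The product of the class sizes of a balanced partition of \<open>m\<close> points into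
  \<open>r\<close> classes.\<close>

definition bal :: "nat => nat => nat" where
 "bal r m = (\<Prod>i<r. (m + i) div r)"

text \<open>The edge count of the extremal graph on \<open>m\<close> vertices.\<close>

definition join_size :: "nat => nat => nat" where
 "join_size r m = (m choose r) - ((m - r) choose r) + bal r (m - r)"

definition jedges :: "'a set => nat => 'a set => ('a => nat) => 'a set set" where
 "jedges V r S hue = {e \<in> nsets V r. e Int S ~= {}} Un tedges (V - S) r hue"

lemma div_add_cases:
 fixes m r i :: nat
 assumes "i < r"
 shows "(m + i) div r = (if i < r - m mod r then m div r else m div r + 1)"
proof -
 have r: "0 < r" using assms by simp
 have mr: "m mod r < r" using r by simp
 have eq: "m + i = (m mod r + i) + r * (m div r)" using mod_mult_div_eq[of m r] by linarith
 have "(m + i) div r = ((m mod r + i) + r * (m div r)) div r"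
  using arg_cong[OF eq, of "%x. x div r"] .
 also have "... = m div r + (m mod r + i) div r" by (rule div_mult_self2) (use r in simp)
 also have "(m mod r + i) div r = (if i < r - m mod r then 0 else 1)"
 proof (cases "i < r - m mod r")
  case True
  then show ?thesis by simp
 next
  case False
  then have "r <= m mod r + i" "m mod r + i < 2 * r" using mr assms by linarith+
  then have "(m mod r + i) div r = 1" using r by (simp add: div_nat_eqI)
  then show ?thesis using False by simp
 qed
 finally show ?thesis by simp
qed

lemma bal_eq: "0 < r ==> bal r m = (m div r) ^ (r - m mod r) * (m div r + 1) ^ (m mod r)"
proof -
 assume r: "0 < r"
 have mr: "m mod r < r" using r by simp
 have "bal r m = (\<Prod>i<r. if i < r - m mod r then m div r else m div r + 1)"
  unfolding bal_def by (rule prod.cong) (use div_add_cases in auto)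
 also have "{..<r} = {..<r - m mod r} Un {r - m mod r..<r}" using mr by auto
 also have "(\<Prod>i\<in>{..<r - m mod r} Un {r - m mod r..<r}. if i < r - m mod r then m div r else m div r + 1)
  = (\<Prod>i<r - m mod r. if i < r - m mod r then m div r else m div r + 1) *
   (\<Prod>i\<in>{r - m mod r..<r}. if i < r - m mod r then m div r else m div r + 1)"
  by (rule prod.union_disjoint) auto
 also have "... = (\<Prod>i<r - m mod r. m div r) * (\<Prod>i\<in>{r - m mod r..<r}. m div r + 1)" by simp
 also have "... = (m div r) ^ (r - m mod r) * (m div r + 1) ^ (m mod r)" using mr by simp
 finally show ?thesis .
qed

text \<open>Tangent comparison: the exponential through \<open>(q, q)\<close> and \<open>(q + 1, q + 1)\<close> dominates the
 identity on the integers, strictly elsewhere.\<close>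

lemma nat_le_exponential:
 fixes q a :: nat
 assumes q: "1 <= q"
 shows "real a <= real q * ((real q + 1) / real q) powr (real a - real q)"
  and "a ~= q ==> a ~= q + 1 ==> real a < real q * ((real q + 1) / real q) powr (real a - real q)"
proof -
 define x where "x = (real q + 1) / real q"
 have x: "x > 1" using q by (simp add: x_def)
 have up: "real a <= real q * x powr (real a - real q) & (a ~= q --> a ~= q + 1 --> real a < real q * x powr (real a - real q))"
 proof (cases "q <= a")
  case True
  then obtain d where d: "a = q + d" using le_Suc_ex by blast
  have p: "x powr (real a - real q) = x ^ d" using d x by (simp add: powr_realpow)
  have x1: "x = 1 + 1 / real q" using q by (simp add: x_def field_simps)
  have b: "1 + real d * (1 / real q) <= x ^ d"
   unfolding x1 by (rule Bernoulli_inequality) (use q in \<open>simp add: field_simps\<close>)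
  have "real q * (1 + real d * (1 / real q)) = real a" using q d by (simp add: field_simps)
  then have le: "real a <= real q * x ^ d"
   using mult_left_mono[OF b, of "real q"] by simp
  moreover have "real a < real q * x ^ d" if "a ~= q" "a ~= q + 1"
  proof -
   have d2: "2 <= d" using that d by simp
   then obtain d' where d': "d = Suc d'" "1 <= d'" by (cases d) auto
   have b': "1 + real d' * (1 / real q) <= x ^ d'"
    unfolding x1 by (rule Bernoulli_inequality) (use q in \<open>simp add: field_simps\<close>)
   have "1 + real d * (1 / real q) < (1 + 1 / real q) * (1 + real d' * (1 / real q))"
    using q d' by (simp add: field_simps)
   also have "... <= (1 + 1 / real q) * x ^ d'" using b' q by (intro mult_left_mono) auto
   also have "... = x ^ d" using d' x1 by simp
   finally have "real q * (1 + real d * (1 / real q)) < real q * x ^ d" using q by simp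
   moreover have "real q * (1 + real d * (1 / real q)) = real a" using q d by (simp add: field_simps)
   ultimately show ?thesis by simp
  qed
  ultimately show ?thesis using p by simp
 next
  case False
  then obtain d where d: "q = a + d" "1 <= d" by (metis less_imp_add_positive not_le Suc_leI One_nat_def)
  have p: "x powr (real a - real q) = 1 / x ^ d"
  proof -
   have "real a - real q = - real d" using d by simp
   then show ?thesis using x by (simp add: powr_minus powr_realpow inverse_eq_divide)
  qed
  have y: "1 / x = 1 + (- 1 / (real q + 1))" using q by (simp add: x_def field_simps)
  have "1 + real d * (- 1 / (real q + 1)) <= (1 + (- 1 / (real q + 1))) ^ d"
   by (rule Bernoulli_inequality) (simp add: field_simps)
  then have b: "1 - real d / (real q + 1) <= 1 / x ^ d" unfolding y[symmetric] by (simp add: power_one_over)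
  have "1 - real d / real q < 1 - real d / (real q + 1)" using q d by (simp add: frac_less2)
  then have "1 - real d / real q < 1 / x ^ d" using b by linarith
  then have "real q * (1 - real d / real q) < real q * (1 / x ^ d)" by (rule mult_strict_left_mono) (use q in simp)
  moreover have "real q * (1 - real d / real q) = real a" using q d by (simp add: field_simps)
  ultimately show ?thesis using p by simp
 qed
 then show "real a <= real q * ((real q + 1) / real q) powr (real a - real q)"
  and "a ~= q ==> a ~= q + 1 ==> real a < real q * ((real q + 1) / real q) powr (real a - real q)"
  unfolding x_def by blast+
qed

text \<open>The tangent comparison is multiplied over all \<open>i\<close>; the total exponent
  depends only on the sum, so the right-hand side becomes the balanced product. A factor away from
  \<open>q\<close> and \<open>q + 1\<close> makes the comparison strict.\<close>

lemma prod_le_bal: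
 fixes a :: "nat => nat"
 assumes r: "0 < r" and sum: "(\<Sum>i<r. a i) = m" and m: "r <= m"
 shows "(\<Prod>i<r. a i) <= bal r m"
  and "(\<Prod>i<r. a i) = bal r m ==> i < r ==> a i = m div r \<or> a i = m div r + 1"
proof -
 define q where "q = m div r"
 define s where "s = m mod r"
 have q: "1 <= q" using m r by (simp add: q_def Suc_leI div_greater_zero_iff)
 have s: "s < r" "m = r * q + s" using r by (simp_all add: s_def q_def)
 define x where "x = (real q + 1) / real q"
 have x: "x > 0" using q by (simp add: x_def)
 define g where "g = (%i. real q * x powr (real (a i) - real q))"
 have ag: "real (a i) <= g i" for i unfolding g_def x_def by (rule nat_le_exponential(1)[OF q])
 have gpos: "0 < g i" for i using q x by (simp add: g_def)
 have "(\<Prod>i<r. g i) = real q ^ r * (\<Prod>i<r. x powr (real (a i) - real q))"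
  by (simp add: g_def prod.distrib)
 also have "(\<Prod>i<r. x powr (real (a i) - real q)) = x powr (\<Sum>i<r. real (a i) - real q)"
  using x by (simp add: powr_sum)
 also have "(\<Sum>i<r. real (a i) - real q) = real s"
 proof -
  have "(\<Sum>i<r. real (a i)) = real m" using sum by (metis of_nat_sum)
  then show ?thesis using s by (simp add: sum_subtractf)
 qed
 also have "x powr real s = x ^ s" using x by (simp add: powr_realpow)
 also have "real q ^ r * x ^ s = real (bal r m)"
 proof -
  have "real q ^ r = real q ^ (r - s) * real q ^ s" using s(1) by (simp add: power_add[symmetric])
  moreover have "real q ^ s * x ^ s = (real q + 1) ^ s" using q by (simp add: x_def power_mult_distrib[symmetric])
  ultimately have "real q ^ r * x ^ s = real q ^ (r - s) * (real q + 1) ^ s" by (simp add: mult.assoc)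
  also have "... = real (bal r m)" unfolding bal_eq[OF r] q_def s_def by (simp add: add.commute)
  finally show ?thesis .
 qed
 finally have G: "(\<Prod>i<r. g i) = real (bal r m)" .
 have le: "(\<Prod>i<r. real (a i)) <= (\<Prod>i<r. g i)" by (rule prod_mono) (use ag in auto)
 then show "(\<Prod>i<r. a i) <= bal r m" unfolding G by (metis of_nat_le_iff of_nat_prod)
 show "a i = m div r \<or> a i = m div r + 1" if eq: "(\<Prod>i<r. a i) = bal r m" and i: "i < r"
 proof (rule ccontr)
  assume "\<not> (a i = m div r \<or> a i = m div r + 1)"
  then have lt: "real (a i) < g i" unfolding g_def x_def
   by (intro nat_le_exponential(2)[OF q]) (simp_all add: q_def)
  have "(\<Prod>j<r. real (a j)) = real (a i) * (\<Prod>j\<in>{..<r} - {i}. real (a j))"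
   using i by (subst prod.remove[of _ i]) auto
  also have "... <= real (a i) * (\<Prod>j\<in>{..<r} - {i}. g j)"
   by (intro mult_left_mono prod_mono) (use ag in auto)
  also have "... < g i * (\<Prod>j\<in>{..<r} - {i}. g j)"
   using lt by (intro mult_strict_right_mono prod_pos) (use gpos in auto)
  also have "... = (\<Prod>j<r. g j)" using i by (subst (2) prod.remove[of _ i]) auto
  finally have "(\<Prod>j<r. real (a j)) < real (bal r m)" unfolding G .
  then show False using eq by (metis of_nat_prod less_irrefl)
 qed
qed

text \<open>The class sizes for \<open>m + 1\<close> arise from those for \<open>m\<close> by
  shifting the index: one class of size \<open>m div r\<close> gains a point, and the other factors
  are at least \<open>m div r\<close>.\<close>

lemma bal_Suc:
 assumes r: "0 < r"
 shows "bal r m + (m div r) ^ (r - 1) <= bal r (Suc m)"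
proof -
 obtain p where p: "r = Suc p" using r by (cases r) auto
 define f where "f = (%i. (m + i) div r)"
 have "bal r m = f 0 * (\<Prod>i<p. f (Suc i))"
  unfolding bal_def f_def p by (rule prod.lessThan_Suc_shift)
 moreover have "bal r (Suc m) = (\<Prod>i<p. f (Suc i)) * f r"
 proof -
  have "bal r (Suc m) = (\<Prod>i<Suc p. f (Suc i))" unfolding bal_def f_def p by simp
  then show ?thesis by (simp add: p)
 qed
 moreover have "f r = f 0 + 1" using r by (simp add: f_def)
 moreover have "(m div r) ^ p <= (\<Prod>i<p. f (Suc i))"
 proof -
  have "(m div r) ^ p = (\<Prod>i<p. m div r)" by simp
  also have "... <= (\<Prod>i<p. f (Suc i))" by (rule prod_mono) (auto simp: f_def intro: div_le_mono)
  finally show ?thesis .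
 qed
 ultimately show ?thesis by (simp add: p algebra_simps)
qed

lemma join_size_Suc:
 assumes r: "2 <= r" and m: "r <= m"
 shows "join_size r m + ((m - r) div r) ^ (r - 1) <= join_size r (Suc m)"
proof -
 obtain p where p: "r = Suc p" using r by (cases r) auto
 have 1: "(m - r) choose r <= m choose r" by (rule binomial_right_mono) simp
 have 2: "(m - r) choose p <= m choose p" by (rule binomial_right_mono) simp
 have 3: "bal r (m - r) + ((m - r) div r) ^ (r - 1) <= bal r (Suc (m - r))" by (rule bal_Suc) (use r in simp)
 have e: "Suc m choose r = (m choose r) + (m choose p)" by (simp add: p)
 have e': "Suc m - r = Suc (m - r)" using m by simp
 have e'': "Suc (m - r) choose r = ((m - r) choose r) + ((m - r) choose p)" by (simp add: p)
 show ?thesis unfolding join_size_def e e' e'' using 1 2 3 by linarith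
qed

lemma bal_lower:
 assumes r: "0 < r" and m: "r <= m"
 shows "(real m / real r - 1) ^ r <= real (bal r m)"
proof -
 have "(real m / real r - 1) ^ r = (\<Prod>i<r. real m / real r - 1)" by simp
 also have "... <= (\<Prod>i<r. real ((m + i) div r))"
 proof (rule prod_mono)
  fix i assume "i \<in> {..<r}"
  have "m <= r + r * (m div r)" using mod_mult_div_eq[of m r] mod_less_divisor[OF r, of m] by linarith
  then have "real m <= real r + real r * real (m div r)" by (simp only: of_nat_le_iff[symmetric, where 'a = real] of_nat_add of_nat_mult)
  then have "real m / real r - 1 <= real (m div r)" using r by (simp add: field_simps)
  also have "... <= real ((m + i) div r)" by (simp add: div_le_mono)
  finally show "0 <= real m / real r - 1 & real m / real r - 1 <= real ((m + i) div r)"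
   using m r by simp
 qed
 also have "... = real (bal r m)" by (simp add: bal_def)
 finally show ?thesis .
qed

lemma finite_tedges: "finite V ==> finite (tedges V r hue)"
 by (simp add: tedges_def finite_imp_finite_nsets)

lemma jedges_subset: "jedges V r S hue \<subseteq> nsets V r"
 by (auto simp: jedges_def tedges_def nsets_def)

lemma card_jedges:
 assumes V: "finite V" and S: "S \<subseteq> V"
 shows "card (jedges V r S hue) = (card V choose r) - ((card V - card S) choose r)
  + (\<Prod>k<r. card {v \<in> V - S. hue v = k})"
proof -
 have finS: "finite S" using S V finite_subset by blast
 have "{e \<in> nsets V r. e Int S ~= {}} = nsets V r - nsets (V - S) r" by (auto simp: nsets_def)
 moreover have "card (nsets V r - nsets (V - S) r) = card (nsets V r) - card (nsets (V - S) r)"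
  using V by (intro card_Diff_subset finite_imp_finite_nsets nsets_mono) auto
 moreover have "card (V - S) = card V - card S" by (rule card_Diff_subset[OF finS S])
 ultimately have 1: "card {e \<in> nsets V r. e Int S ~= {}} = (card V choose r) - ((card V - card S) choose r)"
  by simp
 have "card (jedges V r S hue) = card {e \<in> nsets V r. e Int S ~= {}} + card (tedges (V - S) r hue)"
  unfolding jedges_def
  by (rule card_Un_disjoint) (use V in \<open>auto simp: finite_imp_finite_nsets finite_tedges tedges_def nsets_def\<close>)
 then show ?thesis using 1 card_tedges[of "V - S" r hue] V by simp
qed

lemma sum_class_sizes:
 fixes hue :: "'a => nat"
 assumes "finite V" "\<And>v. v \<in> V ==> hue v < r"
 shows "(\<Sum>k<r. card {v \<in> V. hue v = k}) = card V"
proof -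
 have "card (\<Union>k\<in>{..<r}. {v \<in> V. hue v = k}) = (\<Sum>k<r. card {v \<in> V. hue v = k})"
  by (rule card_UN_disjoint) (use assms in auto)
 moreover have "(\<Union>k\<in>{..<r}. {v \<in> V. hue v = k}) = V" using assms by auto
 ultimately show ?thesis by simp
qed

lemma card_jedges_le:
 assumes r: "0 < r" and V: "finite V" and S: "S \<subseteq> V" "card S = r" and hue: "\<And>v. hue v < r" and n: "2 * r <= card V"
 shows "card (jedges V r S hue) <= join_size r (card V)"
  and "card (jedges V r S hue) = join_size r (card V) ==> k < r ==>
   card {v \<in> V - S. hue v = k} = (card V - r) div r \<or> card {v \<in> V - S. hue v = k} = (card V - r) div r + 1"
proof -
 have "card (V - S) = card V - r" using S V finite_subset by (subst card_Diff_subset) auto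
 then have sum: "(\<Sum>k<r. card {v \<in> V - S. hue v = k}) = card V - r"
  using sum_class_sizes[of "V - S" hue r] V hue by simp
 have m: "r <= card V - r" using n by simp
 note c = card_jedges[OF V S(1), of r hue, unfolded S(2)]
 show "card (jedges V r S hue) <= join_size r (card V)"
  unfolding c join_size_def using prod_le_bal(1)[OF r sum m] by simp
 show "card {v \<in> V - S. hue v = k} = (card V - r) div r \<or> card {v \<in> V - S. hue v = k} = (card V - r) div r + 1"
  if "card (jedges V r S hue) = join_size r (card V)" "k < r"
  using prod_le_bal(2)[OF r sum m _ that(2)] that(1) unfolding c join_size_def by simp
qed

text \<open>AM-GM from \<open>b <= exp (b - 1)\<close> for the normalised factors. A factor that is
  at most \<open>1 - eps\<close> is kept out of this estimate, which improves the product by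
  \<open>(1 - eps) * exp eps\<close>.\<close>

lemma prod_le_power_mean:
 fixes a :: "nat => real"
 assumes r: "0 < r" and a: "\<And>i. i < r ==> 0 <= a i" and sum: "(\<Sum>i<r. a i) = m" and m: "0 < m"
 shows "(\<Prod>i<r. a i) <= (m / real r) ^ r"
  and "j < r ==> 0 <= eps ==> eps <= 1 ==> a j <= (1 - eps) * (m / real r) ==> (\<Prod>i<r. a i) <= (1 - eps) * exp eps * (m / real r) ^ r"
proof -
 define b where "b = (%i. a i / (m / real r))"
 have c: "m / real r > 0" using r m by simp
 have b0: "0 <= b i" if "i < r" for i unfolding b_def by (rule divide_nonneg_pos[OF a[OF that] c])
 have bs: "(\<Sum>i<r. b i - 1) = 0"
  unfolding b_def sum_subtractf sum_divide_distrib[symmetric] sum using r m by simp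
 have be: "b i <= exp (b i - 1)" for i using exp_ge_add_one_self[of "b i - 1"] by simp
 have pa: "(\<Prod>i<r. a i) = (\<Prod>i<r. b i) * (m / real r) ^ r"
 proof -
  have "b i * (m / real r) = a i" for i using r m by (simp add: b_def)
  then have "(\<Prod>i<r. a i) = (\<Prod>i<r. b i * (m / real r))" by simp
  also have "... = (\<Prod>i<r. b i) * (m / real r) ^ r" by (simp only: prod.distrib prod_constant card_lessThan)
  finally show ?thesis .
 qed
 have "(\<Prod>i<r. b i) <= (\<Prod>i<r. exp (b i - 1))" by (rule prod_mono) (use b0 be in auto)
 also have "... = exp (\<Sum>i<r. b i - 1)" by (simp add: exp_sum)
 finally have "(\<Prod>i<r. b i) <= 1" unfolding bs by simp
 then show "(\<Prod>i<r. a i) <= (m / real r) ^ r" unfolding pa using c by (simp add: mult_le_cancel_right1)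
 show "(\<Prod>i<r. a i) <= (1 - eps) * exp eps * (m / real r) ^ r"
  if j: "j < r" and e: "0 <= eps" "eps <= 1" and aj: "a j <= (1 - eps) * (m / real r)"
 proof -
  have bj: "b j <= 1 - eps" unfolding b_def using aj c by (simp only: pos_divide_le_eq)
  have "(\<Prod>i<r. b i) = b j * (\<Prod>i\<in>{..<r} - {j}. b i)" using j by (subst prod.remove[of _ j]) auto
  also have "... <= b j * (\<Prod>i\<in>{..<r} - {j}. exp (b i - 1))"
   by (intro mult_left_mono prod_mono) (use b0 be j in auto)
  also have "(\<Prod>i\<in>{..<r} - {j}. exp (b i - 1)) = exp (\<Sum>i\<in>{..<r} - {j}. b i - 1)" by (simp add: exp_sum)
  also have "(\<Sum>i\<in>{..<r} - {j}. b i - 1) = 1 - b j" using bs j by (subst (asm) sum.remove[of _ j]) auto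
  \<comment> \<open>The function \<open>b * exp (1 - b)\<close> increases up to 1; the difference to
    \<open>1 - eps\<close> is moved into the exponential.\<close>
  also have "b j * exp (1 - b j) <= (1 - eps) * exp eps"
  proof -
   define \<delta> where "\<delta> = (1 - b j) - eps"
   have \<delta>: "0 <= \<delta>" "b j = (1 - eps) - \<delta>" using bj by (simp_all add: \<delta>_def)
   show ?thesis
   proof (cases "eps = 1")
    case True
    then have "b j = 0" using bj b0[OF j] by simp
    then show ?thesis using True by simp
   next
    case False
    then have e1: "0 < 1 - eps" using e by simp
    have "b j <= (1 - eps) * (1 - \<delta>)" using \<delta> e by (simp add: algebra_simps)
    also have "... <= (1 - eps) * exp (- \<delta>)"
     using exp_ge_add_one_self[of "- \<delta>"] e1 by (intro mult_left_mono) auto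
    finally have "b j * exp (1 - b j) <= (1 - eps) * exp (- \<delta>) * exp (1 - b j)" by (rule mult_right_mono) simp
    also have "... = (1 - eps) * exp eps" by (simp add: \<delta>_def mult.assoc exp_add[symmetric])
    finally show ?thesis .
   qed
  qed
  finally have "(\<Prod>i<r. b i) <= (1 - eps) * exp eps" .
  then show ?thesis unfolding pa using c by (intro mult_right_mono) auto
 qed
qed

section \<open>Joins are free and the pattern is not partite\<close>

lemma copies_mono:
 assumes "verts G' \<subseteq> verts G" "edges G' \<subseteq> edges G"
 shows "copies F G' \<subseteq> copies F G"
 using assms unfolding copies_def by (fastforce simp: PiE_iff)

lemma hyp_free_mono:
 "hyp_free F G ==> verts G' \<subseteq> verts G ==> edges G' \<subseteq> edges G ==> hyp_free F G'"
 using copies_mono[of G' G F] by (simp add: hyp_free_def)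

text \<open>The \<open>r + 1\<close> cores of a block would need \<open>r + 1\<close> colours.\<close>

lemma block_not_rainbow:
 assumes r: "2 <= r" and inj: "inj_on \<phi> (block r i)"
 shows "\<exists>k l. k < l & l <= r & \<phi> ` pedge r i k l \<notin> tedges V r hue"
proof (rule ccontr)
 assume "\<not> ?thesis"
 then have T: "\<phi> ` pedge r i k l \<in> tedges V r hue" if "k < l" "l <= r" for k l using that by blast
 have lt: "hue (\<phi> (core i k)) < r" if "k <= r" for k
 proof -
  have "\<exists>k' l. k' < l & l <= r & core i k \<in> pedge r i k' l"
  proof (cases "k = 0")
   case True
   then show ?thesis using r by (intro exI[of _ 0] exI[of _ 1]) auto
  next
   case False
   then show ?thesis using that by (intro exI[of _ 0] exI[of _ k]) auto
  qed
  then obtain k' l where kl: "k' < l" "l <= r" "core i k \<in> pedge r i k' l" by blast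
  then have "hue (\<phi> (core i k)) \<in> hue ` \<phi> ` pedge r i k' l" by blast
  then show ?thesis using T[OF kl(1,2)] by (auto simp: tedges_def)
 qed
 have "inj_on (%k. hue (\<phi> (core i k))) {..r}"
 proof -
  have ne: "hue (\<phi> (core i k)) ~= hue (\<phi> (core i l))" if "k < l" "l <= r" for k l
  proof
   assume "hue (\<phi> (core i k)) = hue (\<phi> (core i l))"
   then have "\<phi> (core i k) = \<phi> (core i l)"
    by (intro tedges_same_colour[OF T[OF that]]) auto
   then have "core i k = core i l"
    using inj_onD[OF inj _ core_in_block[of k r i] core_in_block[of l r i]] that by simp
   then show False using that by simp
  qed
  show ?thesis
  proof (rule inj_onI, rule ccontr)
   fix k l assume "k \<in> {..r}" "l \<in> {..r}" "hue (\<phi> (core i k)) = hue (\<phi> (core i l))" "k ~= l"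
   then show False using ne[of k l] ne[of l k] by (cases k l rule: linorder_cases) auto
  qed
 qed
 then have "card {..r} <= card {..<r}" by (rule card_inj_on_le) (use lt in auto)
 then show False by simp
qed

lemma block_subset_verts: "i <= r ==> block r i \<subseteq> verts (pattern r t)"
 by (auto simp: verts_pattern core_part_def)

lemma pedge_in_edges: "i <= r ==> k < l ==> l <= r ==> pedge r i k l \<in> edges (pattern r t)"
 unfolding edges_pattern insert_iff Un_iff pedges_iff by blast

text \<open>Every block has an edge that is not transversal outside \<open>S\<close> and so meets
  \<open>S\<close>; \<open>r + 1\<close> disjoint blocks do not fit.\<close>

lemma join_free:
 assumes r: "2 <= r" and S: "finite S" "card S <= r" and E: "edges G \<subseteq> jedges V r S hue"
 shows "hyp_free (pattern r t) G"
proof (rule ccontr)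
 assume "\<not> hyp_free (pattern r t) G"
 then obtain \<phi> where \<phi>: "\<phi> \<in> copies (pattern r t) G" by (auto simp: hyp_free_def)
 then have inj: "inj_on \<phi> (verts (pattern r t))" and ed: "\<And>e. e \<in> edges (pattern r t) ==> \<phi> ` e \<in> edges G"
  by (auto simp: copies_def)
 have "\<exists>v\<in>block r i. \<phi> v \<in> S" if i: "i <= r" for i
 proof -
  have "inj_on \<phi> (block r i)" by (rule inj_on_subset[OF inj block_subset_verts[OF i]])
  then obtain k l where kl: "k < l" "l <= r" "\<phi> ` pedge r i k l \<notin> tedges (V - S) r hue"
   using block_not_rainbow[OF r] by blast
  have "\<phi> ` pedge r i k l \<in> jedges V r S hue"
   using ed[OF pedge_in_edges[OF i kl(1,2)]] E by blast
  then have "\<phi> ` pedge r i k l Int S ~= {}" using kl(3) by (simp add: jedges_def)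
  then show ?thesis using pedge_subset_block[OF kl(1,2)] by blast
 qed
 then have "\<forall>i. \<exists>v. i <= r --> v \<in> block r i & \<phi> v \<in> S" by blast
 from choice[OF this] obtain v where v: "\<forall>i. i <= r --> v i \<in> block r i & \<phi> (v i) \<in> S" by (elim exE)
 have "inj_on (%i. \<phi> (v i)) {..r}"
 proof (rule inj_onI, rule ccontr)
  fix i j assume ij: "i \<in> {..r}" "j \<in> {..r}" "\<phi> (v i) = \<phi> (v j)" "i ~= j"
  have m: "v i \<in> block r i" "v j \<in> block r j" using v ij by auto
  then have "v i \<in> verts (pattern r t)" "v j \<in> verts (pattern r t)"
   using block_subset_verts ij by auto
  then have "v i = v j" using inj_onD[OF inj ij(3)] by blast
  then show False using m block_disjoint[OF ij(4), of r] by auto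
 qed
 then have "card {..r} <= card S" by (rule card_inj_on_le) (use v S in auto)
 then show False using S by simp
qed

text \<open>A partition would colour the vertices so that all edges of a block are rainbow.\<close>

lemma pattern_not_r_partite:
 assumes r: "2 <= r"
 shows "\<not> r_partite r (pattern r t)"
proof
 assume "r_partite r (pattern r t)"
 then obtain P where P: "(\<Union>i<r. P i) = verts (pattern r t)" "disjoint_family_on P {..<r}"
  "\<forall>e\<in>edges (pattern r t). \<forall>i<r. card (e Int P i) = 1"
  by (auto simp: r_partite_def)
 define hue where "hue = (%v. SOME i. i < r & v \<in> P i)"
 have hue: "hue v = i" if "i < r" "v \<in> P i" for v i
 proof -
  have "hue v < r & v \<in> P (hue v)" unfolding hue_def by (rule someI[of _ i]) (use that in simp)
  then show ?thesis using P(2) that by (auto simp: disjoint_family_on_def)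
 qed
 obtain k l where kl: "k < l" "l <= r" "id ` pedge r 0 k l \<notin> tedges (verts (pattern r t)) r hue"
  using block_not_rainbow[OF r inj_on_id, of 0] by blast
 let ?e = "pedge r 0 k l"
 have e: "?e \<in> edges (pattern r t)" using pedge_in_edges kl by simp
 then have en: "?e \<in> nsets (verts (pattern r t)) r" using rgraph_pattern[OF r] by (auto simp: rgraph_def)
 have "hue ` ?e = {..<r}"
 proof
  show "hue ` ?e \<subseteq> {..<r}"
  proof
   fix c assume "c \<in> hue ` ?e"
   then obtain v where v: "v \<in> ?e" "c = hue v" by auto
   then have "v \<in> (\<Union>i<r. P i)" using en P(1) by (auto simp: nsets_def)
   then show "c \<in> {..<r}" using hue v by auto
  qed
  show "{..<r} \<subseteq> hue ` ?e"
  proof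
   fix i assume i: "i \<in> {..<r}"
   then have "card (?e Int P i) = 1" using P(3) e by auto
   then obtain v where v: "?e Int P i = {v}" by (rule card_1_singletonE)
   then have "v \<in> ?e" "v \<in> P i" by auto
   then show "i \<in> hue ` ?e" using hue[of i v] i by auto
  qed
 qed
 then have "id ` ?e \<in> tedges (verts (pattern r t)) r hue" using en by (simp add: tedges_def)
 then show False using kl(3) by simp
qed

section \<open>Graphs of large minimum degree\<close>

text \<open>A poor pair comes with at most \<open>kap * n\<close> blocking vertices. The transversal
  edges through the pair that avoid them are all missing, and for different \<open>z\<close> of one
  colour these families are disjoint, so the missing edges at \<open>y\<close> bound the number of
  poor \<open>z\<close>.\<close>

lemma few_poor_pairs:
 fixes G :: "'a hypergraph"
 assumes r: "2 <= r" and G: "rgraph r G" and hue: "\<And>v. hue v < r"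
  and size: "\<And>k. k < r ==> rcard (verts G) / (2 * real r) <= rcard {v \<in> verts G. hue v = k}"
  and kap: "0 < kap" "kap <= 1 / (4 * real r)" and y: "y \<in> verts G" and k: "k < r" "k ~= hue y"
  and miss: "rcard {e \<in> tedges (verts G) r hue - edges G. y \<in> e} <= \<mu> * rcard (verts G) ^ (r - 1)"
 shows "rcard {z \<in> verts G. hue z = k & \<not> rich (edges G Int tedges (verts G) r hue) (kap * rcard (verts G)) {y, z}}
  <= \<mu> * (4 * real r) ^ (r - 2) * rcard (verts G)"
proof -
 let ?V = "verts G" and ?T = "tedges (verts G) r hue"
 define n where "n = rcard ?V"
 have fin: "finite ?V" using G by (auto simp: rgraph_def)
 have n: "n > 0" using y fin by (auto simp: n_def card_gt_0_iff)
 define Z where "Z = {z \<in> ?V. hue z = k & \<not> rich (edges G Int ?T) (kap * n) {y, z}}"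
 have finZ: "finite Z" using fin by (simp add: Z_def)
 have finT: "finite (?T - edges G)" using finite_tedges[OF fin] by simp
 have low: "(n / (4 * real r)) ^ (r - 2) <= rcard {e \<in> ?T - edges G. {y, z} \<subseteq> e}" if z: "z \<in> Z" for z
 proof -
  have zV: "z \<in> ?V" "hue z = k" "\<not> rich (edges G Int ?T) (kap * n) {y, z}" using z by (auto simp: Z_def)
  obtain X where X: "finite X" "rcard X <= kap * n"
   "\<forall>e\<in>edges G Int ?T. {y, z} \<subseteq> e --> (e - {y, z}) Int X ~= {}"
   by (rule not_richE[OF zV(3)])
  let ?K = "{..<r} - hue ` {y, z}" and ?U = "%j. {v \<in> ?V. hue v = j} - X"
  let ?F = "(\<union>) {y, z} ` rainbow hue ?K ?U"
  have B: "{y, z} \<subseteq> ?V" "inj_on hue {y, z}" "hue ` {y, z} \<subseteq> {..<r}"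
   using y zV k hue by (auto simp: inj_on_def)
  have U: "?U j \<subseteq> {v \<in> ?V. hue v = j}" for j by auto
  have cardF: "card ?F = (\<Prod>j\<in>?K. card (?U j))" by (rule card_trans_extensions(1)[OF fin B U])
  have Fsub: "?F \<subseteq> {e \<in> ?T. {y, z} \<subseteq> e & (\<forall>v\<in>e - {y, z}. v \<in> ?U (hue v))}"
   by (rule card_trans_extensions(2)[OF fin B U])
  have cK: "card ?K = r - 2" using zV(2) k hue[of y] by (simp add: card_Diff_subset)
  have cU: "n / (4 * real r) <= rcard (?U j)" if "j \<in> ?K" for j
  proof -
   have "card {v \<in> ?V. hue v = j} - card X <= card (?U j)" by (rule diff_card_le_card_Diff[OF X(1)])
   then have "rcard {v \<in> ?V. hue v = j} - rcard X <= rcard (?U j)" by linarith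
   moreover have "n / (2 * real r) <= rcard {v \<in> ?V. hue v = j}" using size[of j] that by (simp add: n_def)
   moreover have "kap * n <= 1 / (4 * real r) * n" using kap(2) n by (intro mult_right_mono) auto
   moreover have "n / (2 * real r) = 2 * (n / (4 * real r))" by simp
   moreover have "1 / (4 * real r) * n = n / (4 * real r)" by simp
   ultimately show ?thesis using X(2) by linarith
  qed
  have "(n / (4 * real r)) ^ (r - 2) = (\<Prod>j\<in>?K. n / (4 * real r))" by (simp only: prod_constant cK)
  also have "... <= (\<Prod>j\<in>?K. rcard (?U j))" by (rule prod_mono) (use cU n in auto)
  also have "... = rcard ?F" by (simp only: cardF of_nat_prod)
  also have "... <= rcard {e \<in> ?T - edges G. {y, z} \<subseteq> e}"
  proof -
   have "?F \<subseteq> {e \<in> ?T - edges G. {y, z} \<subseteq> e}"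
   proof
    fix e assume "e \<in> ?F"
    then have e: "e \<in> ?T" "{y, z} \<subseteq> e" "\<forall>v\<in>e - {y, z}. v \<in> ?U (hue v)" using Fsub by blast+
    then have "(e - {y, z}) Int X = {}" by auto
    then show "e \<in> {e \<in> ?T - edges G. {y, z} \<subseteq> e}" using e(1,2) X(3) by auto
   qed
   moreover have "finite {e \<in> ?T - edges G. {y, z} \<subseteq> e}" by (rule finite_subset[OF _ finT]) blast
   ultimately show ?thesis by (intro of_nat_mono card_mono)
  qed
  finally show ?thesis .
 qed
 have "card (\<Union>z\<in>Z. {e \<in> ?T - edges G. {y, z} \<subseteq> e}) = (\<Sum>z\<in>Z. card {e \<in> ?T - edges G. {y, z} \<subseteq> e})"
 proof (rule card_UN_disjoint[OF finZ])
  show "\<forall>i\<in>Z. finite {e \<in> ?T - edges G. {y, i} \<subseteq> e}" by (intro ballI finite_subset[OF _ finT]) blast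
  show "\<forall>i\<in>Z. \<forall>j\<in>Z. i ~= j --> {e \<in> ?T - edges G. {y, i} \<subseteq> e} Int {e \<in> ?T - edges G. {y, j} \<subseteq> e} = {}"
  proof (intro ballI impI)
   fix i j assume ij: "i \<in> Z" "j \<in> Z" "i ~= j"
   have "hue i = hue j" using ij by (simp add: Z_def)
   then show "{e \<in> ?T - edges G. {y, i} \<subseteq> e} Int {e \<in> ?T - edges G. {y, j} \<subseteq> e} = {}"
    using tedges_same_colour[of _ ?V r hue i j] ij(3) by auto
  qed
 qed
 moreover have "card (\<Union>z\<in>Z. {e \<in> ?T - edges G. {y, z} \<subseteq> e}) <= card {e \<in> ?T - edges G. y \<in> e}"
  by (rule card_mono[OF finite_subset[OF _ finT]]) auto
 ultimately have "real (\<Sum>z\<in>Z. card {e \<in> ?T - edges G. {y, z} \<subseteq> e}) <= rcard {e \<in> ?T - edges G. y \<in> e}"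
  by linarith
 then have "(\<Sum>z\<in>Z. rcard {e \<in> ?T - edges G. {y, z} \<subseteq> e}) <= \<mu> * n ^ (r - 1)"
  using miss unfolding n_def of_nat_sum by linarith
 moreover have "(\<Sum>z\<in>Z. (n / (4 * real r)) ^ (r - 2)) <= (\<Sum>z\<in>Z. rcard {e \<in> ?T - edges G. {y, z} \<subseteq> e})"
  by (rule sum_mono) (rule low)
 ultimately have "rcard Z * (n / (4 * real r)) ^ (r - 2) <= \<mu> * n ^ (r - 1)" by simp
 moreover have "n ^ (r - 1) = n * n ^ (r - 2)"
 proof -
  have "r - 1 = Suc (r - 2)" using r by simp
  then show ?thesis by simp
 qed
 moreover have "(n / (4 * real r)) ^ (r - 2) = n ^ (r - 2) / (4 * real r) ^ (r - 2)" by (rule power_divide)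
 ultimately have "rcard Z * (n ^ (r - 2) / (4 * real r) ^ (r - 2)) <= \<mu> * (n * n ^ (r - 2))" by simp
 moreover have p4: "(4 * real r) ^ (r - 2) > 0" using r by simp
 ultimately have "rcard Z * n ^ (r - 2) <= (\<mu> * (4 * real r) ^ (r - 2) * n) * n ^ (r - 2)"
  by (simp add: pos_divide_le_eq mult_ac)
 then have "rcard Z <= \<mu> * (4 * real r) ^ (r - 2) * n" using n by (simp add: mult_le_cancel_right)
 then show ?thesis by (simp add: Z_def n_def)
qed

lemma trans_degree_lower:
 assumes r: "2 <= r" and V: "finite V" and hue: "\<And>v. hue v < r" and y: "y \<in> V" and a: "0 <= a"
  and size: "\<And>k. k < r ==> a <= rcard {v \<in> V. hue v = k}"
 shows "a ^ (r - 1) <= rcard {e \<in> tedges V r hue. y \<in> e}"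
proof -
 let ?K = "{..<r} - hue ` {y}" and ?U = "%j. {v \<in> V. hue v = j}"
 let ?F = "(\<union>) {y} ` rainbow hue ?K ?U"
 have B: "{y} \<subseteq> V" "inj_on hue {y}" "hue ` {y} \<subseteq> {..<r}" using y hue by auto
 have cardF: "card ?F = (\<Prod>j\<in>?K. card (?U j))" by (rule card_trans_extensions(1)[OF V B order_refl])
 have Fsub: "?F \<subseteq> {e \<in> tedges V r hue. {y} \<subseteq> e & (\<forall>v\<in>e - {y}. v \<in> ?U (hue v))}"
  by (rule card_trans_extensions(2)[OF V B order_refl])
 have cK: "card ?K = r - 1" using hue[of y] by (simp add: card_Diff_subset)
 have "a ^ (r - 1) = (\<Prod>j\<in>?K. a)" by (simp only: prod_constant cK)
 also have "... <= (\<Prod>j\<in>?K. rcard (?U j))" by (rule prod_mono) (use size a in auto)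
 also have "... = rcard ?F" by (simp only: cardF of_nat_prod)
 also have "... <= rcard {e \<in> tedges V r hue. y \<in> e}"
  using Fsub finite_tedges[OF V] by (intro of_nat_mono card_mono) auto
 finally show ?thesis .
qed

text \<open>An edge through \<open>y\<close> is determined by its vertices of the other colours, and
  the class of \<open>y\<close> supplies the last factor of the product.\<close>

lemma trans_degree_upper:
 assumes V: "finite V" and hue: "\<And>v. hue v < r" and y: "y \<in> V"
 shows "card {e \<in> tedges V r hue. y \<in> e} * card {v \<in> V. hue v = hue y} <= card (tedges V r hue)"
proof -
 let ?K = "{..<r} - {hue y}" and ?U = "%j. {v \<in> V. hue v = j}"
 have "card {e \<in> tedges V r hue. y \<in> e} <= card (rainbow hue ?K ?U)"
 proof (rule card_inj_on_le[where f = "%e. e - {y}"])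
  show "inj_on (%e. e - {y}) {e \<in> tedges V r hue. y \<in> e}" by (auto simp: inj_on_def)
  show "(%e. e - {y}) ` {e \<in> tedges V r hue. y \<in> e} \<subseteq> rainbow hue ?K ?U"
  proof
   fix d assume "d \<in> (%e. e - {y}) ` {e \<in> tedges V r hue. y \<in> e}"
   then obtain e where e: "e \<in> tedges V r hue" "y \<in> e" "d = e - {y}" by blast
   have inj: "inj_on hue e" by (rule tedges_inj[OF e(1)])
   have im: "hue ` e = {..<r}" "e \<subseteq> V" using e(1) by (auto simp: tedges_def nsets_def)
   have "hue ` (e - {y}) = hue ` e - hue ` {y}" using inj_on_image_set_diff[OF inj, of e "{y}"] e(2) by simp
   then have "hue ` d = ?K" using im e(3) by simp
   then show "d \<in> rainbow hue ?K ?U" using inj_on_subset[OF inj, of d] e(3) im(2) by (auto simp: rainbow_def)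
  qed
  have "rainbow hue ?K ?U \<subseteq> Pow V" by (auto simp: rainbow_def)
  then show "finite (rainbow hue ?K ?U)" using V by (meson finite_Pow_iff finite_subset)
 qed
 also have "... = (\<Prod>k\<in>?K. card (?U k))" by (rule card_rainbow) auto
 finally have "card {e \<in> tedges V r hue. y \<in> e} * card (?U (hue y)) <= (\<Prod>k\<in>?K. card (?U k)) * card (?U (hue y))"
  by (rule mult_le_mono1)
 also have "... = (\<Prod>k<r. card (?U k))" using hue[of y] by (subst (2) prod.remove[of _ "hue y"]) (auto simp: mult.commute)
 finally show ?thesis by (simp add: card_tedges[OF V])
qed

text \<open>A bound \<open>\<mu>\<close> on the missing edges at a vertex gives the three vertex
  conditions of the locale. Poor pairs cost the factor \<open>(4 * real r) ^ (r - 2)\<close>; the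
  vertex itself is rich since its transversal degree is at least twice the bound on the missing
  part.\<close>

lemma near_partiteI:
 fixes G :: "'a hypergraph"
 assumes r: "2 <= r" and G: "rgraph r G" and hue: "\<And>v. hue v < r"
  and size: "\<And>k. k < r ==> rcard (verts G) / (2 * real r) <= rcard {v \<in> verts G. hue v = k}"
  and kap: "0 < kap" "kap <= 1 / (4 * real r)"
  and \<nu>: "0 < \<nu>" "4 * (real r + 4) * \<nu> <= kap" "\<nu> < (kap / 2) ^ (r - 1)"
  and \<mu>: "0 < \<mu>" "\<mu> * (4 * real r) ^ (r - 2) <= \<nu>" "\<mu> <= \<nu>" "2 * \<mu> <= (1 / (2 * real r)) ^ (r - 1)"
  and A: "A \<subseteq> verts G" "rcard A <= \<nu> * rcard (verts G)"
   "\<And>y. y \<in> verts G - A ==> rcard {e \<in> tedges (verts G) r hue - edges G. y \<in> e} <= \<mu> * rcard (verts G) ^ (r - 1)"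
  and M: "real M < \<mu> * rcard (verts G)" "real M + 10 * (real r + 1)\<^sup>2 <= kap / 4 * rcard (verts G)"
 shows "near_partite G r hue A kap \<nu> M"
proof
 let ?V = "verts G" and ?T = "tedges (verts G) r hue"
 define n where "n = rcard ?V"
 have fin: "finite ?V" "edges G \<subseteq> nsets ?V r" using G by (auto simp: rgraph_def)
 fix y assume y: "y \<in> ?V - A"
 have n: "n > 0" using y fin by (auto simp: n_def card_gt_0_iff)
 show "rcard {e \<in> ?T - edges G. y \<in> e} <= \<nu> * rcard ?V ^ (r - 1)"
  using A(3)[OF y] mult_right_mono[OF \<mu>(3), of "rcard ?V ^ (r - 1)"] by simp
 show "rcard {z \<in> ?V. hue z = k & \<not> rich (edges G Int ?T) (kap * rcard ?V) {y, z}} <= \<nu> * rcard ?V"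
  if "k < r" "k ~= hue y" for k
  using few_poor_pairs[OF r G hue size kap _ that A(3)[OF y]] y mult_right_mono[OF \<mu>(2), of "rcard ?V"] by simp
 show "rich (edges G) (real M) {y}"
 proof (rule rich_of_codeg[OF fin(1) _ fin(2) _ _ M(1)])
  have finT: "finite ?T" by (rule finite_tedges[OF fin(1)])
  have finE: "finite (edges G)" using fin finite_imp_finite_nsets finite_subset by blast
  have sz: "n / (2 * real r) <= rcard {v \<in> ?V. hue v = k}" if "k < r" for k using size[OF that] by (simp add: n_def)
  have "(n / (2 * real r)) ^ (r - 1) <= rcard {e \<in> ?T. y \<in> e}"
   by (rule trans_degree_lower[where a = "n / (2 * real r)", OF r fin(1) hue _ _ sz]) (use y n in auto)
  also have "card {e \<in> ?T. y \<in> e} <= card ({e \<in> edges G. {y} \<subseteq> e} Un {e \<in> ?T - edges G. y \<in> e})"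
   by (rule card_mono) (use finT finE in auto)
  then have "rcard {e \<in> ?T. y \<in> e} <= real (codeg (edges G) {y} + card {e \<in> ?T - edges G. y \<in> e})"
   unfolding codeg_def using card_Un_le order_trans by (intro of_nat_mono) blast
  finally have "(n / (2 * real r)) ^ (r - 1) <= real (codeg (edges G) {y}) + \<mu> * n ^ (r - 1)"
   using A(3)[OF y] by (simp add: n_def)
  moreover have "(n / (2 * real r)) ^ (r - 1) = (1 / (2 * real r)) ^ (r - 1) * n ^ (r - 1)"
   by (simp add: power_mult_distrib[symmetric])
  moreover have "2 * \<mu> * n ^ (r - 1) <= (1 / (2 * real r)) ^ (r - 1) * n ^ (r - 1)"
   using \<mu>(4) n by (intro mult_right_mono) auto
  ultimately have "\<mu> * n ^ (r - 1) <= real (codeg (edges G) {y})" by linarith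
  then show "\<mu> * rcard ?V ^ (r - card {y}) <= real (codeg (edges G) {y})" by (simp add: n_def)
 qed (use y r in auto)
qed (use assms in auto)

lemma ex_near_parameters:
 assumes r: "2 <= r" and kap: "0 < (kap :: real)"
 shows "\<exists>\<nu> \<mu>. 0 < \<nu> & 4 * (real r + 4) * \<nu> <= kap & \<nu> < (kap / 2) ^ (r - 1) \<and>
  0 < \<mu> & \<mu> * (4 * real r) ^ (r - 2) <= \<nu> & \<mu> <= \<nu> & 2 * \<mu> <= (1 / (2 * real r)) ^ (r - 1)"
proof -
 define \<nu> where "\<nu> = min (kap / (4 * (real r + 4))) ((kap / 2) ^ (r - 1) / 2)"
 have p: "(kap / 2) ^ (r - 1) > 0" using kap by simp
 have \<nu>: "0 < \<nu>" "\<nu> <= kap / (4 * (real r + 4))" "\<nu> < (kap / 2) ^ (r - 1)"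
 proof -
  have "0 < kap / (4 * (real r + 4))" using kap by (intro divide_pos_pos) auto
  then show "0 < \<nu>" unfolding \<nu>_def using p by (simp only: min_less_iff_conj half_gt_zero_iff)
  show "\<nu> <= kap / (4 * (real r + 4))" unfolding \<nu>_def by (rule min.cobounded1)
  have "\<nu> <= (kap / 2) ^ (r - 1) / 2" unfolding \<nu>_def by (rule min.cobounded2)
  then show "\<nu> < (kap / 2) ^ (r - 1)" using p by linarith
 qed
 define \<mu> where "\<mu> = min (min (\<nu> / (4 * real r) ^ (r - 2)) \<nu>) ((1 / (2 * real r)) ^ (r - 1) / 2)"
 have p4: "(4 * real r) ^ (r - 2) > 0" "(1 / (2 * real r)) ^ (r - 1) > 0" using r by simp_all
 have \<mu>: "0 < \<mu>" "\<mu> <= \<nu> / (4 * real r) ^ (r - 2)" "\<mu> <= \<nu>" "\<mu> <= (1 / (2 * real r)) ^ (r - 1) / 2"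
 proof -
  have "0 < \<nu> / (4 * real r) ^ (r - 2)" using \<nu>(1) p4(1) by (rule divide_pos_pos)
  then show "0 < \<mu>" unfolding \<mu>_def using \<nu>(1) p4(2) by (simp only: min_less_iff_conj half_gt_zero_iff)
  show "\<mu> <= \<nu> / (4 * real r) ^ (r - 2)" "\<mu> <= \<nu>"
   unfolding \<mu>_def by (rule min.coboundedI1, rule min.cobounded1, rule min.coboundedI1, rule min.cobounded2)
  show "\<mu> <= (1 / (2 * real r)) ^ (r - 1) / 2" unfolding \<mu>_def by (rule min.cobounded2)
 qed
 have "4 * (real r + 4) * \<nu> <= kap"
  using \<nu>(2) pos_le_divide_eq[of "4 * (real r + 4)" \<nu> kap] by (simp add: mult.commute)
 moreover have "\<mu> * (4 * real r) ^ (r - 2) <= \<nu>" using \<mu>(2) p4(1) by (simp only: pos_le_divide_eq)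
 moreover have "2 * \<mu> <= (1 / (2 * real r)) ^ (r - 1)" using \<mu>(4) by linarith
 ultimately show ?thesis using \<nu>(1,3) \<mu>(1,3) by blast
qed

text \<open>Edges through \<open>x\<close> inside its own colour class are enough.\<close>

lemma many_nontransversal:
 assumes r: "2 <= r" and V: "finite V" and x: "x \<in> V" "x \<notin> S" and S: "finite S" "card S <= r"
  and size: "rcard V / (2 * real r) <= rcard {v \<in> V. hue v = hue x}"
  and n: "4 * real r * (real r + 1) <= rcard V"
 shows "(1 / (4 * real r * real r)) ^ (r - 1) * rcard V ^ (r - 1)
  <= rcard {e \<in> nsets V r. x \<in> e & e Int S = {} & hue ` e ~= {..<r}}"
proof -
 define n where "n = rcard V"
 define W where "W = {v \<in> V. hue v = hue x} - insert x S"
 have finW: "finite W" using V by (simp add: W_def)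
 have "card {v \<in> V. hue v = hue x} - card (insert x S) <= card W" unfolding W_def by (rule diff_card_le_card_Diff) (use S in simp)
 moreover have "card (insert x S) <= r + 1" using S card_insert_le_m1[of "r + 1" S x] by simp
 ultimately have "rcard {v \<in> V. hue v = hue x} <= rcard W + (real r + 1)" by linarith
 then have 1: "n / (2 * real r) <= rcard W + (real r + 1)" using size by (simp add: n_def)
 have 2: "real r + 1 <= n / (4 * real r)" using n r by (simp add: n_def field_simps)
 have 3: "n / (2 * real r) = n / (4 * real r) + n / (4 * real r)" by simp
 have W: "n / (4 * real r) <= rcard W" using 1 2 3 by linarith
 then have rW: "r - 1 <= card W" using 2 by linarith
 have n0: "0 <= n" by (simp add: n_def)
 have "(1 / (4 * real r * real r)) ^ (r - 1) * n ^ (r - 1) = (n / (4 * real r) / real r) ^ (r - 1)"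
  by (simp add: power_mult_distrib[symmetric])
 also have "... <= (rcard W / real (r - 1)) ^ (r - 1)"
  using W n0 r by (intro power_mono frac_le) auto
 also have "... <= real (card W choose (r - 1))" by (rule binomial_ge_n_over_k_pow_k[OF rW])
 also have "... = rcard (nsets W (r - 1))" by simp
 also have "card (nsets W (r - 1)) <= card {e \<in> nsets V r. x \<in> e & e Int S = {} & hue ` e ~= {..<r}}"
 proof (rule card_inj_on_le[where f = "insert x"])
  show "inj_on (insert x) (nsets W (r - 1))"
  proof (rule inj_onI)
   fix a b assume "a \<in> nsets W (r - 1)" "b \<in> nsets W (r - 1)" "insert x a = insert x b"
   moreover then have "x \<notin> a" "x \<notin> b" by (auto simp: nsets_def W_def)
   ultimately show "a = b" by auto
  qed
  show "insert x ` nsets W (r - 1) \<subseteq> {e \<in> nsets V r. x \<in> e & e Int S = {} & hue ` e ~= {..<r}}"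
  proof
   fix e assume "e \<in> insert x ` nsets W (r - 1)"
   then obtain d where d: "e = insert x d" "d \<subseteq> W" "finite d" "card d = r - 1" by (auto simp: nsets_def)
   have xd: "x \<notin> d" using d(2) by (auto simp: W_def)
   have "e \<in> nsets V r" using d xd x r by (auto simp: nsets_def W_def)
   moreover have "e Int S = {}" using d x by (auto simp: W_def)
   moreover have "hue ` e \<subseteq> {hue x}" using d by (auto simp: W_def)
   then have "hue ` e ~= {..<r}" using r by (metis card_lessThan card_mono finite.emptyI finite_insert card.empty card_insert_disjoint empty_iff not_less_eq_eq numeral_2_eq_2 order_trans One_nat_def)
   ultimately show "e \<in> {e \<in> nsets V r. x \<in> e & e Int S = {} & hue ` e ~= {..<r}}" using d by simp
  qed
  show "finite {e \<in> nsets V r. x \<in> e & e Int S = {} & hue ` e ~= {..<r}}" using V by (simp add: finite_imp_finite_nsets)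
 qed
 finally show ?thesis by (simp add: n_def)
qed

text \<open>Bernoulli's inequality for the balanced product on \<open>n - r\<close> vertices; the
  removed \<open>r\<close> vertices and the rounding each cost a relative \<open>r / n\<close> per
  class.\<close>

lemma join_size_lower:
 assumes r: "2 <= r" and n: "4 * r <= n"
 shows "(1 / real r ^ r - 2 * real r ^ 2 / real n) * real n ^ r <= real (join_size r n)"
proof -
 have n0: "0 < real n" and r0: "0 < real r" using n r by simp_all
 have "(1 / real r ^ r - 2 * real r ^ 2 / real n) * real n ^ r <= (1 / real r ^ r - 1 / real r ^ r * (2 * real r ^ 2 / real n)) * real n ^ r"
 proof (intro mult_right_mono diff_left_mono)
  have "1 / real r ^ r <= 1" using r by (simp add: divide_le_eq)
  then show "1 / real r ^ r * (2 * real r ^ 2 / real n) <= 2 * real r ^ 2 / real n"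
   using n0 by (intro mult_left_le_one_le) auto
 qed simp
 also have "... = (real n / real r) ^ r * (1 + real r * (- (2 * real r / real n)))"
  by (simp add: power_divide power2_eq_square algebra_simps)
 also have "... <= (real n / real r) ^ r * (1 + (- (2 * real r / real n))) ^ r"
  using n n0 by (intro mult_left_mono Bernoulli_inequality) (auto simp: field_simps)
 also have "... = (real n / real r * (1 + (- (2 * real r / real n)))) ^ r" by (simp only: power_mult_distrib)
 also have "real n / real r * (1 + (- (2 * real r / real n))) = real (n - r) / real r - 1"
  using n n0 r0 by (simp add: field_simps)
 also have "... ^ r <= real (bal r (n - r))" by (rule bal_lower) (use n r in auto)
 also have "... <= real (join_size r n)" by (simp add: join_size_def)
 finally show ?thesis .
qed

text \<open>The strict gain comes from comparing \<open>1 - eps\<close> with the square of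
  \<open>1 - eps / 2\<close>.\<close>

lemma one_minus_times_exp_less_one:
 fixes eps :: real
 assumes "0 < eps" "eps <= 1"
 shows "(1 - eps) * exp eps < 1"
proof -
 have "1 - eps < (1 - eps / 2)\<^sup>2" using assms by (simp add: power2_eq_square algebra_simps)
 also have "... <= (exp (- eps / 2))\<^sup>2"
  using exp_ge_add_one_self[of "- eps / 2"] assms by (intro power_mono) auto
 also have "... = exp (- eps)" by (simp add: power2_eq_square exp_add[symmetric])
 finally have "(1 - eps) * exp eps < exp (- eps) * exp eps" by (rule mult_strict_right_mono) simp
 then show ?thesis by (simp add: exp_add[symmetric])
qed

lemma ex_max_cut:
 assumes r: "0 < r" and E: "finite (edges G)"
 shows "\<exists>hue. (\<forall>v. hue v < r) & max_cut G r hue"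
proof -
 let ?f = "%hue. card (edges G Int tedges (verts G) r hue)"
 have "\<forall>hue. (\<forall>v. hue v < r) --> ?f hue < Suc (card (edges G))"
  using E by (auto simp: less_Suc_eq_le intro: card_mono)
 then have "\<exists>hue. (\<forall>v. hue v < r) & (\<forall>hue'. (\<forall>v. hue' v < r) --> ?f hue' <= ?f hue)"
  using r by (intro ex_has_greatest_nat[of "%hue. \<forall>v. hue v < r" "%_. 0"]) simp_all
 then show ?thesis by (simp only: max_cut_def)
qed

lemma card_tedges_le_power:
 assumes r: "0 < r" and V: "finite V" and hue: "\<And>v. hue v < r"
 shows "rcard (tedges V r hue) <= (rcard V / real r) ^ r"
proof (cases "V = {}")
 case True
 have "tedges V r hue = {}" using True r by (auto simp: tedges_def nsets_def)
 then show ?thesis by simp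
next
 case False
 have s: "(\<Sum>k<r. rcard {v \<in> V. hue v = k}) = rcard V"
  using sum_class_sizes[of V hue r] V hue by (simp only: of_nat_sum[symmetric])
 have "(\<Prod>k<r. rcard {v \<in> V. hue v = k}) <= (rcard V / real r) ^ r"
  by (rule prod_le_power_mean(1)[OF r _ s]) (use False V in \<open>auto simp: card_gt_0_iff\<close>)
 then show ?thesis by (simp only: card_tedges[OF V] of_nat_prod)
qed

text \<open>A class that is too small costs the factor \<open>q < 1\<close> in the number of
  transversal edges, while the hypothesis allows for only half of that loss.\<close>

lemma class_size_lower:
 fixes eps :: real
 assumes r: "0 < r" and eps: "0 < eps" "eps <= 1" and V: "finite V" "V ~= {}" and hue: "\<And>v. hue v < r"
  and T: "(1 / real r ^ r - (1 - (1 - eps) * exp eps) / (2 * real r ^ r)) * rcard V ^ r <= rcard (tedges V r hue)"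
  and j: "j < r"
 shows "(1 - eps) * (rcard V / real r) <= rcard {v \<in> V. hue v = j}"
proof (rule ccontr)
 assume "\<not> ?thesis"
 then have a: "rcard {v \<in> V. hue v = j} <= (1 - eps) * (rcard V / real r)" by simp
 have n: "0 < rcard V" using V by (simp add: card_gt_0_iff)
 have s: "(\<Sum>k<r. rcard {v \<in> V. hue v = k}) = rcard V"
  using sum_class_sizes[of V hue r] V hue by (simp only: of_nat_sum[symmetric])
 define q where "q = (1 - eps) * exp eps"
 have q: "q < 1" unfolding q_def by (rule one_minus_times_exp_less_one[OF eps])
 have "(\<Prod>k<r. rcard {v \<in> V. hue v = k}) <= q * (rcard V / real r) ^ r"
  unfolding q_def by (rule prod_le_power_mean(2)[OF r _ s n j _ eps(2) a]) (use eps in auto)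
 then have "rcard (tedges V r hue) <= q * (rcard V / real r) ^ r"
  by (simp only: card_tedges[OF V(1)] of_nat_prod)
 also have "... = q / real r ^ r * rcard V ^ r" by (simp add: power_divide)
 also have "... < (1 / real r ^ r - (1 - q) / (2 * real r ^ r)) * rcard V ^ r"
 proof (rule mult_strict_right_mono)
  have "1 / real r ^ r - (1 - q) / (2 * real r ^ r) = (1 + q) / 2 / real r ^ r"
   using r by (simp add: diff_divide_distrib add_divide_distrib)
  moreover have "q / real r ^ r < (1 + q) / 2 / real r ^ r" using q r by (intro divide_strict_right_mono) auto
  ultimately show "q / real r ^ r < 1 / real r ^ r - (1 - q) / (2 * real r ^ r)" by simp
 qed (use n in simp)
 finally show False using T by (simp add: q_def)
qed

lemma sum_degrees:
 assumes V: "finite V" and E: "E \<subseteq> nsets V r"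
 shows "(\<Sum>v\<in>V. card {e \<in> E. v \<in> e}) = r * card E"
proof -
 have finE: "finite E" by (rule finite_subset[OF E finite_imp_finite_nsets[OF V]])
 have "\<forall>e\<in>E. card {v \<in> V. v \<in> e} = r"
 proof
  fix e assume "e \<in> E"
  then have "e \<subseteq> V" "card e = r" using E by (auto simp: nsets_def)
  moreover from this(1) have "{v \<in> V. v \<in> e} = e" by auto
  ultimately show "card {v \<in> V. v \<in> e} = r" by simp
 qed
 from sum_multicount_gen[OF V finE this] show ?thesis by simp
qed

text \<open>Markov's inequality for the degrees.\<close>

lemma card_high_degree_le:
 assumes V: "finite V" and E: "E \<subseteq> nsets V r" and b: "0 < b" and sz: "real r * rcard E <= b * c"
 shows "rcard {v \<in> V. b < rcard {e \<in> E. v \<in> e}} <= c"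
proof -
 let ?A = "{v \<in> V. b < rcard {e \<in> E. v \<in> e}}"
 have "b * rcard ?A = (\<Sum>v\<in>?A. b)" by simp
 also have "... <= (\<Sum>v\<in>?A. rcard {e \<in> E. v \<in> e})" by (rule sum_mono) auto
 also have "... <= (\<Sum>v\<in>V. rcard {e \<in> E. v \<in> e})" using V by (intro sum_mono2) auto
 also have "... = real (r * card E)" by (simp only: of_nat_sum[symmetric] sum_degrees[OF V E])
 finally have "b * rcard ?A <= b * c" using sz by simp
 then show ?thesis using b by simp
qed

lemma jedges_mono:
 assumes "S \<subseteq> S'"
 shows "jedges V r S hue \<subseteq> jedges V r S' hue"
proof
 fix e assume "e \<in> jedges V r S hue"
 then show "e \<in> jedges V r S' hue" using assms
  by (cases "e Int S' = {}") (auto simp: jedges_def tedges_def nsets_def)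
qed

lemma edges_subset_joinI:
 assumes "E \<subseteq> nsets V r" "\<And>e. e \<in> E ==> e Int S = {} ==> hue ` e = {..<r}"
 shows "E \<subseteq> jedges V r S hue"
proof
 fix e assume e: "e \<in> E"
 then have "e \<in> nsets V r" using assms by auto
 then show "e \<in> jedges V r S hue" using assms(2)[OF e]
  by (cases "e Int S = {}") (auto simp: jedges_def tedges_def nsets_def)
qed

lemma ex_maximal_matching:
 assumes "finite B"
 shows "\<exists>D\<subseteq>B. (\<forall>e\<in>D. \<forall>e'\<in>D. e ~= e' --> e Int e' = {}) & (\<forall>e\<in>B. e ~= {} --> e Int \<Union>D ~= {})"
 using assms
proof (induction B)
 case empty
 show ?case by simp
next
 case (insert b B)
 obtain D where D: "D \<subseteq> B" "\<forall>e\<in>D. \<forall>e'\<in>D. e ~= e' --> e Int e' = {}" "\<forall>e\<in>B. e ~= {} --> e Int \<Union>D ~= {}"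
  using insert.IH by (elim exE conjE)
 show ?case
 proof (cases "b Int \<Union>D = {}")
  case True
  have "\<forall>e\<in>insert b D. \<forall>e'\<in>insert b D. e ~= e' --> e Int e' = {}" using D(2) True by blast
  moreover have "\<forall>e\<in>insert b B. e ~= {} --> e Int \<Union>(insert b D) ~= {}" using D(3) by blast
  moreover have "insert b D \<subseteq> insert b B" using D(1) by blast
  ultimately show ?thesis by (intro exI[of _ "insert b D"] conjI)
 next
  case False
  have "\<forall>e\<in>insert b B. e ~= {} --> e Int \<Union>D ~= {}" using D(3) False by blast
  then show ?thesis using D(1,2) by (intro exI[of _ D] conjI) auto
 qed
qed

text \<open>Two scales are needed: the vertices exceptional for the fine scale \<open>\<theta>\<^sub>2\<close> number at most \<open>r\<close>, so that
 they may serve as the exceptional set of the coarse scale \<open>\<theta>\<^sub>1\<close>.\<close>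

lemma join_structure_of_max_cut:
 fixes G :: "'a hypergraph" and \<theta>1 \<theta>2 \<nu>1 \<nu>2 \<mu>1 \<mu>2 :: real
 assumes r: "2 <= r" and G: "rgraph r G" and hue: "\<And>v. hue v < r"
  and mc: "max_cut G r hue" and free: "hyp_free (pattern r t) G"
  and size: "\<And>k. k < r ==> rcard (verts G) / (2 * real r) <= rcard {v \<in> verts G. hue v = k}"
  and tight: "\<And>y. y \<in> verts G ==> rcard {e \<in> tedges (verts G) r hue. y \<in> e}
   <= real (codeg (edges G) {y}) + \<mu>1 / 2 * rcard (verts G) ^ (r - 1)"
  and \<theta>: "0 < \<theta>1" "\<theta>1 <= 1" "2 * (real r + real r * real r) * \<theta>1 <= (1 / (4 * real r * real r)) ^ (r - 1)"
   "0 < \<theta>2" "\<theta>2 <= \<theta>1" "\<theta>2 <= \<mu>1 / 4"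
  and p1: "0 < \<nu>1" "4 * (real r + 4) * \<nu>1 <= \<theta>1 / (4 * real r)" "\<nu>1 < (\<theta>1 / (4 * real r) / 2) ^ (r - 1)"
   "0 < \<mu>1" "\<mu>1 * (4 * real r) ^ (r - 2) <= \<nu>1" "\<mu>1 <= \<nu>1" "2 * \<mu>1 <= (1 / (2 * real r)) ^ (r - 1)"
  and p2: "0 < \<nu>2" "4 * (real r + 4) * \<nu>2 <= \<theta>2 / (4 * real r)" "\<nu>2 < (\<theta>2 / (4 * real r) / 2) ^ (r - 1)"
   "0 < \<mu>2" "\<mu>2 * (4 * real r) ^ (r - 2) <= \<nu>2" "\<mu>2 <= \<nu>2" "2 * \<mu>2 <= (1 / (2 * real r)) ^ (r - 1)"
  and few: "rcard {v \<in> verts G. \<mu>2 * rcard (verts G) ^ (r - 1)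
   < rcard {e \<in> tedges (verts G) r hue - edges G. v \<in> e}} <= \<nu>2 * rcard (verts G)"
  and large: "real (pattern_bound r t) < \<mu>1 * rcard (verts G)" "real (pattern_bound r t) < \<mu>2 * rcard (verts G)"
   "real (pattern_bound r t) + 10 * (real r + 1)\<^sup>2 <= \<theta>1 / (4 * real r) / 4 * rcard (verts G)"
   "real (pattern_bound r t) + 10 * (real r + 1)\<^sup>2 <= \<theta>2 / (4 * real r) / 4 * rcard (verts G)"
   "4 * real r * (real r + 1) <= rcard (verts G)" "real r <= \<nu>1 * rcard (verts G)"
  and edges: "join_size r (card (verts G)) <= card (edges G)"
 shows "\<exists>S \<subseteq> verts G. card S = r & edges G \<subseteq> jedges (verts G) r S hue"
proof -
 let ?V = "verts G" and ?T = "tedges (verts G) r hue"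
 define n where "n = rcard ?V"
 define N where "N = n ^ (r - 1)"
 have fin: "finite ?V" "edges G \<subseteq> nsets ?V r" using G by (auto simp: rgraph_def)
 have finE: "finite (edges G)" using fin finite_imp_finite_nsets finite_subset by blast
 have finT: "finite ?T" by (rule finite_tedges[OF fin(1)])
 have r0: "0 < real r" using r by simp
 have n0: "0 < n"
 proof -
  have "0 < 4 * real r * (real r + 1)" using r0 by simp
  then show ?thesis using large(5) unfolding n_def by linarith
 qed
 have N0: "0 < N" using n0 by (simp add: N_def)
 have half: "\<theta> / (4 * real r) * 2 * n <= rcard {v \<in> ?V. hue v = k}" if "\<theta> <= 1" "k < r" for \<theta> k
 proof -
  have "\<theta> / (4 * real r) * 2 * n <= 1 / (4 * real r) * 2 * n" using that(1) r0 n0 by (intro mult_right_mono divide_right_mono) auto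
  also have "... = n / (2 * real r)" by simp
  finally show ?thesis using size[OF that(2)] by (simp add: n_def)
 qed
 define S2 where "S2 = {v \<in> ?V. \<theta>2 * N <= bad_deg G r hue v}"
 define S1 where "S1 = {v \<in> ?V. \<theta>1 * N <= bad_deg G r hue v}"
 have "\<theta>2 * N <= \<theta>1 * N" using \<theta>(5) N0 by (intro mult_right_mono) auto
 then have S12: "S1 \<subseteq> S2" unfolding S1_def S2_def by auto
 have finS: "finite S2" "finite S1" using fin by (simp_all add: S1_def S2_def)
 have \<theta>21: "\<theta>2 <= 1" using \<theta> by linarith
 define A2 where "A2 = {v \<in> ?V. \<mu>2 * n ^ (r - 1) < rcard {e \<in> ?T - edges G. v \<in> e}}"
 have k2: "0 < \<theta>2 / (4 * real r)" "\<theta>2 / (4 * real r) <= 1 / (4 * real r)" using \<theta> \<theta>21 r0 by (auto intro: divide_right_mono)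
 have k1: "0 < \<theta>1 / (4 * real r)" "\<theta>1 / (4 * real r) <= 1 / (4 * real r)" using \<theta> r0 by (auto intro: divide_right_mono)
 have np2: "near_partite G r hue A2 (\<theta>2 / (4 * real r)) \<nu>2 (pattern_bound r t)"
 proof (rule near_partiteI[OF r G hue size k2 p2 _ _ _ large(2,4)])
  show "A2 \<subseteq> ?V" by (auto simp: A2_def)
  show "rcard A2 <= \<nu>2 * rcard ?V" using few by (simp add: A2_def n_def)
  show "rcard {e \<in> ?T - edges G. y \<in> e} <= \<mu>2 * rcard ?V ^ (r - 1)" if "y \<in> ?V - A2" for y
   using that by (auto simp: A2_def n_def)
 qed
 interpret P2: near_partite G r hue A2 "\<theta>2 / (4 * real r)" \<nu>2 "pattern_bound r t" by (rule np2)
 have cS2: "card S2 <= r"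
 proof -
  have "card S2 + card ({} :: 'a set set) <= r"
  proof (rule P2.card_bad_vertices_plus_matching[OF _ mc free order_refl])
   show "2 * (\<theta>2 / (4 * real r)) * P2.n <= rcard {v \<in> ?V. hue v = k}" if "k < r" for k
    using half[OF \<theta>21 that] by (simp add: P2.n_def n_def mult_ac)
   show "v \<in> ?V & 4 * real r * (\<theta>2 / (4 * real r)) * P2.n ^ (r - 1) <= bad_deg G r hue v" if "v \<in> S2" for v
    using that r0 by (simp add: S2_def P2.n_def n_def N_def)
  qed auto
  then show ?thesis by simp
 qed
 \<comment> \<open>Outside \<open>S2\<close> the bad degree is below the fine threshold, and by
   \<open>tight\<close> the total degree nearly reaches the transversal degree, so few transversal
   edges are missing.\<close>
 have np1: "near_partite G r hue S2 (\<theta>1 / (4 * real r)) \<nu>1 (pattern_bound r t)"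
 proof (rule near_partiteI[OF r G hue size k1 p1 _ _ _ large(1,3)])
  show "S2 \<subseteq> ?V" by (auto simp: S2_def)
  show "rcard S2 <= \<nu>1 * rcard ?V" using cS2 large(6) by linarith
  fix y assume "y \<in> ?V - S2"
  then have y: "y \<in> ?V" "bad_deg G r hue y <= \<theta>2 * N" by (auto simp: S2_def)
  have f: "finite {e \<in> ?T. y \<in> e}" "finite {e \<in> edges G. y \<in> e}"
   by (rule finite_subset[OF _ finT], blast, rule finite_subset[OF _ finE], blast)
  have "{e \<in> ?T. y \<in> e} = {e \<in> ?T - edges G. y \<in> e} Un {e \<in> edges G Int ?T. y \<in> e}" by blast
  moreover have "card ({e \<in> ?T - edges G. y \<in> e} Un {e \<in> edges G Int ?T. y \<in> e})
   = card {e \<in> ?T - edges G. y \<in> e} + card {e \<in> edges G Int ?T. y \<in> e}"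
   by (rule card_Un_disjoint) (auto intro: finite_subset[OF _ f(1)])
  ultimately have 1: "card {e \<in> ?T. y \<in> e} = card {e \<in> ?T - edges G. y \<in> e} + card {e \<in> edges G Int ?T. y \<in> e}" by (simp only:)
  have "{e \<in> edges G. {y} \<subseteq> e} = {e \<in> edges G - ?T. y \<in> e} Un {e \<in> edges G Int ?T. y \<in> e}" by blast
  moreover have "card ({e \<in> edges G - ?T. y \<in> e} Un {e \<in> edges G Int ?T. y \<in> e})
   = card {e \<in> edges G - ?T. y \<in> e} + card {e \<in> edges G Int ?T. y \<in> e}"
   by (rule card_Un_disjoint) (auto intro: finite_subset[OF _ f(2)])
  ultimately have 2: "codeg (edges G) {y} = card {e \<in> edges G - ?T. y \<in> e} + card {e \<in> edges G Int ?T. y \<in> e}"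
   unfolding codeg_def by (simp only:)
  have 3: "\<theta>2 * N <= \<mu>1 / 4 * N" using \<theta>(6) N0 by (intro mult_right_mono) auto
  have 4: "rcard {e \<in> ?T. y \<in> e} <= real (codeg (edges G) {y}) + \<mu>1 / 2 * N"
   using tight[OF y(1)] by (simp only: n_def N_def)
  have 5: "0 <= \<mu>1 * N" using p1(4) N0 by simp
  have "rcard {e \<in> edges G - ?T. y \<in> e} <= \<theta>2 * N" using y(2) by (simp only: bad_deg_def)
  then have "rcard {e \<in> ?T - edges G. y \<in> e} <= \<mu>1 * N"
   using 4 3 5 unfolding 1 2 of_nat_add by linarith
  then show "rcard {e \<in> ?T - edges G. y \<in> e} <= \<mu>1 * rcard ?V ^ (r - 1)"
   by (simp only: n_def N_def)
 qed
 interpret P1: near_partite G r hue S2 "\<theta>1 / (4 * real r)" \<nu>1 "pattern_bound r t" by (rule np1)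
 have match: "card S1 + card D <= r"
  if D: "D \<subseteq> edges G - ?T" "\<And>e e'. e \<in> D ==> e' \<in> D ==> e ~= e' ==> e Int e' = {}" "\<And>e. e \<in> D ==> e Int S2 = {}" for D
 proof (rule P1.card_bad_vertices_plus_matching[OF _ mc free order_refl _ D(1,2)])
  show "2 * (\<theta>1 / (4 * real r)) * P1.n <= rcard {v \<in> ?V. hue v = k}" if "k < r" for k
   using half[OF \<theta>(2) that] by (simp add: P1.n_def n_def mult_ac)
  show "v \<in> ?V & 4 * real r * (\<theta>1 / (4 * real r)) * P1.n ^ (r - 1) <= bad_deg G r hue v" if "v \<in> S1" for v
   using that r0 by (simp add: S1_def P1.n_def n_def N_def)
  show "e Int (S1 Un S2) = {}" if "e \<in> D" for e using D(3)[OF that] S12 by blast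
 qed
 have notT: "hue ` e = {..<r}" if "e \<in> edges G" "e \<in> ?T" for e using that by (simp add: tedges_def)
 have cS1: "card S1 <= r" using card_mono[OF finS(1) S12] cS2 by linarith
 show ?thesis
 proof (cases "card S1 = r")
  case True
  have eq: "S1 = S2" using card_seteq[OF finS(1) S12] True cS2 by simp
  \<comment> \<open>A bad edge avoiding \<open>S1\<close> would be a matching of size 1 on top of
    \<open>r\<close> bad vertices.\<close>
  have "edges G \<subseteq> jedges ?V r S1 hue"
  proof (rule edges_subset_joinI[OF fin(2)])
   fix e assume e: "e \<in> edges G" "e Int S1 = {}"
   show "hue ` e = {..<r}"
   proof (rule ccontr)
    assume "hue ` e ~= {..<r}"
    then have "e \<in> edges G - ?T" using e(1) by (simp add: tedges_def)
    then have "card S1 + card {e} <= r" by (intro match) (use e(2) eq in auto)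
    then show False using True by simp
   qed
  qed
  then show ?thesis using True by (intro exI[of _ S1]) (auto simp: S1_def)
 next
  case False
  then have lt: "card S1 < r" using cS1 by simp
  define B where "B = {e \<in> edges G - ?T. e Int S2 = {}}"
  have finB: "finite B" using finE by (simp add: B_def)
  obtain D where D: "D \<subseteq> B" "\<forall>e\<in>D. \<forall>e'\<in>D. e ~= e' --> e Int e' = {}" "\<forall>e\<in>B. e ~= {} --> e Int \<Union>D ~= {}"
   using ex_maximal_matching[OF finB] by (elim exE conjE)
  have cD: "card D <= r"
  proof -
   have "card S1 + card D <= r" by (rule match) (use D(1,2) in \<open>auto simp: B_def\<close>)
   then show ?thesis by simp
  qed
  have edge: "finite e" "card e = r" "e \<subseteq> ?V" if "e \<in> edges G" for e using that fin(2) by (auto simp: nsets_def)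
  \<comment> \<open>All bad edges avoiding \<open>S1\<close> meet this bounded set, whose vertices
    have bad degree below the coarse threshold; so these edges are few.\<close>
  define U where "U = \<Union>D Un (S2 - S1)"
  have DE: "D \<subseteq> edges G" using D(1) by (auto simp: B_def)
  have finU: "finite U" using finite_subset[OF DE finE] edge(1) DE finS by (auto simp: U_def)
  have cU: "card U <= r * r + r"
  proof -
   have "card (\<Union>D) <= (\<Sum>e\<in>D. card e)" using card_Union_le_sum_card[of D] by simp
   also have "... = (\<Sum>e\<in>D. r)" by (rule sum.cong) (use edge(2) DE in auto)
   also have "... <= r * r" using cD by simp
   finally have "card (\<Union>D) <= r * r" .
   moreover have "card (S2 - S1) <= r" using card_mono[OF finS(1), of "S2 - S1"] cS2 by auto
   ultimately show ?thesis unfolding U_def using card_Un_le[of "\<Union>D" "S2 - S1"] by linarith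
  qed
  have US: "U \<subseteq> ?V - S1" using DE edge(3) D(1) S12 by (fastforce simp: U_def B_def S2_def)
  define Q where "Q = {e \<in> edges G - ?T. e Int S1 = {}}"
  have finQ: "finite Q" using finE by (simp add: Q_def)
  have "Q \<subseteq> (\<Union>u\<in>U. {e \<in> edges G - ?T. u \<in> e})"
  proof
   fix e assume "e \<in> Q"
   then have e: "e \<in> edges G - ?T" "e Int S1 = {}" by (auto simp: Q_def)
   have ne: "e ~= {}" using edge(2)[of e] e(1) r by auto
   have "e Int U ~= {}"
   proof (cases "e Int S2 = {}")
    case True
    then have "e \<in> B" using e(1) by (simp add: B_def)
    then have "e Int \<Union>D ~= {}" by (rule D(3)[rule_format, OF _ ne])
    then show ?thesis unfolding U_def by (simp only: Int_Un_distrib Un_empty not_False_eq_True de_Morgan_conj simp_thms)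
   next
    case F: False
    then show ?thesis using e(2) by (auto simp: U_def)
   qed
   then show "e \<in> (\<Union>u\<in>U. {e \<in> edges G - ?T. u \<in> e})" using e(1) by blast
  qed
  then have "card Q <= card (\<Union>u\<in>U. {e \<in> edges G - ?T. u \<in> e})"
   by (rule card_mono[rotated]) (use finU finE in auto)
  also have "... <= (\<Sum>u\<in>U. card {e \<in> edges G - ?T. u \<in> e})" by (rule card_UN_le[OF finU])
  finally have "rcard Q <= real (\<Sum>u\<in>U. card {e \<in> edges G - ?T. u \<in> e})" by (simp only: of_nat_le_iff)
  also have "... = (\<Sum>u\<in>U. bad_deg G r hue u)" by (simp only: bad_deg_def of_nat_sum)
  also have "... <= (\<Sum>u\<in>U. \<theta>1 * N)" by (rule sum_mono) (use US in \<open>force simp: S1_def\<close>)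
  also have "... = rcard U * (\<theta>1 * N)" by simp
  also have "... <= (real r + real r * real r) * (\<theta>1 * N)"
  proof (rule mult_right_mono)
   have "rcard U <= real (r * r + r)" using cU by (simp only: of_nat_le_iff)
   then show "rcard U <= real r + real r * real r" by simp
  qed (use \<theta> N0 in simp)
  finally have cQ: "rcard Q <= (real r + real r * real r) * \<theta>1 * N" by (simp add: mult.assoc)
  define c0 where "c0 = (1 / (4 * real r * real r)) ^ (r - 1)"
  have c0: "0 < c0" using r0 by (simp add: c0_def)
  have "2 * (real r + real r * real r) * \<theta>1 * N <= c0 * N" using \<theta>(3) N0 unfolding c0_def by (intro mult_right_mono) auto
  moreover have "0 < c0 * N" using c0 N0 by simp
  moreover have "2 * (real r + real r * real r) * \<theta>1 * N = 2 * ((real r + real r * real r) * \<theta>1 * N)" by (simp only: mult.assoc)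
  ultimately have cQ': "rcard Q < c0 * N" using cQ by linarith
  have nV: "2 * r + 1 <= card ?V"
  proof -
   have "1 <= real r" using r by simp
   moreover have "0 <= real r * real r" by simp
   moreover have "4 * real r * (real r + 1) = 4 * (real r * real r) + 4 * real r" by (simp add: algebra_simps)
   ultimately have "2 * real r + 1 <= 4 * real r * (real r + 1)" by linarith
   then have "real (2 * r + 1) <= rcard ?V" using large(5) by simp
   then show ?thesis by (simp only: of_nat_le_iff)
  qed
  have S1V: "S1 \<subseteq> ?V" by (auto simp: S1_def)
  have "\<not> ?V \<subseteq> S1" using card_mono[OF finS(2), of ?V] lt nV by linarith
  then obtain x where x: "x \<in> ?V" "x \<notin> S1" by blast
  have cx: "card (insert x S1) <= r" using lt finS(2) x by simp
  \<comment> \<open>Enlarging \<open>S1\<close> by \<open>x\<close> adds more edges than the bad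
    edges in \<open>Q\<close> account for, so \<open>G\<close> would have fewer edges than a
    join.\<close>
  obtain Sp where Sp: "insert x S1 \<subseteq> Sp" "Sp \<subseteq> ?V" "card Sp = r"
   using exists_subset_between[OF cx, of ?V] nV S1V x(1) fin(1) by auto
  define Nt where "Nt = {e \<in> nsets ?V r. x \<in> e & e Int S1 = {} & hue ` e ~= {..<r}}"
  have cN: "c0 * N <= rcard Nt"
   unfolding c0_def N_def n_def Nt_def
   by (rule many_nontransversal[OF r fin(1) x finS(2) cS1 size[OF hue] large(5)])
  define J where "J = jedges ?V r S1 hue"
  have finJ: "finite J" unfolding J_def by (rule finite_subset[OF jedges_subset finite_imp_finite_nsets[OF fin(1)]])
  have finNt: "finite Nt" unfolding Nt_def using finite_imp_finite_nsets[OF fin(1), of r] by simp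
  have "edges G - Q \<subseteq> J" unfolding J_def
  proof (rule edges_subset_joinI)
   show "edges G - Q \<subseteq> nsets ?V r" using fin(2) by blast
   fix e assume "e \<in> edges G - Q" "e Int S1 = {}"
   then show "hue ` e = {..<r}" by (auto simp: Q_def tedges_def)
  qed
  then have "edges G \<subseteq> J Un Q" by blast
  then have "card (edges G) <= card (J Un Q)" by (rule card_mono[rotated]) (simp add: finJ finQ)
  then have 1: "card (edges G) <= card J + card Q" using card_Un_le[of J Q] by linarith
  have "J Un Nt \<subseteq> jedges ?V r Sp hue"
   using jedges_mono[of S1 Sp ?V r hue] Sp(1) by (auto simp: J_def Nt_def jedges_def)
  then have "card (J Un Nt) <= card (jedges ?V r Sp hue)"
   by (rule card_mono[rotated]) (rule finite_subset[OF jedges_subset finite_imp_finite_nsets[OF fin(1)]])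
  also have "... <= join_size r (card ?V)"
   by (rule card_jedges_le(1)[OF _ fin(1) Sp(2,3) hue]) (use r nV in auto)
  finally have 2: "card (J Un Nt) <= join_size r (card ?V)" .
  have "card (J Un Nt) = card J + card Nt"
   by (rule card_Un_disjoint[OF finJ finNt]) (auto simp: J_def Nt_def jedges_def tedges_def)
  then have "card Nt <= card Q" using 1 2 edges by linarith
  then show ?thesis using cN cQ' by linarith
 qed
qed

lemma eventually_less_mult:
 fixes a c :: real
 assumes "0 < a"
 shows "\<forall>\<^sub>F n in sequentially. c < a * real n"
proof -
 have "\<forall>\<^sub>F n in sequentially. c / a < real n"
  using filterlim_real_sequentially by (simp only: filterlim_at_top_dense)
 then show ?thesis by eventually_elim (use assms in \<open>simp add: pos_divide_less_eq mult.commute\<close>)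
qed

text \<open>\<open>near_rainbow\<close> supplies some colouring with few bad edges, and a maximum
  cut has at least as many transversal edges.\<close>

lemma transversal_edges_of_dense:
 fixes \<omega> :: real
 assumes r: "2 <= r" and \<omega>: "0 < \<omega>"
 shows "\<exists>\<gamma>>0. \<exists>n0. \<forall>G :: 'a hypergraph. rgraph r G --> n0 <= card (verts G) --> hyp_free (pattern r t) G -->
  (1 / real r ^ r - \<gamma>) * rcard (verts G) ^ r <= rcard (edges G) -->
  (\<exists>hue. (\<forall>v. hue v < r) & max_cut G r hue \<and>
   (1 / real r ^ r - \<omega>) * rcard (verts G) ^ r <= rcard (edges G Int tedges (verts G) r hue))"
proof -
 have \<omega>2: "0 < \<omega> / 2" using \<omega> by simp
 obtain \<gamma> n0 where \<gamma>: "\<gamma> > 0" and n0: "\<forall>G :: 'a hypergraph. rgraph r G --> n0 <= card (verts G) --> hyp_free (pattern r t) G -->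
  rcard (edges G) \<ge> (1 / real r ^ r - \<gamma>) * rcard (verts G) ^ r -->
  (\<exists>hue. (\<forall>v. hue v < r) & rcard {e \<in> edges G. hue ` e ~= {..<r}} <= \<omega> / 2 * rcard (verts G) ^ r)"
  using near_rainbow[OF r \<omega>2, of t] by (elim exE conjE)
 show ?thesis
 proof (intro exI[of _ "min \<gamma> (\<omega> / 2)"] conjI exI[of _ n0] allI impI)
  show "0 < min \<gamma> (\<omega> / 2)" using \<gamma> \<omega> by simp
  fix G :: "'a hypergraph"
  define N where "N = rcard (verts G) ^ r"
  assume G: "rgraph r G" "n0 <= card (verts G)" "hyp_free (pattern r t) G"
   and d: "(1 / real r ^ r - min \<gamma> (\<omega> / 2)) * rcard (verts G) ^ r <= rcard (edges G)"
  have fin: "finite (verts G)" "edges G \<subseteq> nsets (verts G) r" using G(1) by (auto simp: rgraph_def)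
  have finE: "finite (edges G)" using fin finite_imp_finite_nsets finite_subset by blast
  have N0: "0 <= N" by (simp add: N_def)
  have "(1 / real r ^ r - \<gamma>) * N <= (1 / real r ^ r - min \<gamma> (\<omega> / 2)) * N"
   by (rule mult_right_mono[OF diff_left_mono[OF min.cobounded1] N0])
  then have d1: "(1 / real r ^ r - \<gamma>) * rcard (verts G) ^ r <= rcard (edges G)" using d unfolding N_def by linarith
  have "(1 / real r ^ r - \<omega> / 2) * N <= (1 / real r ^ r - min \<gamma> (\<omega> / 2)) * N"
   by (rule mult_right_mono[OF diff_left_mono[OF min.cobounded2] N0])
  then have d2: "(1 / real r ^ r - \<omega> / 2) * N <= rcard (edges G)" using d unfolding N_def by linarith
  obtain hue0 where hue0: "\<forall>v. hue0 v < r" "rcard {e \<in> edges G. hue0 ` e ~= {..<r}} <= \<omega> / 2 * N"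
   using n0[rule_format, OF G d1] unfolding N_def by (elim exE conjE)
  obtain hue where hue: "\<forall>v. hue v < r" "max_cut G r hue" using ex_max_cut[OF _ finE, of r] r by auto
  have "edges G \<subseteq> (edges G Int tedges (verts G) r hue0) Un {e \<in> edges G. hue0 ` e ~= {..<r}}"
   using fin(2) by (auto simp: tedges_def)
  then have "card (edges G) <= card ((edges G Int tedges (verts G) r hue0) Un {e \<in> edges G. hue0 ` e ~= {..<r}})"
   by (rule card_mono[rotated]) (simp add: finE)
  also have "... <= card (edges G Int tedges (verts G) r hue0) + card {e \<in> edges G. hue0 ` e ~= {..<r}}" by (rule card_Un_le)
  finally have "card (edges G) <= card (edges G Int tedges (verts G) r hue) + card {e \<in> edges G. hue0 ` e ~= {..<r}}"
   using hue(2)[unfolded max_cut_def, rule_format, of hue0] hue0(1) by fastforce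
  then have "rcard (edges G) <= rcard (edges G Int tedges (verts G) r hue) + \<omega> / 2 * N"
   using hue0(2) by linarith
  moreover have "(1 / real r ^ r - \<omega> / 2) * N = (1 / real r ^ r - \<omega>) * N + \<omega> / 2 * N" by (simp add: algebra_simps)
  ultimately have "(1 / real r ^ r - \<omega>) * N <= rcard (edges G Int tedges (verts G) r hue)" using d2 by linarith
  then show "\<exists>hue. (\<forall>v. hue v < r) & max_cut G r hue \<and>
   (1 / real r ^ r - \<omega>) * rcard (verts G) ^ r <= rcard (edges G Int tedges (verts G) r hue)"
   using hue unfolding N_def by (intro exI[of _ hue] conjI)
 qed
qed

text \<open>Either the density is low already, or \<open>near_rainbow\<close> applies and the
  transversal edges number at most the \<open>r\<close>-th power of \<open>n / r\<close>.\<close>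

lemma density_upper:
 fixes \<delta> :: real
 assumes r: "2 <= r" and \<delta>: "0 < \<delta>"
 shows "\<exists>n0. \<forall>G :: 'a hypergraph. rgraph r G --> n0 <= card (verts G) --> hyp_free (pattern r t) G -->
  rcard (edges G) <= (1 / real r ^ r + \<delta>) * rcard (verts G) ^ r"
proof -
 obtain \<gamma> n0 where \<gamma>: "\<gamma> > 0" and n0: "\<forall>G :: 'a hypergraph. rgraph r G --> n0 <= card (verts G) --> hyp_free (pattern r t) G -->
  rcard (edges G) \<ge> (1 / real r ^ r - \<gamma>) * rcard (verts G) ^ r -->
  (\<exists>hue. (\<forall>v. hue v < r) & rcard {e \<in> edges G. hue ` e ~= {..<r}} <= \<delta> * rcard (verts G) ^ r)"
  using near_rainbow[OF r \<delta>, of t] by (elim exE conjE)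
 show ?thesis
 proof (intro exI[of _ n0] allI impI)
  fix G :: "'a hypergraph"
  assume G: "rgraph r G" "n0 <= card (verts G)" "hyp_free (pattern r t) G"
  define N where "N = rcard (verts G) ^ r"
  have N0: "0 <= N" by (simp add: N_def)
  have fin: "finite (verts G)" "edges G \<subseteq> nsets (verts G) r" using G(1) by (auto simp: rgraph_def)
  have finE: "finite (edges G)" using fin finite_imp_finite_nsets finite_subset by blast
  show "rcard (edges G) <= (1 / real r ^ r + \<delta>) * rcard (verts G) ^ r"
  proof (cases "(1 / real r ^ r - \<gamma>) * rcard (verts G) ^ r <= rcard (edges G)")
   case True
   obtain hue where hue: "\<forall>v. hue v < r" "rcard {e \<in> edges G. hue ` e ~= {..<r}} <= \<delta> * N"
    using n0[rule_format, OF G True] unfolding N_def by (elim exE conjE)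
   have "edges G \<subseteq> tedges (verts G) r hue Un {e \<in> edges G. hue ` e ~= {..<r}}"
    using fin(2) by (auto simp: tedges_def)
   then have "card (edges G) <= card (tedges (verts G) r hue Un {e \<in> edges G. hue ` e ~= {..<r}})"
    by (rule card_mono[rotated]) (simp add: finE finite_tedges[OF fin(1)])
   then have "card (edges G) <= card (tedges (verts G) r hue) + card {e \<in> edges G. hue ` e ~= {..<r}}"
    using card_Un_le order_trans by blast
   moreover have "rcard (tedges (verts G) r hue) <= (rcard (verts G) / real r) ^ r"
    by (rule card_tedges_le_power) (use r fin hue(1) in auto)
   moreover have "(rcard (verts G) / real r) ^ r = 1 / real r ^ r * N" by (simp add: power_divide N_def)
   ultimately have "rcard (edges G) <= 1 / real r ^ r * N + \<delta> * N" using hue(2) by linarith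
   then show ?thesis by (simp only: N_def distrib_right)
  next
   case False
   moreover have "(1 / real r ^ r - \<gamma>) * N <= (1 / real r ^ r + \<delta>) * N" using \<gamma> \<delta> N0 by (intro mult_right_mono) auto
   ultimately show ?thesis unfolding N_def by linarith
  qed
 qed
qed

text \<open>Constants are fixed from coarse to fine: the coarse richness scale, the tolerance for
  missing edges it permits, the fine scale below that tolerance, and finally the density. The degree
  deficit \<open>\<mu>1 / 4\<close> leaves a further \<open>\<mu>1 / 4\<close>, within the tolerated
  \<open>\<mu>1 / 2\<close>, for unbalanced classes.\<close>

lemma min_degree_structure:
 assumes r: "2 <= r"
 shows "\<exists>eps0>0. \<exists>n0. \<forall>G :: 'a hypergraph. rgraph r G --> n0 <= card (verts G) --> hyp_free (pattern r t) G -->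
  (\<forall>v\<in>verts G. (1 / real r ^ (r - 1) - eps0) * rcard (verts G) ^ (r - 1) <= real (codeg (edges G) {v})) -->
  join_size r (card (verts G)) <= card (edges G) -->
  (\<exists>S hue. (\<forall>v. hue v < r) & S \<subseteq> verts G & card S = r & edges G \<subseteq> jedges (verts G) r S hue)"
proof -
 have r0: "0 < real r" using r by simp
 define c0 where "c0 = (1 / (4 * real r * real r)) ^ (r - 1)"
 have c0: "0 < c0" using r0 by (simp add: c0_def)
 define b where "b = 2 * (real r + real r * real r)"
 have b: "0 < b" using r0 by (simp add: b_def add_pos_pos)
 define \<theta>1 where "\<theta>1 = min 1 (c0 / b)"
 have \<theta>1: "0 < \<theta>1" "\<theta>1 <= 1" "b * \<theta>1 <= c0"
 proof -
  show "0 < \<theta>1" "\<theta>1 <= 1" using c0 b by (auto simp: \<theta>1_def)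
  have "b * \<theta>1 <= b * (c0 / b)" using b unfolding \<theta>1_def by (intro mult_left_mono) auto
  then show "b * \<theta>1 <= c0" using b by simp
 qed
 have kap1: "0 < \<theta>1 / (4 * real r)" using \<theta>1 r0 by simp
 obtain \<nu>1 \<mu>1 where p1: "0 < \<nu>1" "4 * (real r + 4) * \<nu>1 <= \<theta>1 / (4 * real r)" "\<nu>1 < (\<theta>1 / (4 * real r) / 2) ^ (r - 1)"
   "0 < \<mu>1" "\<mu>1 * (4 * real r) ^ (r - 2) <= \<nu>1" "\<mu>1 <= \<nu>1" "2 * \<mu>1 <= (1 / (2 * real r)) ^ (r - 1)"
  using ex_near_parameters[OF r kap1] by (elim exE conjE)
 define \<theta>2 where "\<theta>2 = min (\<mu>1 / 4) \<theta>1"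
 have \<theta>2: "0 < \<theta>2" "\<theta>2 <= \<theta>1" "\<theta>2 <= \<mu>1 / 4" using p1 \<theta>1 by (auto simp: \<theta>2_def)
 have kap2: "0 < \<theta>2 / (4 * real r)" using \<theta>2 r0 by simp
 obtain \<nu>2 \<mu>2 where p2: "0 < \<nu>2" "4 * (real r + 4) * \<nu>2 <= \<theta>2 / (4 * real r)" "\<nu>2 < (\<theta>2 / (4 * real r) / 2) ^ (r - 1)"
   "0 < \<mu>2" "\<mu>2 * (4 * real r) ^ (r - 2) <= \<nu>2" "\<mu>2 <= \<nu>2" "2 * \<mu>2 <= (1 / (2 * real r)) ^ (r - 1)"
  using ex_near_parameters[OF r kap2] by (elim exE conjE)
 \<comment> \<open>Classes of size at least \<open>1 - eps\<close> times \<open>n / r\<close> raise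
   the transversal degree by a factor of at most \<open>1 + 2 * eps\<close> over the balanced
   value.\<close>
 define eps where "eps = min (1 / 2) (\<mu>1 / 8)"
 have eps: "0 < eps" "eps <= 1 / 2" "2 * eps <= \<mu>1 / 4" using p1 by (auto simp: eps_def)
 have eps1: "eps <= 1" using eps by linarith
 define q where "q = (1 - eps) * exp eps"
 have q: "q < 1" unfolding q_def by (rule one_minus_times_exp_less_one[OF eps(1) eps1])
 \<comment> \<open>The first bound keeps vertices with many missing edges few, the second keeps the
   classes large.\<close>
 define \<omega> where "\<omega> = min (\<nu>2 * \<mu>2 / real r) ((1 - q) / (2 * real r ^ r))"
 have \<omega>: "0 < \<omega>" "\<omega> <= \<nu>2 * \<mu>2 / real r" "\<omega> <= (1 - q) / (2 * real r ^ r)" using p2 q r0 by (auto simp: \<omega>_def)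
 have \<omega>r: "real r * \<omega> <= \<nu>2 * \<mu>2" using \<omega>(2) r0 by (simp add: pos_le_divide_eq mult.commute)
 obtain \<gamma> n1 where \<gamma>: "\<gamma> > 0" and n1: "\<forall>G :: 'a hypergraph. rgraph r G --> n1 <= card (verts G) --> hyp_free (pattern r t) G -->
  (1 / real r ^ r - \<gamma>) * rcard (verts G) ^ r <= rcard (edges G) -->
  (\<exists>hue. (\<forall>v. hue v < r) & max_cut G r hue \<and>
   (1 / real r ^ r - \<omega>) * rcard (verts G) ^ r <= rcard (edges G Int tedges (verts G) r hue))"
  using transversal_edges_of_dense[OF r \<omega>(1), of t] by (elim exE conjE)
 define M where "M = real (pattern_bound r t)"
 have \<theta>4: "0 < \<theta>1 / (4 * real r) / 4" "0 < \<theta>2 / (4 * real r) / 4" using kap1 kap2 by simp_all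
 have "\<forall>\<^sub>F n in sequentially. n1 + 4 * r <= n & M < \<mu>1 * real n & M < \<mu>2 * real n \<and>
   M + 10 * (real r + 1)\<^sup>2 < \<theta>1 / (4 * real r) / 4 * real n \<and>
   M + 10 * (real r + 1)\<^sup>2 < \<theta>2 / (4 * real r) / 4 * real n \<and>
   4 * real r * (real r + 1) < 1 * real n & real r < \<nu>1 * real n & 2 * real r ^ 2 < \<gamma> * real n"
  using eventually_ge_at_top[of "n1 + 4 * r"] eventually_less_mult[OF p1(4)] eventually_less_mult[OF p2(4)]
   eventually_less_mult[OF \<theta>4(1)] eventually_less_mult[OF \<theta>4(2)] eventually_less_mult[OF zero_less_one]
   eventually_less_mult[OF p1(1)] eventually_less_mult[OF \<gamma>]
  by (intro eventually_conj)
 then obtain n0 where n0: "\<And>n. n0 <= n ==> n1 + 4 * r <= n & M < \<mu>1 * real n & M < \<mu>2 * real n \<and>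
   M + 10 * (real r + 1)\<^sup>2 < \<theta>1 / (4 * real r) / 4 * real n \<and>
   M + 10 * (real r + 1)\<^sup>2 < \<theta>2 / (4 * real r) / 4 * real n \<and>
   4 * real r * (real r + 1) < 1 * real n & real r < \<nu>1 * real n & 2 * real r ^ 2 < \<gamma> * real n"
  by (auto simp only: eventually_sequentially)
 show ?thesis
 proof (intro exI[of _ "\<mu>1 / 4"] conjI exI[of _ n0] allI impI)
  show "0 < \<mu>1 / 4" using p1(4) by simp
  fix G :: "'a hypergraph"
  let ?V = "verts G"
  define n where "n = rcard ?V"
  assume G: "rgraph r G" and n0G: "n0 <= card ?V" and free: "hyp_free (pattern r t) G"
   and deg: "\<forall>v\<in>?V. (1 / real r ^ (r - 1) - \<mu>1 / 4) * rcard ?V ^ (r - 1) <= real (codeg (edges G) {v})"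
   and big: "join_size r (card ?V) <= card (edges G)"
  have N: "n1 + 4 * r <= card ?V" "M < \<mu>1 * n" "M < \<mu>2 * n" "M + 10 * (real r + 1)\<^sup>2 <= \<theta>1 / (4 * real r) / 4 * n"
   "M + 10 * (real r + 1)\<^sup>2 <= \<theta>2 / (4 * real r) / 4 * n" "4 * real r * (real r + 1) <= n" "real r <= \<nu>1 * n" "2 * real r ^ 2 < \<gamma> * n"
   using n0[OF n0G] by (auto simp: n_def)
  have fin: "finite ?V" "edges G \<subseteq> nsets ?V r" using G by (auto simp: rgraph_def)
  have n: "0 < n" using N(1) r by (simp add: n_def)
  have "2 * real r ^ 2 / n <= \<gamma>" using N(8) n by (simp add: pos_divide_le_eq)
  then have "(1 / real r ^ r - \<gamma>) * n ^ r <= (1 / real r ^ r - 2 * real r ^ 2 / n) * n ^ r"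
   using n by (intro mult_right_mono) auto
  also have "... <= real (join_size r (card ?V))" unfolding n_def by (rule join_size_lower[OF r]) (use N(1) in simp)
  also have "... <= rcard (edges G)" using big by simp
  finally have dense: "(1 / real r ^ r - \<gamma>) * rcard ?V ^ r <= rcard (edges G)" by (simp only: n_def)
  have n1G: "n1 <= card ?V" using N(1) by simp
  obtain hue where hue: "\<forall>v. hue v < r" "max_cut G r hue"
   "(1 / real r ^ r - \<omega>) * n ^ r <= rcard (edges G Int tedges ?V r hue)"
   using n1[rule_format, OF G n1G free dense] unfolding n_def by (elim exE conjE)
  let ?T = "tedges ?V r hue"
  have finT: "finite ?T" by (rule finite_tedges[OF fin(1)])
  have V0: "?V ~= {}" using n by (auto simp: n_def)
  have r1: "0 < r" using r by simp
  have Tup: "rcard ?T <= (n / real r) ^ r"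
   unfolding n_def by (rule card_tedges_le_power[OF r1 fin(1)]) (use hue(1) in simp)
  have size: "(1 - eps) * (n / real r) <= rcard {v \<in> ?V. hue v = k}" if "k < r" for k
   unfolding n_def
  proof (rule class_size_lower[OF r1 eps(1) eps1 fin(1) V0 hue(1)[rule_format] _ that])
   have "card (edges G Int ?T) <= card ?T" by (rule card_mono[OF finT]) simp
   then have "(1 / real r ^ r - \<omega>) * n ^ r <= rcard ?T" using hue(3) by linarith
   moreover have "(1 / real r ^ r - (1 - q) / (2 * real r ^ r)) * n ^ r <= (1 / real r ^ r - \<omega>) * n ^ r"
    using \<omega>(3) n by (intro mult_right_mono) auto
   ultimately show "(1 / real r ^ r - (1 - (1 - eps) * exp eps) / (2 * real r ^ r)) * rcard ?V ^ r <= rcard ?T"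
    unfolding q_def n_def by linarith
  qed
  have nr: "0 < n / real r" using n r0 by simp
  have size2: "n / (2 * real r) <= rcard {v \<in> ?V. hue v = k}" if "k < r" for k
  proof -
   have "1 / 2 * (n / real r) <= (1 - eps) * (n / real r)" using eps(2) nr by (intro mult_right_mono) auto
   then show ?thesis using size[OF that] by simp
  qed
  have tight: "rcard {e \<in> ?T. y \<in> e} <= real (codeg (edges G) {y}) + \<mu>1 / 2 * n ^ (r - 1)" if y: "y \<in> ?V" for y
  proof -
   let ?d = "rcard {e \<in> ?T. y \<in> e}"
   have "?d * ((1 - eps) * (n / real r)) <= ?d * rcard {v \<in> ?V. hue v = hue y}"
    by (rule mult_left_mono[OF size]) (use hue(1) in auto)
   also have "... <= rcard ?T"
    using trans_degree_upper[OF fin(1) hue(1)[rule_format] y] by (simp only: of_nat_mult[symmetric] of_nat_le_iff)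
   also have "... <= (n / real r) ^ (r - 1) * (n / real r)"
    using Tup power_minus_mult[OF r1, of "n / real r"] by simp
   finally have "(?d * (1 - eps)) * (n / real r) <= (n / real r) ^ (r - 1) * (n / real r)" by (simp only: mult.assoc)
   then have d1: "?d * (1 - eps) <= (n / real r) ^ (r - 1)" by (rule mult_right_le_imp_le[OF _ nr])
   have p: "0 <= (n / real r) ^ (r - 1)" using nr by simp
   have e: "1 <= (1 - eps) * (1 + 2 * eps)"
   proof -
    have "(1 - eps) * (1 + 2 * eps) = 1 + eps * (1 - 2 * eps)" by (simp add: algebra_simps)
    moreover have "0 <= eps * (1 - 2 * eps)" using eps by (intro mult_nonneg_nonneg) auto
    ultimately show ?thesis by linarith
   qed
   have "?d * 1 <= ?d * ((1 - eps) * (1 + 2 * eps))" by (rule mult_left_mono[OF e]) simp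
   also have "... = (?d * (1 - eps)) * (1 + 2 * eps)" by (simp only: mult.assoc)
   also have "... <= (n / real r) ^ (r - 1) * (1 + 2 * eps)" by (rule mult_right_mono[OF d1]) (use eps in simp)
   also have "... = (1 / real r ^ (r - 1)) * n ^ (r - 1) + (1 / real r ^ (r - 1)) * (2 * eps * n ^ (r - 1))"
    by (simp add: power_divide algebra_simps add_divide_distrib)
   also have "(1 / real r ^ (r - 1)) * (2 * eps * n ^ (r - 1)) <= 1 * (2 * eps * n ^ (r - 1))"
    using r eps n by (intro mult_right_mono) (auto simp: divide_le_eq)
   also have "1 * (2 * eps * n ^ (r - 1)) <= \<mu>1 / 4 * n ^ (r - 1)"
    using mult_right_mono[OF eps(3), of "n ^ (r - 1)"] n by simp
   finally have "?d <= 1 / real r ^ (r - 1) * n ^ (r - 1) + \<mu>1 / 4 * n ^ (r - 1)" by simp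
   moreover have "(1 / real r ^ (r - 1) - \<mu>1 / 4) * n ^ (r - 1) <= real (codeg (edges G) {y})"
    using deg y by (simp only: n_def)
   moreover have "(1 / real r ^ (r - 1) - \<mu>1 / 4) * n ^ (r - 1) = 1 / real r ^ (r - 1) * n ^ (r - 1) - \<mu>1 / 4 * n ^ (r - 1)"
    by (rule left_diff_distrib)
   moreover have "\<mu>1 / 2 * n ^ (r - 1) = \<mu>1 / 4 * n ^ (r - 1) + \<mu>1 / 4 * n ^ (r - 1)" by simp
   ultimately show ?thesis by linarith
  qed
  have miss: "rcard (?T - edges G) <= \<omega> * n ^ r"
  proof -
   have "card (?T - edges G) = card ?T - card (edges G Int ?T)"
    using card_Diff_subset_Int[of ?T "edges G"] finT by (simp add: Int_commute)
   moreover have "card (edges G Int ?T) <= card ?T" by (rule card_mono[OF finT]) simp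
   ultimately have "rcard (?T - edges G) = rcard ?T - rcard (edges G Int ?T)" by simp
   also have "... <= (n / real r) ^ r - (1 / real r ^ r - \<omega>) * n ^ r" using Tup hue(3) by linarith
   also have "... = \<omega> * n ^ r" by (simp add: power_divide algebra_simps)
   finally show ?thesis .
  qed
  have few: "rcard {v \<in> ?V. \<mu>2 * n ^ (r - 1) < rcard {e \<in> ?T - edges G. v \<in> e}} <= \<nu>2 * n"
  proof (rule card_high_degree_le[OF fin(1)])
   show "?T - edges G \<subseteq> nsets ?V r" by (auto simp: tedges_def)
   show "0 < \<mu>2 * n ^ (r - 1)" using p2 n by simp
   have "real r * rcard (?T - edges G) <= real r * (\<omega> * n ^ r)" using miss by (intro mult_left_mono) auto
   also have "... = (real r * \<omega>) * n ^ r" by simp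
   also have "... <= (\<nu>2 * \<mu>2) * n ^ r" using \<omega>r n by (intro mult_right_mono) auto
   also have "n ^ r = n ^ (r - 1) * n" using power_minus_mult[OF r1, of n] by simp
   finally show "real r * rcard (?T - edges G) <= \<mu>2 * n ^ (r - 1) * (\<nu>2 * n)" by (simp add: mult_ac)
  qed
  have "\<exists>S \<subseteq> ?V. card S = r & edges G \<subseteq> jedges ?V r S hue"
   by (rule join_structure_of_max_cut[OF r G hue(1)[rule_format] hue(2) free size2[unfolded n_def] tight[unfolded n_def]
    \<theta>1(1,2) \<theta>1(3)[unfolded b_def c0_def] \<theta>2 p1 p2 few[unfolded n_def] N(2-7)[unfolded n_def M_def] big])
  then show "\<exists>S hue. (\<forall>v. hue v < r) & S \<subseteq> ?V & card S = r & edges G \<subseteq> jedges ?V r S hue"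
   using hue(1) by (elim exE conjE) (intro exI conjI)
 qed
qed

section \<open>Dropping the minimum degree condition\<close>

definition induced :: "'a hypergraph => 'a set => 'a hypergraph" where
 "induced G U = \<lparr>verts = U, edges = {e \<in> edges G. e \<subseteq> U}\<rparr>"

lemma verts_induced [simp]: "verts (induced G U) = U"
 and edges_induced [simp]: "edges (induced G U) = {e \<in> edges G. e \<subseteq> U}"
 by (simp_all add: induced_def)

lemma rgraph_induced: "rgraph r G ==> U \<subseteq> verts G ==> rgraph r (induced G U)"
 by (auto simp: rgraph_def nsets_def intro: finite_subset)

text \<open>The new vertex contributes at least the smallest transversal degree of a balanced
  partition; Bernoulli's inequality compares it with the \<open>(r - 1)\<close>-st power of
  \<open>m / r\<close>.\<close>

lemma join_size_growth:
 fixes eps :: real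
 assumes r: "2 <= r" and m: "2 * r + 2 <= m" and eps: "real r * (1 + 2 * real r) <= eps * real m"
 shows "real (join_size r (m - 1)) + (1 / real r ^ (r - 1) - eps) * real m ^ (r - 1) <= real (join_size r m)"
proof -
 have r0: "0 < real r" and m0: "0 < real m" using r m by simp_all
 have "join_size r (m - 1) + ((m - 1 - r) div r) ^ (r - 1) <= join_size r (Suc (m - 1))"
  by (rule join_size_Suc[OF r]) (use m in simp)
 moreover have "Suc (m - 1) = m" using m by simp
 ultimately have "join_size r (m - 1) + ((m - 1 - r) div r) ^ (r - 1) <= join_size r m" by (simp only:)
 then have 1: "real (join_size r (m - 1)) + real ((m - 1 - r) div r) ^ (r - 1) <= real (join_size r m)"
  by (simp only: of_nat_add[symmetric] of_nat_power[symmetric] of_nat_le_iff)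
 let ?x = "(1 + 2 * real r) / real m"
 have x: "?x <= 1" using m m0 by (simp add: divide_le_eq)
 have "real (m - 1 - r) <= real (r + r * ((m - 1 - r) div r))"
 proof (rule of_nat_mono)
  have "(m - 1 - r) mod r < r" using r by simp
  then show "m - 1 - r <= r + r * ((m - 1 - r) div r)" using mod_mult_div_eq[of "m - 1 - r" r] by linarith
 qed
 then have "real m - 1 - 2 * real r <= real r * real ((m - 1 - r) div r)" using m by (simp add: of_nat_diff)
 then have "(real m - 1 - 2 * real r) / real r <= real ((m - 1 - r) div r)" using r0 by (simp add: pos_divide_le_eq mult.commute)
 moreover have "(real m - 1 - 2 * real r) / real r = real m / real r * (1 + (- ?x))" using r0 m0 by (simp add: field_simps)
 ultimately have "real m / real r * (1 + (- ?x)) <= real ((m - 1 - r) div r)" by simp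
 then have "(real m / real r * (1 + (- ?x))) ^ (r - 1) <= real ((m - 1 - r) div r) ^ (r - 1)"
  using x m0 r0 by (intro power_mono mult_nonneg_nonneg) auto
 moreover have "(1 / real r ^ (r - 1) - eps) * real m ^ (r - 1) <= (real m / real r * (1 + (- ?x))) ^ (r - 1)"
 proof -
  have "real (r - 1) * ?x <= real r * ?x" using r0 m0 by (intro mult_right_mono) auto
  also have "... <= eps" using eps m0 by (simp add: pos_divide_le_eq)
  finally have a: "real (r - 1) * ?x <= eps" .
  have "1 / real r ^ (r - 1) * (real (r - 1) * ?x) <= 1 * (real (r - 1) * ?x)"
   using r m0 by (intro mult_right_mono) (auto simp: divide_le_eq)
  then have "1 / real r ^ (r - 1) - eps <= 1 / real r ^ (r - 1) * (1 + real (r - 1) * (- ?x))"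
   using a by (simp only: ring_distribs mult_minus_right mult_1_right mult_1_left)
  also have "... <= 1 / real r ^ (r - 1) * (1 + (- ?x)) ^ (r - 1)"
   using x by (intro mult_left_mono Bernoulli_inequality) auto
  finally have "(1 / real r ^ (r - 1) - eps) * real m ^ (r - 1) <= 1 / real r ^ (r - 1) * (1 + (- ?x)) ^ (r - 1) * real m ^ (r - 1)"
   using m0 by (intro mult_right_mono) auto
  also have "... = (real m / real r * (1 + (- ?x))) ^ (r - 1)" by (simp only: power_mult_distrib power_divide) simp
  finally show ?thesis .
 qed
 ultimately show ?thesis using 1 by linarith
qed

lemma card_edges_delete_vertex:
 assumes "finite E"
 shows "card {e \<in> E. e \<subseteq> U} = card {e \<in> E. e \<subseteq> U - {v}} + codeg {e \<in> E. e \<subseteq> U} {v}"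
proof -
 have "{e \<in> E. e \<subseteq> U} = {e \<in> E. e \<subseteq> U - {v}} Un {e \<in> {e \<in> E. e \<subseteq> U}. {v} \<subseteq> e}" by auto
 moreover have "card ({e \<in> E. e \<subseteq> U - {v}} Un {e \<in> {e \<in> E. e \<subseteq> U}. {v} \<subseteq> e})
  = card {e \<in> E. e \<subseteq> U - {v}} + card {e \<in> {e \<in> E. e \<subseteq> U}. {v} \<subseteq> e}"
  by (rule card_Un_disjoint) (use assms in auto)
 ultimately show ?thesis unfolding codeg_def by (simp only:)
qed

text \<open>Deleting vertices of low degree one at a time increases the surplus over \<open>join_size\<close>; either the
 process stops and the minimum degree result applies, or the density exceeds the Turan density.\<close>

lemma exactness:
 assumes r: "2 <= r"
 shows "\<exists>n0. \<forall>G :: 'a hypergraph. rgraph r G --> n0 <= card (verts G) --> hyp_free (pattern r t) G -->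
  join_size r (card (verts G)) <= card (edges G) -->
  (\<exists>S hue. (\<forall>v. hue v < r) & S \<subseteq> verts G & card S = r & edges G = jedges (verts G) r S hue \<and>
   card (edges G) = join_size r (card (verts G)))"
proof -
 obtain eps n1 where eps: "eps > 0" and n1: "\<forall>G :: 'a hypergraph. rgraph r G --> n1 <= card (verts G) --> hyp_free (pattern r t) G -->
  (\<forall>v\<in>verts G. (1 / real r ^ (r - 1) - eps) * rcard (verts G) ^ (r - 1) <= real (codeg (edges G) {v})) -->
  join_size r (card (verts G)) <= card (edges G) -->
  (\<exists>S hue. (\<forall>v. hue v < r) & S \<subseteq> verts G & card S = r & edges G \<subseteq> jedges (verts G) r S hue)"
  using min_degree_structure[OF r, of t] by (elim exE conjE)
 \<comment> \<open>Chosen so that the surplus gathered during about \<open>m / 2\<close> deletions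
   is at least \<open>4 * \<delta> * real m ^ r\<close>.\<close>
 define \<delta> where "\<delta> = eps / 16 * (1 / 2) ^ (r - 1)"
 have \<delta>: "0 < \<delta>" using eps by (simp add: \<delta>_def)
 obtain n2 where n2: "\<forall>G :: 'a hypergraph. rgraph r G --> n2 <= card (verts G) --> hyp_free (pattern r t) G -->
  rcard (edges G) <= (1 / real r ^ r + \<delta>) * rcard (verts G) ^ r"
  using density_upper[OF r \<delta>, of t] by (elim exE)
 have eps2: "0 < eps / 2" using eps by simp
 have "\<forall>\<^sub>F m in sequentially. n1 + n2 + 4 * r + 2 <= m & real r * (1 + 2 * real r) < eps / 2 * real m & 2 * real r ^ 2 < \<delta> * real m"
  using eventually_ge_at_top[of "n1 + n2 + 4 * r + 2"] eventually_less_mult[OF eps2] eventually_less_mult[OF \<delta>]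
  by (intro eventually_conj)
 then obtain m0 where m0: "\<And>m. m0 <= m ==> n1 + n2 + 4 * r + 2 <= m & real r * (1 + 2 * real r) < eps / 2 * real m & 2 * real r ^ 2 < \<delta> * real m"
  by (auto simp only: eventually_sequentially)
 show ?thesis
 proof (intro exI[of _ "2 * m0"] allI impI)
  fix G :: "'a hypergraph"
  assume G: "rgraph r G" and n0G: "2 * m0 <= card (verts G)" and free: "hyp_free (pattern r t) G"
   and big: "join_size r (card (verts G)) <= card (edges G)"
  let ?V = "verts G"
  define n where "n = card ?V"
  \<comment> \<open>The surplus gained per deleted vertex. Deletion stops at half of the vertices,
    so one value works for all sizes \<open>m\<close>.\<close>
  define s where "s = eps / 2 * (real n / 2) ^ (r - 1)"
  have fin: "finite ?V" "edges G \<subseteq> nsets ?V r" using G by (auto simp: rgraph_def)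
  have finE: "finite (edges G)" using fin finite_imp_finite_nsets finite_subset by blast
  define P where "P = (%m. \<exists>U\<subseteq>?V. card U = m & n <= 2 * m \<and>
   real (join_size r m) + (real n - real m) * s <= rcard {e \<in> edges G. e \<subseteq> U})"
  have all: "{e \<in> edges G. e \<subseteq> ?V} = edges G" using fin(2) by (auto simp: nsets_def)
  have "P n" unfolding P_def
  proof (intro exI[of _ ?V] conjI)
   show "real (join_size r n) + (real n - real n) * s <= rcard {e \<in> edges G. e \<subseteq> ?V}"
    using big by (simp add: all n_def)
  qed (auto simp: n_def)
  define m where "m = (LEAST m. P m)"
  have "P m" unfolding m_def by (rule LeastI[of P n, OF \<open>P n\<close>])
  then obtain U where U: "U \<subseteq> ?V" "card U = m" "n <= 2 * m"
   "real (join_size r m) + (real n - real m) * s <= rcard {e \<in> edges G. e \<subseteq> U}"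
   unfolding P_def by (elim exE conjE)
  have mn: "m <= n" unfolding m_def by (rule Least_le[of P n, OF \<open>P n\<close>])
  have "m0 <= m" using n0G U(3) by (simp add: n_def)
  then have M: "n1 + n2 + 4 * r + 2 <= m" "real r * (1 + 2 * real r) <= eps / 2 * real m" "2 * real r ^ 2 < \<delta> * real m"
   using m0[of m] by auto
  have mpos: "0 < real m" using M(1) by simp
  have npos: "0 < real n" using M(1) mn by simp
  have s0: "0 < s" using eps npos by (simp add: s_def)
  define H where "H = induced G U"
  have H: "verts H = U" "edges H = {e \<in> edges G. e \<subseteq> U}" by (simp_all add: H_def)
  have rH: "rgraph r H" unfolding H_def by (rule rgraph_induced[OF G U(1)])
  have fH: "hyp_free (pattern r t) H" by (rule hyp_free_mono[OF free]) (auto simp: H U(1))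
  have finU: "finite U" using U(1) fin(1) finite_subset by blast
  have sm: "s <= eps / 2 * real m ^ (r - 1)" unfolding s_def
   by (intro mult_left_mono power_mono) (use U(3) eps in auto)
  have nm: "0 <= (real n - real m) * s" using mn s0 by (intro mult_nonneg_nonneg) auto
  have dense: "\<forall>v\<in>U. (1 / real r ^ (r - 1) - eps) * real m ^ (r - 1) <= real (codeg (edges H) {v})"
  proof (rule ccontr)
   assume "\<not> ?thesis"
   then obtain v where v: "v \<in> U" "real (codeg (edges H) {v}) < (1 / real r ^ (r - 1) - eps) * real m ^ (r - 1)" by (auto simp: not_le)
   have c1: "card (U - {v}) = m - 1" using v(1) U(2) finU by simp
   have "card {e \<in> edges G. e \<subseteq> U} = card {e \<in> edges G. e \<subseteq> U - {v}} + codeg (edges H) {v}"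
    unfolding H(2) by (rule card_edges_delete_vertex[OF finE])
   then have e1: "rcard {e \<in> edges G. e \<subseteq> U} = rcard {e \<in> edges G. e \<subseteq> U - {v}} + real (codeg (edges H) {v})"
    by (simp only: of_nat_add)
   have g: "real (join_size r (m - 1)) + (1 / real r ^ (r - 1) - eps / 2) * real m ^ (r - 1) <= real (join_size r m)"
    by (rule join_size_growth[OF r _ M(2)]) (use M(1) in simp)
   have e2: "(1 / real r ^ (r - 1) - eps / 2) * real m ^ (r - 1) = (1 / real r ^ (r - 1) - eps) * real m ^ (r - 1) + eps / 2 * real m ^ (r - 1)"
    by (simp add: algebra_simps)
   have e3: "(real n - real (m - 1)) * s = (real n - real m) * s + s"
    using M(1) by (simp add: of_nat_diff algebra_simps)
   have ge: "real (join_size r (m - 1)) + (real n - real (m - 1)) * s <= rcard {e \<in> edges G. e \<subseteq> U - {v}}"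
    using U(4) e1 g e2 e3 sm v(2) by linarith
   have "\<not> P (m - 1)"
   proof
    assume "P (m - 1)"
    then have "m <= m - 1" unfolding m_def by (rule Least_le[of P])
    then show False using M(1) by linarith
   qed
   \<comment> \<open>\<open>P\<close> fails at \<open>m - 1\<close> only because half of the
     vertices are gone; then the surplus contradicts the density bound.\<close>
   then have "\<not> n <= 2 * (m - 1)" using ge c1 U(1) unfolding P_def by blast
   then have "2 * m <= n + 1" by linarith
   then have "real m - 1 <= real n - real m" by linarith
   moreover have "real m / 2 <= real m - 1" using M(1) by simp
   ultimately have h1: "real m / 2 <= real n - real m" by linarith
   have h2: "eps / 2 * (real m / 2) ^ (r - 1) <= s" unfolding s_def
    by (intro mult_left_mono power_mono) (use mn eps in auto)
   have h3: "0 <= eps / 2 * (real m / 2) ^ (r - 1)" using eps by simp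
   have "real m / 2 * (eps / 2 * (real m / 2) ^ (r - 1)) <= (real n - real m) * s"
    by (rule mult_mono[OF h1 h2 _ h3]) (use h1 in linarith)
   moreover have "real m / 2 * (eps / 2 * (real m / 2) ^ (r - 1)) = 4 * \<delta> * real m ^ r"
   proof -
    have "real m ^ r = real m * real m ^ (r - 1)" using power_minus_mult[of r "real m"] r by (simp add: mult.commute)
    moreover have "(real m / 2) ^ (r - 1) = (1 / 2) ^ (r - 1) * real m ^ (r - 1)" by (simp add: power_divide)
    ultimately show ?thesis unfolding \<delta>_def by (simp only:) simp
   qed
   ultimately have k1: "real (join_size r m) + 4 * \<delta> * real m ^ r <= rcard (edges H)" using U(4) unfolding H(2) by linarith
   have k2: "(1 / real r ^ r - 2 * real r ^ 2 / real m) * real m ^ r <= real (join_size r m)"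
    by (rule join_size_lower[OF r]) (use M(1) in simp)
   have "2 * real r ^ 2 / real m <= \<delta>" using M(3) mpos by (simp add: pos_divide_le_eq)
   then have k3: "(1 / real r ^ r - \<delta>) * real m ^ r <= (1 / real r ^ r - 2 * real r ^ 2 / real m) * real m ^ r"
    using mpos by (intro mult_right_mono) auto
   have n2U: "n2 <= card (verts H)" using M(1) U(2) H(1) by simp
   have k4: "rcard (edges H) <= (1 / real r ^ r + \<delta>) * real m ^ r"
    using n2[rule_format, OF rH n2U fH] unfolding H(1) U(2) .
   have k5: "0 < \<delta> * real m ^ r" using \<delta> mpos by simp
   from k1 k2 k3 k4 k5 show False unfolding left_diff_distrib distrib_right by argo
  qed
  have bigU: "real (join_size r m) <= rcard (edges H)" using U(4) nm unfolding H(2) by linarith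
  have n1U: "n1 <= card (verts H)" using M(1) U(2) H(1) by simp
  have "\<exists>S hue. (\<forall>v. hue v < r) & S \<subseteq> verts H & card S = r & edges H \<subseteq> jedges (verts H) r S hue"
   by (rule n1[rule_format, OF rH n1U fH]) (use dense bigU U(2) in \<open>simp_all add: H(1)\<close>)
  then obtain S hue where S: "\<forall>v. hue v < r" "S \<subseteq> U" "card S = r" "edges H \<subseteq> jedges U r S hue"
   unfolding H(1) by (elim exE conjE)
  have finJ: "finite (jedges U r S hue)"
   by (rule finite_subset[OF jedges_subset finite_imp_finite_nsets[OF finU]])
  have c1: "card (edges H) <= card (jedges U r S hue)" by (rule card_mono[OF finJ S(4)])
  have "card (jedges U r S hue) <= join_size r (card U)"
   by (rule card_jedges_le(1)[OF _ finU S(2,3) S(1)[rule_format]]) (use r M(1) U(2) in auto)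
  then have c2: "card (jedges U r S hue) <= join_size r m" using U(2) by simp
  have "rcard (edges H) <= real (join_size r m)" using c1 c2 by simp
  \<comment> \<open>A join leaves no surplus, so no vertex was deleted.\<close>
  then have "(real n - real m) * s <= 0" using U(4) unfolding H(2) by linarith
  then have "n = m" using s0 mn by (simp add: mult_le_0_iff)
  then have UV: "U = ?V" using U(1,2) fin(1) by (intro card_subset_eq) (auto simp: n_def)
  have HG: "edges H = edges G" using all by (simp only: H UV)
  have cc: "join_size r m <= card (edges H)" using bigU by simp
  have "edges H = jedges U r S hue"
   by (rule card_seteq[OF finJ S(4)]) (use c2 cc in linarith)
  then show "\<exists>S hue. (\<forall>v. hue v < r) & S \<subseteq> ?V & card S = r & edges G = jedges ?V r S hue \<and>
   card (edges G) = join_size r (card ?V)"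
   using S c1 c2 cc HG UV U(2) by (intro exI[of _ S] exI[of _ hue]) (simp add: le_antisym)
 qed
qed

section \<open>Uniqueness and stability of the extremal graph\<close>

text \<open>Balance is expressed by the edge count: once there are at least \<open>2 * r\<close>
  vertices, the equality case of \<open>prod_le_bal\<close> fixes the class sizes up to
  order.\<close>

definition is_join :: "nat => 'a hypergraph => 'a set => ('a => nat) => bool" where
 "is_join r G S hue \<longleftrightarrow> finite (verts G) & (\<forall>v. hue v < r) & S \<subseteq> verts G & card S = r \<and>
   edges G = jedges (verts G) r S hue & card (edges G) = join_size r (card (verts G))"

lemma rgraph_join: "is_join r G S hue ==> rgraph r G"
 by (simp add: is_join_def rgraph_def jedges_subset)

lemma joinD:
 assumes "is_join r G S hue"
 shows "finite (verts G)" "hue v < r" "S \<subseteq> verts G" "card S = r" "edges G = jedges (verts G) r S hue"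
  "card (edges G) = join_size r (card (verts G))"
 using assms unfolding is_join_def by blast+

lemma card_join: "is_join r G S hue ==> card (jedges (verts G) r S hue) = join_size r (card (verts G))"
 using joinD(5,6)[of r G S hue] by simp

lemma sum_balanced:
 fixes m :: nat
 shows "0 < r ==> (\<Sum>i<r. (m + i) div r) = m"
proof (induction m)
 case 0
 then show ?case by simp
next
 case (Suc m)
 obtain p where p: "r = Suc p" using Suc.prems by (cases r) auto
 define f where "f = (%i. (m + i) div r)"
 have "m = f 0 + (\<Sum>i<p. f (Suc i))"
 proof -
  have "(\<Sum>i<r. f i) = f 0 + (\<Sum>i<p. f (Suc i))" unfolding p by (rule sum.lessThan_Suc_shift)
  then show ?thesis using Suc.IH[OF Suc.prems] by (simp only: f_def)
 qed
 moreover have "(\<Sum>i<r. (Suc m + i) div r) = (\<Sum>i<p. f (Suc i)) + f r"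
 proof -
  have "(\<Sum>i<r. (Suc m + i) div r) = (\<Sum>i<Suc p. f (Suc i))" unfolding f_def p by simp
  then show ?thesis by (simp add: p)
 qed
 moreover have "f r = Suc (f 0)" using Suc.prems by (simp add: f_def)
 ultimately show ?case by linarith
qed

lemma ex_colouring_with_class_sizes:
 fixes b :: "nat => nat"
 assumes "finite U" "0 < r" "(\<Sum>k<r. b k) = card U"
 shows "\<exists>hue. (\<forall>v. hue v < r) & (\<forall>k<r. card {v \<in> U. hue v = k} = b k)"
 using assms
proof (induction U arbitrary: b)
 case empty
 then show ?case by (intro exI[of _ "%_. 0"]) auto
next
 case (insert x U)
 have "(\<Sum>k<r. b k) ~= 0" using insert by simp
 then obtain k where k: "k < r" "b k ~= 0" by auto
 have "(\<Sum>j<r. b j) = b k + (\<Sum>j\<in>{..<r} - {k}. b j)" by (rule sum.remove) (use k in auto)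
 moreover have "(\<Sum>j<r. (b(k := b k - 1)) j) = (b(k := b k - 1)) k + (\<Sum>j\<in>{..<r} - {k}. (b(k := b k - 1)) j)"
  by (rule sum.remove) (use k in auto)
 moreover have "(\<Sum>j\<in>{..<r} - {k}. (b(k := b k - 1)) j) = (\<Sum>j\<in>{..<r} - {k}. b j)" by (rule sum.cong) auto
 ultimately have s: "(\<Sum>j<r. (b(k := b k - 1)) j) = card U" using insert k by simp
 obtain hue where hue: "\<forall>v. hue v < r" "\<forall>j<r. card {v \<in> U. hue v = j} = (b(k := b k - 1)) j"
  using insert.IH[OF insert.prems(1) s] by (elim exE conjE)
 have "card {v \<in> insert x U. (hue(x := k)) v = j} = b j" if j: "j < r" for j
 proof (cases "j = k")
  case True
  have "{v \<in> insert x U. (hue(x := k)) v = j} = insert x {v \<in> U. hue v = j}" using True insert.hyps(2) by auto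
  then have "card {v \<in> insert x U. (hue(x := k)) v = j} = Suc (card {v \<in> U. hue v = j})"
   using insert.hyps by simp
  then show ?thesis using hue(2) j True k by simp
 next
  case False
  have "{v \<in> insert x U. (hue(x := k)) v = j} = {v \<in> U. hue v = j}" using False insert.hyps(2) by auto
  then show ?thesis using hue(2) j False by simp
 qed
 then show ?case using hue(1) k(1) by (intro exI[of _ "hue(x := k)"] conjI allI impI) auto
qed

text \<open>Each class keeps as many vertices as its target permits, and the rest is distributed by
  need. The truncated differences add up to the number of vertices that may change.\<close>

lemma ex_recolouring_with_class_sizes:
 fixes b :: "nat => nat"
 assumes U: "finite U" and r: "0 < r" and b: "(\<Sum>k<r. b k) = card U" and hue: "\<And>v. hue v < r"
 shows "\<exists>hue'. (\<forall>v. hue' v < r) & (\<forall>k<r. card {v \<in> U. hue' v = k} = b k) \<and>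
  card {v \<in> U. hue' v ~= hue v} <= (\<Sum>k<r. b k - card {v \<in> U. hue v = k})"
proof -
 let ?a = "%k. card {v \<in> U. hue v = k}"
 have "\<forall>k. \<exists>C. C \<subseteq> {v \<in> U. hue v = k} & card C = min (?a k) (b k)"
  by (meson obtain_subset_with_card_n min.cobounded1)
 then obtain C where C: "\<And>k. C k \<subseteq> {v \<in> U. hue v = k}" "\<And>k. card (C k) = min (?a k) (b k)" by metis
 have finC: "finite (C k)" for k by (rule finite_subset[OF C(1)]) (use U in simp)
 have Cx: "v \<in> U & hue v = k" if "v \<in> C k" for v k using C(1) that by blast
 define W where "W = U - (\<Union>k<r. C k)"
 have cC: "card (\<Union>k<r. C k) = (\<Sum>k<r. min (?a k) (b k))"
 proof -
  have "card (\<Union>k\<in>{..<r}. C k) = (\<Sum>k<r. card (C k))"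
   by (rule card_UN_disjoint) (use finC C(1) in \<open>auto, blast\<close>)
  then show ?thesis by (simp only: C(2))
 qed
 have sub: "(\<Union>k<r. C k) \<subseteq> U" using C(1) by blast
 have "card W + card (\<Union>k<r. C k) = card U"
  unfolding W_def using card_Diff_subset[OF _ sub] card_mono[OF U sub] finC by simp
 moreover have "(\<Sum>k<r. b k - ?a k) + (\<Sum>k<r. min (?a k) (b k)) = (\<Sum>k<r. b k)"
  unfolding sum.distrib[symmetric] by (rule sum.cong) auto
 ultimately have cW: "(\<Sum>k<r. b k - ?a k) = card W" using cC b by linarith
 have finW: "finite W" using U by (simp add: W_def)
 obtain \<psi> where \<psi>: "\<forall>v. \<psi> v < r" "\<forall>k<r. card {v \<in> W. \<psi> v = k} = b k - ?a k"
  using ex_colouring_with_class_sizes[OF finW r cW] by (elim exE conjE)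
 define hue' where "hue' = (%v. if v \<in> W then \<psi> v else hue v)"
 have "card {v \<in> U. hue' v = k} = b k" if k: "k < r" for k
 proof -
  have "{v \<in> U. hue' v = k} = C k Un {v \<in> W. \<psi> v = k}"
   using k hue by (auto simp: hue'_def W_def dest: Cx) (metis Cx)
  moreover have "card (C k Un {v \<in> W. \<psi> v = k}) = card (C k) + card {v \<in> W. \<psi> v = k}"
   by (rule card_Un_disjoint) (use finC finW k in \<open>auto simp: W_def\<close>)
  ultimately show ?thesis using C(2) \<psi>(2) k by simp
 qed
 moreover have "card {v \<in> U. hue' v ~= hue v} <= card W" by (rule card_mono[OF finW]) (auto simp: hue'_def)
 moreover have "hue' v < r" for v using \<psi>(1) hue by (simp add: hue'_def)
 ultimately show ?thesis unfolding cW by (intro exI[of _ hue']) simp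
qed

lemma is_joinI:
 assumes r: "0 < r" and G: "finite (verts G)" "edges G = jedges (verts G) r S hue" and hue: "\<And>v. hue v < r"
  and S: "S \<subseteq> verts G" "card S = r"
  and sz: "\<And>k. k < r ==> card {v \<in> verts G - S. hue v = k} = (card (verts G) - r + k) div r"
 shows "is_join r G S hue"
proof -
 have "(\<Prod>k<r. card {v \<in> verts G - S. hue v = k}) = bal r (card (verts G) - r)"
  unfolding bal_def by (rule prod.cong) (use sz in auto)
 then have "card (edges G) = join_size r (card (verts G))"
  unfolding G(2) card_jedges[OF G(1) S(1)] S(2) join_size_def by simp
 then show ?thesis using assms by (simp add: is_join_def)
qed

lemma ex_join:
 assumes r: "0 < r" and V: "finite V" "r <= card V"
 shows "\<exists>S hue. is_join r \<lparr>verts = V, edges = jedges V r S hue\<rparr> S hue"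
proof -
 obtain S where S: "S \<subseteq> V" "card S = r" using obtain_subset_with_card_n[OF V(2)] by blast
 have c: "card (V - S) = card V - r" using S V finite_subset by (subst card_Diff_subset) auto
 have U: "finite (V - S)" using V by simp
 have s: "(\<Sum>k<r. (card V - r + k) div r) = card (V - S)" unfolding c by (rule sum_balanced[OF r])
 obtain hue where hue: "\<forall>v. hue v < r" "\<forall>k<r. card {v \<in> V - S. hue v = k} = (card V - r + k) div r"
  using ex_colouring_with_class_sizes[OF U r s] by (elim exE conjE)
 have "is_join r \<lparr>verts = V, edges = jedges V r S hue\<rparr> S hue"
  by (rule is_joinI[OF r]) (use V S hue in auto)
 then show ?thesis by blast
qed

lemma join_class_sizes:
 assumes r: "0 < r" and G: "is_join r G S hue" and n: "2 * r <= card (verts G)" and k: "k < r"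
 shows "card {v \<in> verts G - S. hue v = k} = (card (verts G) - r) div r \<or>
  card {v \<in> verts G - S. hue v = k} = (card (verts G) - r) div r + 1"
 by (rule card_jedges_le(2)[OF r joinD(1,3,4,2)[OF G] n card_join[OF G] k])

lemma card_large_classes:
 assumes r: "0 < r" and G: "is_join r G S hue" and n: "2 * r <= card (verts G)"
 shows "card {k. k < r & card {v \<in> verts G - S. hue v = k} = (card (verts G) - r) div r + 1} = (card (verts G) - r) mod r"
proof -
 define q where "q = (card (verts G) - r) div r"
 define K where "K = {k. k < r & card {v \<in> verts G - S. hue v = k} = q + 1}"
 have G': "finite (verts G)" "\<forall>v. hue v < r" "S \<subseteq> verts G" "card S = r" using G by (auto simp: is_join_def)
 have "card (verts G - S) = card (verts G) - r" using G' finite_subset by (subst card_Diff_subset) auto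
 then have "card (verts G) - r = (\<Sum>k<r. card {v \<in> verts G - S. hue v = k})"
  using sum_class_sizes[of "verts G - S" hue r] G' by simp
 also have "... = (\<Sum>k<r. q + (if k \<in> K then 1 else 0))"
  by (rule sum.cong) (use join_class_sizes[OF r G n] in \<open>auto simp: K_def q_def\<close>)
 also have "... = r * q + (\<Sum>k<r. if k \<in> K then 1 else 0)" by (simp add: sum.distrib)
 also have "(\<Sum>k<r. if k \<in> K then 1 else (0 :: nat)) = card K"
 proof -
  have "{..<r} Int {k. k \<in> K} = K" by (auto simp: K_def)
  then show ?thesis by (simp add: sum.If_cases)
 qed
 finally have "card K = card (verts G) - r - r * q" by simp
 then show ?thesis by (simp add: K_def q_def minus_mult_div_eq_mod)
qed

text \<open>Both graphs have the same number of classes of each size, so some permutation of colours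
  matches them and lifts to the vertices. Mapping edges into edges suffices, as the edge counts
  agree.\<close>

lemma joins_isomorphic:
 fixes G :: "'a hypergraph" and G' :: "'b hypergraph"
 assumes r: "0 < r" and G: "is_join r G S hue" and G': "is_join r G' S' hue'"
  and c: "card (verts G) = card (verts G')" and n: "2 * r <= card (verts G)"
 shows "hyp_iso G G'"
proof -
 let ?V = "verts G" and ?V' = "verts G'"
 define q where "q = (card ?V - r) div r"
 define cl where "cl = (%k. {v \<in> ?V - S. hue v = k})"
 define cl' where "cl' = (%k. {v \<in> ?V' - S'. hue' v = k})"
 have n': "2 * r <= card ?V'" using n c by simp
 have H: "finite ?V" "\<forall>v. hue v < r" "S \<subseteq> ?V" "card S = r" "edges G = jedges ?V r S hue" "card (edges G) = join_size r (card ?V)"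
  using G by (auto simp: is_join_def)
 have H': "finite ?V'" "\<forall>v. hue' v < r" "S' \<subseteq> ?V'" "card S' = r" "edges G' = jedges ?V' r S' hue'" "card (edges G') = join_size r (card ?V')"
  using G' by (auto simp: is_join_def)
 have sz: "card (cl k) = q \<or> card (cl k) = q + 1" if "k < r" for k
  using join_class_sizes[OF r G n that] by (simp add: q_def cl_def)
 have sz': "card (cl' k) = q \<or> card (cl' k) = q + 1" if "k < r" for k
  using join_class_sizes[OF r G' n' that] by (simp add: q_def cl'_def c)
 define K where "K = {k. k < r & card (cl k) = q + 1}"
 define K' where "K' = {k. k < r & card (cl' k) = q + 1}"
 have cK: "card K = card K'"
  using card_large_classes[OF r G n] card_large_classes[OF r G' n'] by (simp add: K_def K'_def cl_def cl'_def q_def c)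
 have sub: "K \<subseteq> {..<r}" "K' \<subseteq> {..<r}" by (auto simp: K_def K'_def)
 have finK: "finite K" "finite K'" using sub finite_subset by auto
 obtain g where g: "bij_betw g K K'" using finite_same_card_bij[OF finK cK] by blast
 have cK2: "card ({..<r} - K) = card ({..<r} - K')"
  using card_Diff_subset[OF finK(1) sub(1)] card_Diff_subset[OF finK(2) sub(2)] cK by simp
 obtain h where h: "bij_betw h ({..<r} - K) ({..<r} - K')" using finite_same_card_bij[OF _ _ cK2] by auto
 define \<pi> where "\<pi> = (%k. if k \<in> K then g k else h k)"
 have "bij_betw \<pi> (K Un ({..<r} - K)) (K' Un ({..<r} - K'))"
  unfolding \<pi>_def by (rule bij_betw_disjoint_Un[OF g h]) auto
 then have \<pi>: "bij_betw \<pi> {..<r} {..<r}" using sub by (simp add: Un_absorb1)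
 have \<pi>r: "\<pi> k < r" if "k < r" for k using bij_betw_apply[OF \<pi>, of k] that by simp
 have \<pi>sz: "card (cl k) = card (cl' (\<pi> k))" if k: "k < r" for k
 proof (cases "k \<in> K")
  case True
  then have "\<pi> k \<in> K'" using bij_betw_apply[OF g, of k] by (simp add: \<pi>_def)
  then show ?thesis using True by (simp add: K_def K'_def)
 next
  case False
  then have "\<pi> k \<in> {..<r} - K'" using bij_betw_apply[OF h, of k] k by (simp add: \<pi>_def)
  then show ?thesis using False k sz[OF k] sz'[of "\<pi> k"] by (auto simp: K_def K'_def)
 qed
 have fcl: "finite (cl k)" "finite (cl' k)" for k using H(1) H'(1) by (simp_all add: cl_def cl'_def)
 have "\<forall>k. \<exists>F. k < r --> bij_betw F (cl k) (cl' (\<pi> k))"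
  using finite_same_card_bij[OF fcl \<pi>sz] by blast
 then obtain F where F: "\<And>k. k < r ==> bij_betw (F k) (cl k) (cl' (\<pi> k))" by metis
 have finS: "finite S" "finite S'" using H(1,3) H'(1,3) finite_subset by auto
 obtain fS where fS: "bij_betw fS S S'" using finite_same_card_bij[OF finS] H(4) H'(4) by auto
 define g0 where "g0 = (%v. F (hue v) v)"
 have g0cl: "g0 v \<in> cl' (\<pi> (hue v))" if "v \<in> ?V - S" for v
  using bij_betw_apply[OF F[of "hue v"], of v] H(2) that by (simp add: g0_def cl_def)
 have inj: "inj_on g0 (?V - S)"
 proof (rule inj_onI)
  fix v w assume vw: "v \<in> ?V - S" "w \<in> ?V - S" "g0 v = g0 w"
  have "\<pi> (hue v) = \<pi> (hue w)" using g0cl[OF vw(1)] g0cl[OF vw(2)] vw(3) by (simp add: cl'_def)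
  then have e: "hue v = hue w" using inj_onD[OF bij_betw_imp_inj_on[OF \<pi>]] H(2) by simp
  show "v = w"
   by (rule inj_onD[OF bij_betw_imp_inj_on[OF F[of "hue v"]]]) (use vw H(2) e in \<open>auto simp: g0_def cl_def\<close>)
 qed
 have im: "g0 ` (?V - S) = ?V' - S'"
 proof (rule card_subset_eq)
  show "g0 ` (?V - S) \<subseteq> ?V' - S'" using g0cl by (auto simp: cl'_def)
  show "card (g0 ` (?V - S)) = card (?V' - S')"
   unfolding card_image[OF inj] using card_Diff_subset[OF finS(1) H(3)] card_Diff_subset[OF finS(2) H'(3)] c H(4) H'(4) by simp
 qed (use H' in simp)
 define f where "f = (%v. if v \<in> S then fS v else g0 v)"
 have "bij_betw f (S Un (?V - S)) (S' Un (?V' - S'))"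
  unfolding f_def by (rule bij_betw_disjoint_Un[OF fS]) (use inj im in \<open>auto simp: bij_betw_def\<close>)
 then have f: "bij_betw f ?V ?V'" using H(3) H'(3) by (simp add: Un_absorb1)
 have injf: "inj_on f ?V" using f by (rule bij_betw_imp_inj_on)
 have fS': "f v \<in> S'" if "v \<in> S" for v using bij_betw_apply[OF fS that] that by (simp add: f_def)
 have fc: "hue' (f v) = \<pi> (hue v)" "f v \<in> ?V' - S'" if "v \<in> ?V - S" for v
  using g0cl[OF that] that by (simp_all add: f_def cl'_def)
 have nE: "edges G \<subseteq> nsets ?V r" "edges G' \<subseteq> nsets ?V' r" unfolding H(5) H'(5) by (rule jedges_subset)+
 have "(`) f ` edges G \<subseteq> edges G'"
 proof (rule image_subsetI)
  fix e assume e: "e \<in> edges G"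
  have eV: "e \<subseteq> ?V" "finite e" "card e = r" using nE(1) e by (auto simp: nsets_def)
  have fe: "f ` e \<subseteq> ?V'" using f eV(1) by (auto simp: bij_betw_def)
  have ce: "card (f ` e) = r" using card_image[OF inj_on_subset[OF injf eV(1)]] eV(3) by simp
  have ne: "f ` e \<in> nsets ?V' r" using fe ce eV(2) by (simp add: nsets_def)
  show "f ` e \<in> edges G'"
  proof (cases "e Int S = {}")
   case False
   then have "f ` e Int S' ~= {}" using fS' by auto
   then show ?thesis using ne H'(5) by (simp add: jedges_def)
  next
   case True
   then have t: "hue ` e = {..<r}" "e \<subseteq> ?V - S" using e H(5) eV(1) by (auto simp: jedges_def tedges_def)
   have "hue' ` (f ` e) = \<pi> ` (hue ` e)" unfolding image_image by (rule image_cong) (use fc t(2) in auto)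
   then have "hue' ` (f ` e) = {..<r}" using t(1) \<pi> by (simp add: bij_betw_def)
   moreover have "f ` e \<in> nsets (?V' - S') r" using fc(2) t(2) ce eV(2) by (auto simp: nsets_def)
   ultimately show ?thesis using H'(5) by (simp add: jedges_def tedges_def)
  qed
 qed
 moreover have "card ((`) f ` edges G) = card (edges G')"
 proof -
  have "edges G \<subseteq> Pow ?V" using nE(1) by (auto simp: nsets_def)
  then have "inj_on ((`) f) (edges G)" using inj_on_subset[OF inj_on_image_Pow[OF injf]] by blast
  then show ?thesis using card_image[of "(`) f" "edges G"] H(6) H'(6) c by simp
 qed
 moreover have "finite (edges G')" using nE(2) finite_imp_finite_nsets[OF H'(1)] finite_subset by blast
 ultimately have "(`) f ` edges G = edges G'" by (intro card_subset_eq)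
 then show ?thesis using f by (auto simp: hyp_iso_def)
qed

text \<open>Joins are free by \<open>join_free\<close>, and by \<open>exactness\<close> a large free
  graph with at least as many edges is itself a join.\<close>

lemma extremal_iff_join:
 assumes r: "2 <= r"
 shows "\<exists>n0. \<forall>n\<ge>n0. turan_number r (pattern r t) n = join_size r n \<and>
  (\<forall>H :: nat hypergraph. extremal r (pattern r t) n H \<longleftrightarrow> card (verts H) = n & (\<exists>S hue. is_join r H S hue))"
proof -
 obtain n0 where n0: "\<forall>G :: nat hypergraph. rgraph r G --> n0 <= card (verts G) --> hyp_free (pattern r t) G -->
  join_size r (card (verts G)) <= card (edges G) -->
  (\<exists>S hue. (\<forall>v. hue v < r) & S \<subseteq> verts G & card S = r & edges G = jedges (verts G) r S hue \<and>
   card (edges G) = join_size r (card (verts G)))"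
  using exactness[OF r, of t] by (elim exE)
 have free: "hyp_free (pattern r t) H" if "is_join r H S hue" for H :: "nat hypergraph" and S hue
 proof (rule join_free[OF r])
  show "finite S" using that finite_subset by (auto simp: is_join_def)
  show "card S <= r" "edges H \<subseteq> jedges (verts H) r S hue" using that by (simp_all add: is_join_def)
 qed
 show ?thesis
 proof (intro exI[of _ "n0 + r"] allI impI)
  fix n assume n: "n0 + r <= n"
  let ?A = "{card (edges H) | H :: nat hypergraph. rgraph r H & card (verts H) = n & hyp_free (pattern r t) H}"
  have join: "\<exists>S hue. is_join r H S hue"
   if H: "rgraph r H" "card (verts H) = n" "hyp_free (pattern r t) H" "join_size r n <= card (edges H)" for H :: "nat hypergraph"
  proof -
   have c: "n0 <= card (verts H)" "join_size r (card (verts H)) <= card (edges H)" using H n by simp_all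
   obtain S hue where "(\<forall>v. hue v < r) & S \<subseteq> verts H & card S = r & edges H = jedges (verts H) r S hue \<and>
    card (edges H) = join_size r (card (verts H))"
    using n0[rule_format, OF H(1) c(1) H(3) c(2)] by (elim exE)
   moreover have "finite (verts H)" using H(1) by (simp add: rgraph_def)
   ultimately show ?thesis unfolding is_join_def by blast
  qed
  have le: "card (edges H) <= join_size r n"
   if H: "rgraph r H" "card (verts H) = n" "hyp_free (pattern r t) H" for H :: "nat hypergraph"
  proof (cases "join_size r n <= card (edges H)")
   case True
   then show ?thesis using join[OF H True] H(2) by (auto simp: is_join_def)
  qed simp
  have fin: "finite ?A" by (rule finite_subset[of _ "{..join_size r n}"]) (use le in auto)
  have r1: "0 < r" using r by simp
  have rn: "r <= card {..<n}" using n by simp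
  obtain S hue where J: "is_join r \<lparr>verts = {..<n}, edges = jedges {..<n} r S hue\<rparr> S hue" (is "is_join r ?J S hue")
   using ex_join[OF r1 finite_lessThan rn] by (elim exE)
  have turan: "turan_number r (pattern r t) n = join_size r n" unfolding turan_number_def
  proof (rule Max_eqI[OF fin])
   show "y <= join_size r n" if "y \<in> ?A" for y using that le by auto
   have "card (edges ?J) = join_size r n" using J by (simp add: is_join_def)
   moreover have "rgraph r ?J & card (verts ?J) = n & hyp_free (pattern r t) ?J"
    using free[OF J] rgraph_join[OF J] by simp
   ultimately show "join_size r n \<in> ?A" by (intro CollectI exI[of _ ?J]) simp
  qed
  moreover have "extremal r (pattern r t) n H \<longleftrightarrow> card (verts H) = n & (\<exists>S hue. is_join r H S hue)" for H :: "nat hypergraph"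
  proof
   assume "extremal r (pattern r t) n H"
   then have "rgraph r H" "card (verts H) = n" "hyp_free (pattern r t) H" "card (edges H) = join_size r n"
    using turan by (simp_all add: extremal_def)
   then show "card (verts H) = n & (\<exists>S hue. is_join r H S hue)" using join[of H] by simp
  next
   assume "card (verts H) = n & (\<exists>S hue. is_join r H S hue)"
   then obtain S hue where H: "card (verts H) = n" "is_join r H S hue" by (elim exE conjE)
   then show "extremal r (pattern r t) n H"
    using free[OF H(2)] rgraph_join[OF H(2)] turan joinD(6)[OF H(2)] by (simp add: extremal_def)
  qed
  ultimately show "turan_number r (pattern r t) n = join_size r n \<and>
   (\<forall>H :: nat hypergraph. extremal r (pattern r t) n H \<longleftrightarrow> card (verts H) = n & (\<exists>S hue. is_join r H S hue))" by blast
 qed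
qed

text \<open>Rebalancing the given colouring touches few vertices. An edge avoiding them and
  \<open>S\<close> is in the join exactly if it is transversal for the old colouring.\<close>

lemma ex_near_join:
 fixes G :: "'a hypergraph" and eps :: real
 assumes r: "0 < r" and V: "finite (verts G)" "2 * r <= card (verts G)" and E: "edges G \<subseteq> nsets (verts G) r"
  and hue: "\<And>v. hue v < r" and eps: "0 <= eps"
  and size: "\<And>k. k < r ==> (1 - eps) * (rcard (verts G) / real r) <= rcard {v \<in> verts G. hue v = k}"
 shows "\<exists>S hue' X. is_join r \<lparr>verts = verts G, edges = jedges (verts G) r S hue'\<rparr> S hue' \<and>
  finite X & rcard X <= eps * rcard (verts G) + real r * real r + real r \<and>
  (edges G - jedges (verts G) r S hue') Un (jedges (verts G) r S hue' - edges G) \<subseteq>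
  (edges G - tedges (verts G) r hue) Un (tedges (verts G) r hue - edges G) Un {e \<in> nsets (verts G) r. e Int X ~= {}}"
proof -
 let ?V = "verts G"
 define n where "n = rcard ?V"
 have "r <= card ?V" using V(2) by simp
 then obtain S where S: "S \<subseteq> ?V" "card S = r" using obtain_subset_with_card_n by blast
 have finS: "finite S" using S(1) V(1) finite_subset by blast
 have U: "finite (?V - S)" using V(1) by simp
 have cU: "card (?V - S) = card ?V - r" using card_Diff_subset[OF finS S(1)] S(2) by simp
 define b where "b = (%k. (card ?V - r + k) div r)"
 have sb: "(\<Sum>k<r. b k) = card (?V - S)" unfolding cU b_def by (rule sum_balanced[OF r])
 obtain hue' where hue': "\<forall>v. hue' v < r" "\<forall>k<r. card {v \<in> ?V - S. hue' v = k} = b k"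
  "card {v \<in> ?V - S. hue' v ~= hue v} <= (\<Sum>k<r. b k - card {v \<in> ?V - S. hue v = k})"
  using ex_recolouring_with_class_sizes[where hue = hue, OF U r sb hue] by (elim exE conjE)
 define X where "X = {v \<in> ?V - S. hue' v ~= hue v} Un S"
 have n0: "0 <= n" by (simp add: n_def)
 have "real (b k - card {v \<in> ?V - S. hue v = k}) <= eps * (n / real r) + real r" if k: "k < r" for k
 proof -
  have "real (b k) <= real (card ?V - r + k) / real r" unfolding b_def by (rule of_nat_div_le_of_nat)
  also have "... <= n / real r" unfolding n_def using k V(2) by (intro divide_right_mono) auto
  finally have 1: "real (b k) <= n / real r" .
  have "card {v \<in> ?V. hue v = k} - card S <= card ({v \<in> ?V. hue v = k} - S)" by (rule diff_card_le_card_Diff[OF finS])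
  also have "{v \<in> ?V. hue v = k} - S = {v \<in> ?V - S. hue v = k}" by blast
  finally have 2: "rcard {v \<in> ?V. hue v = k} <= rcard {v \<in> ?V - S. hue v = k} + real r" using S(2) by linarith
  have 3: "(1 - eps) * (n / real r) <= rcard {v \<in> ?V. hue v = k}" using size[OF k] by (simp only: n_def)
  have 4: "(1 - eps) * (n / real r) = n / real r - eps * (n / real r)" by (simp only: left_diff_distrib mult_1_left)
  have 5: "0 <= eps * (n / real r)" using eps n0 by simp
  show ?thesis using 1 2 3 4 5 by linarith
 qed
 then have "(\<Sum>k<r. real (b k - card {v \<in> ?V - S. hue v = k})) <= (\<Sum>k<r. eps * (n / real r) + real r)" by (intro sum_mono) auto
 also have "... = eps * n + real r * real r" using r by (simp add: algebra_simps)
 finally have "real (\<Sum>k<r. b k - card {v \<in> ?V - S. hue v = k}) <= eps * n + real r * real r" by (simp only: of_nat_sum)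
 moreover have "rcard {v \<in> ?V - S. hue' v ~= hue v} <= real (\<Sum>k<r. b k - card {v \<in> ?V - S. hue v = k})"
  using hue'(3) by (simp only: of_nat_le_iff)
 moreover have "card X <= card {v \<in> ?V - S. hue' v ~= hue v} + r" unfolding X_def S(2)[symmetric] by (rule card_Un_le)
 ultimately have cX: "rcard X <= eps * n + real r * real r + real r" by linarith
 have same: "hue' ` e = hue ` e" if "e \<subseteq> ?V" "e Int X = {}" for e
  by (rule image_cong) (use that in \<open>auto simp: X_def\<close>)
 have join: "is_join r \<lparr>verts = ?V, edges = jedges ?V r S hue'\<rparr> S hue'"
  by (rule is_joinI[OF r]) (use V S hue' in \<open>auto simp: b_def\<close>)
 have diff: "e \<in> (edges G - tedges ?V r hue) Un (tedges ?V r hue - edges G)"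
  if e: "e \<in> nsets ?V r" "e Int X = {}" "(e \<in> edges G) ~= (e \<in> jedges ?V r S hue')" for e
 proof -
  have eV: "e \<subseteq> ?V" using e(1) by (simp add: nsets_def)
  have eS: "e Int S = {}" using e(2) by (auto simp: X_def)
  have "e \<in> nsets (?V - S) r" using e(1) eS by (auto simp: nsets_def)
  then have "e \<in> jedges ?V r S hue' \<longleftrightarrow> e \<in> tedges ?V r hue"
   using e(1) eS same[OF eV e(2)] by (auto simp: jedges_def tedges_def)
  then show ?thesis using e(3) by blast
 qed
 have sub: "(edges G - jedges ?V r S hue') Un (jedges ?V r S hue' - edges G) \<subseteq>
  (edges G - tedges ?V r hue) Un (tedges ?V r hue - edges G) Un {e \<in> nsets ?V r. e Int X ~= {}}"
 proof
  fix e assume e: "e \<in> (edges G - jedges ?V r S hue') Un (jedges ?V r S hue' - edges G)"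
  have en: "e \<in> nsets ?V r" using e E jedges_subset[of ?V r S hue'] by blast
  have ne: "(e \<in> edges G) ~= (e \<in> jedges ?V r S hue')" using e by blast
  show "e \<in> (edges G - tedges ?V r hue) Un (tedges ?V r hue - edges G) Un {e \<in> nsets ?V r. e Int X ~= {}}"
  proof (cases "e Int X = {}")
   case True
   show ?thesis by (rule UnI1[OF diff[OF en True ne]])
  next
   case False
   then show ?thesis using en by simp
  qed
 qed
 have finX: "finite X" using V(1) finS by (simp add: X_def)
 show ?thesis using join finX cX sub unfolding n_def by (intro exI[of _ S] exI[of _ hue'] exI[of _ X] conjI)
qed

lemma extremal_graph_join:
 assumes "r <= n" "0 < r"
  and "\<forall>H :: nat hypergraph. extremal r F n H \<longleftrightarrow> card (verts H) = n & (\<exists>S hue. is_join r H S hue)"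
 shows "extremal r F n (extremal_graph r F n)" "card (verts (extremal_graph r F n)) = n"
  "\<exists>S hue. is_join r (extremal_graph r F n) S hue"
proof -
 have c: "r <= card {..<n}" using assms(1) by simp
 obtain S hue where J: "is_join r \<lparr>verts = {..<n}, edges = jedges {..<n} r S hue\<rparr> S hue"
  using ex_join[OF assms(2) finite_lessThan c] by (elim exE)
 then have "\<exists>S hue. is_join r \<lparr>verts = {..<n}, edges = jedges {..<n} r S hue\<rparr> S hue" by (intro exI)
 then have "extremal r F n \<lparr>verts = {..<n}, edges = jedges {..<n} r S hue\<rparr>"
  using assms(3) J by auto
 then show e: "extremal r F n (extremal_graph r F n)" unfolding extremal_graph_def by (rule someI)
 then show "card (verts (extremal_graph r F n)) = n" "\<exists>S hue. is_join r (extremal_graph r F n) S hue"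
  using assms(3)[rule_format, of "extremal_graph r F n"] by simp_all
qed

lemma stable_pattern:
 assumes r: "2 <= r"
 shows "stable_rgraph r (pattern r t)"
proof -
 have r1: "0 < r" using r by simp
 obtain n3 where n3: "\<forall>n\<ge>n3. turan_number r (pattern r t) n = join_size r n \<and>
  (\<forall>H :: nat hypergraph. extremal r (pattern r t) n H \<longleftrightarrow> card (verts H) = n & (\<exists>S hue. is_join r H S hue))"
  using extremal_iff_join[OF r, of t] by (elim exE)
 have tn: "turan_number r (pattern r t) n = join_size r n"
  and ex: "\<forall>H :: nat hypergraph. extremal r (pattern r t) n H \<longleftrightarrow> card (verts H) = n & (\<exists>S hue. is_join r H S hue)"
  if "n3 <= n" for n using n3 that by blast+
 have iso: "hyp_iso H H'" if n: "n3 + 2 * r <= n" and H: "extremal r (pattern r t) n H" "extremal r (pattern r t) n H'" for n and H H' :: "nat hypergraph"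
 proof -
  have n': "n3 <= n" using n by simp
  obtain S hue where S: "card (verts H) = n" "is_join r H S hue" using ex[OF n'] H(1) by blast
  obtain S' hue' where S': "card (verts H') = n" "is_join r H' S' hue'" using ex[OF n'] H(2) by blast
  show ?thesis by (rule joins_isomorphic[OF r1 S(2) S'(2)]) (use S S' n in auto)
 qed
 have part1: "\<exists>n0. \<forall>n\<ge>n0. (\<exists>H. extremal r (pattern r t) n H) \<and>
    (\<forall>H H'. extremal r (pattern r t) n H --> extremal r (pattern r t) n H' --> hyp_iso H H')"
 proof (intro exI[of _ "n3 + 2 * r"] allI impI conjI)
  fix n assume n: "n3 + 2 * r <= n"
  have "r <= n" "n3 <= n" using n by auto
  show "\<exists>H. extremal r (pattern r t) n H" using extremal_graph_join(1)[OF \<open>r <= n\<close> r1 ex[OF \<open>n3 <= n\<close>]] by (rule exI)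
 qed (rule iso)
 have part2: "\<exists>eps::real. eps > 0 & (\<exists>n0. \<forall>n\<ge>n0. \<forall>H :: nat hypergraph.
    rgraph r H --> card (verts H) = n --> hyp_free (pattern r t) H -->
    rcard (edges H) \<ge> (1 - eps) * real (turan_number r (pattern r t) n) -->
    (\<exists>H' :: nat hypergraph. verts H' = verts H & hyp_iso (extremal_graph r (pattern r t) n) H' \<and>
      rcard ((edges H - edges H') Un (edges H' - edges H)) <= \<eta> * real n ^ r))" if \<eta>: "\<eta> > 0" for \<eta> :: real
 proof -
  \<comment> \<open>\<open>eps * n\<close> is the main part of the exceptional set \<open>X\<close>,
    whose edges may use up half of \<open>\<eta>\<close>.\<close>
  define eps where "eps = min (1 / 2) (\<eta> / 4)"
  have eps: "0 < eps" "eps <= 1" "eps <= \<eta> / 4" using \<eta> by (auto simp: eps_def)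
  define q where "q = (1 - eps) * exp eps"
  have q: "q < 1" unfolding q_def by (rule one_minus_times_exp_less_one[OF eps(1,2)])
  \<comment> \<open>Bad edges contribute \<open>2 * \<omega>\<close> and missing ones
    \<open>\<omega>\<close>, together at most \<open>\<eta> / 2\<close>; the second bound makes the
    classes large.\<close>
  define \<omega> where "\<omega> = min (\<eta> / 6) ((1 - q) / (2 * real r ^ r))"
  have \<omega>: "0 < \<omega>" "\<omega> <= \<eta> / 6" "\<omega> <= (1 - q) / (2 * real r ^ r)" using \<eta> q r1 by (auto simp: \<omega>_def)
  obtain \<gamma> n1 where \<gamma>: "\<gamma> > 0" and n1: "\<forall>G :: nat hypergraph. rgraph r G --> n1 <= card (verts G) --> hyp_free (pattern r t) G -->
   (1 / real r ^ r - \<gamma>) * rcard (verts G) ^ r <= rcard (edges G) -->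
   (\<exists>hue. (\<forall>v. hue v < r) & max_cut G r hue \<and>
    (1 / real r ^ r - \<omega>) * rcard (verts G) ^ r <= rcard (edges G Int tedges (verts G) r hue))"
   using transversal_edges_of_dense[OF r \<omega>(1), of t] by (elim exE conjE)
  obtain n2 where n2: "\<forall>G :: nat hypergraph. rgraph r G --> n2 <= card (verts G) --> hyp_free (pattern r t) G -->
   rcard (edges G) <= (1 / real r ^ r + \<omega>) * rcard (verts G) ^ r"
   using density_upper[OF r \<omega>(1), of t] by (elim exE)
  have pos: "0 < \<gamma> / 2" "0 < \<eta> / 4" using \<gamma> \<eta> by auto
  have "\<forall>\<^sub>F n in sequentially. n1 + n2 + n3 + 4 * r <= n & 2 * real r ^ 2 < \<gamma> / 2 * real n & real r * real r + real r < \<eta> / 4 * real n"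
   using eventually_ge_at_top[of "n1 + n2 + n3 + 4 * r"] eventually_less_mult[OF pos(1)] eventually_less_mult[OF pos(2)]
   by (intro eventually_conj)
  then obtain n0 where n0: "\<And>n. n0 <= n ==> n1 + n2 + n3 + 4 * r <= n & 2 * real r ^ 2 < \<gamma> / 2 * real n & real r * real r + real r < \<eta> / 4 * real n"
   by (auto simp only: eventually_sequentially)
  \<comment> \<open>The deficit \<open>eps'\<close> and the lower-order loss in
    \<open>join_size_lower\<close> each cost at most \<open>\<gamma> / 2\<close>.\<close>
  define eps' where "eps' = min 1 (\<gamma> / 2)"
  have eps': "0 < eps'" "eps' <= 1" "eps' <= \<gamma> / 2" using \<gamma> by (auto simp: eps'_def)
  show ?thesis
  proof (intro exI[of _ eps'] conjI exI[of _ n0] allI impI)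
   fix m and H :: "nat hypergraph"
   assume m: "n0 <= m" and H: "rgraph r H" and c: "card (verts H) = m" and free: "hyp_free (pattern r t) H"
    and dense: "(1 - eps') * real (turan_number r (pattern r t) m) <= rcard (edges H)"
   define n where "n = real m"
   let ?V = "verts H"
   have N: "n1 + n2 + n3 + 4 * r <= m" "2 * real r ^ 2 < \<gamma> / 2 * n" "real r * real r + real r < \<eta> / 4 * n"
    using n0[OF m] by (simp_all add: n_def)
   have n: "0 < n" using N(1) r by (simp add: n_def)
   have m3: "n3 <= m" using N(1) by simp
   have fin: "finite ?V" "edges H \<subseteq> nsets ?V r" using H by (auto simp: rgraph_def)
   have finE: "finite (edges H)" using fin finite_imp_finite_nsets finite_subset by blast
   have "(1 / real r ^ r - 2 * real r ^ 2 / n) * n ^ r <= real (join_size r m)"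
    unfolding n_def by (rule join_size_lower[OF r]) (use N(1) in simp)
   then have j: "(1 - eps') * ((1 / real r ^ r - 2 * real r ^ 2 / n) * n ^ r) <= (1 - eps') * real (join_size r m)"
    using eps'(2) by (intro mult_left_mono) auto
   have "1 / real r ^ r - \<gamma> <= (1 - eps') * (1 / real r ^ r - 2 * real r ^ 2 / n)"
   proof -
    have "1 / real r ^ r <= 1" using r by (simp add: divide_le_eq)
    moreover have b0: "0 <= 2 * real r ^ 2 / n" using n by simp
    ultimately have "eps' * (1 / real r ^ r - 2 * real r ^ 2 / n) <= eps' * 1" using eps'(1) by (intro mult_left_mono) auto
    moreover have "2 * real r ^ 2 / n <= \<gamma> / 2" using N(2) n by (simp add: pos_divide_le_eq)
    ultimately show ?thesis using eps'(3) by (simp only: left_diff_distrib mult_1_left)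
   qed
   then have "(1 / real r ^ r - \<gamma>) * n ^ r <= (1 - eps') * (1 / real r ^ r - 2 * real r ^ 2 / n) * n ^ r"
    using n by (intro mult_right_mono) auto
   then have d: "(1 / real r ^ r - \<gamma>) * rcard ?V ^ r <= rcard (edges H)"
    using j dense tn[OF m3] by (simp add: c n_def mult.assoc)
   have n12: "n1 <= card ?V" "n2 <= card ?V" using N(1) c by auto
   obtain hue where hue: "\<forall>v. hue v < r" "(1 / real r ^ r - \<omega>) * n ^ r <= rcard (edges H Int tedges ?V r hue)"
    using n1[rule_format, OF H n12(1) free d] unfolding n_def c by (elim exE conjE)
   let ?T = "tedges ?V r hue"
   have finT: "finite ?T" by (rule finite_tedges[OF fin(1)])
   have V0: "?V ~= {}" using n c by (auto simp: n_def)
   have Tge: "(1 / real r ^ r - \<omega>) * n ^ r <= rcard ?T"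
    using hue(2) card_mono[OF finT, of "edges H Int ?T"] by simp
   have size: "(1 - eps) * (rcard ?V / real r) <= rcard {v \<in> ?V. hue v = k}" if "k < r" for k
   proof (rule class_size_lower[OF r1 eps(1,2) fin(1) V0 hue(1)[rule_format] _ that])
    have "(1 / real r ^ r - (1 - q) / (2 * real r ^ r)) * n ^ r <= (1 / real r ^ r - \<omega>) * n ^ r"
     using \<omega>(3) n by (intro mult_right_mono) auto
    then show "(1 / real r ^ r - (1 - (1 - eps) * exp eps) / (2 * real r ^ r)) * rcard ?V ^ r <= rcard ?T"
     using Tge unfolding q_def n_def c by linarith
   qed
   have c2: "2 * r <= card ?V" using N(1) c by simp
   have eps0: "0 <= eps" using eps(1) by simp
   have "\<exists>S hue' X. is_join r \<lparr>verts = ?V, edges = jedges ?V r S hue'\<rparr> S hue' \<and>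
     finite X & rcard X <= eps * rcard ?V + real r * real r + real r \<and>
     (edges H - jedges ?V r S hue') Un (jedges ?V r S hue' - edges H) \<subseteq>
     (edges H - ?T) Un (?T - edges H) Un {e \<in> nsets ?V r. e Int X ~= {}}"
    by (rule ex_near_join[OF r1 fin(1) c2 fin(2) hue(1)[rule_format] eps0 size])
   then obtain S hue' X where J: "is_join r \<lparr>verts = ?V, edges = jedges ?V r S hue'\<rparr> S hue'"
    and X: "finite X" "rcard X <= eps * rcard ?V + real r * real r + real r"
    and sub: "(edges H - jedges ?V r S hue') Un (jedges ?V r S hue' - edges H) \<subseteq>
     (edges H - ?T) Un (?T - edges H) Un {e \<in> nsets ?V r. e Int X ~= {}}"
    by (elim exE conjE)
   let ?H' = "\<lparr>verts = ?V, edges = jedges ?V r S hue'\<rparr>"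
   have "extremal r (pattern r t) m ?H'" using ex[OF m3] J c by auto
   moreover have "extremal r (pattern r t) m (extremal_graph r (pattern r t) m)"
    by (rule extremal_graph_join(1)[OF _ r1 ex[OF m3]]) (use N(1) in simp)
   ultimately have iso': "hyp_iso (extremal_graph r (pattern r t) m) ?H'" using iso[of m] N(1) by simp
   \<comment> \<open>All edges exceed the limiting density by at most \<open>\<omega>\<close>, and
     the transversal ones fall short of it by at most \<open>\<omega>\<close>.\<close>
   have HT: "rcard (edges H - ?T) <= 2 * \<omega> * n ^ r"
   proof -
    have "card (edges H - ?T) = card (edges H) - card (edges H Int ?T)" by (rule card_Diff_subset_Int) (use finE in simp)
    moreover have "card (edges H Int ?T) <= card (edges H)" by (rule card_mono[OF finE]) simp
    ultimately have "rcard (edges H - ?T) = rcard (edges H) - rcard (edges H Int ?T)" by simp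
    moreover have "rcard (edges H) <= (1 / real r ^ r + \<omega>) * n ^ r"
     using n2[rule_format, OF H n12(2) free] by (simp only: c n_def)
    ultimately have "rcard (edges H - ?T) <= (1 / real r ^ r + \<omega>) * n ^ r - (1 / real r ^ r - \<omega>) * n ^ r" using hue(2) by linarith
    then show ?thesis by (simp add: algebra_simps)
   qed
   have TH: "rcard (?T - edges H) <= \<omega> * n ^ r"
   proof -
    have "card (?T - edges H) = card ?T - card (edges H Int ?T)"
     using card_Diff_subset_Int[of ?T "edges H"] finT by (simp add: Int_commute)
    moreover have "card (edges H Int ?T) <= card ?T" by (rule card_mono[OF finT]) simp
    ultimately have "rcard (?T - edges H) = rcard ?T - rcard (edges H Int ?T)" by simp
    moreover have "rcard ?T <= (n / real r) ^ r" unfolding n_def c[symmetric]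
     by (rule card_tedges_le_power[OF r1 fin(1) hue(1)[rule_format]])
    ultimately have "rcard (?T - edges H) <= (n / real r) ^ r - (1 / real r ^ r - \<omega>) * n ^ r" using hue(2) by linarith
    also have "... = \<omega> * n ^ r" by (simp add: power_divide algebra_simps)
    finally show ?thesis .
   qed
   have XH: "rcard {e \<in> nsets ?V r. e Int X ~= {}} <= \<eta> / 2 * n ^ r"
   proof -
    have "card {e \<in> nsets ?V r. e Int X ~= {}} <= card X * card ?V ^ (r - 1)"
     by (rule card_meeting_le[OF fin(1) X(1)]) (use r in simp)
    then have "rcard {e \<in> nsets ?V r. e Int X ~= {}} <= rcard X * n ^ (r - 1)"
     unfolding n_def c[symmetric] by (simp only: of_nat_power[symmetric] of_nat_mult[symmetric] of_nat_le_iff)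
    also have "... <= (\<eta> / 2 * n) * n ^ (r - 1)"
    proof (rule mult_right_mono)
     have "eps * n <= \<eta> / 4 * n" using eps(3) n by (intro mult_right_mono) auto
     then show "rcard X <= \<eta> / 2 * n" using X(2) N(3) unfolding c n_def[symmetric] by linarith
    qed (use n in simp)
    also have "... = \<eta> / 2 * n ^ r" using power_minus_mult[OF r1, of n] by (simp add: mult_ac)
    finally show ?thesis .
   qed
   have "card ((edges H - edges ?H') Un (edges ?H' - edges H)) <= card ((edges H - ?T) Un (?T - edges H) Un {e \<in> nsets ?V r. e Int X ~= {}})"
    by (rule card_mono) (use sub finE finT finite_imp_finite_nsets[OF fin(1)] in auto)
   also have "... <= card (edges H - ?T) + card (?T - edges H) + card {e \<in> nsets ?V r. e Int X ~= {}}"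
    using card_Un_le[of "(edges H - ?T) Un (?T - edges H)" "{e \<in> nsets ?V r. e Int X ~= {}}"] card_Un_le[of "edges H - ?T" "?T - edges H"] by linarith
   finally have "rcard ((edges H - edges ?H') Un (edges ?H' - edges H)) <= 2 * \<omega> * n ^ r + \<omega> * n ^ r + \<eta> / 2 * n ^ r"
    using HT TH XH by linarith
   also have "... = (3 * \<omega>) * n ^ r + \<eta> / 2 * n ^ r" by simp
   also have "... <= (\<eta> / 2) * n ^ r + \<eta> / 2 * n ^ r" using \<omega>(2) n by (intro add_right_mono mult_right_mono) auto
   also have "... = \<eta> * n ^ r" by simp
   finally show "\<exists>H' :: nat hypergraph. verts H' = ?V & hyp_iso (extremal_graph r (pattern r t) m) H' \<and>
      rcard ((edges H - edges H') Un (edges H' - edges H)) <= \<eta> * real m ^ r"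
    using iso' unfolding n_def by (intro exI[of _ ?H'] conjI) simp_all
  qed (rule eps'(1))
 qed
 show ?thesis unfolding stable_rgraph_def using part1 part2 by blast
qed

section \<open>Lower bound for copies through a new edge\<close>

text \<open>The vertices of \<open>W1\<close> get their values in turn, and at most \<open>N\<close>
  values are taken at any time.\<close>

lemma card_inj_extensions:
 fixes A :: "'a => 'b set"
 assumes "finite W1" and W0: "finite W0" "inj_on \<beta> W0"
  and "W0 Int W1 = {}" "\<And>v. v \<in> W1 ==> finite (A v)" "card (W0 Un W1) <= N"
 shows "(\<Prod>v\<in>W1. card (A v) - N) <= card {\<phi> \<in> extensional (W0 Un W1).
  (\<forall>v\<in>W0. \<phi> v = \<beta> v) & (\<forall>v\<in>W1. \<phi> v \<in> A v) & inj_on \<phi> (W0 Un W1)}"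
 using assms(1,4-)
proof (induction W1)
 case empty
 define X where "X = {\<phi> \<in> extensional W0. (\<forall>v\<in>W0. \<phi> v = \<beta> v) & inj_on \<phi> W0}"
 have "X \<subseteq> (\<Pi>\<^sub>E v\<in>W0. {\<beta> v})"
 proof
  fix \<phi> assume "\<phi> \<in> X"
  then show "\<phi> \<in> (\<Pi>\<^sub>E v\<in>W0. {\<beta> v})" unfolding X_def PiE_iff by blast
 qed
 moreover have "finite (\<Pi>\<^sub>E v\<in>W0. {\<beta> v})" by (rule finite_PiE[OF W0(1)]) simp
 ultimately have "finite X" by (rule finite_subset)
 moreover have "restrict \<beta> W0 \<in> X" unfolding X_def
 proof (intro CollectI conjI ballI)
  show "inj_on (restrict \<beta> W0) W0" using W0(2) by (simp only: inj_on_restrict_eq)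
 qed simp_all
 ultimately have "0 < card X" by (auto simp only: card_gt_0_iff)
 then show ?case by (simp add: X_def Suc_le_eq)
next
 case (insert x W1)
 define X where "X = (%W1. {\<phi> \<in> extensional (W0 Un W1).
  (\<forall>v\<in>W0. \<phi> v = \<beta> v) & (\<forall>v\<in>W1. \<phi> v \<in> A v) & inj_on \<phi> (W0 Un W1)})"
 have finX: "finite (X U)" if "finite U" "W0 Int U = {}" "\<And>v. v \<in> U ==> finite (A v)" for U
 proof (rule finite_subset[OF _ finite_PiE[of "W0 Un U" "%v. if v \<in> W0 then {\<beta> v} else A v"]])
  show "X U \<subseteq> (\<Pi>\<^sub>E v\<in>W0 Un U. if v \<in> W0 then {\<beta> v} else A v)"
  proof
   fix \<phi> assume "\<phi> \<in> X U"
   then have "\<phi> \<in> extensional (W0 Un U)" "\<forall>v\<in>W0. \<phi> v = \<beta> v" "\<forall>v\<in>U. \<phi> v \<in> A v" by (simp_all add: X_def)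
   then show "\<phi> \<in> (\<Pi>\<^sub>E v\<in>W0 Un U. if v \<in> W0 then {\<beta> v} else A v)" unfolding PiE_iff by auto
  qed
 qed (use that W0 in auto)
 have x: "x \<notin> W0 Un W1" using insert by auto
 have cN: "card (W0 Un W1) <= N"
 proof -
  have "card (W0 Un W1) <= card (W0 Un insert x W1)" by (rule card_mono) (use insert.hyps(1) W0(1) in auto)
  then show ?thesis using insert.prems(3) by linarith
 qed
 have IH: "(\<Prod>v\<in>W1. card (A v) - N) <= card (X W1)"
  unfolding X_def by (rule insert.IH) (use insert.prems cN in auto)
 let ?D = "SIGMA \<phi>:X W1. A x - \<phi> ` (W0 Un W1)"
 have finX1: "finite (X W1)" by (rule finX) (use insert in auto)
 have "(\<Prod>v\<in>insert x W1. card (A v) - N) = (card (A x) - N) * (\<Prod>v\<in>W1. card (A v) - N)"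
  using insert.hyps by simp
 also have "... <= card (X W1) * (card (A x) - N)" using IH by (simp add: mult.commute)
 also have "... = (\<Sum>\<phi>\<in>X W1. card (A x) - N)" by simp
 also have "... <= (\<Sum>\<phi>\<in>X W1. card (A x - \<phi> ` (W0 Un W1)))"
 proof (rule sum_mono)
  fix \<phi> :: "'a => 'b"
  have "card (\<phi> ` (W0 Un W1)) <= N" using card_image_le[of "W0 Un W1" \<phi>] insert.hyps(1) W0(1) cN by auto
  then have "card (A x) - N <= card (A x) - card (\<phi> ` (W0 Un W1))" by simp
  also have "... <= card (A x - \<phi> ` (W0 Un W1))" by (rule diff_card_le_card_Diff) (use insert.hyps(1) W0(1) in auto)
  finally show "card (A x) - N <= card (A x - \<phi> ` (W0 Un W1))" .
 qed
 also have "... = card ?D" by (rule card_SigmaI[symmetric]) (use finX1 insert.prems in auto)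
 also have "... <= card (X (insert x W1))"
 proof (rule card_inj_on_le[where f = "%(\<phi>, a). \<phi>(x := a)"])
  show "inj_on (%(\<phi>, a). \<phi>(x := a)) ?D"
  proof (rule inj_onI, clarify)
   fix \<phi> a \<psi> b
   assume \<phi>: "\<phi> \<in> X W1" and \<psi>: "\<psi> \<in> X W1" and eq: "\<phi>(x := a) = \<psi>(x := b)"
   have ab: "a = b" using fun_cong[OF eq, of x] by simp
   have "\<phi> v = \<psi> v" for v
   proof (cases "v = x")
    case True
    have "\<phi> x = undefined" "\<psi> x = undefined" using \<phi> \<psi> x by (auto simp: X_def extensional_def)
    then show ?thesis using True by simp
   next
    case False
    then show ?thesis using fun_cong[OF eq, of v] by simp
   qed
   then have "\<phi> = \<psi>" by (rule ext)
   then show "\<phi> = \<psi> & a = b" using ab by (rule conjI)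
  qed
  show "(%(\<phi>, a). \<phi>(x := a)) ` ?D \<subseteq> X (insert x W1)"
  proof (rule image_subsetI, clarify)
   fix \<phi> a assume \<phi>: "\<phi> \<in> X W1" and a: "a \<in> A x" "a \<notin> \<phi> ` (W0 Un W1)"
   have inj: "inj_on \<phi> (W0 Un W1)" using \<phi> by (simp add: X_def)
   have "inj_on (\<phi>(x := a)) (insert x (W0 Un W1))"
    using inj a(2) x by (auto simp: inj_on_def)
   then have "inj_on (\<phi>(x := a)) (W0 Un insert x W1)" by simp
   then show "\<phi>(x := a) \<in> X (insert x W1)" using \<phi> a x by (auto simp: X_def extensional_def)
  qed
  show "finite (X (insert x W1))" by (rule finX) (use insert in auto)
 qed
 finally show ?case unfolding X_def .
qed

lemma join_nonedgeD:
 assumes r: "2 <= r" and G: "is_join r G S hue" and e: "e \<in> nsets (verts G) r - edges G"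
 shows "e Int S = {}" and "\<exists>y\<in>e. \<exists>y'\<in>e. y ~= y' & hue y = hue y'"
proof -
 have eV: "e \<subseteq> verts G" "finite e" "card e = r" using e by (auto simp: nsets_def)
 show eS: "e Int S = {}" using e joinD(5)[OF G] by (auto simp: jedges_def)
 have "e \<in> nsets (verts G - S) r" using eV eS by (auto simp: nsets_def)
 then have ne: "hue ` e ~= {..<r}" using e joinD(5)[OF G] by (auto simp: jedges_def tedges_def)
 have "\<not> inj_on hue e"
 proof
  assume "inj_on hue e"
  then have "card (hue ` e) = r" using card_image eV(3) by blast
  then have "hue ` e = {..<r}" using joinD(2)[OF G] by (intro card_subset_eq) auto
  then show False using ne by simp
 qed
 then show "\<exists>y\<in>e. \<exists>y'\<in>e. y ~= y' & hue y = hue y'" by (auto simp: inj_on_def)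
qed

text \<open>The vertices \<open>uvert i\<close> are mapped onto the dominating set \<open>S\<close> and one edge of the last block onto the new
 edge; then every other edge avoiding \<open>S\<close> can be made rainbow and the pendant vertices are free.\<close>

lemma copies_through_nonedge:
 fixes G :: "'a hypergraph"
 assumes r: "2 <= r" and G: "is_join r G S hue" and e: "e \<in> nsets (verts G) r - edges G"
  and a: "\<And>k. k < r ==> a <= card {v \<in> verts G - S. hue v = k}" and f: "f = card (verts (pattern r t))"
 shows "(a - f) ^ (card (core_part r) - 2 * r) * (card (verts G) - f) ^ card (pend_part r t)
  <= num_copies_at (pattern r t) (G\<lparr>edges := edges G Un {e}\<rparr>) e"
proof -
 let ?V = "verts G" and ?F = "pattern r t"
 note J = joinD[OF G]
 have finS: "finite S" using J(1,3) finite_subset by blast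
 have eV: "e \<subseteq> ?V" "finite e" "card e = r" using e by (auto simp: nsets_def)
 have eS: "e Int S = {}" by (rule join_nonedgeD(1)[OF r G e])
 obtain y y' where y: "y \<in> e" "y' \<in> e" "y ~= y'" "hue y = hue y'" using join_nonedgeD(2)[OF r G e] by blast
 define c where "c = hue y"
 define \<tau> where "\<tau> = (%x. if x = 0 then c else if x = c then 0 else x)"
 \<comment> \<open>Truncated subtraction gives cores 0 and 1 of a block the same colour and keeps
   all other pairs of cores distinct. In block \<open>r\<close> the colour 0 is exchanged with that
   of \<open>y\<close> and \<open>y'\<close>.\<close>
 define col where "col = (%i k. if i = r then \<tau> (k - 1) else k - (1 :: nat))"
 have cr: "c < r" using J(2) by (simp add: c_def)
 have \<tau>: "\<tau> x < r" if "x < r" for x using that cr r by (auto simp: \<tau>_def)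
 have \<tau>i: "\<tau> x = \<tau> x' \<longleftrightarrow> x = x'" for x x' by (auto simp: \<tau>_def)
 have col: "col i k < r" if "k <= r" for i k using \<tau>[of "k - 1"] that r by (auto simp: col_def)
 have coln: "col i k ~= col i l" if "k < l" "(k, l) ~= (0, 1)" for i k l using that by (auto simp: col_def \<tau>i)
 have col01: "col r 0 = c" "col r 1 = c" by (simp_all add: col_def \<tau>_def)
 define pc where "pc = (%i k l. SOME b. bij_betw b {..<r - 2} ({..<r} - {col i k, col i l}))"
 have pc: "bij_betw (pc i k l) {..<r - 2} ({..<r} - {col i k, col i l})" if kl: "k < l" "l <= r" "(k, l) ~= (0, 1)" for i k l
 proof -
  have ck: "card {col i k, col i l} = 2" "{col i k, col i l} \<subseteq> {..<r}" using kl coln[of k l i] col by auto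
  have "card ({..<r} - {col i k, col i l}) = r - 2" using card_Diff_subset[OF _ ck(2)] ck(1) by simp
  then have "\<exists>b. bij_betw b {..<r - 2} ({..<r} - {col i k, col i l})" by (intro finite_same_card_bij) simp_all
  then show ?thesis unfolding pc_def by (rule someI_ex)
 qed
 define cls where "cls = (%k. {v \<in> ?V - S. hue v = k})"
 \<comment> \<open>Pendant vertices and the private vertices of the pair (0,1) are unrestricted,
   because their edges meet \<open>S\<close> or are mapped onto \<open>e\<close>.\<close>
 define A where "A = (%v. case vx_dec v of (w, i, k, l, j) => if w = 0 then cls (col i k)
  else if w = 1 & (k, l) ~= (0, 1) then cls (pc i k l j) else ?V)"
 have A_core: "A (core i k) = cls (col i k)" for i k by (simp add: A_def core_def)
 have A_priv: "A (priv i k l j) = cls (pc i k l j)" if "(k, l) ~= (0, 1)" for i k l j using that by (simp add: A_def priv_def)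
 have A_pend: "A (pend i s j) = ?V" for i s j by (simp add: A_def pend_def)
 have AV: "A v \<subseteq> ?V" for v by (auto simp: A_def cls_def split: prod.split)
 have finA: "finite (A v)" for v by (rule finite_subset[OF AV J(1)])
 let ?U = "uvert ` {..<r}" and ?P = "pedge r r 0 1"
 define W0 where "W0 = ?U Un ?P"
 have finU: "finite ?U" "card ?U = r" by (simp_all add: card_image inj_on_def)
 obtain \<sigma> where \<sigma>: "bij_betw \<sigma> ?U S" using finite_same_card_bij[OF finU(1) finS] finU(2) J(4) by auto
 have cP: "card ?P = r" by (rule card_pedge) (use r in simp_all)
 have "\<exists>\<rho>. bij_betw \<rho> ?P e & \<rho> (core r 0) = y & \<rho> (core r 1) = y'"
 proof -
  have "card (?P - {core r 0, core r 1}) = card (e - {y, y'})"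
   using y eV cP by (simp add: card_Diff_subset)
  then obtain h where h: "bij_betw h (?P - {core r 0, core r 1}) (e - {y, y'})"
   using finite_same_card_bij[of "?P - {core r 0, core r 1}" "e - {y, y'}"] eV by auto
  define g where "g = (%v. if v = core r 0 then y else y')"
  have g: "bij_betw g {core r 0, core r 1} {y, y'}" using y(3) by (auto simp: g_def bij_betw_def)
  have "bij_betw (%v. if v \<in> {core r 0, core r 1} then g v else h v)
   ({core r 0, core r 1} Un (?P - {core r 0, core r 1})) ({y, y'} Un (e - {y, y'}))"
   by (rule bij_betw_disjoint_Un[OF g h]) auto
  moreover have "{core r 0, core r 1} Un (?P - {core r 0, core r 1}) = ?P" "{y, y'} Un (e - {y, y'}) = e" using y by auto
  ultimately have "bij_betw (%v. if v \<in> {core r 0, core r 1} then g v else h v) ?P e" by (simp only:)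
  then show ?thesis by (intro exI[of _ "%v. if v \<in> {core r 0, core r 1} then g v else h v"] conjI) (simp_all add: g_def)
 qed
 then obtain \<rho> where \<rho>: "bij_betw \<rho> ?P e" "\<rho> (core r 0) = y" "\<rho> (core r 1) = y'" by (elim exE conjE)
 define \<beta> where "\<beta> = (%v. if v \<in> ?U then \<sigma> v else \<rho> v)"
 have Pb: "?P \<subseteq> block r r" by (rule pedge_subset_block) (use r in auto)
 have Ub: "uvert i \<in> block r i" if "i < r" for i by (rule uvert_in_block[OF that r])
 have UP: "?U Int ?P = {}"
 proof -
  have "uvert i \<notin> ?P" if "i < r" for i using Ub[OF that] Pb block_disjoint[of i r r] that by auto
  then show ?thesis by auto
 qed
 have "bij_betw \<beta> (?U Un ?P) (S Un e)" unfolding \<beta>_def by (rule bij_betw_disjoint_Un[OF \<sigma> \<rho>(1) UP]) (use eS in auto)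
 then have \<beta>: "inj_on \<beta> W0" by (simp add: W0_def bij_betw_def)
 have finW0: "finite W0" by (simp add: W0_def)
 have cW0: "card W0 = 2 * r" unfolding W0_def using card_Un_disjoint[OF finU(1) finite_pedge UP] finU(2) cP by simp
 have W0c: "W0 \<subseteq> core_part r"
 proof -
  have "?U \<subseteq> core_part r" using Ub by (auto simp: core_part_def intro: less_imp_le)
  then show ?thesis using Pb by (auto simp: W0_def core_part_def)
 qed
 define W1 where "W1 = verts ?F - W0"
 have vF: "verts ?F = core_part r Un pend_part r t" by (rule verts_pattern)
 have finF: "finite (verts ?F)" by (rule finite_verts_pattern)
 have W01: "W0 Un W1 = verts ?F" using W0c vF by (auto simp: W1_def)
 let ?X = "{\<phi> \<in> extensional (W0 Un W1). (\<forall>v\<in>W0. \<phi> v = \<beta> v) & (\<forall>v\<in>W1. \<phi> v \<in> A v) & inj_on \<phi> (W0 Un W1)}"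
 have cX: "(\<Prod>v\<in>W1. card (A v) - f) <= card ?X"
  by (rule card_inj_extensions[OF _ finW0 \<beta>]) (use finF finA f W01 in \<open>auto simp: W1_def\<close>)
 have W1eq: "W1 = (core_part r - W0) Un pend_part r t"
  using W0c core_part_pend_part_disjoint[of r t] vF by (auto simp: W1_def)
 have "(\<Prod>v\<in>W1. card (A v) - f) = (\<Prod>v\<in>core_part r - W0. card (A v) - f) * (\<Prod>v\<in>pend_part r t. card (A v) - f)"
  unfolding W1eq by (rule prod.union_disjoint) (use core_part_pend_part_disjoint[of r t] in auto)
 moreover have "(\<Prod>v\<in>pend_part r t. card (A v) - f) = (\<Prod>v\<in>pend_part r t. card ?V - f)"
  by (rule prod.cong) (auto simp: pend_part_def A_pend)
 moreover have "(\<Prod>v\<in>core_part r - W0. a - f) <= (\<Prod>v\<in>core_part r - W0. card (A v) - f)"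
 proof (rule prod_mono, intro conjI)
  fix v assume v: "v \<in> core_part r - W0"
  have "a <= card (A v)"
  proof -
   have cl: "a <= card (cls k)" if "k < r" for k using a[OF that] by (simp add: cls_def)
   have aV: "a <= card ?V" using a[of 0] r card_mono[OF J(1), of "{v \<in> ?V - S. hue v = 0}"] by auto
   obtain i where i: "i <= r" "v \<in> block r i" using v by (auto simp: core_part_def)
   from i(2) consider k where "v = core i k" "k <= r" | k l j where "v = priv i k l j" "k < l" "l <= r" "j < r - 2"
    by (auto simp: block_def)
   then show ?thesis
   proof cases
    case 1
    then show ?thesis using A_core cl[OF col] by simp
   next
    case 2
    show ?thesis
    proof (cases "(k, l) = (0, 1)")
     case True
     then have "A v = ?V" using 2(1) by (simp add: A_def priv_def)
     then show ?thesis using aV by simp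
    next
     case False
     have "pc i k l j < r" using bij_betw_apply[OF pc[OF 2(2,3) False, of i], of j] 2(4) by simp
     then show ?thesis using 2(1) A_priv[OF False] cl by simp
    qed
   qed
  qed
  then show "a - f <= card (A v) - f" by simp
 qed simp
 moreover have "card (core_part r - W0) = card (core_part r) - 2 * r"
  using card_Diff_subset[OF finW0 W0c] cW0 by simp
 ultimately have low: "(a - f) ^ (card (core_part r) - 2 * r) * (card ?V - f) ^ card (pend_part r t) <= card ?X"
  using cX by (simp add: mult_le_mono1 order_trans[OF mult_le_mono1])
 let ?G = "G\<lparr>edges := edges G Un {e}\<rparr>"
 have "?X \<subseteq> {\<phi> \<in> copies ?F ?G. \<exists>e'\<in>edges ?F. \<phi> ` e' = e}"
 proof
  fix \<phi> assume \<phi>: "\<phi> \<in> ?X"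
  have ext: "\<phi> \<in> extensional (verts ?F)" and inj: "inj_on \<phi> (verts ?F)"
   and \<phi>0: "\<And>v. v \<in> W0 ==> \<phi> v = \<beta> v" and \<phi>1: "\<And>v. v \<in> verts ?F ==> v \<notin> W0 ==> \<phi> v \<in> A v"
   using \<phi> W01 by (auto simp: W1_def)
  have \<phi>U: "\<phi> v \<in> S" if "v \<in> ?U" for v using \<phi>0[of v] bij_betw_apply[OF \<sigma> that] that by (simp add: W0_def \<beta>_def)
  have \<phi>P: "\<phi> v = \<rho> v" if "v \<in> ?P" for v using \<phi>0[of v] that UP by (auto simp: W0_def \<beta>_def)
  have \<phi>e: "\<phi> ` ?P = e"
  proof -
   have "\<phi> ` ?P = \<rho> ` ?P" by (rule image_cong) (use \<phi>P in auto)
   then show ?thesis using \<rho>(1) by (simp add: bij_betw_def)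
  qed
  have \<phi>V: "\<phi> v \<in> ?V" if "v \<in> verts ?F" for v
  proof (cases "v \<in> W0")
   case True
   then show ?thesis using \<phi>U[of v] \<phi>e eV(1) J(3) by (auto simp: W0_def)
  next
   case False
   then show ?thesis using \<phi>1[OF that] AV by auto
  qed
  have Fr: "rgraph r ?F" by (rule rgraph_pattern[OF r])
  have nE: "\<phi> ` d \<in> nsets ?V r" if d: "d \<in> edges ?F" for d
  proof -
   have d': "d \<subseteq> verts ?F" "finite d" "card d = r" using Fr d by (auto simp: rgraph_def nsets_def)
   have "card (\<phi> ` d) = r" using card_image[OF inj_on_subset[OF inj d'(1)]] d'(3) by simp
   then show ?thesis using \<phi>V d' by (auto simp: nsets_def)
  qed
  have hit: "\<phi> ` d \<in> edges G" if d: "d \<in> edges ?F" "d Int ?U ~= {}" for d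
  proof -
   have "\<phi> ` d Int S ~= {}" using \<phi>U d(2) by blast
   then show ?thesis using nE[OF d(1)] J(5) by (simp add: jedges_def)
  qed
  have good: "\<phi> ` d \<in> edges ?G" if d: "d \<in> edges ?F" for d
  proof (cases "d Int ?U = {}")
   case False
   then show ?thesis using hit[OF d] by simp
  next
   case dU: True
   have "uvert 0 \<in> ?U" using r by (intro imageI) simp
   then have d_ne: "d ~= ?U" using dU by blast
   have d_tail: "d \<notin> tails r t"
   proof
    assume "d \<in> tails r t"
    then obtain i s where "i < r" "d = tail r i s" by (auto simp: tails_iff)
    then show False using dU by (auto simp: tail_def)
   qed
   have "d \<in> pedges r" using d d_ne d_tail by (simp add: edges_pattern)
   then obtain i k l where ikl: "i <= r" "k < l" "l <= r" "d = pedge r i k l" by (auto simp: pedges_iff)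
   show ?thesis
   proof (cases "(k, l) = (0, 1)")
    case True
    \<comment> \<open>In any other block this edge contains \<open>uvert i\<close>, contrary to
      \<open>dU\<close>.\<close>
    have "i = r"
    proof (rule ccontr)
     assume "i ~= r"
     then have "i < r" using ikl(1) by simp
     then show False using uvert_in_pedge[OF \<open>i < r\<close> r] True ikl(4) dU by auto
    qed
    then show ?thesis using True ikl(4) \<phi>e by simp
   next
    case False
    have dF: "d \<subseteq> verts ?F" using Fr d by (auto simp: rgraph_def nsets_def)
    have cc: "\<phi> (core i j) \<in> cls (col i j)" if j: "core i j \<in> d" for j
    proof (cases "core i j \<in> W0")
     case True
     then have "core i j \<in> ?P" using j dU by (auto simp: W0_def)
     then have ij: "i = r" "j = 0 \<or> j = 1" by (auto simp: pedge_def)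
     then have "\<phi> (core i j) = (if j = 0 then y else y')" using \<phi>P[OF \<open>core i j \<in> ?P\<close>] \<rho> by auto
     then show ?thesis using ij y eV(1) eS col01 by (auto simp: cls_def c_def)
    next
     case F: False
     then show ?thesis using \<phi>1[of "core i j"] dF j A_core by auto
    qed
    have cp: "\<phi> (priv i k l j) \<in> cls (pc i k l j)" if j: "j < r - 2" for j
    proof -
     have jd: "priv i k l j \<in> d" using ikl(4) j by (simp add: pedge_def)
     have "priv i k l j \<notin> W0" using jd dU False by (auto simp: W0_def pedge_def)
     then show ?thesis using \<phi>1[of "priv i k l j"] dF jd A_priv[OF False] by auto
    qed
    have kl: "core i k \<in> d" "core i l \<in> d" using ikl(4) by simp_all
    have deq: "d = {core i k, core i l} Un priv i k l ` {..<r - 2}" using ikl(4) by (simp add: pedge_def)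
    have "hue ` \<phi> ` d = {col i k, col i l} Un (%j. hue (\<phi> (priv i k l j))) ` {..<r - 2}"
     unfolding deq using cc[OF kl(1)] cc[OF kl(2)] by (auto simp: cls_def)
    also have "(%j. hue (\<phi> (priv i k l j))) ` {..<r - 2} = pc i k l ` {..<r - 2}"
     by (rule image_cong) (use cp in \<open>auto simp: cls_def\<close>)
    also have "pc i k l ` {..<r - 2} = {..<r} - {col i k, col i l}"
     using pc[OF ikl(2,3) False, of i] by (simp add: bij_betw_def)
    finally have rain: "hue ` \<phi> ` d = {..<r}" using col ikl(2,3) by auto
    have "\<phi> ` d Int S = {}" unfolding deq using cc[OF kl(1)] cc[OF kl(2)] cp by (auto simp: cls_def)
    then have "\<phi> ` d \<in> nsets (?V - S) r" using nE[OF d] by (auto simp: nsets_def)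
    then show ?thesis using rain J(5) by (simp add: jedges_def tedges_def)
   qed
  qed
  have "?P \<in> edges ?F" by (rule pedge_in_edges) (use r in auto)
  then show "\<phi> \<in> {\<phi> \<in> copies ?F ?G. \<exists>e'\<in>edges ?F. \<phi> ` e' = e}"
   using ext inj \<phi>V good \<phi>e unfolding copies_def by (auto simp: PiE_iff)
 qed
 moreover have "finite {\<phi> \<in> copies ?F ?G. \<exists>e'\<in>edges ?F. \<phi> ` e' = e}"
 proof -
  have "copies ?F ?G \<subseteq> (verts ?F \<rightarrow>\<^sub>E ?V)" by (auto simp: copies_def)
  then have "finite (copies ?F ?G)" by (rule finite_subset) (simp add: finite_PiE finF J(1))
  then show ?thesis by simp
 qed
 ultimately have "card ?X <= num_copies_at ?F ?G e" unfolding num_copies_at_def by (intro card_mono)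
 then show ?thesis using low by linarith
qed

section \<open>Upper bound for copies after deleting an edge\<close>

text \<open>Each element of \<open>B\<close> selects a preimage in \<open>C\<close>; for a given
  selection only the other \<open>card C - card B\<close> values are free.\<close>

lemma card_functions_covering:
 assumes C: "finite C" and V: "finite V" and B: "finite B" "B \<subseteq> V"
 shows "card {\<psi> \<in> C \<rightarrow>\<^sub>E V. B \<subseteq> \<psi> ` C} <= card C ^ card B * card V ^ (card C - card B)"
proof -
 define Y where "Y = (%p. {\<psi> \<in> C \<rightarrow>\<^sub>E V. \<forall>b\<in>B. \<psi> (p b) = b})"
 have Yd: "\<phi> (p b) = b" if "\<phi> \<in> Y p" "b \<in> B" for \<phi> :: "'a => 'b" and p b
  using that unfolding Y_def by (simp only: mem_Collect_eq)
 have YP: "\<phi> \<in> C \<rightarrow>\<^sub>E V" if "\<phi> \<in> Y p" for \<phi> :: "'a => 'b" and p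
  using that unfolding Y_def by (simp only: mem_Collect_eq)
 have finP: "finite (B \<rightarrow>\<^sub>E C)" by (rule finite_PiE[OF B(1)]) (rule C)
 have Ycard: "card (Y p) <= card V ^ (card C - card B)" if p: "p \<in> B \<rightarrow>\<^sub>E C" for p
 proof (cases "Y p = {}")
  case False
  then obtain \<psi> where \<psi>: "\<psi> \<in> Y p" by blast
  have inj: "inj_on p B"
  proof (rule inj_onI)
   fix b b' assume b: "b \<in> B" "b' \<in> B" "p b = p b'"
   have "\<psi> (p b) = b" "\<psi> (p b') = b'" by (rule Yd[OF \<psi> b(1)], rule Yd[OF \<psi> b(2)])
   then show "b = b'" unfolding b(3) by (rule trans[OF sym])
  qed
  have sub: "p ` B \<subseteq> C" using p unfolding PiE_iff by (intro image_subsetI) (elim conjE bspec)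
  define X where "X = (%v. if v \<in> p ` B then {inv_into B p v} else V)"
  have "Y p \<subseteq> Pi\<^sub>E C X"
  proof
   fix \<phi> assume \<phi>: "\<phi> \<in> Y p"
   have "\<phi> v \<in> X v" if v: "v \<in> C" for v
   proof (cases "v \<in> p ` B")
    case True
    then obtain b where b: "v = p b" "b \<in> B" by (rule imageE)
    have "\<phi> v = b" unfolding b(1) by (rule Yd[OF \<phi> b(2)])
    moreover have "inv_into B p v = b" unfolding b(1) by (rule inv_into_f_f[OF inj b(2)])
    ultimately show ?thesis using True by (simp only: X_def if_True singleton_iff)
   next
    case F: False
    have "\<phi> v \<in> V" using YP[OF \<phi>] v by (rule PiE_mem)
    then show ?thesis using F by (simp only: X_def if_False)
   qed
   moreover have "\<phi> \<in> extensional C" using YP[OF \<phi>] by (simp only: PiE_iff)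
   ultimately show "\<phi> \<in> Pi\<^sub>E C X" by (simp add: PiE_iff)
  qed
  moreover have "finite (Pi\<^sub>E C X)" by (rule finite_PiE[OF C]) (simp add: X_def V)
  ultimately have "card (Y p) <= card (Pi\<^sub>E C X)" by (rule card_mono[rotated])
  also have "... = (\<Prod>v\<in>C. card (X v))" by (rule card_PiE[OF C])
  also have "... = (\<Prod>v\<in>C. if v \<in> p ` B then 1 else card V)" by (rule prod.cong) (auto simp: X_def)
  also have "... = card V ^ card (C - p ` B)"
  proof -
   have "C Int - p ` B = C - p ` B" by blast
   then show ?thesis using C by (simp add: prod.If_cases)
  qed
  also have "card (C - p ` B) = card C - card B"
   using card_Diff_subset[OF finite_imageI[OF B(1)] sub] card_image[OF inj] by simp
  finally show ?thesis .
 qed simp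
 have finY: "finite (Y p)" for p
  by (rule finite_subset[OF _ finite_PiE[OF C, of "%_. V"]]) (rule subsetI, erule YP, rule V)
 have "{\<psi> \<in> C \<rightarrow>\<^sub>E V. B \<subseteq> \<psi> ` C} \<subseteq> (\<Union>p\<in>B \<rightarrow>\<^sub>E C. Y p)"
 proof
  fix \<psi> assume "\<psi> \<in> {\<psi> \<in> C \<rightarrow>\<^sub>E V. B \<subseteq> \<psi> ` C}"
  then have \<psi>: "\<psi> \<in> C \<rightarrow>\<^sub>E V" "B \<subseteq> \<psi> ` C" by blast+
  define p where "p = restrict (inv_into C \<psi>) B"
  have pb: "p b \<in> C & \<psi> (p b) = b" if "b \<in> B" for b
  proof -
   have "b \<in> \<psi> ` C" using \<psi>(2) that by (rule subsetD)
   then show ?thesis using that by (simp add: p_def inv_into_into f_inv_into_f)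
  qed
  have "p \<in> B \<rightarrow>\<^sub>E C" unfolding PiE_iff
   by (intro conjI ballI) (use pb in blast, simp only: p_def restrict_extensional)
  moreover have "\<psi> \<in> Y p" unfolding Y_def using \<psi>(1) pb by (intro CollectI conjI ballI) simp_all
  ultimately show "\<psi> \<in> (\<Union>p\<in>B \<rightarrow>\<^sub>E C. Y p)" by (intro UN_I[of p])
 qed
 then have "card {\<psi> \<in> C \<rightarrow>\<^sub>E V. B \<subseteq> \<psi> ` C} <= card (\<Union>p\<in>B \<rightarrow>\<^sub>E C. Y p)"
  by (rule card_mono[rotated]) (simp add: finP finY)
 also have "... <= (\<Sum>p\<in>B \<rightarrow>\<^sub>E C. card (Y p))" by (rule card_UN_le[OF finP])
 also have "... <= (\<Sum>p\<in>B \<rightarrow>\<^sub>E C. card V ^ (card C - card B))" by (rule sum_mono[OF Ycard])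
 also have "... = card C ^ card B * card V ^ (card C - card B)"
  by (simp add: card_PiE[OF B(1)])
 finally show ?thesis .
qed

lemma card_injections_le:
 assumes d: "finite d" "card d = k"
 shows "card {x \<in> {..<k} \<rightarrow>\<^sub>E d. inj_on x {..<k}} <= fact k"
proof -
 have "card {x \<in> {..<k} \<rightarrow>\<^sub>E d. inj_on x {..<k}} <= card {xs. length xs = k & distinct xs & set xs \<subseteq> d}"
 proof (rule card_inj_on_le[where f = "%x. map x [0..<k]"])
  show "inj_on (%x. map x [0..<k]) {x \<in> {..<k} \<rightarrow>\<^sub>E d. inj_on x {..<k}}"
  proof (rule inj_onI)
   fix x y assume x: "x \<in> {x \<in> {..<k} \<rightarrow>\<^sub>E d. inj_on x {..<k}}" and y: "y \<in> {x \<in> {..<k} \<rightarrow>\<^sub>E d. inj_on x {..<k}}"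
    and e: "map x [0..<k] = map y [0..<k]"
   have "x i = y i" if "i \<in> {..<k}" for i using e that by simp
   moreover have "x \<in> extensional {..<k}" "y \<in> extensional {..<k}" using x y by (simp_all add: PiE_iff)
   ultimately show "x = y" by (intro extensionalityI)
  qed
  show "(%x. map x [0..<k]) ` {x \<in> {..<k} \<rightarrow>\<^sub>E d. inj_on x {..<k}} \<subseteq> {xs. length xs = k & distinct xs & set xs \<subseteq> d}"
   by (auto simp: distinct_map atLeast0LessThan PiE_iff)
  show "finite {xs. length xs = k & distinct xs & set xs \<subseteq> d}"
   by (rule finite_subset[OF _ finite_lists_length_eq[OF d(1), of k]]) auto
 qed
 also have "... = \<Prod>{card d - k + 1..card d}" by (rule card_lists_distinct_length_eq) (use d in auto)
 also have "... = fact k" using d(2) by (simp add: fact_prod)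
 finally show ?thesis .
qed

text \<open>Counts the placements of a pendant edge at \<open>w\<close>: an edge of \<open>E\<close>
  and an order of its other \<open>k\<close> vertices.\<close>

lemma card_orderings_le:
 assumes "finite E" "\<And>e. e \<in> E ==> finite e & card e = Suc k & w \<in> e"
 shows "card {x \<in> extensional {..<k}. inj_on x {..<k} & w \<notin> x ` {..<k} & insert w (x ` {..<k}) \<in> E} <= card E * fact k"
  (is "card ?L <= _")
proof -
 have "?L \<subseteq> (\<Union>e\<in>E. {x \<in> {..<k} \<rightarrow>\<^sub>E (e - {w}). inj_on x {..<k}})"
 proof
  fix x assume x: "x \<in> ?L"
  show "x \<in> (\<Union>e\<in>E. {x \<in> {..<k} \<rightarrow>\<^sub>E (e - {w}). inj_on x {..<k}})"
   by (rule UN_I[of "insert w (x ` {..<k})"]) (use x in \<open>auto simp: PiE_iff\<close>)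
 qed
 moreover have "finite {x \<in> {..<k} \<rightarrow>\<^sub>E (e - {w}). inj_on x {..<k}}" if "e \<in> E" for e
  by (rule finite_subset[OF _ finite_PiE[of "{..<k}" "%_. e - {w}"]]) (use assms(2)[OF that] in auto)
 ultimately have "card ?L <= card (\<Union>e\<in>E. {x \<in> {..<k} \<rightarrow>\<^sub>E (e - {w}). inj_on x {..<k}})"
  by (intro card_mono) (use assms(1) in auto)
 also have "... <= (\<Sum>e\<in>E. card {x \<in> {..<k} \<rightarrow>\<^sub>E (e - {w}). inj_on x {..<k}})" by (rule card_UN_le[OF assms(1)])
 also have "... <= (\<Sum>e\<in>E. fact k)"
 proof (rule sum_mono)
  fix e assume "e \<in> E"
  then have e: "finite (e - {w})" "card (e - {w}) = k" using assms(2) by auto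
  show "card {x \<in> {..<k} \<rightarrow>\<^sub>E (e - {w}). inj_on x {..<k}} <= fact k"
   by (rule card_injections_le[OF e])
 qed
 finally show ?thesis by simp
qed

lemma trans_degree_le:
 assumes V: "finite V" and hue: "\<And>v. hue v < r" and y: "y \<in> V" and b: "\<And>k. k < r ==> card {v \<in> V. hue v = k} <= b"
 shows "card {e \<in> tedges V r hue. y \<in> e} <= b ^ (r - 1)"
proof -
 let ?c = "%k. card {v \<in> V. hue v = k}"
 have pos: "0 < ?c (hue y)" using V y by (auto simp: card_gt_0_iff)
 have "card {e \<in> tedges V r hue. y \<in> e} * ?c (hue y) <= card (tedges V r hue)"
  by (rule trans_degree_upper[OF V hue y])
 also have "... = ?c (hue y) * (\<Prod>k\<in>{..<r} - {hue y}. ?c k)"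
  unfolding card_tedges[OF V] by (rule prod.remove) (use hue in auto)
 finally have "card {e \<in> tedges V r hue. y \<in> e} <= (\<Prod>k\<in>{..<r} - {hue y}. ?c k)" using pos by (simp add: mult.commute)
 also have "... <= (\<Prod>k\<in>{..<r} - {hue y}. b)" by (rule prod_mono) (use b in auto)
 also have "... = b ^ (r - 1)" using hue[of y] by simp
 finally show ?thesis .
qed

text \<open>Deleting the edge \<open>S\<close> forces some \<open>uvert i\<close> outside \<open>S\<close>, so that its \<open>t\<close> pendant edges are
 transversal; this costs a constant factor for each of them.\<close>

lemma num_copies_swapped_join_le:
 fixes G :: "'a hypergraph"
 assumes r: "2 <= r" and G: "finite (verts G)" and S: "S \<subseteq> verts G" "card S = r" and hue: "\<And>v. hue v < r"
  and E: "edges G = (jedges (verts G) r S hue - {S}) Un (%y. insert y W) ` Y"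
  and W: "W \<subseteq> verts G - S" "card W = r - 1" and Y: "Y \<subseteq> verts G - S" "Y Int W = {}"
  and b: "\<And>k. k < r ==> card {v \<in> verts G - S. hue v = k} <= b"
 shows "num_copies (pattern r t) G <= r * (card Y * (card (core_part r) ^ (2 * r) * card (verts G) ^ (card (core_part r) - 2 * r))
  * card (verts G) ^ ((r - 1) * (r - 1) * t) * ((b ^ (r - 1) + card Y) * fact (r - 1)) ^ t)"
proof -
 let ?V = "verts G" and ?F = "pattern r t" and ?C = "core_part r"
 let ?N = "(%y. insert y W) ` Y"
 have finS: "finite S" "finite W" "finite Y" using G S W Y finite_subset by (auto intro: finite_subset)
 have W0: "W ~= {}" using W(2) r by auto
 define T where "T = tedges (?V - S) r hue Un ?N"
 have finT: "finite T" using finite_tedges[of "?V - S"] G finS by (simp add: T_def)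
 have N_card: "finite e & card e = r & e \<subseteq> ?V - S" if eN: "e \<in> ?N" for e
 proof -
  obtain y where y: "y \<in> Y" "e = insert y W" using eN by blast
  have "y \<notin> W" using y(1) Y(2) by blast
  then have "card e = Suc (r - 1)" using y(2) finS(2) W(2) by simp
  then show ?thesis using y W(1) Y(1) finS(2) r by auto
 qed
 have T_card: "finite e & card e = r & e \<subseteq> ?V - S" if "e \<in> T" for e
 proof (cases "e \<in> ?N")
  case True
  then show ?thesis by (rule N_card)
 next
  case False
  then have "e \<in> nsets (?V - S) r" using that by (simp add: T_def tedges_def)
  then show ?thesis by (simp add: nsets_def)
 qed
 have ET: "e \<in> T" if "e \<in> edges G" "e Int S = {}" for e
  using that unfolding E T_def jedges_def by blast
 have S_notin: "S \<notin> edges G"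
 proof
  assume "S \<in> edges G"
  then have "S \<in> ?N" unfolding E by blast
  then have "S \<subseteq> ?V - S" using N_card by blast
  then have "S = {}" by blast
  then show False using S(2) r by simp
 qed
 have EV: "e \<in> nsets ?V r" if "e \<in> edges G" for e
 proof (cases "e \<in> ?N")
  case True
  then show ?thesis using N_card[OF True] unfolding nsets_def by blast
 next
  case False
  then have "e \<in> jedges ?V r S hue" using that unfolding E by blast
  then show ?thesis using jedges_subset[of ?V r S hue] by (rule subsetD[rotated])
 qed
 define Ci where "Ci = (%i. {\<phi> \<in> copies ?F G. \<phi> (uvert i) \<notin> S})"
 define B where "B = (%y. S Un insert y W)"
 have vF: "verts ?F = ?C Un pend_part r t" by (rule verts_pattern)
 have finF: "finite (verts ?F)" by (rule finite_verts_pattern)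
 have finC: "finite (copies ?F G)"
 proof -
  have "copies ?F G \<subseteq> (verts ?F \<rightarrow>\<^sub>E ?V)" by (auto simp: copies_def)
  then show ?thesis by (rule finite_subset) (simp add: finite_PiE finF G)
 qed
 \<comment> \<open>The new edges all contain \<open>W\<close>, so at most one of the disjoint blocks
   avoids \<open>S\<close>. The other \<open>r\<close> blocks use up \<open>S\<close>, hence the
   core part covers \<open>S\<close> and a new edge.\<close>
 have cover: "\<exists>y\<in>Y. B y \<subseteq> \<phi> ` ?C" if \<phi>: "\<phi> \<in> copies ?F G" for \<phi>
 proof -
  have inj: "inj_on \<phi> (verts ?F)" and ed: "\<And>e. e \<in> edges ?F ==> \<phi> ` e \<in> edges G" using \<phi> by (auto simp: copies_def)
  define P where "P = {i. i <= r & (\<exists>v\<in>block r i. \<phi> v \<in> S)}"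
  have Pfin: "finite P" by (simp add: P_def)
  have bF: "block r i \<subseteq> verts ?F" if "i <= r" for i by (rule block_subset_verts[OF that])
  have "\<forall>i\<in>P. \<exists>v. v \<in> block r i & \<phi> v \<in> S" by (auto simp: P_def)
  then obtain z where z: "\<And>i. i \<in> P ==> z i \<in> block r i & \<phi> (z i) \<in> S" by metis
  have zinj: "inj_on (%i. \<phi> (z i)) P"
  proof (rule inj_onI)
   fix i j assume ij: "i \<in> P" "j \<in> P" "\<phi> (z i) = \<phi> (z j)"
   have "z i \<in> verts ?F" "z j \<in> verts ?F" using z[OF ij(1)] z[OF ij(2)] bF ij(1,2) by (auto simp: P_def)
   then have "z i = z j" using inj_onD[OF inj ij(3)] by simp
   then show "i = j" using z[OF ij(1)] z[OF ij(2)] block_disjoint[of i j r] by auto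
  qed
  have zS: "(%i. \<phi> (z i)) ` P \<subseteq> S" using z by auto
  have cP: "card P <= r" using card_mono[OF finS(1) zS] card_image[OF zinj] S(2) by simp
  have new: "\<exists>k l. k < l & l <= r & \<phi> ` pedge r i k l \<in> ?N" if i: "i <= r" "i \<notin> P" for i
  proof -
   have "inj_on \<phi> (block r i)" by (rule inj_on_subset[OF inj bF[OF i(1)]])
   from block_not_rainbow[OF r this, of "?V - S" hue]
   obtain k l where kl: "k < l" "l <= r" "\<phi> ` pedge r i k l \<notin> tedges (?V - S) r hue"
    by (elim exE conjE)
   have e: "\<phi> ` pedge r i k l \<in> edges G" by (rule ed[OF pedge_in_edges[OF i(1) kl(1,2)]])
   have "\<phi> v \<notin> S" if v: "v \<in> pedge r i k l" for v
   proof
    assume vS: "\<phi> v \<in> S"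
    have "v \<in> block r i" using pedge_subset_block[OF kl(1,2)] v by (rule subsetD)
    then have "i \<in> P" unfolding P_def using vS i(1) by (intro CollectI conjI bexI[of _ v])
    then show False using i(2) by (rule notE[rotated])
   qed
   then have "\<phi> ` pedge r i k l Int S = {}" by (auto simp only: Int_iff image_iff empty_iff)
   then have "\<phi> ` pedge r i k l \<in> T" by (rule ET[OF e])
   then have "\<phi> ` pedge r i k l \<in> ?N" using kl(3) unfolding T_def by (simp only: Un_iff simp_thms)
   then show ?thesis using kl(1,2) by (intro exI[of _ k] exI[of _ l] conjI)
  qed
  have WN: "W \<subseteq> e" if "e \<in> ?N" for e using that by (elim imageE) auto
  have two: "i = j" if i: "i <= r" "i \<notin> P" and j: "j <= r" "j \<notin> P" for i j
  proof (rule ccontr)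
   assume ne: "i ~= j"
   from new[OF i] obtain k l where kl: "k < l" "l <= r" "\<phi> ` pedge r i k l \<in> ?N" by (elim exE conjE)
   from new[OF j] obtain k' l' where kl': "k' < l'" "l' <= r" "\<phi> ` pedge r j k' l' \<in> ?N" by (elim exE conjE)
   obtain w where w: "w \<in> W" using W0 by blast
   obtain a where a1: "a \<in> pedge r i k l" "w = \<phi> a" using subsetD[OF WN[OF kl(3)] w] by (elim imageE)
   obtain a' where a2: "a' \<in> pedge r j k' l'" "w = \<phi> a'" using subsetD[OF WN[OF kl'(3)] w] by (elim imageE)
   have a: "a \<in> pedge r i k l" "a' \<in> pedge r j k' l'" "\<phi> a = \<phi> a'" using a1 a2 by simp_all
   have ab: "a \<in> block r i" "a' \<in> block r j"
    by (rule subsetD[OF pedge_subset_block[OF kl(1,2)] a(1)], rule subsetD[OF pedge_subset_block[OF kl'(1,2)] a(2)])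
   then have "a \<in> verts ?F" "a' \<in> verts ?F" using subsetD[OF bF[OF i(1)]] subsetD[OF bF[OF j(1)]] by simp_all
   then have "a = a'" using inj_onD[OF inj a(3)] by simp
   then show False using ab block_disjoint[OF ne] by auto
  qed
  have PC: "P \<subseteq> {..r}" by (auto simp: P_def)
  have "P ~= {..r}" using cP by auto
  then obtain i0 where i0: "i0 <= r" "i0 \<notin> P" using PC by auto
  have Peq: "{..r} - {i0} \<subseteq> P" using two[OF i0] by auto
  have "card ({..r} - {i0}) = r" using i0(1) by simp
  then have "r <= card P" using card_mono[OF Pfin Peq] by simp
  then have "card ((%i. \<phi> (z i)) ` P) = card S" using cP card_image[OF zinj] S(2) by simp
  then have Sz: "(%i. \<phi> (z i)) ` P = S" by (rule card_subset_eq[OF finS(1) zS])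
  have bC: "block r i \<subseteq> ?C" if "i <= r" for i using that by (auto simp: core_part_def)
  have SC: "S \<subseteq> \<phi> ` ?C"
  proof
   fix s assume "s \<in> S"
   then obtain i where i: "i \<in> P" "s = \<phi> (z i)" using Sz by auto
   have "i <= r" using i(1) by (simp add: P_def)
   then have "z i \<in> ?C" using z[OF i(1)] bC[of i] by auto
   then show "s \<in> \<phi> ` ?C" using i(2) by (rule image_eqI[rotated])
  qed
  from new[OF i0] obtain k l where kl: "k < l" "l <= r" "\<phi> ` pedge r i0 k l \<in> ?N" by (elim exE conjE)
  from kl(3) obtain y where y: "\<phi> ` pedge r i0 k l = insert y W" "y \<in> Y" by (rule imageE)
  have "pedge r i0 k l \<subseteq> ?C" using pedge_subset_block[OF kl(1,2), of i0] bC[OF i0(1)] by (rule order_trans)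
  then have "insert y W \<subseteq> \<phi> ` ?C" unfolding y(1)[symmetric] by (rule image_mono)
  then have "B y \<subseteq> \<phi> ` ?C" using SC by (simp add: B_def)
  then show ?thesis using y(2) by (rule bexI)
 qed
 have cB: "card (B y) = 2 * r" "finite (B y)" "B y \<subseteq> ?V" if y: "y \<in> Y" for y
 proof -
  have N: "finite (insert y W) & card (insert y W) = r & insert y W \<subseteq> ?V - S" by (rule N_card) (use y in simp)
  then have "card (B y) = card S + card (insert y W)" unfolding B_def by (intro card_Un_disjoint) (use finS in auto)
  then show "card (B y) = 2 * r" using N S(2) by simp
  show "finite (B y)" "B y \<subseteq> ?V" using N finS S(1) by (auto simp: B_def)
 qed
 define Psi where "Psi = (\<Union>y\<in>Y. {\<psi> \<in> ?C \<rightarrow>\<^sub>E ?V. B y \<subseteq> \<psi> ` ?C})"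
 have finPE: "finite (?C \<rightarrow>\<^sub>E ?V)" by (rule finite_PiE) (simp_all add: G)
 have finPsi: "finite Psi" unfolding Psi_def using finS(3) finPE by simp
 have cPsi: "card Psi <= card Y * (card ?C ^ (2 * r) * card ?V ^ (card ?C - 2 * r))"
 proof -
  have "card Psi <= (\<Sum>y\<in>Y. card {\<psi> \<in> ?C \<rightarrow>\<^sub>E ?V. B y \<subseteq> \<psi> ` ?C})" unfolding Psi_def by (rule card_UN_le[OF finS(3)])
  also have "... <= (\<Sum>y\<in>Y. card ?C ^ (2 * r) * card ?V ^ (card ?C - 2 * r))"
  proof (rule sum_mono)
   fix y assume y: "y \<in> Y"
   show "card {\<psi> \<in> ?C \<rightarrow>\<^sub>E ?V. B y \<subseteq> \<psi> ` ?C} <= card ?C ^ (2 * r) * card ?V ^ (card ?C - 2 * r)"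
    using card_functions_covering[OF finite_core_part G cB(2,3)[OF y], of r] cB(1)[OF y] by simp
  qed
  finally show ?thesis by simp
 qed
 define D where "D = (b ^ (r - 1) + card Y) * fact (r - 1)"
 define L where "L = (%w. {x \<in> extensional {..<r - 1}. inj_on x {..<r - 1} & w \<notin> x ` {..<r - 1} & insert w (x ` {..<r - 1}) \<in> {e \<in> T. w \<in> e}})"
 have rS: "Suc (r - 1) = r" using r by simp
 have cL: "card (L w) <= D" if w: "w \<in> ?V - S" for w
 proof -
  have "card (L w) <= card {e \<in> T. w \<in> e} * fact (r - 1)" unfolding L_def
   by (rule card_orderings_le) (use finT T_card rS in auto)
  also have "card {e \<in> T. w \<in> e} <= b ^ (r - 1) + card Y"
  proof -
   have "{e \<in> T. w \<in> e} \<subseteq> {e \<in> tedges (?V - S) r hue. w \<in> e} Un ?N" by (auto simp: T_def)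
   then have "card {e \<in> T. w \<in> e} <= card ({e \<in> tedges (?V - S) r hue. w \<in> e} Un ?N)"
    by (rule card_mono[rotated]) (use finite_tedges[of "?V - S"] G finS in simp)
   also have "... <= card {e \<in> tedges (?V - S) r hue. w \<in> e} + card ?N" by (rule card_Un_le)
   also have "... <= b ^ (r - 1) + card Y"
    by (rule add_mono[OF trans_degree_le card_image_le]) (use G hue w b finS in auto)
   finally show ?thesis .
  qed
  finally show ?thesis by (simp add: D_def)
 qed
 have finL: "finite (L w)" if w: "w \<in> ?V - S" for w
 proof (rule finite_subset[OF _ finite_PiE[of "{..<r - 1}" "%_. ?V"]])
  show "L w \<subseteq> {..<r - 1} \<rightarrow>\<^sub>E ?V"
  proof
   fix x assume x: "x \<in> L w"
   then have "insert w (x ` {..<r - 1}) \<subseteq> ?V - S" using T_card by (auto simp: L_def)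
   then show "x \<in> {..<r - 1} \<rightarrow>\<^sub>E ?V" using x by (auto simp: L_def PiE_iff)
  qed
 qed (simp_all add: G)
 have Ci_le: "card (Ci i) <= card Psi * card ?V ^ ((r - 1) * (r - 1) * t) * D ^ t" if i: "i < r" for i
 proof -
  \<comment> \<open>Pendant vertices at the other selected vertices are bounded trivially; the
    saving comes from those at \<open>uvert i\<close> alone.\<close>
  define P' where "P' = (\<Union>i'\<in>{..<r} - {i}. \<Union>s<t. pend i' s ` {..<r - 1})"
  have finP': "finite P'" by (simp add: P'_def)
  have cP': "card P' <= (r - 1) * (r - 1) * t"
  proof -
   have "card P' <= (\<Sum>i'\<in>{..<r} - {i}. card (\<Union>s<t. pend i' s ` {..<r - 1}))" unfolding P'_def by (rule card_UN_le) simp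
   also have "... <= (\<Sum>i'\<in>{..<r} - {i}. t * (r - 1))"
   proof (rule sum_mono)
    fix i'
    have "card (\<Union>s<t. pend i' s ` {..<r - 1}) <= (\<Sum>s<t. card (pend i' s ` {..<r - 1}))" by (rule card_UN_le) simp
    also have "... <= (\<Sum>s<t. r - 1)" by (rule sum_mono) (use card_image_le[of "{..<r - 1}"] in simp)
    finally show "card (\<Union>s<t. pend i' s ` {..<r - 1}) <= t * (r - 1)" by simp
   qed
   also have "... = (r - 1) * (r - 1) * t" using i by simp
   finally show ?thesis .
  qed
  define Psi' where "Psi' = {\<psi> \<in> Psi. \<psi> (uvert i) \<in> ?V - S}"
  have finPsi': "finite Psi'" using finPsi by (simp add: Psi'_def)
  let ?Z = "SIGMA \<psi>:Psi'. (P' \<rightarrow>\<^sub>E ?V) \<times> ({..<t} \<rightarrow>\<^sub>E L (\<psi> (uvert i)))"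
  have finV: "finite (P' \<rightarrow>\<^sub>E ?V)" by (rule finite_PiE[OF finP']) (rule G)
  have finLL: "finite ({..<t} \<rightarrow>\<^sub>E L (\<psi> (uvert i)))" if "\<psi> \<in> Psi'" for \<psi>
   by (rule finite_PiE) (use finL that in \<open>auto simp: Psi'_def\<close>)
  \<comment> \<open>A copy is recorded by its core, its other pendant vertices and the ordered
    pendant edges at \<open>uvert i\<close>.\<close>
  define \<Phi> where "\<Phi> = (%\<phi> :: nat => 'a. (restrict \<phi> ?C, restrict \<phi> P', (\<lambda>s\<in>{..<t}. (\<lambda>j\<in>{..<r - 1}. \<phi> (pend i s j)))))"
  have "card (Ci i) <= card ?Z"
  proof (rule card_inj_on_le[where f = \<Phi>])
   show "inj_on \<Phi> (Ci i)"
   proof (rule inj_onI)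
    fix \<phi> \<phi>' assume \<phi>: "\<phi> \<in> Ci i" "\<phi>' \<in> Ci i" "\<Phi> \<phi> = \<Phi> \<phi>'"
    have 1: "restrict \<phi> ?C = restrict \<phi>' ?C" "restrict \<phi> P' = restrict \<phi>' P'"
     "(\<lambda>s\<in>{..<t}. (\<lambda>j\<in>{..<r - 1}. \<phi> (pend i s j))) = (\<lambda>s\<in>{..<t}. (\<lambda>j\<in>{..<r - 1}. \<phi>' (pend i s j)))"
     using \<phi>(3) by (simp_all only: \<Phi>_def prod.inject)
    have pe: "\<phi> (pend i s j) = \<phi>' (pend i s j)" if "s < t" "j < r - 1" for s j
     using fun_cong[OF fun_cong[OF 1(3), of s], of j] that by simp
    have "\<phi> v = \<phi>' v" if v: "v \<in> verts ?F" for v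
    proof -
     show ?thesis
     proof (cases "v \<in> ?C")
      case True
      then show ?thesis using fun_cong[OF 1(1), of v] by simp
     next
      case False
      then have "v \<in> pend_part r t" using v vF by simp
      then obtain i' s j where w: "i' < r" "s < t" "j < r - 1" "v = pend i' s j"
       unfolding pend_part_def by (elim UN_E imageE) simp
      show ?thesis
      proof (cases "i' = i")
       case True
       then show ?thesis using pe[OF w(2,3)] w(4) by simp
      next
       case False
       have "v \<in> P'" unfolding P'_def w(4)
        by (rule UN_I[of i'], use False w in simp, rule UN_I[of s], use w in simp, rule imageI, use w in simp)
       then show ?thesis using fun_cong[OF 1(2), of v] by simp
      qed
     qed
    qed
    moreover have "\<phi> \<in> extensional (verts ?F)" "\<phi>' \<in> extensional (verts ?F)" using \<phi>(1,2) by (auto simp: Ci_def copies_def PiE_iff)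
    ultimately show "\<phi> = \<phi>'" by (intro extensionalityI)
   qed
   show "\<Phi> ` Ci i \<subseteq> ?Z"
   proof (rule image_subsetI)
    fix \<phi> assume "\<phi> \<in> Ci i"
    then have \<phi>: "\<phi> \<in> copies ?F G" "\<phi> (uvert i) \<notin> S" by (simp_all add: Ci_def)
    have inj: "inj_on \<phi> (verts ?F)" and ed: "\<And>e. e \<in> edges ?F ==> \<phi> ` e \<in> edges G" and \<phi>V: "\<And>v. v \<in> verts ?F ==> \<phi> v \<in> ?V"
     using \<phi>(1) by (auto simp: copies_def PiE_iff)
    have uC: "uvert i \<in> ?C" using uvert_in_block[OF i r] i by (auto simp: core_part_def)
    have CF: "?C \<subseteq> verts ?F" by (simp add: vF)
    obtain y where y: "y \<in> Y" "B y \<subseteq> \<phi> ` ?C" using cover[OF \<phi>(1)] by (elim bexE)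
    have im: "restrict \<phi> ?C ` ?C = \<phi> ` ?C" by (rule image_cong) simp_all
    have "restrict \<phi> ?C \<in> {\<psi> \<in> ?C \<rightarrow>\<^sub>E ?V. B y \<subseteq> \<psi> ` ?C}"
    proof (intro CollectI conjI)
     show "restrict \<phi> ?C \<in> ?C \<rightarrow>\<^sub>E ?V" using \<phi>V CF by (auto simp: PiE_iff)
     show "B y \<subseteq> restrict \<phi> ?C ` ?C" unfolding im by (rule y(2))
    qed
    then have "restrict \<phi> ?C \<in> Psi" unfolding Psi_def by (rule UN_I[OF y(1)])
    then have 1: "restrict \<phi> ?C \<in> Psi'" using \<phi>(2) \<phi>V[of "uvert i"] uC CF by (simp add: Psi'_def subset_iff)
    have P'F: "P' \<subseteq> verts ?F" by (auto simp: P'_def vF pend_part_def)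
    then have 2: "restrict \<phi> P' \<in> P' \<rightarrow>\<^sub>E ?V" using \<phi>V by (auto simp: PiE_iff)
    have SC: "S \<subseteq> \<phi> ` ?C" using y(2) by (simp add: B_def)
    have 3: "(\<lambda>j\<in>{..<r - 1}. \<phi> (pend i s j)) \<in> L (\<phi> (uvert i))" if s: "s < t" for s
    proof -
     let ?x = "\<lambda>j\<in>{..<r - 1}. \<phi> (pend i s j)"
     have pF: "pend i s j \<in> verts ?F" if "j < r - 1" for j using that s i by (auto simp: vF pend_part_def)
     have uF: "uvert i \<in> verts ?F" using uC CF by blast
     have ti: "tail r i s \<in> edges ?F" using i s by (auto simp: edges_pattern tails_iff)
     have xim: "?x ` {..<r - 1} = \<phi> ` pend i s ` {..<r - 1}" unfolding image_image by (rule image_cong) simp_all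
     have te: "insert (\<phi> (uvert i)) (?x ` {..<r - 1}) = \<phi> ` tail r i s" unfolding xim by (simp add: tail_def)
     have "inj_on ?x {..<r - 1}"
     proof (rule inj_onI)
      fix j j' assume j: "j \<in> {..<r - 1}" "j' \<in> {..<r - 1}" "?x j = ?x j'"
      have eq: "\<phi> (pend i s j) = \<phi> (pend i s j')" using j by simp
      have "pend i s j \<in> verts ?F" "pend i s j' \<in> verts ?F" using pF[of j] pF[of j'] j(1,2) by simp_all
      then have "pend i s j = pend i s j'" by (rule inj_onD[OF inj eq])
      then show "j = j'" by simp
     qed
     moreover have "\<phi> (uvert i) \<notin> ?x ` {..<r - 1}"
     proof
      assume "\<phi> (uvert i) \<in> ?x ` {..<r - 1}"
      then obtain j0 where j0: "\<phi> (uvert i) = ?x j0" "j0 \<in> {..<r - 1}" by (rule imageE)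
      define j where "j = j0"
      have j: "j < r - 1" "\<phi> (uvert i) = \<phi> (pend i s j)" using j0 by (simp_all add: j_def)
      then have "uvert i = pend i s j" using inj_onD[OF inj j(2) uF pF[OF j(1)]] by simp
      then show False by simp
     qed
     moreover have "\<phi> ` tail r i s \<in> T"
     proof (rule ET[OF ed[OF ti]])
      \<comment> \<open>The core part already covers \<open>S\<close>, so injectivity keeps pendant
        vertices out of it.\<close>
      have "\<phi> (pend i s j) \<notin> S" if j: "j < r - 1" for j
      proof
       assume "\<phi> (pend i s j) \<in> S"
       from subsetD[OF SC this] obtain v where v: "\<phi> (pend i s j) = \<phi> v" "v \<in> ?C" by (rule imageE)
       have vv: "v \<in> verts ?F" using CF v(2) by (rule subsetD)
       have "pend i s j = v" by (rule inj_onD[OF inj v(1) pF[OF j] vv])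
       moreover have "pend i s j \<in> pend_part r t" using i s j by (auto simp: pend_part_def)
       ultimately show False using v(2) core_part_pend_part_disjoint[of r t] by auto
      qed
      then show "\<phi> ` tail r i s Int S = {}" using \<phi>(2) by (auto simp: tail_def)
     qed
     ultimately show ?thesis unfolding L_def te[symmetric]
      by (intro CollectI conjI restrict_extensional insertI1)
    qed
    have "(\<lambda>s\<in>{..<t}. (\<lambda>j\<in>{..<r - 1}. \<phi> (pend i s j))) \<in> {..<t} \<rightarrow>\<^sub>E L (restrict \<phi> ?C (uvert i))"
     by (rule restrict_PiE_iff[THEN iffD2]) (use 3 uC in simp)
    then show "\<Phi> \<phi> \<in> ?Z" unfolding \<Phi>_def using 1 2 by simp
   qed
   show "finite ?Z" by (rule finite_SigmaI[OF finPsi' finite_cartesian_product[OF finV finLL]])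
  qed
  also have "card ?Z = (\<Sum>\<psi>\<in>Psi'. card ((P' \<rightarrow>\<^sub>E ?V) \<times> ({..<t} \<rightarrow>\<^sub>E L (\<psi> (uvert i)))))"
   by (rule card_SigmaI[OF finPsi']) (use finV finLL in auto)
  also have "... <= (\<Sum>\<psi>\<in>Psi'. card ?V ^ ((r - 1) * (r - 1) * t) * D ^ t)"
  proof (rule sum_mono)
   fix \<psi> assume \<psi>: "\<psi> \<in> Psi'"
   have V1: "1 <= card ?V" using S r card_mono[OF G S(1)] by simp
   have "card (P' \<rightarrow>\<^sub>E ?V) = card ?V ^ card P'" using card_PiE[OF finP', of "%_. ?V"] by simp
   also have "... <= card ?V ^ ((r - 1) * (r - 1) * t)" by (rule power_increasing[OF cP' V1])
   finally have a: "card (P' \<rightarrow>\<^sub>E ?V) <= card ?V ^ ((r - 1) * (r - 1) * t)" .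
   have "card ({..<t} \<rightarrow>\<^sub>E L (\<psi> (uvert i))) = card (L (\<psi> (uvert i))) ^ t" by (simp add: card_PiE)
   also have "... <= D ^ t" by (rule power_mono[OF cL]) (use \<psi> in \<open>auto simp: Psi'_def\<close>)
   finally show "card ((P' \<rightarrow>\<^sub>E ?V) \<times> ({..<t} \<rightarrow>\<^sub>E L (\<psi> (uvert i)))) <= card ?V ^ ((r - 1) * (r - 1) * t) * D ^ t"
    unfolding card_cartesian_product by (rule mult_le_mono[OF a])
  qed
  also have "... = card Psi' * (card ?V ^ ((r - 1) * (r - 1) * t) * D ^ t)" by simp
  also have "... <= card Psi * (card ?V ^ ((r - 1) * (r - 1) * t) * D ^ t)"
   by (rule mult_le_mono1[OF card_mono[OF finPsi]]) (simp add: Psi'_def)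
  finally show ?thesis by (simp only: mult.assoc)
 qed
 have "copies ?F G \<subseteq> (\<Union>i<r. Ci i)"
 proof
  fix \<phi> assume \<phi>: "\<phi> \<in> copies ?F G"
  have inj: "inj_on \<phi> (verts ?F)" using \<phi> by (simp add: copies_def)
  have g: "uvert ` {..<r} \<in> edges ?F" by (simp add: edges_pattern)
  have gE: "\<phi> ` uvert ` {..<r} \<in> edges G" using \<phi> g by (simp add: copies_def)
  \<comment> \<open>Otherwise the connecting edge would be mapped onto \<open>S\<close>, which is no
    edge.\<close>
  have "\<exists>i<r. \<phi> (uvert i) \<notin> S"
  proof (rule ccontr)
   assume "\<not> ?thesis"
   then have sub: "\<phi> ` uvert ` {..<r} \<subseteq> S" by auto
   have "card (\<phi> ` uvert ` {..<r}) = r" using EV[OF gE] by (simp add: nsets_def)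
   then have "\<phi> ` uvert ` {..<r} = S" using card_subset_eq[OF finS(1) sub] S(2) by simp
   then show False using gE S_notin by simp
  qed
  then obtain i where "i < r" "\<phi> (uvert i) \<notin> S" by (elim exE conjE)
  then show "\<phi> \<in> (\<Union>i<r. Ci i)" using \<phi> by (intro UN_I[of i]) (simp_all add: Ci_def)
 qed
 then have "card (copies ?F G) <= card (\<Union>i<r. Ci i)" by (rule card_mono[rotated]) (simp add: Ci_def finC)
 also have "... <= (\<Sum>i<r. card (Ci i))" by (rule card_UN_le) simp
 also have "... <= (\<Sum>i<r. card Psi * card ?V ^ ((r - 1) * (r - 1) * t) * D ^ t)" by (rule sum_mono) (rule Ci_le, simp only: lessThan_iff)
 also have "... = r * (card Psi * card ?V ^ ((r - 1) * (r - 1) * t) * D ^ t)" by simp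
 also have "... <= r * (card Y * (card ?C ^ (2 * r) * card ?V ^ (card ?C - 2 * r)) * card ?V ^ ((r - 1) * (r - 1) * t) * D ^ t)"
  by (intro mult_le_mono2 mult_le_mono1 cPsi)
 finally show ?thesis by (simp only: num_copies_def D_def)
qed

section \<open>Comparing the two counts\<close>

lemma card_pend_part: "card (pend_part r t) = r * (r - 1) * t"
proof -
 have "pend_part r t = (%(i, s, j). pend i s j) ` ({..<r} \<times> {..<t} \<times> {..<r - 1})"
  by (force simp: pend_part_def)
 moreover have "inj_on (%(i, s, j). pend i s j) ({..<r} \<times> {..<t} \<times> {..<r - 1})" by (auto simp: inj_on_def)
 ultimately show ?thesis by (simp add: card_image)
qed

text \<open>With \<open>r = k + 2\<close> this is \<open>2 * fact (r - 1) <= r ^ (r - 1)\<close>: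
  when classes have at most \<open>n / r\<close> vertices, at most half of the ordered choices of
  \<open>r - 1\<close> vertices complete a given vertex to a transversal edge.\<close>

lemma two_fact_le_power: "2 * fact (Suc k) <= (Suc (Suc k)) ^ (Suc k)"
proof (induction k)
 case 0
 show ?case by simp
next
 case (Suc k)
 have "2 * fact (Suc (Suc k)) = Suc (Suc k) * (2 * fact (Suc k))" by simp
 also have "... <= Suc (Suc k) * Suc (Suc k) ^ Suc k" by (rule mult_le_mono2[OF Suc.IH])
 also have "... = Suc (Suc k) ^ Suc (Suc k)" by simp
 also have "... <= Suc (Suc (Suc k)) ^ Suc (Suc k)" by (rule power_mono) simp_all
 finally show ?case .
qed

text \<open>Transversal edges account for at most half of the free choices and the \<open>m\<close>
  new edges for at most a quarter, with the crude bound \<open>n <= n ^ (r - 1)\<close>.\<close>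

lemma pendant_factor_le:
 assumes r: "2 <= r" and b: "real b <= real n / real r" and n: "0 < n" and m: "real m * fact (r - 1) <= real n / 4"
 shows "real ((b ^ (r - 1) + m) * fact (r - 1)) <= 3 / 4 * real n ^ (r - 1)"
proof -
 obtain k where k: "r = Suc (Suc k)" using r by (metis add_2_eq_Suc le_Suc_ex)
 have "(2 :: nat) * fact (r - 1) <= r ^ (r - 1)" using two_fact_le_power[of k] by (simp add: k del: fact_Suc power_Suc)
 then have "real (2 * fact (r - 1)) <= real (r ^ (r - 1))" by (simp only: of_nat_le_iff)
 then have F: "2 * fact (r - 1) <= real r ^ (r - 1)" by simp
 have rp: "0 < real r ^ (r - 1)" using r by simp
 have "real b ^ (r - 1) * fact (r - 1) <= (real n / real r) ^ (r - 1) * fact (r - 1)"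
  using b by (intro mult_right_mono power_mono) auto
 also have "... = real n ^ (r - 1) * (fact (r - 1) / real r ^ (r - 1))" by (simp add: power_divide)
 also have "... <= real n ^ (r - 1) * (1 / 2)"
  using F rp by (intro mult_left_mono) (simp_all add: pos_divide_le_eq)
 finally have 1: "real b ^ (r - 1) * fact (r - 1) <= real n ^ (r - 1) / 2" by simp
 have "real n ^ 1 <= real n ^ (r - 1)" using n r by (intro power_increasing) auto
 then have 2: "real n <= real n ^ (r - 1)" by simp
 have "real ((b ^ (r - 1) + m) * fact (r - 1)) = real b ^ (r - 1) * fact (r - 1) + real m * fact (r - 1)"
  by (simp only: of_nat_mult of_nat_add of_nat_power of_nat_fact distrib_right)
 then show ?thesis using 1 2 m by linarith
qed

lemma monochromatic_not_rainbow:
 fixes hue :: "'a => nat"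
 assumes r: "2 <= r" and k: "\<And>v. v \<in> e ==> hue v = k"
 shows "hue ` e ~= {..<r}"
proof
 assume eq: "hue ` e = {..<r}"
 have "hue ` e \<subseteq> {k}" by (rule image_subsetI) (simp add: k)
 then have sub: "{..<r} \<subseteq> {k}" by (simp only: eq)
 have "0 \<in> {k}" by (rule subsetD[OF sub]) (use r in simp)
 moreover have "1 \<in> {k}" by (rule subsetD[OF sub]) (use r in simp)
 ultimately show False by simp
qed

text \<open>The minimum is attained, since an \<open>r\<close>-set inside one colour class is a
  nonedge, and \<open>copies_through_nonedge\<close> applies to the minimiser. For large
  \<open>n\<close> Bernoulli's inequality replaces \<open>n - f\<close> by \<open>n\<close> at the
  price of a factor 2, whatever \<open>t\<close> is.\<close>

lemma c_min_lower:
 fixes E :: "nat hypergraph"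
 assumes r: "2 <= r" and E: "is_join r (extremal_graph r (pattern r t) n) S hue" and c: "card (verts (extremal_graph r (pattern r t) n)) = n"
  and a: "\<And>k. k < r ==> a <= card {v \<in> verts (extremal_graph r (pattern r t) n) - S. hue v = k}"
  and f: "f = card (verts (pattern r t))" and n: "0 < n"
  and big: "real n / (4 * real r) + real f <= real a" "2 * rcard (pend_part r t) * real f <= real n"
 shows "(1 / (4 * real r)) ^ (card (core_part r) - 2 * r) / 2 * (real n ^ (card (core_part r) - 2 * r) * real n ^ (card (pend_part r t)))
  <= real (c_min r (pattern r t) n)"
proof -
 let ?G = "extremal_graph r (pattern r t) n" and ?c = "card (core_part r) - 2 * r" and ?p = "card (pend_part r t)"
 note J = joinD[OF E]
 define A where "A = {num_copies_at (pattern r t) (?G\<lparr>edges := edges ?G Un {e}\<rparr>) e | e. e \<in> nsets (verts ?G) r - edges ?G}"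
 have A_im: "A = (%e. num_copies_at (pattern r t) (?G\<lparr>edges := edges ?G Un {e}\<rparr>) e) ` (nsets (verts ?G) r - edges ?G)"
  unfolding A_def by blast
 have fin: "finite A" unfolding A_im using finite_imp_finite_nsets[OF J(1)] by simp
 have ra: "r <= a"
 proof -
  have "card {..<r} <= f"
  proof -
   have "uvert ` {..<r} \<subseteq> verts (pattern r t)" using uvert_in_core_part[OF _ r] by (auto simp: verts_pattern)
   then have "card (uvert ` {..<r}) <= f" unfolding f by (rule card_mono[OF finite_verts_pattern])
   then show ?thesis by (simp add: card_image inj_on_def)
  qed
  then have "real r <= real f" by simp
  moreover have "0 <= real n / (4 * real r)" by simp
  ultimately have "real r <= real a" using big(1) by linarith
  then show ?thesis by (simp only: of_nat_le_iff)
 qed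
 have "r <= card {v \<in> verts ?G - S. hue v = 0}" using ra a[of 0] r by simp
 then obtain e where e: "e \<subseteq> {v \<in> verts ?G - S. hue v = 0}" "card e = r" "finite e" by (rule obtain_subset_with_card_n)
 have "e \<in> nsets (verts ?G) r - edges ?G"
 proof -
  have eD: "v \<in> verts ?G & v \<notin> S & hue v = 0" if "v \<in> e" for v using subsetD[OF e(1) that] by simp
  have "hue ` e ~= {..<r}" by (rule monochromatic_not_rainbow[OF r, of e hue 0]) (simp add: eD)
  moreover have "e Int S = {}" "e \<subseteq> verts ?G" using eD by blast+
  ultimately have "e \<notin> edges ?G" "e \<in> nsets (verts ?G) r"
   using e(2,3) unfolding J(5) jedges_def tedges_def nsets_def by simp_all
  then show ?thesis by (rule DiffI[rotated])
 qed
 then have "A ~= {}" unfolding A_im by blast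
 then have "Min A \<in> A" by (rule Min_in[OF fin])
 then obtain e' where e': "e' \<in> nsets (verts ?G) r - edges ?G" "Min A = num_copies_at (pattern r t) (?G\<lparr>edges := edges ?G Un {e'}\<rparr>) e'"
  unfolding A_im by (elim imageE) simp
 have cm: "c_min r (pattern r t) n = Min A" by (simp add: c_min_def A_def Let_def)
 have "(a - f) ^ ?c * (n - f) ^ ?p <= c_min r (pattern r t) n"
  unfolding cm e'(2) using copies_through_nonedge[OF r E e'(1) a f] by (simp only: c)
 then have low: "real (a - f) ^ ?c * real (n - f) ^ ?p <= real (c_min r (pattern r t) n)"
  by (simp only: of_nat_power[symmetric] of_nat_mult[symmetric] of_nat_le_iff)
 have n0: "0 < real n" using n by simp
 have "real n / (4 * real r) <= real (a - f)" using big(1) by linarith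
 then have 1: "(real n / (4 * real r)) ^ ?c <= real (a - f) ^ ?c" by (intro power_mono) auto
 have 2: "real n ^ ?p / 2 <= real (n - f) ^ ?p"
 proof (cases "?p = 0")
  case False
  have "1 <= ?p" using False by linarith
  then have "real 1 <= real ?p" by (simp only: of_nat_le_iff)
  then have "1 <= real ?p" by simp
  then have "1 * real f <= real ?p * real f" by (rule mult_right_mono) simp
  moreover have "2 * real ?p * real f = 2 * (real ?p * real f)" by simp
  ultimately have fn: "2 * real f <= real n" using big(2) by linarith
  then have "real f / real n <= 1" using n0 by (simp add: divide_le_eq)
  then have "1 + real ?p * (- (real f / real n)) <= (1 + (- (real f / real n))) ^ ?p" by (intro Bernoulli_inequality) simp
  moreover have "real ?p * (real f / real n) <= 1 / 2" using big(2) n0 by (simp add: pos_divide_le_eq)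
  ultimately have "1 / 2 <= (1 + (- (real f / real n))) ^ ?p" by simp
  then have "real n ^ ?p * (1 / 2) <= real n ^ ?p * (1 + (- (real f / real n))) ^ ?p" by (rule mult_left_mono) simp
  also have "... = (real n * (1 + (- (real f / real n)))) ^ ?p" by (simp only: power_mult_distrib)
  also have "real n * (1 + (- (real f / real n))) = real n - real f" using n0 by (simp add: right_diff_distrib)
  also have "real n - real f = real (n - f)"
  proof -
   have "f <= n" using fn by simp
   then show ?thesis by (rule of_nat_diff[symmetric])
  qed
  finally show ?thesis by simp
 qed simp
 have "(1 / (4 * real r)) ^ ?c / 2 * (real n ^ ?c * real n ^ ?p) = (real n / (4 * real r)) ^ ?c * (real n ^ ?p / 2)"
  by (simp add: power_divide)
 also have "... <= real (a - f) ^ ?c * real (n - f) ^ ?p" by (rule mult_mono[OF 1 2]) auto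
 finally show ?thesis using low by linarith
qed

text \<open>The competitor loses the edge \<open>S\<close> and gains \<open>q + 1\<close> edges that
  share the \<open>r - 1\<close> vertices of \<open>W\<close> inside one colour class, a net gain of
  \<open>q\<close>.\<close>

lemma min_copies_upper:
 fixes E :: "nat hypergraph"
 assumes r: "2 <= r" and E: "is_join r E S hue" and c: "card (verts E) = n" and tn: "turan_number r (pattern r t) n = join_size r n"
  and sz: "r + q <= card {v \<in> verts E - S. hue v = 0}" and b: "\<And>k. k < r ==> card {v \<in> verts E - S. hue v = k} <= b"
 shows "min_copies r (pattern r t) n q <= r * (Suc q * (card (core_part r) ^ (2 * r) * n ^ (card (core_part r) - 2 * r))
  * n ^ ((r - 1) * (r - 1) * t) * ((b ^ (r - 1) + Suc q) * fact (r - 1)) ^ t)"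
proof -
 note J = joinD[OF E]
 obtain Z where Z: "Z \<subseteq> {v \<in> verts E - S. hue v = 0}" "card Z = r + q" "finite Z" by (rule obtain_subset_with_card_n[OF sz])
 have "r - 1 <= card Z" using Z(2) by simp
 then obtain W where W: "W \<subseteq> Z" "card W = r - 1" "finite W" by (rule obtain_subset_with_card_n)
 define Y where "Y = Z - W"
 have cY: "card Y = Suc q" unfolding Y_def using card_Diff_subset[OF W(3,1)] Z(2) W(2) r by simp
 have finY: "finite Y" using Z(3) by (simp add: Y_def)
 have WY: "W \<subseteq> verts E - S" "Y \<subseteq> verts E - S" "Y Int W = {}" using Z(1) W(1) by (auto simp: Y_def)
 let ?N = "(%y. insert y W) ` Y"
 define G where "G = \<lparr>verts = verts E, edges = (edges E - {S}) Un ?N\<rparr>"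
 have G: "verts G = verts E" "edges G = (edges E - {S}) Un ?N" by (simp_all add: G_def)
 have finS: "finite S" using J(1,3) finite_subset by blast
 have SE: "S \<in> edges E"
 proof -
  have "S ~= {}" using J(4) r by auto
  then show ?thesis unfolding J(5) jedges_def using J(3,4) finS by (auto simp: nsets_def)
 qed
 have new: "insert y W \<in> nsets (verts E) r - edges E" if y: "y \<in> Y" for y
 proof -
  have "y \<notin> W" using y WY(3) by blast
  then have "card (insert y W) = r" using W r by simp
  moreover have s: "insert y W \<subseteq> verts E" "insert y W Int S = {}" using y WY by auto
  moreover have "hue ` insert y W ~= {..<r}"
  proof (rule monochromatic_not_rainbow[OF r])
   fix v assume "v \<in> insert y W"
   then have "v \<in> Z" using y W(1) by (auto simp: Y_def)
   then show "hue v = 0" using Z(1) by blast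
  qed
  ultimately show ?thesis unfolding J(5) jedges_def tedges_def using W(3) by (simp add: nsets_def)
 qed
 have Nsub: "?N \<subseteq> nsets (verts E) r - edges E" using new by (intro image_subsetI)
 have finE: "finite (edges E)" "edges E \<subseteq> nsets (verts E) r"
  unfolding J(5) by (rule finite_subset[OF jedges_subset finite_imp_finite_nsets[OF J(1)]], rule jedges_subset)
 have rG: "rgraph r G" unfolding rgraph_def G using J(1) finE(2) Nsub by auto
 have cN: "card ?N = Suc q"
 proof -
  have "inj_on (%y. insert y W) Y"
  proof (rule inj_onI)
   fix y y' assume y: "y \<in> Y" "y' \<in> Y" "insert y W = insert y' W"
   have "y \<in> insert y' W" unfolding y(3)[symmetric] by (rule insertI1)
   moreover have "y \<notin> W" using y(1) WY(3) by blast
   ultimately show "y = y'" by simp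
  qed
  then show ?thesis using cY by (simp add: card_image)
 qed
 have cE: "card (edges G) = turan_number r (pattern r t) n + q"
 proof -
  have "card (edges G) = card (edges E - {S}) + card ?N" unfolding G
   by (rule card_Un_disjoint) (use finE finY Nsub in auto)
  moreover have "card (edges E - {S}) = card (edges E) - 1" using SE finE(1) by simp
  moreover have "0 < card (edges E)" using SE finE(1) by (auto simp: card_gt_0_iff)
  ultimately show ?thesis using cN J(6) c tn by simp
 qed
 let ?A = "{num_copies (pattern r t) H | H :: nat hypergraph. rgraph r H & card (verts H) = n \<and>
  card (edges H) = turan_number r (pattern r t) n + q}"
 have "finite ?A"
 proof (rule finite_subset)
  show "?A \<subseteq> {..n ^ card (verts (pattern r t))}"
  proof
   fix x assume "x \<in> ?A"
   then obtain H :: "nat hypergraph" where H: "x = num_copies (pattern r t) H" "rgraph r H" "card (verts H) = n" by blast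
   have finH: "finite (verts H)" using H(2) by (simp add: rgraph_def)
   have "copies (pattern r t) H \<subseteq> verts (pattern r t) \<rightarrow>\<^sub>E verts H" by (auto simp: copies_def)
   then have "card (copies (pattern r t) H) <= card (verts (pattern r t) \<rightarrow>\<^sub>E verts H)"
    by (rule card_mono[rotated]) (simp add: finite_PiE finite_verts_pattern finH)
   also have "... = n ^ card (verts (pattern r t))" using card_PiE[OF finite_verts_pattern[of r t], of "%_. verts H"] H(3) by simp
   finally show "x \<in> {..n ^ card (verts (pattern r t))}" by (simp add: H(1) num_copies_def)
  qed
 qed simp
 moreover have "num_copies (pattern r t) G \<in> ?A" by (intro CollectI exI[of _ G]) (simp add: rG G(1) c cE)
 ultimately have "min_copies r (pattern r t) n q <= num_copies (pattern r t) G" unfolding min_copies_def by (rule Min_le)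
 also have "... <= r * (card Y * (card (core_part r) ^ (2 * r) * card (verts G) ^ (card (core_part r) - 2 * r))
  * card (verts G) ^ ((r - 1) * (r - 1) * t) * ((b ^ (r - 1) + card Y) * fact (r - 1)) ^ t)"
  by (rule num_copies_swapped_join_le[OF r _ _ J(4) J(2) _ _ W(2)]) (unfold G(1), rule J(1), rule J(3), unfold G(2) J(5), rule refl, rule WY(1), rule WY(2), rule WY(3), erule b)
 finally show ?thesis by (simp only: cY G(1) c)
qed

theorem theorem1p2:
  fixes r :: nat and K :: real
  assumes "r \<ge> 2" and "K > 1"
  shows "\<exists>F :: nat hypergraph. rgraph r F \<and> stable_rgraph r F \<and> \<not> r_partite r F \<and>
    (\<exists>(\<delta>::real) (n0::nat). \<delta> > 0 \<and> n0 > 0 \<and>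
      (\<forall>n\<ge>n0. \<forall>q::nat. 1 \<le> q \<and> real q \<le> \<delta> * real n \<longrightarrow>
         real (min_copies r F n q) \<le> inverse K * real q * real (c_min r F n)))"
proof -
 have r: "2 <= r" and K: "1 < K" using assms by simp_all
 have r1: "0 < r" and r0: "0 < real r" using r by simp_all
 define m where "m = card (core_part r) - 2 * r"
 define c2 where "c2 = (1 / (4 * real r)) ^ m / 2"
 \<comment> \<open>The factor 2 comes from \<open>Suc q <= 2 * q\<close>. Neither \<open>B\<close>
   nor \<open>c2\<close> involves \<open>t\<close>, so \<open>t\<close> can be chosen
   afterwards.\<close>
 define B where "B = 2 * real r * rcard (core_part r) ^ (2 * r)"
 have c2: "0 < c2" using r0 by (simp add: c2_def)
 have B: "0 <= B" using r0 by (simp add: B_def)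
 have "0 < c2 / (K * (B + 1))" using c2 K B by simp
 then obtain t where t: "(3 / 4 :: real) ^ t < c2 / (K * (B + 1))"
  using real_arch_pow_inv[of "c2 / (K * (B + 1))" "3 / 4"] by auto
 have Bt: "K * (B * (3 / 4) ^ t) <= c2"
 proof -
  have "(3 / 4) ^ t * (K * (B + 1)) < c2" using t K B by (simp add: pos_less_divide_eq)
  moreover have "(3 / 4) ^ t * (K * (B + 1)) = K * (B * (3 / 4) ^ t) + K * (3 / 4) ^ t" by (simp add: algebra_simps)
  moreover have "0 <= K * (3 / 4 :: real) ^ t" using K by simp
  ultimately show ?thesis by linarith
 qed
 define F where "F = pattern r t"
 define f where "f = card (verts F)"
 define p where "p = card (pend_part r t)"
 obtain n3 where n3: "\<forall>n\<ge>n3. turan_number r (pattern r t) n = join_size r n \<and>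
  (\<forall>H :: nat hypergraph. extremal r (pattern r t) n H \<longleftrightarrow> card (verts H) = n & (\<exists>S hue. is_join r H S hue))"
  using extremal_iff_join[OF r, of t] by (elim exE)
 \<comment> \<open>The first bound leaves room for the new edges inside a colour class, the second
   keeps \<open>q * fact (r - 1)\<close> at most \<open>n / 8\<close>.\<close>
 define \<delta> where "\<delta> = min (1 / (8 * real r)) (1 / (8 * fact (r - 1)))"
 have \<delta>: "0 < \<delta>" "\<delta> <= 1 / (8 * real r)" "\<delta> <= 1 / (8 * fact (r - 1))"
  using r0 unfolding \<delta>_def by (auto intro: min.cobounded1 min.cobounded2)
 have pos: "0 < 1 / (8 * real r)" "0 < (1 / 8 :: real)" using r0 by simp_all
 have "\<forall>\<^sub>F n in sequentially. n3 + 2 * r <= n & real f + 2 + real r < 1 / (8 * real r) * real n \<and>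
   2 * real p * real f < 1 * real n & fact (r - 1) < 1 / 8 * real n"
  using eventually_ge_at_top[of "n3 + 2 * r"] eventually_less_mult[OF pos(1)]
   eventually_less_mult[OF zero_less_one] eventually_less_mult[OF pos(2)]
  by (intro eventually_conj)
 then obtain n0 where n0: "\<And>n. n0 <= n ==> n3 + 2 * r <= n & real f + 2 + real r < 1 / (8 * real r) * real n \<and>
   2 * real p * real f < 1 * real n & fact (r - 1) < 1 / 8 * real n"
  by (auto simp only: eventually_sequentially)
 have main: "real (min_copies r F n q) <= inverse K * real q * real (c_min r F n)"
  if n: "Suc n0 <= n" and q: "1 <= q" "real q <= \<delta> * real n" for n q
 proof -
  have N: "n3 + 2 * r <= n" "real f + 2 + real r < 1 / (8 * real r) * real n" "2 * real p * real f <= real n" "fact (r - 1) < 1 / 8 * real n"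
   using n0[of n] n by auto
  have npos: "0 < n" using N(1) r by simp
  have rn: "r <= n" "n3 <= n" using N(1) by auto
  have tn: "turan_number r (pattern r t) n = join_size r n" using n3 rn(2) by blast
  have ex: "\<forall>H :: nat hypergraph. extremal r (pattern r t) n H \<longleftrightarrow> card (verts H) = n & (\<exists>S hue. is_join r H S hue)"
   using n3 rn(2) by blast
  let ?E = "extremal_graph r (pattern r t) n"
  have cE: "card (verts ?E) = n" by (rule extremal_graph_join(2)[OF rn(1) r1 ex])
  obtain S hue where E: "is_join r ?E S hue" using extremal_graph_join(3)[OF rn(1) r1 ex] by (elim exE)
  define a where "a = (n - r) div r"
  define b where "b = n div r"
  have ba: "b = a + 1"
  proof -
   have "n = (n - r) + r" using rn(1) by simp
   then have "n div r = ((n - r) + r) div r" by (rule arg_cong)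
   also have "... = (n - r) div r + 1" using r1 by simp
   finally show ?thesis by (simp only: a_def b_def)
  qed
  have n2: "2 * r <= card (verts ?E)" using N(1) cE by simp
  have sizes: "card {v \<in> verts ?E - S. hue v = k} = a \<or> card {v \<in> verts ?E - S. hue v = k} = a + 1" if "k < r" for k
   using join_class_sizes[OF r1 E n2 that] unfolding cE a_def .
  have lo: "a <= card {v \<in> verts ?E - S. hue v = k}" and hi: "card {v \<in> verts ?E - S. hue v = k} <= b" if "k < r" for k
   using sizes[OF that] ba by linarith+
  have b_le: "real b <= real n / real r" unfolding b_def by (rule of_nat_div_le_of_nat)
  have a_ge: "real n / real r - 2 <= real a"
  proof -
   have "n mod r < r" using r1 by simp
   then have "n <= r + r * b" using mod_mult_div_eq[of n r] unfolding b_def by linarith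
   then have "real n <= real (r + r * b)" by (simp only: of_nat_le_iff)
   then have "real n <= real r * (real b + 1)" by (simp add: algebra_simps)
   then have "real n / real r <= real b + 1" using r0 by (simp add: pos_divide_le_eq mult.commute)
   then show ?thesis using ba by simp
  qed
  define x where "x = real n / (8 * real r)"
  have x: "real n / real r = 8 * x" "real n / (4 * real r) = 2 * x" "1 / (8 * real r) * real n = x" by (simp_all add: x_def)
  have x0: "0 <= x" by (simp add: x_def)
  have big: "real n / (4 * real r) + real f <= real a" using a_ge N(2) x0 unfolding x by linarith
  have qx: "real q <= x"
  proof -
   have "\<delta> * real n <= 1 / (8 * real r) * real n" using \<delta>(2) by (rule mult_right_mono) simp
   then show ?thesis using q(2) unfolding x by linarith
  qed
  have "r + q <= a" 
  proof -
   have "real (r + q) <= real a" using a_ge N(2) x0 qx unfolding x of_nat_add by linarith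
   then show ?thesis by (simp only: of_nat_le_iff)
  qed
  then have rq: "r + q <= card {v \<in> verts ?E - S. hue v = 0}" using lo[OF r1] by linarith
  have low: "c2 * (real n ^ m * real n ^ p) <= real (c_min r F n)"
   unfolding c2_def m_def p_def F_def
   by (rule c_min_lower[OF r E cE lo _ npos big]) (use N(3) in \<open>simp_all only: f_def F_def p_def\<close>)
  have D: "real ((b ^ (r - 1) + Suc q) * fact (r - 1)) <= 3 / 4 * real n ^ (r - 1)"
  proof (rule pendant_factor_le[OF r b_le npos])
   have "real q * fact (r - 1) <= (\<delta> * real n) * fact (r - 1)" by (rule mult_right_mono[OF q(2)]) simp
   also have "... <= (1 / (8 * fact (r - 1)) * real n) * fact (r - 1)" using \<delta>(3) by (intro mult_right_mono) auto
   also have "... = real n / 8" by simp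
   finally have "real q * fact (r - 1) <= real n / 8" .
   moreover have "real (Suc q) * fact (r - 1) = real q * fact (r - 1) + fact (r - 1)" by (simp add: distrib_right)
   ultimately show "real (Suc q) * fact (r - 1) <= real n / 4" using N(4) by linarith
  qed
  \<comment> \<open>Free and restricted pendant edges together give the same power of
    \<open>n\<close> as in the lower bound, so only constants remain.\<close>
  have pe: "(r - 1) * (r - 1) * t + (r - 1) * t = p"
  proof -
   have "r = Suc (r - 1)" using r by simp
   then have "p = Suc (r - 1) * (r - 1) * t" unfolding p_def card_pend_part by simp
   then show ?thesis by (simp add: algebra_simps)
  qed
  let ?X = "rcard (core_part r) ^ (2 * r) * real n ^ m"
  have "real (min_copies r F n q) <= real (r * (Suc q * (card (core_part r) ^ (2 * r) * n ^ m)
   * n ^ ((r - 1) * (r - 1) * t) * ((b ^ (r - 1) + Suc q) * fact (r - 1)) ^ t))"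
   unfolding F_def m_def of_nat_le_iff by (rule min_copies_upper[OF r E cE tn rq hi])
  also have "... = real r * (real (Suc q) * ?X * real n ^ ((r - 1) * (r - 1) * t) * real ((b ^ (r - 1) + Suc q) * fact (r - 1)) ^ t)"
   by (simp only: of_nat_mult of_nat_power)
  also have "... <= real r * (real (Suc q) * ?X * real n ^ ((r - 1) * (r - 1) * t) * (3 / 4 * real n ^ (r - 1)) ^ t)"
   using D by (intro mult_left_mono power_mono) auto
  also have "... = real r * (real (Suc q) * ?X * (3 / 4) ^ t * real n ^ p)"
  proof -
   have "real n ^ p = real n ^ ((r - 1) * (r - 1) * t) * (real n ^ (r - 1)) ^ t"
    by (simp only: pe[symmetric] power_add power_mult)
   then show ?thesis by (simp only: power_mult_distrib mult_ac)
  qed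
  also have "... <= real r * (2 * real q * ?X * (3 / 4) ^ t * real n ^ p)"
   using q(1) by (intro mult_left_mono mult_right_mono) auto
  also have "... = real q * (B * (3 / 4) ^ t) * (real n ^ m * real n ^ p)" unfolding B_def by (simp only: mult_ac)
  also have "... <= real q * (inverse K * c2) * (real n ^ m * real n ^ p)"
  proof -
   have "inverse K * (K * (B * (3 / 4) ^ t)) <= inverse K * c2" using Bt K by (intro mult_left_mono) auto
   moreover have "inverse K * (K * (B * (3 / 4) ^ t)) = B * (3 / 4) ^ t" using K by (simp add: mult.assoc[symmetric])
   ultimately show ?thesis by (intro mult_left_mono mult_right_mono) auto
  qed
  also have "... = inverse K * real q * (c2 * (real n ^ m * real n ^ p))" by (simp only: mult_ac)
  also have "... <= inverse K * real q * real (c_min r F n)" using low K by (intro mult_left_mono) auto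
  finally show ?thesis .
 qed
 show ?thesis
 proof (intro exI[of _ F] conjI exI[of _ \<delta>] exI[of _ "Suc n0"] allI impI)
  show "rgraph r F" unfolding F_def by (rule rgraph_pattern[OF r])
  show "stable_rgraph r F" unfolding F_def by (rule stable_pattern[OF r])
  show "\<not> r_partite r F" unfolding F_def by (rule pattern_not_r_partite[OF r])
  show "real (min_copies r F n q) <= inverse K * real q * real (c_min r F n)"
   if "Suc n0 <= n" "1 <= q & real q <= \<delta> * real n" for n q using main that by blast
 qed (use \<delta>(1) in simp_all)
qed

end
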